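(* Let $M$ be an $n$-dimensional Hadamard manifold, let $p\in M$, and let $f:M\to\mathbb{R}$. Then the following statements are equivalent: (i) $\partial B^p f(x)\neq\varnothing$ for every $x\in M$; (ii) $f$ is a pointwise-attained $H_p$-envelope. Moreover, for any pointwise-attained representation $f(z)=\sup_{\alpha\in A}\{H_p(z,y_\alpha)-a_\alpha\}$ of $f$, one has $$\{V_p(x,y_\alpha):\alpha\in A_f(x)\}\subseteq\partial B^p f(x),\qquad x\in M.$$
   Context: A Hadamard manifold is a complete, simply connected Riemannian manifold of nonpositive sectional curvature; $d$ is its Riemannian distance and $\exp$ its exponential map (each $\exp_p$ is a diffeomorphism). For $q\in M$ and a unit vector $u\in T_qM$, $\gamma_{(q,u)}(t)=\exp_q(tu)$, $t\ge 0$, is the unit-speed geodesic ray from $q$ in direction $u$, and $B_u^q(x)=\lim_{t\to+\infty}\bigl(d(x,\gamma_{(q,u)}(t))-t\bigr)$ is the Busemann function. For a nonzero $u\in T_qM$, $B_u^q:=B_{u/\|u\|}^q$. Two unit-speed rays $\gamma,\sigma$ are asymptotic if $t\mapsto d(\gamma(t),\sigma(t))$ is bounded on $[0,\infty)$; for each ray and each point $q$ there is exactly one ray from $q$ asymptotic to it. Busemann coupling with base point $p$: $H_p:M\times M\to\mathbb{R}$, $H_p(z,y)=d(p,z)\,B^p_{-\exp_p^{-1}z}(y)$ if $z\ne p$, and $H_p(p,y)=0$. For $x\in M$ and $v\in T_xM\setminus\{0\}$, $\eta_{p,x}(v)\in T_pM$ is the unique unit vector such that $\gamma_{(p,\eta_{p,x}(v))}$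 and $\gamma_{(x,-v/\|v\|)}$ are asymptotic; $Y_p(x,v):=\exp_p(-\|v\|\,\eta_{p,x}(v))$ for $v\neq 0$ and $Y_p(x,0):=p$. For $y\ne p$, let $\eta_p(y):=-\exp_p^{-1}y/d(p,y)$ and let $u_{x,y}\in T_xM$ be the unique unit vector such that $\gamma_{(p,\eta_p(y))}$ and $\gamma_{(x,-u_{x,y})}$ are asymptotic; $V_p(x,y):=d(p,y)\,u_{x,y}\in T_xM$ for $y\ne p$ and $V_p(x,p):=0$. $B^p$-subdifferential: $\partial B^p f(x)$ is the set of all $v\in T_xM$ such that $f(z)\ge f(x)+H_p(z,Y_p(x,v))-H_p(x,Y_p(x,v))$ for all $z\in M$. A function $f:M\to\mathbb{R}$ is an $H_p$-envelope if there exist a nonempty index set $A$, points $y_\alpha\in M$ and constants $a_\alpha\in\mathbb{R}$ ($\alpha\in A$) with $f(z)=\sup_{\alpha\in A}\{H_p(z,y_\alpha)-a_\alpha\}$ for all $z\in M$. For such a representation, the active index set at $x\in M$ is $A_f(x):=\{\alpha\in A: f(x)=H_p(x,y_\alpha)-a_\alpha\}$. The envelope (representation) is pointwise attained if $A_f(x)\neq\varnothing$ for every $x\in M$. *)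

theory Defs
  imports "HOL-Analysis.Analysis"
begin

section \<open>Smooth manifolds\<close>

text \<open>\<open>C_k k S f\<close> and \<open>smooth_on S f\<close> are meant for open sets \<open>S\<close>: all iterated
  partial derivatives up to order \<open>k\<close> (respectively, of every order) exist and are continuous.\<close>

fun C_k :: "nat \<Rightarrow> 'a::euclidean_space set \<Rightarrow> ('a \<Rightarrow> 'b::real_normed_vector) \<Rightarrow> bool" where
  "C_k 0 S f \<longleftrightarrow> continuous_on S f"
| "C_k (Suc k) S f \<longleftrightarrow>
     f differentiable_on S \<and> (\<forall>b\<in>Basis. C_k k S (\<lambda>x. frechet_derivative f (at x) b))"

definition smooth_on :: "'a::euclidean_space set \<Rightarrow> ('a \<Rightarrow> 'b::real_normed_vector) \<Rightarrow> bool" where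
  "smooth_on S f \<longleftrightarrow> (\<forall>k. C_k k S f)"

text \<open>A chart is a domain together with a coordinate map; the values of the coordinate map
  outside the domain are never used.\<close>

type_synonym ('m, 'n) chart = "'m set \<times> ('m \<Rightarrow> real ^ 'n)"

abbreviation dom_of :: "('m, 'n) chart \<Rightarrow> 'm set" where "dom_of \<equiv> fst"
abbreviation coord :: "('m, 'n) chart \<Rightarrow> 'm \<Rightarrow> real ^ 'n" where "coord \<equiv> snd"

definition coord_inv :: "('m, 'n) chart \<Rightarrow> real ^ 'n \<Rightarrow> 'm" where
  "coord_inv c = inv_into (dom_of c) (coord c)"

definition smooth_atlas :: "('m::topological_space, 'n::finite) chart set \<Rightarrow> bool" where
  "smooth_atlas \<A> \<longleftrightarrow>
     (\<forall>c\<in>\<A>. open (dom_of c) \<and> open (coord c ` dom_of c) \<and>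
        homeomorphism (dom_of c) (coord c ` dom_of c) (coord c) (coord_inv c)) \<and>
     (\<Union>c\<in>\<A>. dom_of c) = UNIV \<and>
     (\<forall>c\<in>\<A>. \<forall>c'\<in>\<A>. smooth_on (coord c ` (dom_of c \<inter> dom_of c')) (coord c' \<circ> coord_inv c))"

text \<open>Differential at the point \<open>x\<close> of the change of coordinates from \<open>c\<close> to \<open>c'\<close>.\<close>

definition transition_deriv ::
  "('m, 'n::finite) chart \<Rightarrow> ('m, 'n) chart \<Rightarrow> 'm \<Rightarrow> real ^ 'n \<Rightarrow> real ^ 'n" where
  "transition_deriv c c' x = frechet_derivative (coord c' \<circ> coord_inv c) (at (coord c x))"


section \<open>Riemannian manifolds\<close>

text \<open>The underlying manifold is the whole type \<open>'m\<close>, its dimension is \<open>CARD('n)\<close>, and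
  \<open>gram M c x\<close> is the matrix \<open>(g\<^sub>i\<^sub>j(x))\<close> of the metric in the chart \<open>c\<close>, relevant only for
  charts \<open>c\<close> of the atlas and points \<open>x\<close> in the domain of \<open>c\<close>.\<close>

record ('m, 'n) riemannian =
  atlas :: "('m, 'n) chart set"
  gram :: "('m, 'n) chart \<Rightarrow> 'm \<Rightarrow> real ^ 'n ^ 'n"

definition charts_at :: "('m, 'n::finite) riemannian \<Rightarrow> 'm \<Rightarrow> ('m, 'n) chart set" where
  "charts_at M x = {c \<in> atlas M. x \<in> dom_of c}"

definition riemannian_manifold ::
  "('m::{t2_space, second_countable_topology}, 'n::finite) riemannian \<Rightarrow> bool" where
  "riemannian_manifold M \<longleftrightarrow>
     smooth_atlas (atlas M) \<and>
     (\<forall>c\<in>atlas M.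
        smooth_on (coord c ` dom_of c) (\<lambda>a. gram M c (coord_inv c a)) \<and>
        (\<forall>x\<in>dom_of c. transpose (gram M c x) = gram M c x \<and>
           (\<forall>u. u \<noteq> 0 \<longrightarrow> 0 < u \<bullet> (gram M c x *v u)))) \<and>
     (\<forall>x. \<forall>c\<in>charts_at M x. \<forall>c'\<in>charts_at M x. \<forall>u v.
        u \<bullet> (gram M c x *v v) =
        transition_deriv c c' x u \<bullet> (gram M c' x *v transition_deriv c c' x v))"

text \<open>A tangent vector at \<open>x\<close> is the family of its coordinate vectors in all charts around \<open>x\<close>,
  related by the differentials of the coordinate changes (and \<open>0\<close> in the remaining charts, so
  that the family is determined by the vector).\<close>

type_synonym ('m, 'n) tvec = "('m, 'n) chart \<Rightarrow> real ^ 'n"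

definition tangent_space :: "('m, 'n::finite) riemannian \<Rightarrow> 'm \<Rightarrow> ('m, 'n) tvec set" where
  "tangent_space M x =
     {v. (\<forall>c. c \<notin> charts_at M x \<longrightarrow> v c = 0) \<and>
         (\<forall>c\<in>charts_at M x. \<forall>c'\<in>charts_at M x. v c' = transition_deriv c c' x (v c))}"

definition tzero :: "('m, 'n::finite) tvec" where
  "tzero = (\<lambda>c. 0)"

definition tscale :: "real \<Rightarrow> ('m, 'n::finite) tvec \<Rightarrow> ('m, 'n) tvec" where
  "tscale r v = (\<lambda>c. r *\<^sub>R v c)"

definition tinner ::
  "('m, 'n::finite) riemannian \<Rightarrow> 'm \<Rightarrow> ('m, 'n) tvec \<Rightarrow> ('m, 'n) tvec \<Rightarrow> real" where
  "tinner M x v w = (let c = (SOME c. c \<in> charts_at M x) in v c \<bullet> (gram M c x *v w c))"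

definition tnorm :: "('m, 'n::finite) riemannian \<Rightarrow> 'm \<Rightarrow> ('m, 'n) tvec \<Rightarrow> real" where
  "tnorm M x v = sqrt (tinner M x v v)"

definition unit_tangent :: "('m, 'n::finite) riemannian \<Rightarrow> 'm \<Rightarrow> ('m, 'n) tvec set" where
  "unit_tangent M x = {u \<in> tangent_space M x. tnorm M x u = 1}"


subsection \<open>Levi-Civita connection and curvature in coordinates\<close>

definition partial :: "'n \<Rightarrow> (real ^ 'n::finite \<Rightarrow> real) \<Rightarrow> real ^ 'n \<Rightarrow> real" where
  "partial i h a = frechet_derivative h (at a) (axis i 1)"

definition metric_coeff ::
  "('m, 'n::finite) riemannian \<Rightarrow> ('m, 'n) chart \<Rightarrow> 'n \<Rightarrow> 'n \<Rightarrow> real ^ 'n \<Rightarrow> real" where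
  "metric_coeff M c i j a = gram M c (coord_inv c a) $ i $ j"

text \<open>\<open>christoffel M c k i j\<close> is \<open>\<Gamma>\<^sup>k\<^sub>i\<^sub>j\<close>.\<close>

definition christoffel ::
  "('m, 'n::finite) riemannian \<Rightarrow> ('m, 'n) chart \<Rightarrow> 'n \<Rightarrow> 'n \<Rightarrow> 'n \<Rightarrow> real ^ 'n \<Rightarrow> real" where
  "christoffel M c k i j a =
     1 / 2 * (\<Sum>l\<in>UNIV. matrix_inv (gram M c (coord_inv c a)) $ k $ l *
       (partial i (metric_coeff M c j l) a + partial j (metric_coeff M c i l) a
        - partial l (metric_coeff M c i j) a))"

text \<open>\<open>riemann_coeff M c l i j k\<close> is the \<open>l\<close>-th component of \<open>R(\<partial>\<^sub>i,\<partial>\<^sub>j)\<partial>\<^sub>k\<close>, for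
  \<open>R(X,Y)Z = \<nabla>\<^sub>X\<nabla>\<^sub>YZ - \<nabla>\<^sub>Y\<nabla>\<^sub>XZ - \<nabla>\<^sub>[\<^sub>X\<^sub>,\<^sub>Y\<^sub>]Z\<close>.\<close>

definition riemann_coeff ::
  "('m, 'n::finite) riemannian \<Rightarrow> ('m, 'n) chart \<Rightarrow> 'n \<Rightarrow> 'n \<Rightarrow> 'n \<Rightarrow> 'n \<Rightarrow> real ^ 'n \<Rightarrow> real" where
  "riemann_coeff M c l i j k a =
     partial i (christoffel M c l j k) a - partial j (christoffel M c l i k) a +
     (\<Sum>m\<in>UNIV. christoffel M c l i m a * christoffel M c m j k a
               - christoffel M c l j m a * christoffel M c m i k a)"

definition curvature ::
  "('m, 'n::finite) riemannian \<Rightarrow> ('m, 'n) chart \<Rightarrow> 'm \<Rightarrow>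
     real ^ 'n \<Rightarrow> real ^ 'n \<Rightarrow> real ^ 'n \<Rightarrow> real ^ 'n" where
  "curvature M c x u v w =
     (\<chi> l. \<Sum>i\<in>UNIV. \<Sum>j\<in>UNIV. \<Sum>k\<in>UNIV.
        riemann_coeff M c l i j k (coord c x) * u $ i * v $ j * w $ k)"

text \<open>Sectional curvature \<open>\<langle>R(u,v)v,u\<rangle> / (\<langle>u,u\<rangle>\<langle>v,v\<rangle> - \<langle>u,v\<rangle>\<^sup>2)\<close> of the plane spanned by \<open>u\<close> and
  \<open>v\<close>, both given by their coordinates in the chart \<open>c\<close>.\<close>

definition sectional_curvature ::
  "('m, 'n::finite) riemannian \<Rightarrow> ('m, 'n) chart \<Rightarrow> 'm \<Rightarrow> real ^ 'n \<Rightarrow> real ^ 'n \<Rightarrow> real" where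
  "sectional_curvature M c x u v =
     (let ip = (\<lambda>a b. a \<bullet> (gram M c x *v b))
      in ip (curvature M c x u v v) u / (ip u u * ip v v - (ip u v)\<^sup>2))"

definition nonpositive_curvature :: "('m, 'n::finite) riemannian \<Rightarrow> bool" where
  "nonpositive_curvature M \<longleftrightarrow>
     (\<forall>x. \<forall>c\<in>charts_at M x. \<forall>u v. u \<noteq> v \<and> independent {u, v} \<longrightarrow>
        sectional_curvature M c x u v \<le> 0)"


subsection \<open>Geodesics, exponential map, distance\<close>

definition velocity ::
  "('m, 'n::finite) riemannian \<Rightarrow> (real \<Rightarrow> 'm) \<Rightarrow> real \<Rightarrow> ('m, 'n) tvec" where
  "velocity M \<gamma> t =
     (\<lambda>c. if c \<in> charts_at M (\<gamma> t) then vector_derivative (coord c \<circ> \<gamma>) (at t) else 0)"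

text \<open>Geodesics defined on all of \<open>\<real>\<close>: the coordinate expressions are twice differentiable and
  satisfy \<open>x\<^sub>k'' + \<Sum>\<^sub>i\<^sub>j \<Gamma>\<^sup>k\<^sub>i\<^sub>j x\<^sub>i' x\<^sub>j' = 0\<close>.\<close>

definition geodesic ::
  "('m::topological_space, 'n::finite) riemannian \<Rightarrow> (real \<Rightarrow> 'm) \<Rightarrow> bool" where
  "geodesic M \<gamma> \<longleftrightarrow>
     continuous_on UNIV \<gamma> \<and>
     (\<forall>t. \<forall>c\<in>charts_at M (\<gamma> t).
        (coord c \<circ> \<gamma>) differentiable (at t) \<and>
        ((\<lambda>s. vector_derivative (coord c \<circ> \<gamma>) (at s)) has_vector_derivative
           (\<chi> k. - (\<Sum>i\<in>UNIV. \<Sum>j\<in>UNIV. christoffel M c k i j (coord c (\<gamma> t)) *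
              vector_derivative (coord c \<circ> \<gamma>) (at t) $ i *
              vector_derivative (coord c \<circ> \<gamma>) (at t) $ j))) (at t))"

text \<open>Completeness: the geodesic with any given initial position and velocity is defined for all
  times.\<close>

definition geodesically_complete ::
  "('m::topological_space, 'n::finite) riemannian \<Rightarrow> bool" where
  "geodesically_complete M \<longleftrightarrow>
     (\<forall>x. \<forall>v\<in>tangent_space M x. \<exists>\<gamma>. geodesic M \<gamma> \<and> \<gamma> 0 = x \<and> velocity M \<gamma> 0 = v)"

definition rexp ::
  "('m::topological_space, 'n::finite) riemannian \<Rightarrow> 'm \<Rightarrow> ('m, 'n) tvec \<Rightarrow> 'm" where
  "rexp M x v = (THE \<gamma>. geodesic M \<gamma> \<and> \<gamma> 0 = x \<and> velocity M \<gamma> 0 = v) 1"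

definition rexp_inv ::
  "('m::topological_space, 'n::finite) riemannian \<Rightarrow> 'm \<Rightarrow> 'm \<Rightarrow> ('m, 'n) tvec" where
  "rexp_inv M x = inv_into (tangent_space M x) (rexp M x)"

definition C1_curve_on ::
  "('m::topological_space, 'n::finite) riemannian \<Rightarrow> real set \<Rightarrow> (real \<Rightarrow> 'm) \<Rightarrow> bool" where
  "C1_curve_on M I \<gamma> \<longleftrightarrow>
     continuous_on I \<gamma> \<and>
     (\<forall>c\<in>atlas M.
        (\<forall>t\<in>I. \<gamma> t \<in> dom_of c \<longrightarrow> (coord c \<circ> \<gamma>) differentiable (at t within I)) \<and>
        continuous_on {t \<in> I. \<gamma> t \<in> dom_of c}
          (\<lambda>t. vector_derivative (coord c \<circ> \<gamma>) (at t within I)))"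

text \<open>\<open>S\<close> contains the break points; on each closed subinterval free of interior break points the
  curve is \<open>C\<^sup>1\<close> up to and including the end points.\<close>

definition piecewise_C1_curve ::
  "('m::topological_space, 'n::finite) riemannian \<Rightarrow> (real \<Rightarrow> 'm) \<Rightarrow> bool" where
  "piecewise_C1_curve M \<gamma> \<longleftrightarrow>
     continuous_on {0..1} \<gamma> \<and>
     (\<exists>S. finite S \<and>
        (\<forall>a b. 0 \<le> a \<and> a < b \<and> b \<le> 1 \<and> {a<..<b} \<inter> S = {} \<longrightarrow> C1_curve_on M {a..b} \<gamma>))"

definition curve_length :: "('m, 'n::finite) riemannian \<Rightarrow> (real \<Rightarrow> 'm) \<Rightarrow> real" where
  "curve_length M \<gamma> = integral {0..1} (\<lambda>t. tnorm M (\<gamma> t) (velocity M \<gamma> t))"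

definition rdist ::
  "('m::topological_space, 'n::finite) riemannian \<Rightarrow> 'm \<Rightarrow> 'm \<Rightarrow> real" where
  "rdist M x y = Inf {curve_length M \<gamma> |\<gamma>. piecewise_C1_curve M \<gamma> \<and> \<gamma> 0 = x \<and> \<gamma> 1 = y}"


section \<open>Hadamard manifolds\<close>

definition hadamard_manifold ::
  "('m::{t2_space, second_countable_topology}, 'n::finite) riemannian \<Rightarrow> bool" where
  "hadamard_manifold M \<longleftrightarrow>
     riemannian_manifold M \<and> geodesically_complete M \<and>
     simply_connected (UNIV :: 'm set) \<and> nonpositive_curvature M"

definition geodesic_ray ::
  "('m::topological_space, 'n::finite) riemannian \<Rightarrow> 'm \<Rightarrow> ('m, 'n) tvec \<Rightarrow> real \<Rightarrow> 'm" where
  "geodesic_ray M q u t = rexp M q (tscale t u)"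

text \<open>\<open>busemann M q u\<close> is \<open>B\<^sub>u\<^sup>q\<close> for nonzero \<open>u\<close>, which is normalized first.\<close>

definition busemann ::
  "('m::topological_space, 'n::finite) riemannian \<Rightarrow> 'm \<Rightarrow> ('m, 'n) tvec \<Rightarrow> 'm \<Rightarrow> real" where
  "busemann M q u x =
     Lim at_top (\<lambda>t. rdist M x (geodesic_ray M q (tscale (1 / tnorm M q u) u) t) - t)"

definition asymptotic ::
  "('m::topological_space, 'n::finite) riemannian \<Rightarrow> (real \<Rightarrow> 'm) \<Rightarrow> (real \<Rightarrow> 'm) \<Rightarrow> bool" where
  "asymptotic M \<gamma> \<sigma> \<longleftrightarrow> bounded ((\<lambda>t. rdist M (\<gamma> t) (\<sigma> t)) ` {0..})"


section \<open>Busemann coupling and subdifferential\<close>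

definition coupling ::
  "('m::topological_space, 'n::finite) riemannian \<Rightarrow> 'm \<Rightarrow> 'm \<Rightarrow> 'm \<Rightarrow> real" where
  "coupling M p z y =
     (if z = p then 0 else rdist M p z * busemann M p (tscale (- 1) (rexp_inv M p z)) y)"

definition eta_dir ::
  "('m::topological_space, 'n::finite) riemannian \<Rightarrow> 'm \<Rightarrow> 'm \<Rightarrow> ('m, 'n) tvec \<Rightarrow> ('m, 'n) tvec" where
  "eta_dir M p x v =
     (THE \<eta>. \<eta> \<in> unit_tangent M p \<and>
        asymptotic M (geodesic_ray M p \<eta>) (geodesic_ray M x (tscale (- 1 / tnorm M x v) v)))"

definition Y_map ::
  "('m::topological_space, 'n::finite) riemannian \<Rightarrow> 'm \<Rightarrow> 'm \<Rightarrow> ('m, 'n) tvec \<Rightarrow> 'm" where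
  "Y_map M p x v =
     (if v = tzero then p else rexp M p (tscale (- tnorm M x v) (eta_dir M p x v)))"

definition eta_pt ::
  "('m::topological_space, 'n::finite) riemannian \<Rightarrow> 'm \<Rightarrow> 'm \<Rightarrow> ('m, 'n) tvec" where
  "eta_pt M p y = tscale (- 1 / rdist M p y) (rexp_inv M p y)"

definition u_dir ::
  "('m::topological_space, 'n::finite) riemannian \<Rightarrow> 'm \<Rightarrow> 'm \<Rightarrow> 'm \<Rightarrow> ('m, 'n) tvec" where
  "u_dir M p x y =
     (THE u. u \<in> unit_tangent M x \<and>
        asymptotic M (geodesic_ray M p (eta_pt M p y)) (geodesic_ray M x (tscale (- 1) u)))"

definition V_map ::
  "('m::topological_space, 'n::finite) riemannian \<Rightarrow> 'm \<Rightarrow> 'm \<Rightarrow> 'm \<Rightarrow> ('m, 'n) tvec" where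
  "V_map M p x y = (if y = p then tzero else tscale (rdist M p y) (u_dir M p x y))"

definition subdiff ::
  "('m::topological_space, 'n::finite) riemannian \<Rightarrow> 'm \<Rightarrow> ('m \<Rightarrow> real) \<Rightarrow> 'm \<Rightarrow> ('m, 'n) tvec set"
  where
  "subdiff M p f x =
     {v \<in> tangent_space M x. \<forall>z. f z \<ge>
        f x + coupling M p z (Y_map M p x v) - coupling M p x (Y_map M p x v)}"

text \<open>The boundedness condition makes the real-valued \<open>Sup\<close> a genuine (finite) supremum.\<close>

definition envelope_rep ::
  "('m::topological_space, 'n::finite) riemannian \<Rightarrow> 'm \<Rightarrow>
     'i set \<Rightarrow> ('i \<Rightarrow> 'm) \<Rightarrow> ('i \<Rightarrow> real) \<Rightarrow> ('m \<Rightarrow> real) \<Rightarrow> bool" where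
  "envelope_rep M p A y a f \<longleftrightarrow>
     A \<noteq> {} \<and>
     (\<forall>z. bdd_above ((\<lambda>\<alpha>. coupling M p z (y \<alpha>) - a \<alpha>) ` A) \<and>
          f z = (SUP \<alpha>\<in>A. coupling M p z (y \<alpha>) - a \<alpha>))"

definition active_indices ::
  "('m::topological_space, 'n::finite) riemannian \<Rightarrow> 'm \<Rightarrow>
     'i set \<Rightarrow> ('i \<Rightarrow> 'm) \<Rightarrow> ('i \<Rightarrow> real) \<Rightarrow> ('m \<Rightarrow> real) \<Rightarrow> 'm \<Rightarrow> 'i set" where
  "active_indices M p A y a f x = {\<alpha> \<in> A. f x = coupling M p x (y \<alpha>) - a \<alpha>}"

definition attained_envelope_rep ::
  "('m::topological_space, 'n::finite) riemannian \<Rightarrow> 'm \<Rightarrow>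
     'i set \<Rightarrow> ('i \<Rightarrow> 'm) \<Rightarrow> ('i \<Rightarrow> real) \<Rightarrow> ('m \<Rightarrow> real) \<Rightarrow> bool" where
  "attained_envelope_rep M p A y a f \<longleftrightarrow>
     envelope_rep M p A y a f \<and> (\<forall>x. active_indices M p A y a f x \<noteq> {})"

text \<open>HOL cannot quantify existentially over the type of indices. Indices in \<open>'m \<times> real\<close> are no
  restriction: any family \<open>(y\<^sub>\<alpha>, a\<^sub>\<alpha>)\<close> can be reindexed by the set of its values.\<close>

definition attained_envelope ::
  "('m::topological_space, 'n::finite) riemannian \<Rightarrow> 'm \<Rightarrow> ('m \<Rightarrow> real) \<Rightarrow> bool" where
  "attained_envelope M p f \<longleftrightarrow>
     (\<exists>(A :: ('m \<times> real) set) y a. attained_envelope_rep M p A y a f)"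

end

theory Submission
  imports Defs
begin

text \<open>The theorem rests on the identity \<open>Y\<^sub>p(x, V\<^sub>p(x, y)) = y\<close>: since an active affine piece
  \<open>H\<^sub>p(\<cdot>, y\<^sub>\<alpha>) - a\<^sub>\<alpha>\<close> touches \<open>f\<close> from below at \<open>x\<close>, it makes \<open>V\<^sub>p(x, y\<^sub>\<alpha>)\<close> a subgradient there;
  conversely, a choice of one subgradient at each point gives an attained envelope, with
  \<open>y\<^sub>\<alpha> = Y\<^sub>p(x, v)\<close>.

  The identity needs \<open>exp\<^sub>p\<close> to be bijective with \<open>d(p, exp\<^sub>p v) = \<bar>v\<bar>\<close>, and for each ray and each
  point exactly one asymptotic ray from that point. In nonpositive curvature a Jacobi field \<open>J\<close> with
  \<open>J(0) = 0\<close> has convex length, so \<open>\<bar>J(l)\<bar> \<le> l \<bar>J(1)\<bar>\<close> for \<open>l \<le> 1\<close>, and the differential of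
  \<open>exp\<^sub>x\<close> does not shrink vectors. The second fact gives the Cartan-Hadamard theorem (path lifting
  along \<open>exp\<^sub>x\<close>, and simple connectedness for injectivity) and \<open>d(exp\<^sub>x u, exp\<^sub>x v) \<ge> \<bar>u - v\<bar>\<close>, hence
  also uniqueness of asymptotic rays; the first makes \<open>exp\<^sub>x v \<mapsto> exp\<^sub>x (l v)\<close> an \<open>l\<close>-contraction.
  By this contraction, seen from \<open>\<gamma>(n)\<close>, the segments from \<open>x\<close> to \<open>\<gamma>(n)\<close> stay within distance
  \<open>2 d(x, \<gamma>(0))\<close> of \<open>\<gamma>\<close>, and a limit of their directions gives the asymptotic ray.\<close>

section \<open>Continuously differentiable maps\<close>

text \<open>\<open>exp\<close> is given only through the geodesic equation in charts, and a geodesic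
  may cross many charts before time 1. Its differentiability in the initial velocity is therefore
  proved for short times inside one chart, from an ODE theorem with explicit constants, and carried
  along by induction on time. The derivative solves the linearised geodesic equation; rewritten with
  covariant derivatives this is the Jacobi equation, where the curvature enters. Since a Jacobi
  field \<open>J\<close> with \<open>J 0 = 0\<close> may have a length that is not differentiable at
  0, the length of its initial derivative is recovered as a limit, that of |J(t)|^2 / t^2. Before
  \<open>rdist\<close> is understood, the manifold carries only its topology. The limits needed for
  path lifting therefore come from compact sets inside charts, and the Euclidean norm of the
  coordinates stands in for the metric, at the price of a constant \<open>\<kappa>\<close> that is
  uniform on compact pieces of a chart. The metric axioms of \<open>rdist\<close> are derived
  afterwards, by comparison with the norm of one tangent space.\<close>

definition C1_on :: "'a::euclidean_space set \<Rightarrow> ('a \<Rightarrow> 'b::real_normed_vector) \<Rightarrow> bool" where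
  "C1_on S f \<longleftrightarrow> (\<exists>f'. (\<forall>x\<in>S. (f has_derivative blinfun_apply (f' x)) (at x)) \<and> continuous_on S f')"

lemmas continuous_on_blinfun_apply = bounded_bilinear.continuous_on[OF bounded_bilinear_blinfun_apply]
lemmas continuous_on_blinfun_compose = bounded_bilinear.continuous_on[OF bounded_bilinear_blinfun_compose]

text \<open>In finite dimension, continuity of the derivative on each basis vector already gives
  continuity in the operator norm. \<open>C1_on\<close> asks for the latter because the ODE
  estimates and local injectivity need uniformity over all directions.\<close>

lemma C1_onI:
  fixes f :: "'a::euclidean_space \<Rightarrow> 'b::real_normed_vector"
  assumes "\<And>x. x \<in> S \<Longrightarrow> (f has_derivative f' x) (at x)"
    and "\<And>b. b \<in> Basis \<Longrightarrow> continuous_on S (\<lambda>x. f' x b)"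
  shows "C1_on S f"
proof -
  have bl: "bounded_linear (f' x)" if "x \<in> S" for x
    using assms(1)[OF that] has_derivative_bounded_linear by blast
  have "continuous_on S (\<lambda>x. Blinfun (f' x))"
  proof -
    have "continuous_on S (\<lambda>x. blinfun_apply (Blinfun (f' x)) i)" if "i \<in> Basis" for i
      using assms(2)[OF that] by (rule continuous_on_eq) (simp add: bounded_linear_Blinfun_apply bl)
    then show ?thesis
      unfolding continuous_on_eq_continuous_within
      by (intro ballI continuous_blinfun_componentwiseI1) auto
  qed
  then show ?thesis
    unfolding C1_on_def using assms(1) bl by (intro exI[of _ "\<lambda>x. Blinfun (f' x)"]) (simp add: bounded_linear_Blinfun_apply)
qed

lemma C1_onE:
  assumes "C1_on S f"
  obtains f' where "\<And>x. x \<in> S \<Longrightarrow> (f has_derivative blinfun_apply (f' x)) (at x)" "continuous_on S f'"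
  using assms unfolding C1_on_def by blast

lemma C1_on_subset: "C1_on S f \<Longrightarrow> T \<subseteq> S \<Longrightarrow> C1_on T f"
  unfolding C1_on_def by (meson continuous_on_subset subsetD)

lemma C1_on_imp_continuous_on: "C1_on S f \<Longrightarrow> continuous_on S f"
  by (meson C1_onE continuous_at_imp_continuous_on has_derivative_continuous)

lemma C1_on_cong:
  assumes "open S" "C1_on S f" "\<And>x. x \<in> S \<Longrightarrow> f x = g x"
  shows "C1_on S g"
proof -
  obtain f' where f': "\<And>x. x \<in> S \<Longrightarrow> (f has_derivative blinfun_apply (f' x)) (at x)" "continuous_on S f'"
    using assms(2) C1_onE by blast
  have "(g has_derivative blinfun_apply (f' x)) (at x)" if "x \<in> S" for x
    using has_derivative_transform_within_open[OF f'(1)[OF that] assms(1) that] assms(3) by simp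
  with f'(2) show ?thesis unfolding C1_on_def by blast
qed

lemma C1_on_frechet:
  assumes "C1_on S f"
  shows "x \<in> S \<Longrightarrow> (f has_derivative frechet_derivative f (at x)) (at x)"
    and "continuous_on S (\<lambda>x. frechet_derivative f (at x) v)"
proof -
  obtain f' where f': "\<And>x. x \<in> S \<Longrightarrow> (f has_derivative blinfun_apply (f' x)) (at x)" "continuous_on S f'"
    using assms C1_onE by blast
  have eq: "frechet_derivative f (at x) = blinfun_apply (f' x)" if "x \<in> S" for x
    using frechet_derivative_at[OF f'(1)[OF that]] by simp
  show "x \<in> S \<Longrightarrow> (f has_derivative frechet_derivative f (at x)) (at x)"
    using eq f'(1) by simp
  have "continuous_on S (\<lambda>x. blinfun_apply (f' x) v)"
    by (rule continuous_on_blinfun_apply[OF f'(2) continuous_on_const])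
  then show "continuous_on S (\<lambda>x. frechet_derivative f (at x) v)"
    by (rule continuous_on_eq) (simp add: eq)
qed

lemma C1_on_const: "C1_on S (\<lambda>x. k)"
  by (rule C1_onI[where f' = "\<lambda>x v. 0"]) (auto intro!: derivative_eq_intros)

lemma C1_on_bounded_linear: "bounded_linear h \<Longrightarrow> C1_on S h"
  by (rule C1_onI[where f' = "\<lambda>x. h"]) (auto intro!: bounded_linear_imp_has_derivative)

lemma C1_on_compose:
  assumes "C1_on S f" "C1_on T g" "\<And>x. x \<in> S \<Longrightarrow> f x \<in> T"
  shows "C1_on S (\<lambda>x. g (f x))"
proof -
  obtain f' where f': "\<And>x. x \<in> S \<Longrightarrow> (f has_derivative blinfun_apply (f' x)) (at x)" "continuous_on S f'"
    using assms C1_onE by blast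
  obtain g' where g': "\<And>x. x \<in> T \<Longrightarrow> (g has_derivative blinfun_apply (g' x)) (at x)" "continuous_on T g'"
    using assms C1_onE by blast
  have "continuous_on S (\<lambda>x. g' (f x) o\<^sub>L f' x)"
    by (rule continuous_on_blinfun_compose[OF continuous_on_compose2[OF g'(2) C1_on_imp_continuous_on[OF assms(1)]] f'(2)])
       (use assms(3) in auto)
  moreover have "((\<lambda>x. g (f x)) has_derivative blinfun_apply (g' (f x) o\<^sub>L f' x)) (at x)" if "x \<in> S" for x
    using has_derivative_compose[OF f'(1)[OF that] g'(1)[OF assms(3)[OF that]]]
    by (simp add: blinfun_compose.rep_eq o_def)
  ultimately show ?thesis unfolding C1_on_def by (intro exI[of _ "\<lambda>x. g' (f x) o\<^sub>L f' x"]) simp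
qed

lemma C1_on_linear_compose: "bounded_linear h \<Longrightarrow> C1_on S f \<Longrightarrow> C1_on S (\<lambda>x. h (f x))"
  for f :: "'a::euclidean_space \<Rightarrow> 'b::euclidean_space"
  by (rule C1_on_compose[OF _ C1_on_bounded_linear[where S=UNIV]]) auto

lemma C1_on_add:
  assumes "C1_on S f" "C1_on S g" shows "C1_on S (\<lambda>x. f x + g x)"
proof -
  obtain f' where f': "\<And>x. x \<in> S \<Longrightarrow> (f has_derivative blinfun_apply (f' x)) (at x)" "continuous_on S f'"
    using assms C1_onE by blast
  obtain g' where g': "\<And>x. x \<in> S \<Longrightarrow> (g has_derivative blinfun_apply (g' x)) (at x)" "continuous_on S g'"
    using assms C1_onE by blast
  show ?thesis
  proof (rule C1_onI[where f' = "\<lambda>x v. f' x v + g' x v"])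
    show "((\<lambda>x. f x + g x) has_derivative (\<lambda>v. f' x v + g' x v)) (at x)" if "x \<in> S" for x
      by (intro has_derivative_add f' g' that)
    show "continuous_on S (\<lambda>x. f' x b + g' x b)" for b
      by (intro continuous_on_add continuous_on_blinfun_apply f' g' continuous_on_const)
  qed
qed

lemma C1_on_bilinear:
  fixes f :: "'a::euclidean_space \<Rightarrow> 'b::real_normed_vector" and g :: "'a \<Rightarrow> 'c::real_normed_vector"
    and pr :: "'b \<Rightarrow> 'c \<Rightarrow> 'd::real_normed_vector"
  assumes bl: "bounded_bilinear pr" and "C1_on S f" "C1_on S g"
  shows "C1_on S (\<lambda>x. pr (f x) (g x))"
proof -
  obtain f' where f': "\<And>x. x \<in> S \<Longrightarrow> (f has_derivative blinfun_apply (f' x)) (at x)" "continuous_on S f'"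
    using assms C1_onE by blast
  obtain g' where g': "\<And>x. x \<in> S \<Longrightarrow> (g has_derivative blinfun_apply (g' x)) (at x)" "continuous_on S g'"
    using assms C1_onE by blast
  show ?thesis
  proof (rule C1_onI[where f' = "\<lambda>x v. pr (f x) (g' x v) + pr (f' x v) (g x)"])
    fix x assume "x \<in> S"
    then show "((\<lambda>x. pr (f x) (g x)) has_derivative (\<lambda>v. pr (f x) (g' x v) + pr (f' x v) (g x))) (at x)"
      by (intro bounded_bilinear.FDERIV[OF bl] f' g')
  next
    fix b :: 'a assume "b \<in> Basis"
    show "continuous_on S (\<lambda>x. pr (f x) (g' x b) + pr (f' x b) (g x))"
      using assms(2,3)[THEN C1_on_imp_continuous_on]
      by (intro continuous_on_add bounded_bilinear.continuous_on[OF bl] continuous_on_blinfun_apply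
          continuous_on_const f' g') auto
  qed
qed

lemmas C1_on_mult = C1_on_bilinear[OF bounded_bilinear_mult]
lemmas C1_on_scaleR = C1_on_bilinear[OF bounded_bilinear_scaleR]
lemmas C1_on_inner = C1_on_bilinear[OF bounded_bilinear_inner]

lemma C1_on_minus: "C1_on S f \<Longrightarrow> C1_on S (\<lambda>x. - f x)"
  using C1_on_scaleR[OF C1_on_const[of S "-1::real"], of f] by simp

lemma C1_on_diff: "C1_on S f \<Longrightarrow> C1_on S g \<Longrightarrow> C1_on S (\<lambda>x. f x - g x)"
  using C1_on_add[OF _ C1_on_minus, of S f g] by simp

lemma C1_on_sum: "(\<And>i. i \<in> I \<Longrightarrow> C1_on S (f i)) \<Longrightarrow> C1_on S (\<lambda>x. \<Sum>i\<in>I. f i x)"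
  by (induction I rule: infinite_finite_induct) (auto intro: C1_on_const C1_on_add)

lemma C1_on_prod:
  fixes f :: "'i \<Rightarrow> 'a::euclidean_space \<Rightarrow> real"
  shows "(\<And>i. i \<in> I \<Longrightarrow> C1_on S (f i)) \<Longrightarrow> C1_on S (\<lambda>x. \<Prod>i\<in>I. f i x)"
  by (induction I rule: infinite_finite_induct) (auto intro: C1_on_const C1_on_mult)

lemma C1_on_inverse:
  fixes f :: "'a::euclidean_space \<Rightarrow> real"
  assumes "C1_on S f" "\<And>x. x \<in> S \<Longrightarrow> f x \<noteq> 0"
  shows "C1_on S (\<lambda>x. inverse (f x))"
proof (rule C1_on_compose[OF assms(1), where T = "-{0}"])
  show "C1_on (-{0}) (inverse :: real \<Rightarrow> real)"
    by (rule C1_onI[where f' = "\<lambda>x v. - (inverse x * v * inverse x)"])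
      (auto intro: has_derivative_inverse' intro!: continuous_on_minus continuous_on_mult continuous_on_inverse continuous_on_id continuous_on_const)
qed (use assms in auto)

lemma C1_on_divide:
  fixes f :: "'a::euclidean_space \<Rightarrow> real"
  assumes "C1_on S f" "C1_on S g" "\<And>x. x \<in> S \<Longrightarrow> g x \<noteq> 0"
  shows "C1_on S (\<lambda>x. f x / g x)"
  unfolding divide_inverse by (intro C1_on_mult C1_on_inverse assms)

lemma C1_on_vec:
  fixes f :: "'a::euclidean_space \<Rightarrow> real ^ 'n::finite"
  assumes "\<And>i. C1_on S (\<lambda>x. f x $ i)"
  shows "C1_on S f"
proof -
  have "C1_on S (\<lambda>x. \<Sum>i\<in>UNIV. (f x $ i) *\<^sub>R (axis i 1 :: real^'n))"
    by (intro C1_on_sum C1_on_scaleR assms C1_on_const)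
  moreover have "(\<Sum>i\<in>UNIV. (v $ i) *\<^sub>R (axis i 1 :: real^'n)) = v" for v :: "real^'n"
    using basis_expansion[of v] by (simp add: vector_scalar_mult_def scalar_mult_eq_scaleR)
  ultimately show ?thesis by simp
qed

lemma C1_on_nth:
  fixes f :: "'a::euclidean_space \<Rightarrow> 'b::euclidean_space ^ 'n::finite"
  shows "C1_on S f \<Longrightarrow> C1_on S (\<lambda>x. f x $ i)"
  by (rule C1_on_linear_compose[OF bounded_linear_vec_nth])

lemma C1_on_Pair:
  fixes f :: "'a::euclidean_space \<Rightarrow> 'b::euclidean_space" and g :: "'a \<Rightarrow> 'c::euclidean_space"
  assumes "C1_on S f" "C1_on S g" shows "C1_on S (\<lambda>x. (f x, g x))"
proof -
  have "C1_on S (\<lambda>x. (f x, 0) + (0, g x))"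
    by (intro C1_on_add C1_on_linear_compose[OF _ assms(1)] C1_on_linear_compose[OF _ assms(2)]
        bounded_linear_Pair bounded_linear_ident bounded_linear_zero)
  then show ?thesis by simp
qed

lemma C1_on_fst: "C1_on S f \<Longrightarrow> C1_on S (\<lambda>x. fst (f x))"
  for f :: "'a::euclidean_space \<Rightarrow> 'b::euclidean_space \<times> 'c::euclidean_space"
  by (rule C1_on_linear_compose[OF bounded_linear_fst])

lemma C1_on_snd: "C1_on S f \<Longrightarrow> C1_on S (\<lambda>x. snd (f x))"
  for f :: "'a::euclidean_space \<Rightarrow> 'b::euclidean_space \<times> 'c::euclidean_space"
  by (rule C1_on_linear_compose[OF bounded_linear_snd])

lemma C1_on_id: "C1_on S (\<lambda>x. x)"
  by (rule C1_on_bounded_linear[OF bounded_linear_ident])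

lemmas C1_intros = C1_on_const C1_on_id C1_on_add C1_on_diff C1_on_minus C1_on_mult C1_on_scaleR C1_on_inner
  C1_on_sum C1_on_nth C1_on_Pair C1_on_fst C1_on_snd

lemma C1_on_det:
  fixes A :: "'a::euclidean_space \<Rightarrow> real ^ 'n::finite ^ 'n"
  assumes "\<And>i j. C1_on S (\<lambda>x. A x $ i $ j)"
  shows "C1_on S (\<lambda>x. det (A x))"
  unfolding det_def by (intro C1_on_sum C1_on_mult C1_on_const C1_on_prod assms)

text \<open>By Cramer's rule an entry of the inverse is a quotient of two determinants, hence of
  polynomials in the entries. This makes the Christoffel symbols continuously
  differentiable.\<close>

lemma C1_on_matrix_inv:
  fixes A :: "'a::euclidean_space \<Rightarrow> real ^ 'n::finite ^ 'n"
  assumes "open S" "C1_on S A" "\<And>x. x \<in> S \<Longrightarrow> invertible (A x)"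
  shows "C1_on S (\<lambda>x. matrix_inv (A x) $ k $ l)"
proof (rule C1_on_cong[OF assms(1)])
  let ?d = "\<lambda>x. det (\<chi> i j. if j = k then axis l 1 $ i else A x $ i $ j) / det (A x)"
  show "C1_on S ?d"
  proof (intro C1_on_divide C1_on_det)
    fix i j
    show "C1_on S (\<lambda>x. (\<chi> i j. if j = k then axis l 1 $ i else A x $ i $ j) $ i $ j)"
      using C1_on_nth[OF C1_on_nth[OF assms(2)]] by (cases "j = k") (simp_all add: C1_on_const)
    show "C1_on S (\<lambda>x. A x $ i $ j)" using C1_on_nth[OF C1_on_nth[OF assms(2)]] .
  qed (use assms(3) invertible_det_nz in blast)
  fix x assume x: "x \<in> S"
  have "A x ** matrix_inv (A x) = mat 1"
    using assms(3)[OF x] someI_ex[of "\<lambda>A'. A x ** A' = mat 1 \<and> A' ** A x = mat 1"]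
    unfolding invertible_def matrix_inv_def by blast
  then have "A x *v (matrix_inv (A x) *v axis l 1) = axis l 1"
    by (simp add: matrix_vector_mul_assoc)
  then have "matrix_inv (A x) *v axis l 1
      = (\<chi> k. det (\<chi> i j. if j = k then axis l 1 $ i else A x $ i $ j) / det (A x))"
    using cramer[of "A x"] assms(3)[OF x] invertible_det_nz[of "A x"] by blast
  then have "(matrix_inv (A x) *v axis l 1) $ k = ?d x" by simp
  then show "?d x = matrix_inv (A x) $ k $ l"
    by (simp add: matrix_vector_mul_component inner_axis)
qed

section \<open>Smooth maps and their derivatives\<close>

lemma smooth_on_frechet: "smooth_on S f \<Longrightarrow> b \<in> Basis \<Longrightarrow> smooth_on S (\<lambda>x. frechet_derivative f (at x) b)"
  unfolding smooth_on_def by (metis C_k.simps(2))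

lemma smooth_on_imp_C1_on:
  assumes "open S" "smooth_on S f" shows "C1_on S f"
proof (rule C1_onI)
  have "f differentiable_on S" using assms(2) unfolding smooth_on_def by (metis C_k.simps(2))
  then show "(f has_derivative frechet_derivative f (at x)) (at x)" if "x \<in> S" for x
    using that assms(1) frechet_derivative_works differentiable_on_eq_differentiable_at by blast
  show "continuous_on S (\<lambda>x. frechet_derivative f (at x) b)" if "b \<in> Basis" for b
    using smooth_on_frechet[OF assms(2) that] unfolding smooth_on_def by (metis C_k.simps(1))
qed

lemma linear_basis_expansion:
  fixes f :: "'a::euclidean_space \<Rightarrow> 'b::real_vector"
  assumes "linear f" shows "f v = (\<Sum>b\<in>Basis. (v \<bullet> b) *\<^sub>R f b)"
  by (metis (no_types, lifting) assms euclidean_representation linear_cmul linear_sum sum.cong)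

text \<open>Linearity in the direction reduces the claim to the finitely many basis directions.
  Applied to a change of charts, it says that velocities transform in a C1 way jointly with
  positions.\<close>

lemma smooth_on_imp_C1_on_derivative:
  fixes f :: "'a::euclidean_space \<Rightarrow> 'b::real_normed_vector"
  assumes "open S" "smooth_on S f"
  shows "C1_on (S \<times> UNIV) (\<lambda>z. frechet_derivative f (at (fst z)) (snd z))"
proof (rule C1_on_cong[of _ "\<lambda>z. \<Sum>b\<in>Basis. (snd z \<bullet> b) *\<^sub>R frechet_derivative f (at (fst z)) b"])
  show "open (S \<times> (UNIV::'a set))" using assms(1) by (simp add: open_Times)
  have *: "C1_on (S \<times> UNIV) (\<lambda>z::'a\<times>'a. frechet_derivative f (at (fst z)) b)" if "b \<in> Basis" for b
    by (rule C1_on_compose[where g = "\<lambda>x. frechet_derivative f (at x) b" and f = fst,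
          OF C1_on_fst[OF C1_on_id] smooth_on_imp_C1_on[OF assms(1) smooth_on_frechet[OF assms(2) that]]])
      auto
  show "C1_on (S \<times> UNIV) (\<lambda>z::'a\<times>'a. \<Sum>b\<in>Basis. (snd z \<bullet> b) *\<^sub>R frechet_derivative f (at (fst z)) b)"
    by (rule C1_on_sum, rule C1_on_scaleR[OF C1_on_inner[OF C1_on_snd[OF C1_on_id] C1_on_const] *])
  fix z :: "'a \<times> 'a" assume z: "z \<in> S \<times> UNIV"
  have "linear (frechet_derivative f (at (fst z)))"
    using C1_on_frechet(1)[OF smooth_on_imp_C1_on[OF assms], of "fst z"] z
    by (auto dest: has_derivative_linear)
  from linear_basis_expansion[OF this, of "snd z"]
  show "(\<Sum>b\<in>Basis. (snd z \<bullet> b) *\<^sub>R frechet_derivative f (at (fst z)) b) = frechet_derivative f (at (fst z)) (snd z)"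
    by simp
qed

section \<open>Ordinary differential equations\<close>

text \<open>The integral bound \<open>U\<close> dominates \<open>norm (f t)\<close> and satisfies
  \<open>U' \<le> L * U\<close>, so \<open>U\<close> times the decaying exponential is
  nonincreasing. With \<open>\<eta> = 0\<close> this yields uniqueness, with small
  \<open>\<eta>\<close> error estimates, and with \<open>L = 0\<close> a bound on the
  displacement.\<close>

lemma gronwall:
  fixes f :: "real \<Rightarrow> 'a::banach"
  assumes der: "\<And>t. t \<in> {a..b} \<Longrightarrow> (f has_vector_derivative f' t) (at t within {a..b})"
    and bound: "\<And>t. t \<in> {a..b} \<Longrightarrow> norm (f' t) \<le> L * norm (f t) + \<eta>"
    and "0 \<le> L" "0 \<le> \<eta>" "t \<in> {a..b}"
  shows "norm (f t) \<le> (norm (f a) + \<eta> * (b - a)) * exp (L * (b - a))"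
proof -
  have ab: "a \<le> b" using \<open>t \<in> {a..b}\<close> by auto
  define A where "A = norm (f a) + \<eta> * (b - a)"
  have A0: "0 \<le> A" using ab \<open>0 \<le> \<eta>\<close> by (simp add: A_def)
  have cf: "continuous_on {a..b} f"
    by (meson continuous_on_vector_derivative der)
  then have c\<phi>: "continuous_on {a..b} (\<lambda>t. norm (f t))" by (rule continuous_on_norm)
  define U where "U t = A + L * integral {a..t} (\<lambda>t. norm (f t))" for t
  have derU: "(U has_real_derivative L * norm (f t)) (at t within {a..b})" if "t \<in> {a..b}" for t
    unfolding U_def
    by (rule DERIV_cong[OF DERIV_add[OF DERIV_const DERIV_cmult[OF integral_has_real_derivative[OF c\<phi> that]]]]) simp
  have \<phi>U: "norm (f t) \<le> U t" if t: "t \<in> {a..b}" for t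
  proof -
    have sub: "{a..t} \<subseteq> {a..b}" using t by auto
    have d: "(f' has_integral (f t - f a)) {a..t}"
    proof (rule fundamental_theorem_of_calculus)
      fix x assume "x \<in> {a..t}"
      with sub have "x \<in> {a..b}" by blast
      from has_vector_derivative_within_subset[OF der[OF this] sub]
      show "(f has_vector_derivative f' x) (at x within {a..t})" .
    qed (use t in auto)
    have ci: "(\<lambda>t. L * norm (f t) + \<eta>) integrable_on {a..t}"
      by (intro integrable_continuous_real continuous_intros continuous_on_subset[OF cf sub])
    have "norm (f t - f a) \<le> integral {a..t} (\<lambda>t. L * norm (f t) + \<eta>)"
      using integral_norm_bound_integral[OF has_integral_integrable[OF d] ci] bound sub d
      by (simp add: integral_unique subset_iff)
    also have "\<dots> = L * integral {a..t} (\<lambda>t. norm (f t)) + \<eta> * (t - a)"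
      using t by (subst integral_add) (auto intro!: integrable_continuous_real continuous_intros continuous_on_subset[OF cf sub])
    also have "\<dots> \<le> L * integral {a..t} (\<lambda>t. norm (f t)) + \<eta> * (b - a)"
      using t \<open>0 \<le> \<eta>\<close> by (auto intro: mult_left_mono)
    finally show ?thesis unfolding U_def A_def
      using norm_triangle_ineq[of "f a" "f t - f a"] by simp
  qed
  define V where "V t = U t * exp (- L * (t - a))" for t
  have derV: "(V has_real_derivative (L * norm (f t) - L * U t) * exp (- L * (t - a))) (at t within {a..b})"
    if "t \<in> {a..b}" for t
  proof -
    have e: "((\<lambda>t. exp (- L * (t - a))) has_real_derivative (- L) * exp (- L * (t - a))) (at t within {a..b})"
    proof -
      have "((\<lambda>t. - L * (t - a)) has_real_derivative - L) (at t within {a..b})"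
        by (rule DERIV_cong[OF DERIV_cmult[OF DERIV_diff[OF DERIV_ident DERIV_const]]]) simp
      from DERIV_chain2[OF DERIV_exp this] show ?thesis by (simp add: mult.commute)
    qed
    have "(V has_real_derivative (L * norm (f t)) * exp (- L * (t - a)) + (- L) * exp (- L * (t - a)) * U t) (at t within {a..b})"
      unfolding V_def by (rule DERIV_mult[OF derU[OF that] e])
    then show ?thesis by (rule DERIV_cong) (simp add: algebra_simps)
  qed
  have "V t \<le> V a"
  proof (rule DERIV_nonpos_imp_decreasing_open[where f = V and a = a and b = t])
    show "a \<le> t" using \<open>t \<in> {a..b}\<close> by auto
  next
    fix x assume x: "a < x" "x < t"
    then have xb: "x \<in> {a..b}" "a < x" "x < b" using \<open>t \<in> {a..b}\<close> by auto
    have "(V has_real_derivative (L * norm (f x) - L * U x) * exp (- L * (x - a))) (at x)"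
      using derV[OF xb(1)] at_within_Icc_at[OF xb(2,3)] by simp
    moreover have "(L * norm (f x) - L * U x) * exp (- L * (x - a)) \<le> 0"
      using \<phi>U[OF xb(1)] \<open>0 \<le> L\<close> by (simp add: mult_left_mono mult_nonpos_nonneg)
    ultimately show "\<exists>y. (V has_real_derivative y) (at x) \<and> y \<le> 0" by blast
  next
    have "continuous_on {a..b} V"
      by (rule DERIV_continuous_on[OF derV])
    then show "continuous_on {a..t} V" by (rule continuous_on_subset) (use \<open>t \<in> {a..b}\<close> in auto)
  qed
  then have UA: "U t * exp (- L * (t - a)) \<le> A" unfolding V_def by (simp add: U_def)
  have "U t = (U t * exp (- L * (t - a))) * exp (L * (t - a))"
    by (simp add: mult.assoc flip: exp_add)
  also have "\<dots> \<le> A * exp (L * (t - a))"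
    using UA by (rule mult_right_mono) simp
  also have "\<dots> \<le> A * exp (L * (b - a))"
    using A0 \<open>0 \<le> L\<close> \<open>t \<in> {a..b}\<close> by (intro mult_left_mono) (auto intro: mult_left_mono)
  finally show ?thesis using \<phi>U[OF \<open>t \<in> {a..b}\<close>] unfolding A_def by linarith
qed

text \<open>Banach's fixed point theorem: on an interval this short the integral operator is a
  contraction with factor 1/2. The unknown is operator-valued, so that all initial directions are
  solved at once.\<close>

lemma linear_ode_exists:
  fixes B :: "real \<Rightarrow> 'a::banach \<Rightarrow>\<^sub>L 'a" and Dinit :: "'w::real_normed_vector \<Rightarrow>\<^sub>L 'a"
  assumes ab: "a \<le> b" and cB: "continuous_on {a..b} B"
    and BL: "\<And>t. t \<in> {a..b} \<Longrightarrow> norm (B t) \<le> L" and Lb: "L * (b - a) \<le> 1 / 2"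
  obtains D where "D a = Dinit"
    "\<And>t. t \<in> {a..b} \<Longrightarrow> (D has_vector_derivative B t o\<^sub>L D t) (at t within {a..b})"
proof -
  have L0: "0 \<le> L" by (rule order_trans[OF norm_ge_zero BL[of a]]) (use ab in auto)
  \<comment> \<open>Clamping the time to \<open>{a..b}\<close> turns the integral operator into a
    self-map of the bounded continuous functions on the whole line, a complete space.\<close>
  define cl where "cl t = max a (min b t)" for t :: real
  have cl: "cl t \<in> {a..b}" for t using ab by (auto simp: cl_def)
  have ccl: "continuous_on UNIV cl" unfolding cl_def by (intro continuous_intros)
  define T where "T \<phi> t = Dinit + integral {a..cl t} (\<lambda>s. B s o\<^sub>L apply_bcontfun \<phi> s)" for \<phi> :: "real \<Rightarrow>\<^sub>C ('w \<Rightarrow>\<^sub>L 'a)" and t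
  have ch: "continuous_on {a..b} (\<lambda>s. B s o\<^sub>L apply_bcontfun \<phi> s)" for \<phi> :: "real \<Rightarrow>\<^sub>C ('w \<Rightarrow>\<^sub>L 'a)"
    by (intro continuous_on_blinfun_compose cB continuous_on_apply_bcontfun)
  have ih: "(\<lambda>s. B s o\<^sub>L apply_bcontfun \<phi> s) integrable_on {a..cl t}" for \<phi> :: "real \<Rightarrow>\<^sub>C ('w \<Rightarrow>\<^sub>L 'a)" and t
    using cl[of t] by (intro integrable_continuous_real continuous_on_subset[OF ch]) auto
  have diff: "norm (T \<phi> t - T \<psi> t) \<le> 1/2 * dist \<phi> \<psi>" for \<phi> \<psi> t
  proof -
    have "T \<phi> t - T \<psi> t = integral {a..cl t} (\<lambda>s. (B s o\<^sub>L apply_bcontfun \<phi> s) - (B s o\<^sub>L apply_bcontfun \<psi> s))"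
      unfolding T_def by (subst integral_diff[OF ih ih]) simp
    also have "norm \<dots> \<le> integral {a..cl t} (\<lambda>s. L * dist \<phi> \<psi>)"
    proof (rule integral_norm_bound_integral)
      fix s assume s: "s \<in> {a..cl t}"
      then have sb: "s \<in> {a..b}" using cl[of t] by auto
      have "norm ((B s o\<^sub>L apply_bcontfun \<phi> s) - (B s o\<^sub>L apply_bcontfun \<psi> s))
          = norm (B s o\<^sub>L (apply_bcontfun \<phi> s - apply_bcontfun \<psi> s))"
        by (simp add: bounded_bilinear.diff_right[OF bounded_bilinear_blinfun_compose])
      also have "\<dots> \<le> norm (B s) * norm (apply_bcontfun \<phi> s - apply_bcontfun \<psi> s)"
        by (rule norm_blinfun_compose)
      also have "\<dots> \<le> L * dist \<phi> \<psi>"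
        using BL[OF sb] dist_bounded[of \<phi> s \<psi>] L0 by (intro mult_mono) (auto simp: dist_norm)
      finally show "norm ((B s o\<^sub>L apply_bcontfun \<phi> s) - (B s o\<^sub>L apply_bcontfun \<psi> s)) \<le> L * dist \<phi> \<psi>" .
    qed (auto intro!: integrable_diff ih)
    also have "\<dots> = (L * (cl t - a)) * dist \<phi> \<psi>"
      using cl[of t] by (simp add: mult_ac)
    also have "\<dots> \<le> (L * (b - a)) * dist \<phi> \<psi>"
      using cl[of t] L0 by (intro mult_right_mono mult_left_mono) auto
    also have "\<dots> \<le> 1/2 * dist \<phi> \<psi>"
      using Lb by (intro mult_right_mono) auto
    finally show ?thesis .
  qed
  have Tb: "T \<phi> \<in> bcontfun" for \<phi>
  proof (rule bcontfun_normI)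
    have "continuous_on {a..b} (\<lambda>t. integral {a..t} (\<lambda>s. B s o\<^sub>L apply_bcontfun \<phi> s))"
      by (intro indefinite_integral_continuous_1 integrable_continuous_real ch)
    then have "continuous_on UNIV (\<lambda>t. integral {a..cl t} (\<lambda>s. B s o\<^sub>L apply_bcontfun \<phi> s))"
      by (rule continuous_on_compose2[OF _ ccl]) (use cl in blast)
    then show "continuous_on UNIV (T \<phi>)" unfolding T_def by (intro continuous_on_add continuous_on_const)
    have "T 0 t = Dinit" for t unfolding T_def by simp
    then show "norm (T \<phi> t) \<le> 1/2 * dist \<phi> 0 + norm Dinit" for t
      using diff[of \<phi> t 0] norm_triangle_ineq2[of "T \<phi> t" Dinit] by simp
  qed
  have ap: "apply_bcontfun (Bcontfun (T \<phi>)) = T \<phi>" for \<phi>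
    using Tb by (rule Bcontfun_inverse)
  have "\<exists>!\<phi>\<in>UNIV. Bcontfun (T \<phi>) = \<phi>"
  proof (rule Banach_fix[where c = "1/2"])
    show "complete (UNIV :: (real \<Rightarrow>\<^sub>C ('w \<Rightarrow>\<^sub>L 'a)) set)" by (rule complete_UNIV)
    show "dist (Bcontfun (T \<phi>)) (Bcontfun (T \<psi>)) \<le> 1 / 2 * dist \<phi> \<psi>" for \<phi> \<psi>
      by (rule dist_bound) (simp only: ap dist_norm[of "T _ _"] diff)
  qed auto
  then obtain \<phi> where \<phi>: "T \<phi> = apply_bcontfun \<phi>" using ap by metis
  have eq: "apply_bcontfun \<phi> t = Dinit + integral {a..t} (\<lambda>s. B s o\<^sub>L apply_bcontfun \<phi> s)" if "t \<in> {a..b}" for t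
  proof -
    have "cl t = t" using that by (auto simp: cl_def)
    then show ?thesis using fun_cong[OF \<phi>, of t] unfolding T_def by simp
  qed
  show thesis
  proof
    show "apply_bcontfun \<phi> a = Dinit" using eq[of a] ab by simp
    fix t assume t: "t \<in> {a..b}"
    have "((\<lambda>t. Dinit + integral {a..t} (\<lambda>s. B s o\<^sub>L apply_bcontfun \<phi> s)) has_vector_derivative B t o\<^sub>L apply_bcontfun \<phi> t) (at t within {a..b})"
      using has_vector_derivative_add[OF has_vector_derivative_const integral_has_vector_derivative[OF ch t]] by simp
    from has_vector_derivative_transform[OF t eq this]
    show "(apply_bcontfun \<phi> has_vector_derivative B t o\<^sub>L apply_bcontfun \<phi> t) (at t within {a..b})" by simp
  qed
qed


text \<open>Moving first in \<open>w\<close>, uniformly in \<open>t\<close>, and then in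
  \<open>t\<close> alone costs \<open>e/2\<close> each.\<close>

lemma continuous_on_Times_uniform:
  fixes f :: "'t::metric_space \<Rightarrow> 'w::metric_space \<Rightarrow> 'c::metric_space"
  assumes 1: "\<And>w. w \<in> W \<Longrightarrow> continuous_on T (\<lambda>t. f t w)"
    and 2: "\<And>w e. w \<in> W \<Longrightarrow> e > 0 \<Longrightarrow> \<exists>d>0. \<forall>w'\<in>W. dist w' w < d \<longrightarrow> (\<forall>t\<in>T. dist (f t w') (f t w) < e)"
  shows "continuous_on (T \<times> W) (\<lambda>z. f (fst z) (snd z))"
  unfolding continuous_on_iff
proof (intro ballI allI impI)
  fix z e assume z: "z \<in> T \<times> W" and e: "(0::real) < e"
  obtain d1 where d1: "d1 > 0" "\<And>t. t \<in> T \<Longrightarrow> dist t (fst z) < d1 \<Longrightarrow> dist (f t (snd z)) (f (fst z) (snd z)) < e/2"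
    using 1[of "snd z"] z e unfolding continuous_on_iff by (metis half_gt_zero mem_Times_iff)
  obtain d2 where d2: "d2 > 0" "\<And>w t. w \<in> W \<Longrightarrow> dist w (snd z) < d2 \<Longrightarrow> t \<in> T \<Longrightarrow> dist (f t w) (f t (snd z)) < e/2"
    using 2[of "snd z" "e/2"] z e by (auto simp: mem_Times_iff)
  show "\<exists>d>0. \<forall>x'\<in>T \<times> W. dist x' z < d \<longrightarrow> dist (f (fst x') (snd x')) (f (fst z) (snd z)) < e"
  proof (intro exI[of _ "min d1 d2"] conjI ballI impI)
    fix x' assume x': "x' \<in> T \<times> W" "dist x' z < min d1 d2"
    have "dist (fst x') (fst z) < d1" "dist (snd x') (snd z) < d2"
      using x' dist_fst_le[of x' z] dist_snd_le[of x' z] by auto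
    then have "dist (f (fst x') (snd z)) (f (fst z) (snd z)) < e/2" "dist (f (fst x') (snd x')) (f (fst x') (snd z)) < e/2"
      using d1 d2 x' by (auto simp: mem_Times_iff)
    then show "dist (f (fst x') (snd x')) (f (fst z) (snd z)) < e"
      by (metis dist_commute dist_triangle_half_r)
  qed (use d1 d2 in auto)
qed

lemma has_vector_derivative_blinfun_apply_left:
  "(D has_vector_derivative D') F \<Longrightarrow> ((\<lambda>t. blinfun_apply (D t) v) has_vector_derivative blinfun_apply D' v) F"
  by (rule bounded_linear.has_vector_derivative[OF bounded_bilinear.bounded_linear_left[OF bounded_bilinear_blinfun_apply]])

text \<open>The candidate for the derivative is the solution \<open>E\<close> of the linear
  variational equation. The remainder \<open>z t y - z t w - E w t (y - w)\<close> satisfies the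
  same linear equation up to an error that is small compared with \<open>norm (y - w)\<close>, by
  uniform continuity of \<open>F'\<close> on the compact set \<open>K\<close>; Gronwall then bounds
  it. The bound on \<open>L * (b - a)\<close> keeps every exponential factor below 2.\<close>

lemma ode_derivative_wrt_parameter:
  fixes z :: "real \<Rightarrow> 'w::euclidean_space \<Rightarrow> 'a::euclidean_space" and F' :: "'a \<Rightarrow> 'a \<Rightarrow>\<^sub>L 'a"
  assumes ab: "a \<le> b" and K: "convex K" "compact K"
    and F: "\<And>x. x \<in> K \<Longrightarrow> (F has_derivative blinfun_apply (F' x)) (at x within K)"
    and cF': "continuous_on K F'"
    and L0: "0 \<le> L" and L: "\<And>x. x \<in> K \<Longrightarrow> norm (F' x) \<le> L" and Lb: "L * (b - a) \<le> 1/2"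
    and W: "open W"
    and ode: "\<And>t w. t \<in> {a..b} \<Longrightarrow> w \<in> W \<Longrightarrow> ((\<lambda>t. z t w) has_vector_derivative F (z t w)) (at t within {a..b})"
    and zK: "\<And>t w. t \<in> {a..b} \<Longrightarrow> w \<in> W \<Longrightarrow> z t w \<in> K"
    and D0: "\<And>w. w \<in> W \<Longrightarrow> (z a has_derivative blinfun_apply (D0 w)) (at w)"
    and cD0: "continuous_on W D0"
  obtains D where
    "\<And>t w. t \<in> {a..b} \<Longrightarrow> w \<in> W \<Longrightarrow> (z t has_derivative blinfun_apply (D t w)) (at w)"
    "continuous_on ({a..b} \<times> W) (\<lambda>y. D (fst y) (snd y))"
    "continuous_on ({a..b} \<times> W) (\<lambda>y. z (fst y) (snd y))"
    "\<And>t w. t \<in> {a..b} \<Longrightarrow> w \<in> W \<Longrightarrow>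
       ((\<lambda>t. D t w) has_vector_derivative F' (z t w) o\<^sub>L D t w) (at t within {a..b})"
    "\<And>w. w \<in> W \<Longrightarrow> D a w = D0 w"
proof -
  have aux: "e / (8 * C * q) * (2 * C * n) * r = e / 4 * n * (r / q)" "e / (8 * C * q) * C * r = e / 8 * (r / q)"
    if "0 < C" "0 < q" for e C q n r :: real
    using that by (simp_all add: field_simps)
  have exp2: "exp (L * (b - a)) \<le> 2" using Lb exp_half_le2 by (meson exp_le_cancel_iff order_trans)
  have aI: "a \<in> {a..b}" using ab by auto
  have FLip: "norm (F x - F y) \<le> L * norm (x - y)" if "x \<in> K" "y \<in> K" for x y
    by (rule differentiable_bound[OF K(1) F _ that]) (assumption, subst norm_blinfun.rep_eq[symmetric], rule L)
  have zlip: "norm (z t w - z t w') \<le> 2 * norm (z a w - z a w')" if "t \<in> {a..b}" "w \<in> W" "w' \<in> W" for t w w'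
  proof -
    have "norm (z t w - z t w') \<le> (norm (z a w - z a w') + 0 * (b - a)) * exp (L * (b - a))"
      by (rule gronwall[where f = "\<lambda>t. z t w - z t w'" and f' = "\<lambda>t. F (z t w) - F (z t w')"])
        (use that L0 FLip zK ode in \<open>auto intro: has_vector_derivative_diff\<close>)
    also have "\<dots> \<le> norm (z a w - z a w') * 2" using exp2 by (simp add: mult_left_mono)
    finally show ?thesis by simp
  qed
  have cz: "continuous_on {a..b} (\<lambda>t. z t w)" if "w \<in> W" for w
    by (rule continuous_on_vector_derivative[OF ode[OF _ that]])
  have "\<exists>D. D a = D0 w \<and> (\<forall>t\<in>{a..b}. (D has_vector_derivative F' (z t w) o\<^sub>L D t) (at t within {a..b}))" if w: "w \<in> W" for w
  proof -
    have "continuous_on {a..b} (\<lambda>t. F' (z t w))"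
      by (rule continuous_on_compose2[OF cF' cz[OF w]]) (use zK[OF _ w] in auto)
    from linear_ode_exists[OF ab this L[OF zK[OF _ w]] Lb, where Dinit = "D0 w"] show ?thesis by metis
  qed
  then obtain E where Ea: "\<And>w. w \<in> W \<Longrightarrow> E w a = D0 w"
    and Ed: "\<And>w t. w \<in> W \<Longrightarrow> t \<in> {a..b} \<Longrightarrow> (E w has_vector_derivative F' (z t w) o\<^sub>L E w t) (at t within {a..b})"
    by metis
  have Eb: "norm (E w t) \<le> 2 * norm (D0 w)" if w: "w \<in> W" and t: "t \<in> {a..b}" for w t
  proof -
    have "norm (E w t) \<le> (norm (E w a) + 0 * (b - a)) * exp (L * (b - a))"
    proof (rule gronwall[OF Ed[OF w]])
      fix t assume "t \<in> {a..b}"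
      show "norm (F' (z t w) o\<^sub>L E w t) \<le> L * norm (E w t) + 0"
        using norm_blinfun_compose[of "F' (z t w)" "E w t"] L[OF zK[OF \<open>t \<in> {a..b}\<close> w]]
        by (metis add.right_neutral mult_right_mono norm_ge_zero order_trans)
    qed (use t L0 in auto)
    also have "\<dots> \<le> norm (E w a) * 2" using exp2 by (simp add: mult_left_mono)
    finally show ?thesis using Ea[OF w] by simp
  qed
  have uc: "uniformly_continuous_on K F'" using compact_uniformly_continuous cF' K(2) by blast
  have der: "(z t has_derivative blinfun_apply (E w t)) (at w)" if t: "t \<in> {a..b}" and w: "w \<in> W" for t w
    unfolding has_derivative_at_alt
  proof (intro conjI allI impI)
    show "bounded_linear (blinfun_apply (E w t))" by (rule blinfun.bounded_linear_right)
    fix e :: real assume e: "0 < e"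
    \<comment> \<open>\<open>C\<close> bounds the growth of the initial data:
      \<open>norm (z a y - z a w) \<le> C * norm (y - w)\<close> once \<open>y\<close> is close to
      \<open>w\<close>.\<close>
    define C where "C = norm (D0 w) + 1"
    have C: "C > 0" unfolding C_def using norm_ge_zero[of "D0 w"] by linarith
    \<comment> \<open>With this \<open>\<eta>\<close> the inhomogeneity, integrated over the
      interval, contributes at most \<open>e/4\<close>, as do the initial data. The factor 2 from
      Gronwall then gives exactly \<open>e\<close>.\<close>
    define \<eta> where "\<eta> = e / (8 * C * (b - a + 1))"
    have \<eta>: "\<eta> > 0" using e C ab unfolding \<eta>_def by (intro divide_pos_pos mult_pos_pos) auto
    obtain r where r: "r > 0" "ball w r \<subseteq> W" using W w open_contains_ball by blast
    obtain d1 where d1: "d1 > 0" "\<And>w'. norm (w' - w) < d1 \<Longrightarrow>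
        norm (z a w' - z a w - D0 w (w' - w)) \<le> min 1 (e/4) * norm (w' - w)"
      using D0[OF w] e unfolding has_derivative_at_alt by (metis half_gt_zero_iff less_numeral_extra(1) min_less_iff_conj zero_less_divide_iff zero_less_numeral)
    obtain \<rho> where \<rho>: "\<rho> > 0" "\<And>x y. x \<in> K \<Longrightarrow> y \<in> K \<Longrightarrow> dist y x < \<rho> \<Longrightarrow> dist (F' y) (F' x) < \<eta>"
      using uc \<eta> unfolding uniformly_continuous_on_def by metis
    define d where "d = min r (min d1 (\<rho> / (2 * C)))"
    show "\<exists>d>0. \<forall>y. norm (y - w) < d \<longrightarrow> norm (z t y - z t w - blinfun_apply (E w t) (y - w)) \<le> e * norm (y - w)"
    proof (intro exI[of _ d] conjI allI impI)
      show "d > 0" using r d1 \<rho> C by (simp add: d_def)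
      fix y assume y: "norm (y - w) < d"
      then have yW: "y \<in> W" using r by (auto simp: d_def dist_norm norm_minus_commute subset_iff)
      have ya: "norm (z a y - z a w - D0 w (y - w)) \<le> min 1 (e/4) * norm (y - w)"
        using y by (intro d1) (simp add: d_def)
      have "norm (z a y - z a w) \<le> norm (z a y - z a w - D0 w (y - w)) + norm (D0 w (y - w))"
        using norm_triangle_ineq[of "z a y - z a w - D0 w (y - w)" "D0 w (y - w)"] by simp
      also have "\<dots> \<le> 1 * norm (y - w) + norm (D0 w) * norm (y - w)"
        by (intro add_mono norm_blinfun order_trans[OF ya] mult_right_mono) auto
      finally have yC: "norm (z a y - z a w) \<le> C * norm (y - w)" by (simp add: C_def algebra_simps)
      have zz: "norm (z t y - z t w) \<le> 2 * C * norm (y - w)" if "t \<in> {a..b}" for t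
        using zlip[OF that yW w] yC by linarith
      have "2 * C * norm (y - w) < \<rho>"
        using y C by (simp add: d_def field_simps)
      then have zr: "norm (z t y - z t w) < \<rho>" if "t \<in> {a..b}" for t using zz[OF that] by linarith
      \<comment> \<open>The linearisation error of \<open>F\<close>. It is at most
        \<open>\<eta>\<close> times \<open>norm (z t y - z t w)\<close> by the mean value inequality
        on the segment between the two points, which stays in \<open>K\<close> by convexity.\<close>
      define R where "R t = F (z t y) - F (z t w) - F' (z t w) (z t y - z t w)" for t
      have Rb: "norm (R t) \<le> \<eta> * (2 * C * norm (y - w))" if t: "t \<in> {a..b}" for t
      proof -
        let ?S = "closed_segment (z t w) (z t y)"
        have SK: "?S \<subseteq> K" by (rule closed_segment_subset) (use zK t w yW K in auto)
        have "norm (R t) \<le> norm (z t y - z t w) * \<eta>"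
          unfolding R_def
        proof (rule differentiable_bound_linearization[where S = ?S and f' = "\<lambda>x. blinfun_apply (F' x)"])
          show "z t w + s *\<^sub>R (z t y - z t w) \<in> ?S" if "s \<in> {0..1}" for s
            using that unfolding closed_segment_def by (auto simp: algebra_simps intro!: exI[of _ s])
          show "(F has_derivative blinfun_apply (F' x)) (at x within ?S)" if "x \<in> ?S" for x
            using F SK that has_derivative_subset by blast
          show "onorm (blinfun_apply (F' x) - blinfun_apply (F' (z t w))) \<le> \<eta>" if x: "x \<in> ?S" for x
          proof -
            have "dist x (z t w) \<le> norm (z t y - z t w)"
              using segment_bound(1)[OF x] by (simp add: dist_norm norm_minus_commute)
            then have "dist (F' x) (F' (z t w)) < \<eta>"
              using \<rho>(2)[of "z t w" x] zr[OF t] x SK zK[OF t w] by auto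
            then show ?thesis unfolding dist_norm norm_blinfun.rep_eq by (simp add: minus_blinfun.rep_eq fun_diff_def)
          qed
        qed auto
        also have "\<dots> \<le> (2 * C * norm (y - w)) * \<eta>" using zz[OF t] \<eta> by (intro mult_right_mono) auto
        finally show ?thesis by (simp add: mult_ac)
      qed
      have "norm (z t y - z t w - E w t (y - w)) \<le> (norm (z a y - z a w - E w a (y - w)) + \<eta> * (2 * C * norm (y - w)) * (b - a)) * exp (L * (b - a))"
      proof (rule gronwall)
        fix t assume t: "t \<in> {a..b}"
        show "((\<lambda>t. z t y - z t w - E w t (y - w)) has_vector_derivative
           F (z t y) - F (z t w) - (F' (z t w) o\<^sub>L E w t) (y - w)) (at t within {a..b})"
          by (intro has_vector_derivative_diff ode t w yW has_vector_derivative_blinfun_apply_left Ed)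
        have "F (z t y) - F (z t w) - (F' (z t w) o\<^sub>L E w t) (y - w) = F' (z t w) (z t y - z t w - E w t (y - w)) + R t"
          by (simp add: R_def blinfun.diff_right)
        also have "norm \<dots> \<le> norm (F' (z t w)) * norm (z t y - z t w - E w t (y - w)) + norm (R t)"
          by (rule order_trans[OF norm_triangle_ineq]) (simp add: norm_blinfun)
        also have "\<dots> \<le> L * norm (z t y - z t w - E w t (y - w)) + \<eta> * (2 * C * norm (y - w))"
          by (intro add_mono mult_right_mono L zK t w Rb norm_ge_zero)
        finally show "norm (F (z t y) - F (z t w) - (F' (z t w) o\<^sub>L E w t) (y - w)) \<le> L * norm (z t y - z t w - E w t (y - w)) + \<eta> * (2 * C * norm (y - w))" .
      qed (use \<eta> C t L0 in auto)
      also have "\<dots> \<le> (norm (z a y - z a w - E w a (y - w)) + \<eta> * (2 * C * norm (y - w)) * (b - a)) * 2"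
        using exp2 \<eta> C ab by (intro mult_left_mono) auto
      also have "\<dots> \<le> (e/4 * norm (y - w) + e/4 * norm (y - w)) * 2"
      proof (intro mult_right_mono add_mono)
        show "norm (z a y - z a w - E w a (y - w)) \<le> e/4 * norm (y - w)"
          unfolding Ea[OF w] by (rule order_trans[OF ya mult_right_mono]) auto
        have "\<eta> * (2 * C * norm (y - w)) * (b - a) = e/4 * norm (y - w) * ((b - a) / (b - a + 1))"
          unfolding \<eta>_def using C ab by (intro aux) auto
        also have "\<dots> \<le> e/4 * norm (y - w) * 1"
          using ab e by (intro mult_left_mono) (auto simp: field_simps)
        finally show "\<eta> * (2 * C * norm (y - w)) * (b - a) \<le> e/4 * norm (y - w)" by simp
      qed simp
      finally show "norm (z t y - z t w - E w t (y - w)) \<le> e * norm (y - w)" by simp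
    qed
  qed
  have uzw: "\<exists>d>0. \<forall>w'\<in>W. dist w' w < d \<longrightarrow> (\<forall>t\<in>{a..b}. dist (z t w') (z t w) < e)" if w: "w \<in> W" and e: "e > 0" for w e
  proof -
    have "continuous (at w) (z a)" using D0[OF w] has_derivative_continuous by blast
    then obtain d where d: "d > 0" "\<And>w'. dist w' w < d \<Longrightarrow> dist (z a w') (z a w) < e/2"
      unfolding continuous_at_eps_delta using e by (metis half_gt_zero)
    show ?thesis
    proof (intro exI[of _ d] conjI ballI impI)
      fix w' t assume "w' \<in> W" "dist w' w < d" "t \<in> {a..b}"
      then show "dist (z t w') (z t w) < e" using d(2)[of w'] zlip[of t w' w] w by (simp add: dist_norm)
    qed (use d in auto)
  qed
  \<comment> \<open>The difference \<open>E w' - E w\<close> solves a linear equation with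
    inhomogeneity \<open>(F' (z t w') - F' (z t w)) o\<^sub>L E w t\<close>, which is small
    uniformly in \<open>t\<close>; here \<open>C\<close> bounds \<open>E w t\<close> and
    \<open>\<eta>\<close> the change of \<open>F'\<close>.\<close>
  have uDw: "\<exists>d>0. \<forall>w'\<in>W. dist w' w < d \<longrightarrow> (\<forall>t\<in>{a..b}. dist (E w' t) (E w t) < e)" if w: "w \<in> W" and e: "e > 0" for w e
  proof -
    define C where "C = 2 * norm (D0 w) + 1"
    have C: "C > 0" unfolding C_def using norm_ge_zero[of "D0 w"] by linarith
    define \<eta> where "\<eta> = e / (8 * C * (b - a + 1))"
    have \<eta>: "\<eta> > 0" using e C ab unfolding \<eta>_def by (intro divide_pos_pos mult_pos_pos) auto
    obtain \<rho> where \<rho>: "\<rho> > 0" "\<And>x y. x \<in> K \<Longrightarrow> y \<in> K \<Longrightarrow> dist y x < \<rho> \<Longrightarrow> dist (F' y) (F' x) < \<eta>"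
      using uc \<eta> unfolding uniformly_continuous_on_def by metis
    obtain d1 where d1: "d1 > 0" "\<And>w'. w' \<in> W \<Longrightarrow> dist w' w < d1 \<Longrightarrow> \<forall>t\<in>{a..b}. dist (z t w') (z t w) < \<rho>"
      using uzw[OF w \<rho>(1)] by metis
    obtain d2 where d2: "d2 > 0" "\<And>w'. w' \<in> W \<Longrightarrow> dist w' w < d2 \<Longrightarrow> dist (D0 w') (D0 w) < e/8"
      using cD0 w e unfolding continuous_on_iff by (metis zero_less_divide_iff zero_less_numeral)
    show ?thesis
    proof (intro exI[of _ "min d1 d2"] conjI ballI impI)
      fix w' t assume w': "w' \<in> W" "dist w' w < min d1 d2" and t: "t \<in> {a..b}"
      have "norm (E w' t - E w t) \<le> (norm (E w' a - E w a) + \<eta> * C * (b - a)) * exp (L * (b - a))"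
      proof (rule gronwall)
        fix t assume t: "t \<in> {a..b}"
        show "((\<lambda>t. E w' t - E w t) has_vector_derivative
           (F' (z t w') o\<^sub>L E w' t) - (F' (z t w) o\<^sub>L E w t)) (at t within {a..b})"
          by (intro has_vector_derivative_diff t w w' Ed)
        have "(F' (z t w') o\<^sub>L E w' t) - (F' (z t w) o\<^sub>L E w t)
          = (F' (z t w') o\<^sub>L (E w' t - E w t)) + ((F' (z t w') - F' (z t w)) o\<^sub>L E w t)"
          by (simp add: bounded_bilinear.diff_right[OF bounded_bilinear_blinfun_compose]
              bounded_bilinear.diff_left[OF bounded_bilinear_blinfun_compose])
        also have "norm \<dots> \<le> norm (F' (z t w')) * norm (E w' t - E w t) + norm (F' (z t w') - F' (z t w)) * norm (E w t)"
          by (rule order_trans[OF norm_triangle_ineq]) (intro add_mono norm_blinfun_compose)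
        also have "\<dots> \<le> L * norm (E w' t - E w t) + \<eta> * C"
        proof (intro add_mono mult_right_mono mult_mono)
          show "norm (F' (z t w') - F' (z t w)) \<le> \<eta>"
            using \<rho>(2)[of "z t w" "z t w'"] d1(2)[of w'] w' t zK w by (auto simp: dist_norm less_imp_le)
          show "norm (E w t) \<le> C" using Eb[OF w t] by (simp add: C_def)
        qed (use L zK t w w' \<eta> in auto)
        finally show "norm ((F' (z t w') o\<^sub>L E w' t) - (F' (z t w) o\<^sub>L E w t)) \<le> L * norm (E w' t - E w t) + \<eta> * C" .
      qed (use \<eta> C t L0 in auto)
      also have "\<dots> \<le> (norm (E w' a - E w a) + \<eta> * C * (b - a)) * 2"
        using exp2 \<eta> C ab by (intro mult_left_mono) auto
      also have "\<dots> \<le> (e/8 + e/8) * 2"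
      proof (intro mult_right_mono add_mono)
        show "norm (E w' a - E w a) \<le> e/8"
          using d2(2)[of w'] w' Ea w by (simp add: dist_norm less_imp_le)
        have "\<eta> * C * (b - a) = e/8 * ((b - a) / (b - a + 1))"
          unfolding \<eta>_def using C ab by (intro aux) auto
        also have "\<dots> \<le> e/8 * 1"
          using ab e by (intro mult_left_mono) (auto simp: field_simps)
        finally show "\<eta> * C * (b - a) \<le> e/8" by simp
      qed simp
      finally show "dist (E w' t) (E w t) < e" using e by (simp add: dist_norm)
    qed (use d1 d2 in auto)
  qed
  show thesis
  proof (rule that[of "\<lambda>t w. E w t"])
    show "continuous_on ({a..b} \<times> W) (\<lambda>y. E (snd y) (fst y))"
      by (rule continuous_on_Times_uniform[where f = "\<lambda>t w. E w t"])
        (use uDw continuous_on_vector_derivative[OF Ed] in auto)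
    show "continuous_on ({a..b} \<times> W) (\<lambda>y. z (fst y) (snd y))"
      by (rule continuous_on_Times_uniform) (use uzw cz in auto)
  qed (use der Ed Ea in auto)
qed

section \<open>Charts and tangent vectors\<close>

lemma bounded_bilinear_matrix_vector: "bounded_bilinear ((*v) :: real^'n^'m \<Rightarrow> real^'n \<Rightarrow> real^'m)"
  unfolding bilinear_conv_bounded_bilinear[symmetric] bilinear_def
  by (intro conjI allI matrix_vector_mul_linear linearI)
    (simp_all add: matrix_vector_mult_add_rdistrib scaleR_matrix_vector_assoc[symmetric])

text \<open>Identifies \<open>real ^ 'n\<close> with the tangent space at \<open>x\<close> through
  the chart \<open>c\<close>; the inverse identification is evaluation of a tangent vector at
  \<open>c\<close>.\<close>

definition lift_vec :: "('m, 'n::finite) riemannian \<Rightarrow> ('m, 'n) chart \<Rightarrow> 'm \<Rightarrow> real ^ 'n \<Rightarrow> ('m, 'n) tvec" where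
  "lift_vec M c x \<xi> = (\<lambda>c'. if c' \<in> charts_at M x then transition_deriv c c' x \<xi> else 0)"

locale riem_mfd =
  fixes M :: "('m::{t2_space, second_countable_topology}, 'n::finite) riemannian"
  assumes rm: "riemannian_manifold M"
begin

lemma atlas_smooth: "smooth_atlas (atlas M)"
  using rm unfolding riemannian_manifold_def by blast

lemma open_dom: "c \<in> atlas M \<Longrightarrow> open (dom_of c)"
  and open_img: "c \<in> atlas M \<Longrightarrow> open (coord c ` dom_of c)"
  and chart_homeo: "c \<in> atlas M \<Longrightarrow> homeomorphism (dom_of c) (coord c ` dom_of c) (coord c) (coord_inv c)"
  using atlas_smooth unfolding smooth_atlas_def by blast+

lemma charts_atD: "c \<in> charts_at M x \<Longrightarrow> c \<in> atlas M" "c \<in> charts_at M x \<Longrightarrow> x \<in> dom_of c"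
  by (auto simp: charts_at_def)

lemma charts_atI: "c \<in> atlas M \<Longrightarrow> x \<in> dom_of c \<Longrightarrow> c \<in> charts_at M x"
  by (auto simp: charts_at_def)

lemma ex_chart: "\<exists>c. c \<in> charts_at M x"
  using atlas_smooth unfolding smooth_atlas_def charts_at_def by (metis (mono_tags, lifting) UN_iff UNIV_I mem_Collect_eq)

lemma some_chart: "(SOME c. c \<in> charts_at M x) \<in> charts_at M x"
  by (rule someI_ex[OF ex_chart])

lemma coord_inv_coord: "c \<in> atlas M \<Longrightarrow> x \<in> dom_of c \<Longrightarrow> coord_inv c (coord c x) = x"
  using chart_homeo[of c] unfolding homeomorphism_def by blast

lemma coord_coord_inv:
  assumes "c \<in> atlas M" "a \<in> coord c ` dom_of c"
  shows "coord c (coord_inv c a) = a" "coord_inv c a \<in> dom_of c"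
  using chart_homeo[of c] assms unfolding homeomorphism_def by blast+

lemma cont_coord: "c \<in> atlas M \<Longrightarrow> continuous_on (dom_of c) (coord c)"
  and cont_coord_inv: "c \<in> atlas M \<Longrightarrow> continuous_on (coord c ` dom_of c) (coord_inv c)"
  using chart_homeo[of c] unfolding homeomorphism_def by blast+

lemma eventually_in_dom:
  assumes "c \<in> charts_at M (f z)" "continuous (at z within S) f"
  shows "eventually (\<lambda>y. f y \<in> dom_of c) (at z within S)"
  using topological_tendstoD[OF assms(2)[unfolded continuous_within] open_dom[OF charts_atD(1)[OF assms(1)]] charts_atD(2)[OF assms(1)]] .

lemma overlap_open:
  assumes "c \<in> atlas M" "c' \<in> atlas M"
  shows "open (coord c ` (dom_of c \<inter> dom_of c'))"
proof -
  have "coord c ` (dom_of c \<inter> dom_of c') = coord c ` dom_of c \<inter> coord_inv c -` dom_of c'"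
    using coord_inv_coord[OF assms(1)] coord_coord_inv[OF assms(1)] by (auto simp: image_iff)
  moreover have "open (coord c ` dom_of c \<inter> coord_inv c -` dom_of c')"
    using continuous_on_open_vimage[OF open_img[OF assms(1)]] cont_coord_inv[OF assms(1)] open_dom[OF assms(2)]
    by (metis Int_commute)
  ultimately show ?thesis by simp
qed

lemma smooth_transition:
  assumes "c \<in> atlas M" "c' \<in> atlas M"
  shows "smooth_on (coord c ` (dom_of c \<inter> dom_of c')) (coord c' \<circ> coord_inv c)"
  using assms atlas_smooth unfolding smooth_atlas_def by blast

lemma transition_has_derivative:
  assumes "c \<in> charts_at M x" "c' \<in> charts_at M x"
  shows "((coord c' \<circ> coord_inv c) has_derivative transition_deriv c c' x) (at (coord c x))"
proof -
  have "C1_on (coord c ` (dom_of c \<inter> dom_of c')) (coord c' \<circ> coord_inv c)"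
    using charts_atD(1)[OF assms(1)] charts_atD(1)[OF assms(2)]
    by (intro smooth_on_imp_C1_on overlap_open smooth_transition)
  from C1_on_frechet(1)[OF this, of "coord c x"] show ?thesis
    unfolding transition_deriv_def using charts_atD[OF assms(1)] charts_atD[OF assms(2)] by blast
qed

lemma transition_linear: "c \<in> charts_at M x \<Longrightarrow> c' \<in> charts_at M x \<Longrightarrow> linear (transition_deriv c c' x)"
  and transition_bounded_linear: "c \<in> charts_at M x \<Longrightarrow> c' \<in> charts_at M x \<Longrightarrow> bounded_linear (transition_deriv c c' x)"
  using transition_has_derivative[of c x c'] has_derivative_linear has_derivative_bounded_linear by blast+

lemma chart_change:
  fixes f :: "'z::real_normed_vector \<Rightarrow> 'm"
  assumes "c \<in> charts_at M (f z)" "c' \<in> charts_at M (f z)" and "z \<in> S" and cf: "continuous (at z within S) f"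
    and d: "((\<lambda>y. coord c (f y)) has_derivative f') (at z within S)"
  shows "((\<lambda>y. coord c' (f y)) has_derivative (\<lambda>h. transition_deriv c c' (f z) (f' h))) (at z within S)"
proof -
  have "((\<lambda>y. (coord c' \<circ> coord_inv c) (coord c (f y))) has_derivative (\<lambda>h. transition_deriv c c' (f z) (f' h))) (at z within S)"
    by (rule has_derivative_compose[OF d]) (rule transition_has_derivative[OF assms(1,2)])
  then show ?thesis
  proof (rule has_derivative_transform_eventually)
    show "\<forall>\<^sub>F y in at z within S. (coord c' \<circ> coord_inv c) (coord c (f y)) = coord c' (f y)"
      using eventually_in_dom[OF assms(1) cf]
      by (rule eventually_mono) (simp add: coord_inv_coord[OF charts_atD(1)[OF assms(1)]])
  qed (use \<open>z \<in> S\<close> coord_inv_coord[OF charts_atD[OF assms(1)]] in simp_all)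
qed

lemma has_derivative_chart_change_at:
  assumes "c \<in> charts_at M x" "c' \<in> charts_at M x"
  shows "((\<lambda>a. coord c' (coord_inv c a)) has_derivative transition_deriv c c' x) (at (coord c x))"
  using transition_has_derivative[OF assms] by (simp add: o_def)

lemma isCont_coord_inv: "c \<in> charts_at M x \<Longrightarrow> isCont (coord_inv c) (coord c x)"
  using cont_coord_inv open_img charts_atD continuous_on_eq_continuous_at by blast

lemma transition_comp:
  assumes "c \<in> charts_at M x" "c' \<in> charts_at M x" "c'' \<in> charts_at M x"
  shows "transition_deriv c' c'' x (transition_deriv c c' x v) = transition_deriv c c'' x v"
proof -
  note x = coord_inv_coord[OF charts_atD[OF assms(1)]]
  have "((\<lambda>a. coord c'' (coord_inv c a)) has_derivative (\<lambda>h. transition_deriv c' c'' (coord_inv c (coord c x)) (transition_deriv c c' x h))) (at (coord c x))"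
    by (rule chart_change) (use assms x isCont_coord_inv has_derivative_chart_change_at in auto)
  with has_derivative_chart_change_at[OF assms(1,3)] x show ?thesis
    by (metis has_derivative_unique)
qed

lemma transition_id:
  assumes "c \<in> charts_at M x" shows "transition_deriv c c x v = v"
proof -
  have "((\<lambda>a. coord c (coord_inv c a)) has_derivative (\<lambda>h. h)) (at (coord c x))"
    by (rule has_derivative_transform_within_open[OF has_derivative_ident open_img[OF charts_atD(1)[OF assms]]])
      (use charts_atD[OF assms] coord_coord_inv in auto)
  with has_derivative_chart_change_at[OF assms assms] show ?thesis
    by (metis has_derivative_unique)
qed

lemma tangent_spaceD:
  assumes "v \<in> tangent_space M x"
  shows "c \<in> charts_at M x \<Longrightarrow> c' \<in> charts_at M x \<Longrightarrow> v c' = transition_deriv c c' x (v c)"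
    and "c \<notin> charts_at M x \<Longrightarrow> v c = 0"
  using assms unfolding tangent_space_def by blast+

lemma tangent_space_eqI:
  assumes "v \<in> tangent_space M x" "w \<in> tangent_space M x" "c \<in> charts_at M x" "v c = w c"
  shows "v = w"
proof
  fix c' show "v c' = w c'"
    using tangent_spaceD[OF assms(1)] tangent_spaceD[OF assms(2)] assms(3,4) by (cases "c' \<in> charts_at M x") metis+
qed

lemma lift_vec_tangent: "c \<in> charts_at M x \<Longrightarrow> lift_vec M c x \<xi> \<in> tangent_space M x"
  unfolding tangent_space_def lift_vec_def by (auto simp: transition_comp)

lemma lift_vec_apply: "c \<in> charts_at M x \<Longrightarrow> lift_vec M c x \<xi> c = \<xi>"
  unfolding lift_vec_def by (auto simp: transition_id)

lemma lift_vec_of_tangent: "c \<in> charts_at M x \<Longrightarrow> v \<in> tangent_space M x \<Longrightarrow> lift_vec M c x (v c) = v"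
  by (rule tangent_space_eqI[where c = c]) (simp_all add: lift_vec_apply lift_vec_tangent)

lemma transition_scale:
  "c \<in> charts_at M x \<Longrightarrow> c' \<in> charts_at M x \<Longrightarrow> transition_deriv c c' x (r *\<^sub>R v) = r *\<^sub>R transition_deriv c c' x v"
  by (rule linear_cmul[OF transition_linear])

lemma transition_0: "c \<in> charts_at M x \<Longrightarrow> c' \<in> charts_at M x \<Longrightarrow> transition_deriv c c' x 0 = 0"
  by (rule linear_0[OF transition_linear])

lemma tangent_spaceI:
  assumes "\<And>c. c \<notin> charts_at M x \<Longrightarrow> v c = 0"
    and "\<And>c c'. c \<in> charts_at M x \<Longrightarrow> c' \<in> charts_at M x \<Longrightarrow> v c' = transition_deriv c c' x (v c)"
  shows "v \<in> tangent_space M x"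
  using assms unfolding tangent_space_def by blast

lemma tscale_tangent:
  assumes "v \<in> tangent_space M x" shows "tscale r v \<in> tangent_space M x"
  unfolding tscale_def
proof (rule tangent_spaceI)
  fix c c' assume c: "c \<in> charts_at M x" "c' \<in> charts_at M x"
  show "r *\<^sub>R v c' = transition_deriv c c' x (r *\<^sub>R v c)"
    unfolding transition_scale[OF c] tangent_spaceD(1)[OF assms c] ..
qed (use tangent_spaceD(2)[OF assms] in simp)

lemma tzero_tangent: "tzero \<in> tangent_space M x"
  unfolding tzero_def by (rule tangent_spaceI) (simp_all only: transition_0)

lemma lift_vec_scale: "c \<in> charts_at M x \<Longrightarrow> lift_vec M c x (r *\<^sub>R \<xi>) = tscale r (lift_vec M c x \<xi>)"
  by (rule tangent_space_eqI[where c = c and x = x])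
    (simp_all add: lift_vec_tangent tscale_tangent, simp add: lift_vec_apply tscale_def)

subsection \<open>The metric in a chart\<close>

text \<open>The base point is given by its coordinates \<open>a\<close>, so that the metric can be
  differentiated in it.\<close>

definition gip :: "('m, 'n) chart \<Rightarrow> real ^ 'n \<Rightarrow> real ^ 'n \<Rightarrow> real ^ 'n \<Rightarrow> real" where
  "gip c a u v = u \<bullet> (gram M c (coord_inv c a) *v v)"

lemma gip_coord: "c \<in> charts_at M x \<Longrightarrow> gip c (coord c x) u v = u \<bullet> (gram M c x *v v)"
  unfolding gip_def by (simp add: coord_inv_coord charts_atD)

lemma gram_props:
  assumes "c \<in> atlas M"
  shows "smooth_on (coord c ` dom_of c) (\<lambda>a. gram M c (coord_inv c a))"
    and "x \<in> dom_of c \<Longrightarrow> transpose (gram M c x) = gram M c x"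
    and "x \<in> dom_of c \<Longrightarrow> u \<noteq> 0 \<Longrightarrow> 0 < u \<bullet> (gram M c x *v u)"
  using rm assms unfolding riemannian_manifold_def by blast+

lemma gram_transition:
  assumes "c \<in> charts_at M x" "c' \<in> charts_at M x"
  shows "gip c' (coord c' x) (transition_deriv c c' x u) (transition_deriv c c' x v) = gip c (coord c x) u v"
proof -
  have "u \<bullet> (gram M c x *v v) = transition_deriv c c' x u \<bullet> (gram M c' x *v transition_deriv c c' x v)"
    using rm assms unfolding riemannian_manifold_def by blast
  then show ?thesis by (simp only: gip_coord[OF assms(1)] gip_coord[OF assms(2)])
qed

context
  fixes c a assumes c: "c \<in> atlas M" and a: "a \<in> coord c ` dom_of c"
begin

lemma gip_sym: "gip c a u v = gip c a v u"
  unfolding gip_def using gram_props(2)[OF c coord_coord_inv(2)[OF c a]]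
  by (metis dot_lmul_matrix inner_commute transpose_matrix_vector)

lemma gip_pos: "u \<noteq> 0 \<Longrightarrow> 0 < gip c a u u"
  unfolding gip_def using gram_props(3)[OF c coord_coord_inv(2)[OF c a]] .

lemma gip_nonneg: "0 \<le> gip c a u u"
  using gip_pos[of u] by (cases "u = 0") (auto simp: gip_def less_imp_le)

lemma gram_invertible: "invertible (gram M c (coord_inv c a))"
  unfolding invertible_left_inverse matrix_left_invertible_ker
proof (intro allI impI)
  fix u assume "gram M c (coord_inv c a) *v u = 0"
  then show "u = 0" using gip_pos[of u] by (cases "u = 0") (simp_all add: gip_def)
qed

end

lemma gip_add_left: "gip c a (u + v) w = gip c a u w + gip c a v w"
  and gip_add_right: "gip c a w (u + v) = gip c a w u + gip c a w v"
  and gip_diff_left: "gip c a (u - v) w = gip c a u w - gip c a v w"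
  and gip_diff_right: "gip c a w (u - v) = gip c a w u - gip c a w v"
  and gip_scale_left: "gip c a (r *\<^sub>R u) w = r * gip c a u w"
  and gip_scale_right: "gip c a w (r *\<^sub>R u) = r * gip c a w u"
  and gip_minus_left: "gip c a (- u) w = - gip c a u w"
  and gip_minus_right: "gip c a w (- u) = - gip c a w u"
  and gip_zero_left: "gip c a 0 w = 0"
  and gip_zero_right: "gip c a w 0 = 0"
proof -
  note lin = matrix_vector_mul_linear[of "gram M c (coord_inv c a)"]
  note simps = linear_add[OF lin] linear_diff[OF lin] linear_cmul[OF lin] linear_neg[OF lin] linear_0[OF lin]
    inner_add_left inner_add_right inner_diff_left inner_diff_right inner_scaleR_left inner_scaleR_right
    inner_minus_left inner_minus_right inner_zero_left inner_zero_right
  show "gip c a (u + v) w = gip c a u w + gip c a v w" unfolding gip_def simps ..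
  show "gip c a w (u + v) = gip c a w u + gip c a w v" unfolding gip_def simps ..
  show "gip c a (u - v) w = gip c a u w - gip c a v w" unfolding gip_def simps ..
  show "gip c a w (u - v) = gip c a w u - gip c a w v" unfolding gip_def simps ..
  show "gip c a (r *\<^sub>R u) w = r * gip c a u w" unfolding gip_def simps ..
  show "gip c a w (r *\<^sub>R u) = r * gip c a w u" unfolding gip_def simps ..
  show "gip c a (- u) w = - gip c a u w" unfolding gip_def simps ..
  show "gip c a w (- u) = - gip c a w u" unfolding gip_def simps ..
  show "gip c a 0 w = 0" unfolding gip_def simps ..
  show "gip c a w 0 = 0" unfolding gip_def simps ..
qed

lemmas gip_linear = gip_add_left gip_add_right gip_diff_left gip_diff_right gip_scale_left gip_scale_right
  gip_minus_left gip_minus_right gip_zero_left gip_zero_right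

lemma gip_cauchy_schwarz:
  assumes "c \<in> atlas M" "a \<in> coord c ` dom_of c"
  shows "(gip c a u v)\<^sup>2 \<le> gip c a u u * gip c a v v"
proof (cases "v = 0")
  case False
  note pos = gip_pos[OF assms False] and sym = gip_sym[OF assms]
  define r where "r = gip c a u v / gip c a v v"
  have "0 \<le> gip c a (u - r *\<^sub>R v) (u - r *\<^sub>R v)" by (rule gip_nonneg[OF assms])
  also have "\<dots> = gip c a u u - 2 * r * gip c a u v + r * r * gip c a v v"
    using sym[of v u] by (simp add: gip_linear algebra_simps)
  also have "\<dots> = gip c a u u - (gip c a u v)\<^sup>2 / gip c a v v"
    using pos by (simp add: r_def power2_eq_square)
  finally show ?thesis using pos by (simp add: pos_divide_le_eq)
qed (simp add: gip_linear)

text \<open>Makes the denominator of the sectional curvature positive for independent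
  vectors.\<close>

lemma gip_strict_cauchy_schwarz:
  assumes "c \<in> atlas M" "a \<in> coord c ` dom_of c" and "\<And>r. u \<noteq> r *\<^sub>R v" "v \<noteq> 0"
  shows "(gip c a u v)\<^sup>2 < gip c a u u * gip c a v v"
proof -
  note pos = gip_pos[OF assms(1,2) \<open>v \<noteq> 0\<close>] and sym = gip_sym[OF assms(1,2)]
  define r where "r = gip c a u v / gip c a v v"
  have "0 < gip c a (u - r *\<^sub>R v) (u - r *\<^sub>R v)" by (rule gip_pos[OF assms(1,2)]) (use assms in simp)
  also have "\<dots> = gip c a u u - 2 * r * gip c a u v + r * r * gip c a v v"
    using sym[of v u] by (simp add: gip_linear algebra_simps)
  also have "\<dots> = gip c a u u - (gip c a u v)\<^sup>2 / gip c a v v"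
    using pos by (simp add: r_def power2_eq_square)
  finally show ?thesis using pos by (simp add: pos_divide_less_eq)
qed

lemma tinner_chart:
  assumes "v \<in> tangent_space M x" "w \<in> tangent_space M x" "c \<in> charts_at M x"
  shows "tinner M x v w = gip c (coord c x) (v c) (w c)"
proof -
  define c' where "c' = (SOME c. c \<in> charts_at M x)"
  have c': "c' \<in> charts_at M x" unfolding c'_def by (rule some_chart)
  have "tinner M x v w = gip c' (coord c' x) (v c') (w c')"
    unfolding tinner_def c'_def[symmetric] Let_def by (simp add: gip_coord c')
  also have "\<dots> = gip c (coord c x) (v c) (w c)"
    using gram_transition[OF assms(3) c'] tangent_spaceD(1)[OF assms(1,3) c'] tangent_spaceD(1)[OF assms(2,3) c'] by simp
  finally show ?thesis .
qed

lemma tnorm_chart: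
  "v \<in> tangent_space M x \<Longrightarrow> c \<in> charts_at M x \<Longrightarrow> tnorm M x v = sqrt (gip c (coord c x) (v c) (v c))"
  unfolding tnorm_def by (simp add: tinner_chart)

lemma tnorm_tscale: "v \<in> tangent_space M x \<Longrightarrow> tnorm M x (tscale r v) = \<bar>r\<bar> * tnorm M x v"
  using tnorm_chart[OF _ some_chart[of x]] tscale_tangent[of v x r]
  by (simp add: tscale_def gip_linear real_sqrt_mult flip: mult.assoc)

lemma tnorm_eq_0_iff:
  assumes v: "v \<in> tangent_space M x"
  shows "tnorm M x v = 0 \<longleftrightarrow> v = tzero"
proof -
  obtain c where c: "c \<in> charts_at M x" using ex_chart by blast
  have "tnorm M x v = 0 \<longleftrightarrow> gip c (coord c x) (v c) (v c) = 0"
    by (simp add: tnorm_chart[OF v c])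
  also have "\<dots> \<longleftrightarrow> v c = 0"
    using gip_pos[OF charts_atD(1)[OF c], of "coord c x" "v c"] charts_atD(2)[OF c]
    by (cases "v c = 0") (simp_all add: gip_linear)
  also have "\<dots> \<longleftrightarrow> v = tzero"
    using tangent_space_eqI[OF v tzero_tangent c] by (auto simp: tzero_def)
  finally show ?thesis .
qed

end

section \<open>The Levi-Civita connection in a chart\<close>

lemma linear_axis_expansion:
  fixes F :: "real ^ 'n::finite \<Rightarrow> 'b::real_vector"
  assumes "linear F" shows "F k = (\<Sum>m\<in>UNIV. k $ m *\<^sub>R F (axis m 1))"
proof -
  have "(\<Sum>m\<in>UNIV. k $ m *\<^sub>R axis m 1) = k"
    using basis_expansion[of k] unfolding scalar_mult_eq_scaleR .
  then have "F k = F (\<Sum>m\<in>UNIV. k $ m *\<^sub>R axis m 1)" by (rule arg_cong[OF sym])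
  also have "\<dots> = (\<Sum>m\<in>UNIV. k $ m *\<^sub>R F (axis m 1))"
    by (simp only: linear_sum[OF assms] linear_cmul[OF assms])
  finally show ?thesis .
qed

context riem_mfd
begin

definition gmat :: "('m, 'n) chart \<Rightarrow> real ^ 'n \<Rightarrow> real ^ 'n ^ 'n" where
  "gmat c a = gram M c (coord_inv c a)"

definition dgip :: "('m, 'n) chart \<Rightarrow> real ^ 'n \<Rightarrow> real ^ 'n \<Rightarrow> real ^ 'n \<Rightarrow> real ^ 'n \<Rightarrow> real" where
  "dgip c a k u v = u \<bullet> (frechet_derivative (gmat c) (at a) k *v v)"

text \<open>The Christoffel symbols as a bilinear map. The covariant derivative of a field
  \<open>u\<close> along a curve \<open>\<alpha>\<close> becomes
  \<open>u' + Gam c \<alpha> \<alpha>' u\<close>, and the geodesic equation reads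
  \<open>v' = - Gam c a v v\<close>.\<close>

definition Gam :: "('m, 'n) chart \<Rightarrow> real ^ 'n \<Rightarrow> real ^ 'n \<Rightarrow> real ^ 'n \<Rightarrow> real ^ 'n" where
  "Gam c a u v = (\<chi> k. \<Sum>i\<in>UNIV. \<Sum>j\<in>UNIV. christoffel M c k i j a * u $ i * v $ j)"

definition dGam :: "('m, 'n) chart \<Rightarrow> real ^ 'n \<Rightarrow> real ^ 'n \<Rightarrow> real ^ 'n \<Rightarrow> real ^ 'n \<Rightarrow> real ^ 'n" where
  "dGam c a k u v = (\<chi> l. \<Sum>i\<in>UNIV. \<Sum>j\<in>UNIV. frechet_derivative (christoffel M c l i j) (at a) k * u $ i * v $ j)"

lemma gip_gmat: "gip c a u v = u \<bullet> (gmat c a *v v)"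
  unfolding gip_def gmat_def ..

lemma gmat_smooth: "c \<in> atlas M \<Longrightarrow> smooth_on (coord c ` dom_of c) (gmat c)"
  using gram_props(1)[of c] unfolding gmat_def[abs_def] .

lemma gmat_C1: "c \<in> atlas M \<Longrightarrow> C1_on (coord c ` dom_of c) (gmat c)"
  by (rule smooth_on_imp_C1_on[OF open_img gmat_smooth])

lemma gmat_has_derivative:
  assumes "c \<in> atlas M" "a \<in> coord c ` dom_of c"
  shows "(gmat c has_derivative frechet_derivative (gmat c) (at a)) (at a)"
  using C1_on_frechet(1)[OF gmat_C1[OF assms(1)] assms(2)] .

lemma metric_coeff_derivative:
  assumes "c \<in> atlas M" "a \<in> coord c ` dom_of c"
  shows "frechet_derivative (metric_coeff M c i j) (at a) k = frechet_derivative (gmat c) (at a) k $ i $ j"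
proof -
  have "(metric_coeff M c i j has_derivative (\<lambda>k. frechet_derivative (gmat c) (at a) k $ i $ j)) (at a)"
    unfolding metric_coeff_def[abs_def] gmat_def[symmetric]
    by (intro bounded_linear.has_derivative[OF bounded_linear_vec_nth] gmat_has_derivative assms)
  from frechet_derivative_at[OF this] show ?thesis by metis
qed

lemma axis_in_Basis: "axis i (1::real) \<in> Basis"
  unfolding Basis_vec_def by auto

lemma partial_metric_C1:
  assumes "c \<in> atlas M"
  shows "C1_on (coord c ` dom_of c) (partial l (metric_coeff M c i j))"
proof (rule C1_on_cong[OF open_img[OF assms]])
  show "C1_on (coord c ` dom_of c) (\<lambda>a. frechet_derivative (gmat c) (at a) (axis l 1) $ i $ j)"
    by (intro C1_on_nth smooth_on_imp_C1_on[OF open_img[OF assms]] smooth_on_frechet gmat_smooth assms axis_in_Basis)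
  show "frechet_derivative (gmat c) (at a) (axis l 1) $ i $ j = partial l (metric_coeff M c i j) a"
    if "a \<in> coord c ` dom_of c" for a
    unfolding partial_def using metric_coeff_derivative[OF assms that] by simp
qed

lemma christoffel_C1:
  assumes "c \<in> atlas M"
  shows "C1_on (coord c ` dom_of c) (christoffel M c k i j)"
  unfolding christoffel_def[abs_def]
  by (intro C1_on_mult C1_on_sum C1_on_add C1_on_diff C1_on_const partial_metric_C1 assms
      C1_on_matrix_inv[OF open_img[OF assms] gmat_C1[OF assms, unfolded gmat_def[abs_def]]] gram_invertible)

lemma christoffel_has_derivative:
  assumes "c \<in> atlas M" "a \<in> coord c ` dom_of c"
  shows "(christoffel M c k i j has_derivative frechet_derivative (christoffel M c k i j) (at a)) (at a)"
  using C1_on_frechet(1)[OF christoffel_C1[OF assms(1)] assms(2)] .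

lemma Gam_has_derivative:
  assumes "c \<in> atlas M" "a \<in> coord c ` dom_of c"
  shows "((\<lambda>a. Gam c a u v) has_derivative (\<lambda>k. dGam c a k u v)) (at a)"
proof (subst has_derivative_componentwise_within, intro ballI)
  fix b :: "real ^ 'n" assume "b \<in> Basis"
  then obtain l where b: "b = axis l 1" unfolding Basis_vec_def by auto
  have "((\<lambda>a. \<Sum>i\<in>UNIV. \<Sum>j\<in>UNIV. christoffel M c l i j a * u $ i * v $ j) has_derivative
      (\<lambda>k. \<Sum>i\<in>UNIV. \<Sum>j\<in>UNIV. frechet_derivative (christoffel M c l i j) (at a) k * u $ i * v $ j)) (at a)"
    by (intro has_derivative_sum has_derivative_mult_left christoffel_has_derivative assms)
  then show "((\<lambda>x. Gam c x u v \<bullet> b) has_derivative (\<lambda>x. dGam c a x u v \<bullet> b)) (at a)"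
    by (simp add: b inner_axis Gam_def dGam_def)
qed

lemma bounded_linear_dGam:
  assumes "c \<in> atlas M" "a \<in> coord c ` dom_of c"
  shows "linear (\<lambda>k. dGam c a k u v)"
  using Gam_has_derivative[OF assms] has_derivative_linear by blast

lemma Gam_bilinear: "bilinear (Gam c a)"
  unfolding bilinear_def
proof (intro conjI allI linearI)
  show "Gam c a x (y + z) = Gam c a x y + Gam c a x z" for x y z
    unfolding Gam_def vec_eq_iff by (simp add: distrib_left sum.distrib)
  show "Gam c a (y + z) x = Gam c a y x + Gam c a z x" for x y z
    unfolding Gam_def vec_eq_iff by (simp add: distrib_left distrib_right sum.distrib)
  show "Gam c a x (r *\<^sub>R y) = r *\<^sub>R Gam c a x y" for r x y
    unfolding Gam_def vec_eq_iff by (simp add: sum_distrib_left mult_ac)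
  show "Gam c a (r *\<^sub>R y) x = r *\<^sub>R Gam c a y x" for r x y
    unfolding Gam_def vec_eq_iff by (simp add: sum_distrib_left mult_ac)
qed

lemma dGam_bilinear: "bilinear (dGam c a k)"
  unfolding bilinear_def
proof (intro conjI allI linearI)
  show "dGam c a k x (y + z) = dGam c a k x y + dGam c a k x z" for x y z
    unfolding dGam_def vec_eq_iff by (simp add: distrib_left sum.distrib)
  show "dGam c a k (y + z) x = dGam c a k y x + dGam c a k z x" for x y z
    unfolding dGam_def vec_eq_iff by (simp add: distrib_left distrib_right sum.distrib)
  show "dGam c a k x (r *\<^sub>R y) = r *\<^sub>R dGam c a k x y" for r x y
    unfolding dGam_def vec_eq_iff by (simp add: sum_distrib_left mult_ac)
  show "dGam c a k (r *\<^sub>R y) x = r *\<^sub>R dGam c a k y x" for r x y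
    unfolding dGam_def vec_eq_iff by (simp add: sum_distrib_left mult_ac)
qed

lemmas Gam_linear = bilinear_ladd[OF Gam_bilinear] bilinear_radd[OF Gam_bilinear]
  bilinear_lmul[OF Gam_bilinear] bilinear_rmul[OF Gam_bilinear]
  bilinear_lneg[OF Gam_bilinear] bilinear_rneg[OF Gam_bilinear]
  bilinear_lzero[OF Gam_bilinear] bilinear_rzero[OF Gam_bilinear]
  bilinear_lsub[OF Gam_bilinear] bilinear_rsub[OF Gam_bilinear]

lemma dgip_sum:
  assumes "c \<in> atlas M" "a \<in> coord c ` dom_of c"
  shows "dgip c a k u v = (\<Sum>m\<in>UNIV. \<Sum>i\<in>UNIV. \<Sum>j\<in>UNIV. k $ m * u $ i * v $ j * partial m (metric_coeff M c i j) a)"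
proof -
  let ?F = "frechet_derivative (gmat c) (at a)"
  have lin: "linear ?F" using gmat_has_derivative[OF assms] has_derivative_linear by blast
  have F: "?F k $ i $ j = (\<Sum>m\<in>UNIV. k $ m * partial m (metric_coeff M c i j) a)" for i j
    by (subst linear_axis_expansion[OF lin]) (simp add: partial_def metric_coeff_derivative[OF assms])
  have "dgip c a k u v = (\<Sum>i\<in>UNIV. \<Sum>j\<in>UNIV. \<Sum>m\<in>UNIV. k $ m * u $ i * v $ j * partial m (metric_coeff M c i j) a)"
    unfolding dgip_def inner_vec_def matrix_vector_mult_def
    by (simp add: F sum_distrib_left sum_distrib_right mult_ac)
  also have "\<dots> = (\<Sum>i\<in>UNIV. \<Sum>m\<in>UNIV. \<Sum>j\<in>UNIV. k $ m * u $ i * v $ j * partial m (metric_coeff M c i j) a)"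
    by (rule sum.cong[OF refl]) (rule sum.swap)
  also have "\<dots> = (\<Sum>m\<in>UNIV. \<Sum>i\<in>UNIV. \<Sum>j\<in>UNIV. k $ m * u $ i * v $ j * partial m (metric_coeff M c i j) a)"
    by (rule sum.swap)
  finally show ?thesis .
qed

text \<open>Koszul's formula for fields with constant coordinates. Pairing with \<open>w\<close>
  through the metric cancels the inverse matrix in the Christoffel symbols, so that only derivatives
  of the metric remain.\<close>

lemma gip_Gam:
  assumes "c \<in> atlas M" "a \<in> coord c ` dom_of c"
  shows "gip c a (Gam c a u v) w = (dgip c a u v w + dgip c a v u w - dgip c a w u v) / 2"
proof -
  let ?p = "\<lambda>m i j. partial m (metric_coeff M c i j) a"
  \<comment> \<open>Twice the Christoffel symbols of the first kind, contracted with
    \<open>u\<close> and \<open>v\<close>.\<close>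
  define L where "L = (\<chi> l. \<Sum>i\<in>UNIV. \<Sum>j\<in>UNIV. (?p i j l + ?p j i l - ?p l i j) * u $ i * v $ j)"
  let ?G = "gram M c (coord_inv c a)"
  have "Gam c a u v = (1/2) *\<^sub>R (matrix_inv ?G *v L)"
  proof (rule vec_eq_iff[THEN iffD2], rule allI)
    fix k
    have "Gam c a u v $ k = (\<Sum>i\<in>UNIV. \<Sum>j\<in>UNIV. \<Sum>l\<in>UNIV. 1/2 * (matrix_inv ?G $ k $ l * ((?p i j l + ?p j i l - ?p l i j) * u $ i * v $ j)))"
      unfolding Gam_def christoffel_def by (simp add: sum_distrib_left sum_distrib_right mult_ac)
    also have "\<dots> = (\<Sum>i\<in>UNIV. \<Sum>l\<in>UNIV. \<Sum>j\<in>UNIV. 1/2 * (matrix_inv ?G $ k $ l * ((?p i j l + ?p j i l - ?p l i j) * u $ i * v $ j)))"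
      by (rule sum.cong[OF refl]) (rule sum.swap)
    also have "\<dots> = (\<Sum>l\<in>UNIV. \<Sum>i\<in>UNIV. \<Sum>j\<in>UNIV. 1/2 * (matrix_inv ?G $ k $ l * ((?p i j l + ?p j i l - ?p l i j) * u $ i * v $ j)))"
      by (rule sum.swap)
    also have "\<dots> = ((1/2) *\<^sub>R (matrix_inv ?G *v L)) $ k"
      unfolding matrix_vector_mult_def L_def by (simp add: sum_distrib_left)
    finally show "Gam c a u v $ k = ((1/2) *\<^sub>R (matrix_inv ?G *v L)) $ k" .
  qed
  moreover have "?G ** matrix_inv ?G = mat 1"
    using gram_invertible[OF assms] someI_ex[of "\<lambda>A'. ?G ** A' = mat 1 \<and> A' ** ?G = mat 1"]
    unfolding invertible_def matrix_inv_def by blast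
  ultimately have "?G *v Gam c a u v = (1/2) *\<^sub>R L"
    by (simp add: linear_cmul[OF matrix_vector_mul_linear] matrix_vector_mul_assoc)
  then have "gip c a w (Gam c a u v) = (w \<bullet> L) / 2"
    unfolding gip_def by simp
  then have 1: "gip c a (Gam c a u v) w = (w \<bullet> L) / 2"
    using gip_sym[OF assms] by metis
  have "w \<bullet> L = (\<Sum>l\<in>UNIV. \<Sum>i\<in>UNIV. \<Sum>j\<in>UNIV. w $ l * u $ i * v $ j * (?p i j l + ?p j i l - ?p l i j))"
    unfolding inner_vec_def L_def by (simp add: sum_distrib_left mult_ac)
  also have "\<dots> = (\<Sum>l\<in>UNIV. \<Sum>i\<in>UNIV. \<Sum>j\<in>UNIV. u $ i * v $ j * w $ l * ?p i j l)
     + (\<Sum>l\<in>UNIV. \<Sum>i\<in>UNIV. \<Sum>j\<in>UNIV. v $ j * u $ i * w $ l * ?p j i l)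
     - (\<Sum>l\<in>UNIV. \<Sum>i\<in>UNIV. \<Sum>j\<in>UNIV. w $ l * u $ i * v $ j * ?p l i j)"
    by (simp add: sum.distrib sum_subtractf algebra_simps)
  also have "(\<Sum>l\<in>UNIV. \<Sum>i\<in>UNIV. \<Sum>j\<in>UNIV. u $ i * v $ j * w $ l * ?p i j l)
     = (\<Sum>i\<in>UNIV. \<Sum>j\<in>UNIV. \<Sum>l\<in>UNIV. u $ i * v $ j * w $ l * ?p i j l)"
    by (subst sum.swap, rule sum.cong[OF refl], rule sum.swap)
  also have "(\<Sum>l\<in>UNIV. \<Sum>i\<in>UNIV. \<Sum>j\<in>UNIV. v $ j * u $ i * w $ l * ?p j i l)
     = (\<Sum>i\<in>UNIV. \<Sum>j\<in>UNIV. \<Sum>l\<in>UNIV. v $ j * u $ i * w $ l * ?p j i l)"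
    by (subst sum.swap, rule sum.cong[OF refl], rule sum.swap)
  also have "\<dots> = (\<Sum>j\<in>UNIV. \<Sum>i\<in>UNIV. \<Sum>l\<in>UNIV. v $ j * u $ i * w $ l * ?p j i l)"
    by (rule sum.swap)
  finally have "w \<bullet> L = dgip c a u v w + dgip c a v u w - dgip c a w u v"
    unfolding dgip_sum[OF assms] by simp
  with 1 show ?thesis by simp
qed

lemma dgip_sym:
  assumes "c \<in> atlas M" "a \<in> coord c ` dom_of c"
  shows "dgip c a k u v = dgip c a k v u"
proof -
  have d: "((\<lambda>a. u \<bullet> (gmat c a *v v)) has_derivative (\<lambda>k. dgip c a k u v)) (at a)" for u v
  proof -
    have "bounded_linear (\<lambda>A :: real^'n^'n. u \<bullet> (A *v v))"
      unfolding linear_conv_bounded_linear[symmetric]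
      by (rule linearI) (simp_all add: matrix_vector_mult_add_rdistrib inner_add_right scaleR_matrix_vector_assoc[symmetric])
    from bounded_linear.has_derivative[OF this gmat_has_derivative[OF assms]] show ?thesis unfolding dgip_def .
  qed
  have "((\<lambda>a. u \<bullet> (gmat c a *v v)) has_derivative (\<lambda>k. dgip c a k v u)) (at a)"
    by (rule has_derivative_transform_within_open[OF d open_img[OF assms(1)] assms(2)])
      (use gip_sym[OF assms(1)] in \<open>simp add: gip_gmat\<close>)
  from has_derivative_unique[OF d this] show ?thesis by metis
qed

text \<open>Absence of torsion: the right-hand side of \<open>gip_Gam\<close> is symmetric in
  \<open>u\<close> and \<open>v\<close>, and the metric is nondegenerate.\<close>

lemma Gam_sym:
  assumes "c \<in> atlas M" "a \<in> coord c ` dom_of c"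
  shows "Gam c a u v = Gam c a v u"
proof (rule ccontr)
  assume "Gam c a u v \<noteq> Gam c a v u"
  then have "0 < gip c a (Gam c a u v - Gam c a v u) (Gam c a u v - Gam c a v u)"
    using gip_pos[OF assms] by simp
  moreover have "gip c a (Gam c a u v - Gam c a v u) w = 0" for w
    unfolding gip_diff_left gip_Gam[OF assms] dgip_sym[OF assms, of w u v] by simp
  ultimately show False by simp
qed

text \<open>In the sum of the two Koszul formulas the terms differentiating in the directions
  \<open>u\<close> and \<open>v\<close> cancel.\<close>

lemma metric_compatible:
  assumes "c \<in> atlas M" "a \<in> coord c ` dom_of c"
  shows "dgip c a k u v = gip c a (Gam c a k u) v + gip c a u (Gam c a k v)"
  unfolding gip_sym[OF assms, of u] gip_Gam[OF assms]
  using dgip_sym[OF assms] by (simp add: field_simps)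

text \<open>Metric compatibility turns the derivative of the metric along \<open>\<alpha>\<close>
  into the two \<open>Gam\<close> terms, so that the product rule holds with covariant derivatives
  of \<open>u\<close> and \<open>v\<close>.\<close>

lemma gip_has_real_derivative:
  assumes "c \<in> atlas M" "\<alpha> t \<in> coord c ` dom_of c"
    and "(\<alpha> has_vector_derivative \<alpha>') (at t within T)"
    and "(u has_vector_derivative u') (at t within T)"
    and "(v has_vector_derivative v') (at t within T)"
  shows "((\<lambda>t. gip c (\<alpha> t) (u t) (v t)) has_real_derivative
     gip c (\<alpha> t) (u' + Gam c (\<alpha> t) \<alpha>' (u t)) (v t) + gip c (\<alpha> t) (u t) (v' + Gam c (\<alpha> t) \<alpha>' (v t))) (at t within T)"
proof -
  let ?F = "frechet_derivative (gmat c) (at (\<alpha> t))"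
  have g: "((\<lambda>t. gmat c (\<alpha> t)) has_vector_derivative ?F \<alpha>') (at t within T)"
    using has_derivative_compose[OF assms(3)[unfolded has_vector_derivative_def] gmat_has_derivative[OF assms(1,2)]]
    unfolding has_vector_derivative_def
    by (simp add: linear_cmul[OF has_derivative_linear[OF gmat_has_derivative[OF assms(1,2)]]])
  have gv: "((\<lambda>t. gmat c (\<alpha> t) *v v t) has_vector_derivative gmat c (\<alpha> t) *v v' + ?F \<alpha>' *v v t) (at t within T)"
    by (rule bounded_bilinear.has_vector_derivative[OF bounded_bilinear_matrix_vector g assms(5)])
  have "((\<lambda>t. u t \<bullet> (gmat c (\<alpha> t) *v v t)) has_vector_derivative
     u t \<bullet> (gmat c (\<alpha> t) *v v' + ?F \<alpha>' *v v t) + u' \<bullet> (gmat c (\<alpha> t) *v v t)) (at t within T)"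
    by (rule bounded_bilinear.has_vector_derivative[OF bounded_bilinear_inner assms(4) gv])
  then have "((\<lambda>t. gip c (\<alpha> t) (u t) (v t)) has_real_derivative
     (gip c (\<alpha> t) (u t) v' + dgip c (\<alpha> t) \<alpha>' (u t) (v t)) + gip c (\<alpha> t) u' (v t)) (at t within T)"
    unfolding has_real_derivative_iff_has_vector_derivative gip_gmat dgip_def inner_add_right .
  then show ?thesis
    by (rule DERIV_cong) (simp add: metric_compatible[OF assms(1,2)] gip_linear)
qed

text \<open>R(u,v)w for fields with constant coordinates, whose Lie bracket vanishes: derivatives of
  the connection plus the commutator of its values. The proof only rearranges index sums.\<close>

lemma curvature_formula:
  assumes "c \<in> charts_at M x"
  shows "curvature M c x u v w = dGam c (coord c x) u v w - dGam c (coord c x) v u w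
     + Gam c (coord c x) u (Gam c (coord c x) v w) - Gam c (coord c x) v (Gam c (coord c x) u w)"
proof (rule vec_eq_iff[THEN iffD2], rule allI)
  fix l
  let ?a = "coord c x"
  let ?C = "\<lambda>k i j. christoffel M c k i j ?a"
  have a: "c \<in> atlas M" "?a \<in> coord c ` dom_of c" using charts_atD[OF assms] by auto
  have dC: "frechet_derivative (christoffel M c l i j) (at ?a) k = (\<Sum>m\<in>UNIV. k $ m * partial m (christoffel M c l i j) ?a)" for l i j k
  proof -
    have lin: "linear (frechet_derivative (christoffel M c l i j) (at ?a))"
      using christoffel_has_derivative[OF a] has_derivative_linear by blast
    show ?thesis by (subst linear_axis_expansion[OF lin]) (simp add: partial_def)
  qed
  have 1: "dGam c ?a u v w $ l = (\<Sum>i\<in>UNIV. \<Sum>j\<in>UNIV. \<Sum>k\<in>UNIV. partial i (christoffel M c l j k) ?a * u $ i * v $ j * w $ k)"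
    for u v w
  proof -
    have "dGam c ?a u v w $ l = (\<Sum>j\<in>UNIV. \<Sum>k\<in>UNIV. \<Sum>i\<in>UNIV. partial i (christoffel M c l j k) ?a * u $ i * v $ j * w $ k)"
      unfolding dGam_def by (simp add: dC sum_distrib_left sum_distrib_right mult_ac)
    also have "\<dots> = (\<Sum>j\<in>UNIV. \<Sum>i\<in>UNIV. \<Sum>k\<in>UNIV. partial i (christoffel M c l j k) ?a * u $ i * v $ j * w $ k)"
      by (rule sum.cong[OF refl]) (rule sum.swap)
    also have "\<dots> = (\<Sum>i\<in>UNIV. \<Sum>j\<in>UNIV. \<Sum>k\<in>UNIV. partial i (christoffel M c l j k) ?a * u $ i * v $ j * w $ k)"
      by (rule sum.swap)
    finally show ?thesis .
  qed
  have 2: "Gam c ?a u (Gam c ?a v w) $ l = (\<Sum>i\<in>UNIV. \<Sum>j\<in>UNIV. \<Sum>k\<in>UNIV. (\<Sum>m\<in>UNIV. ?C l i m * ?C m j k) * u $ i * v $ j * w $ k)"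
    for u v w
  proof -
    have "Gam c ?a u (Gam c ?a v w) $ l = (\<Sum>i\<in>UNIV. \<Sum>m\<in>UNIV. \<Sum>j\<in>UNIV. \<Sum>k\<in>UNIV. ?C l i m * ?C m j k * u $ i * v $ j * w $ k)"
      unfolding Gam_def by (simp add: sum_distrib_left sum_distrib_right mult_ac)
    also have "\<dots> = (\<Sum>i\<in>UNIV. \<Sum>j\<in>UNIV. \<Sum>m\<in>UNIV. \<Sum>k\<in>UNIV. ?C l i m * ?C m j k * u $ i * v $ j * w $ k)"
      by (rule sum.cong[OF refl]) (rule sum.swap)
    also have "\<dots> = (\<Sum>i\<in>UNIV. \<Sum>j\<in>UNIV. \<Sum>k\<in>UNIV. \<Sum>m\<in>UNIV. ?C l i m * ?C m j k * u $ i * v $ j * w $ k)"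
      by (rule sum.cong[OF refl], rule sum.cong[OF refl]) (rule sum.swap)
    finally show ?thesis by (simp add: sum_distrib_right)
  qed
  have sw: "(\<Sum>i\<in>UNIV. \<Sum>j\<in>UNIV. \<Sum>k\<in>UNIV. f i j k * v $ i * u $ j * w $ k)
    = (\<Sum>i\<in>UNIV. \<Sum>j\<in>UNIV. \<Sum>k\<in>UNIV. f j i k * u $ i * v $ j * w $ k)" for f :: "'n \<Rightarrow> 'n \<Rightarrow> 'n \<Rightarrow> real"
    by (subst sum.swap) (simp add: mult_ac)
  show "curvature M c x u v w $ l = (dGam c ?a u v w - dGam c ?a v u w + Gam c ?a u (Gam c ?a v w) - Gam c ?a v (Gam c ?a u w)) $ l"
    unfolding vector_minus_component vector_add_component 1 2 sw
    unfolding curvature_def riemann_coeff_def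
    by (simp add: sum.distrib sum_subtractf left_diff_distrib distrib_right)
qed

definition curv :: "('m, 'n) chart \<Rightarrow> real ^ 'n \<Rightarrow> real ^ 'n \<Rightarrow> real ^ 'n \<Rightarrow> real ^ 'n \<Rightarrow> real ^ 'n" where
  "curv c a u v w = dGam c a u v w - dGam c a v u w + Gam c a u (Gam c a v w) - Gam c a v (Gam c a u w)"

lemma curv_same: "curv c a v v w = 0"
  unfolding curv_def by simp

lemma curv_scale_left:
  assumes "c \<in> atlas M" "a \<in> coord c ` dom_of c"
  shows "curv c a (r *\<^sub>R u) v w = r *\<^sub>R curv c a u v w"
  unfolding curv_def linear_cmul[OF bounded_linear_dGam[OF assms]] bilinear_lmul[OF dGam_bilinear] Gam_linear
  by (simp add: algebra_simps)

lemma curv_zero_right: "curv c a u 0 0 = 0"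
  unfolding curv_def by (simp add: Gam_linear bilinear_rzero[OF dGam_bilinear] bilinear_lzero[OF dGam_bilinear])

text \<open>The curvature hypothesis speaks of independent pairs only. For dependent vectors the
  expression is 0, because the curvature vanishes on equal first arguments and is zero for
  \<open>v = 0\<close>.\<close>

lemma curv_nonpos:
  assumes np: "nonpositive_curvature M" and c: "c \<in> charts_at M x"
  shows "gip c (coord c x) (curv c (coord c x) u v v) u \<le> 0"
proof -
  let ?a = "coord c x"
  have a: "c \<in> atlas M" "?a \<in> coord c ` dom_of c" using charts_atD[OF c] by auto
  consider "v = 0" | r where "u = r *\<^sub>R v" | "v \<noteq> 0" "\<And>r. u \<noteq> r *\<^sub>R v" by blast
  then show ?thesis
  proof cases
    case 1 then show ?thesis by (simp add: curv_zero_right gip_linear)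
  next
    case (2 r) then show ?thesis by (simp add: curv_scale_left[OF a] curv_same gip_linear)
  next
    case 3
    have "u \<noteq> v" using 3(2)[of 1] by simp
    moreover have "independent {u, v}"
      using 3 by (simp add: independent_insert dependent_single span_singleton image_iff)
    ultimately have "sectional_curvature M c x u v \<le> 0"
      using np c unfolding nonpositive_curvature_def by blast
    moreover have "0 < gip c ?a u u * gip c ?a v v - (gip c ?a u v)\<^sup>2"
      using gip_strict_cauchy_schwarz[OF a 3(2) 3(1)] by simp
    ultimately show ?thesis
      unfolding sectional_curvature_def Let_def gip_coord[OF c, symmetric] curv_def curvature_formula[OF c]
      by (simp add: divide_le_0_iff)
  qed
qed

end

section \<open>Geodesics\<close>

context riem_mfd
begin

lemma chart_change_vector:
  assumes "c \<in> charts_at M (\<gamma> t)" "c' \<in> charts_at M (\<gamma> t)" "t \<in> S" "continuous (at t within S) \<gamma>"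
    and "((\<lambda>s. coord c (\<gamma> s)) has_vector_derivative v) (at t within S)"
  shows "((\<lambda>s. coord c' (\<gamma> s)) has_vector_derivative transition_deriv c c' (\<gamma> t) v) (at t within S)"
  using chart_change[OF assms(1-4) assms(5)[unfolded has_vector_derivative_def]]
  unfolding has_vector_derivative_def by (simp add: transition_scale[OF assms(1,2)])

definition cvel :: "('m, 'n) chart \<Rightarrow> (real \<Rightarrow> 'm) \<Rightarrow> real \<Rightarrow> real ^ 'n" where
  "cvel c \<gamma> t = vector_derivative (coord c \<circ> \<gamma>) (at t)"

lemma cvel_eqI: "((\<lambda>s. coord c (\<gamma> s)) has_vector_derivative v) (at t) \<Longrightarrow> cvel c \<gamma> t = v"
  unfolding cvel_def o_def by (rule vector_derivative_at)

lemma velocity_chart: "c \<in> charts_at M (\<gamma> t) \<Longrightarrow> velocity M \<gamma> t c = cvel c \<gamma> t"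
  unfolding velocity_def cvel_def by simp

lemma curve_in_dom:
  assumes "isCont \<gamma> t" "c \<in> charts_at M (\<gamma> t)"
  shows "eventually (\<lambda>s. \<gamma> s \<in> dom_of c) (at t)"
  using eventually_in_dom[where f = \<gamma> and z = t and S = UNIV and c = c] assms by simp

lemma velocity_tangent:
  assumes "isCont \<gamma> t" "c \<in> charts_at M (\<gamma> t)" "((\<lambda>s. coord c (\<gamma> s)) has_vector_derivative v) (at t)"
  shows "velocity M \<gamma> t \<in> tangent_space M (\<gamma> t)"
proof (rule tangent_spaceI)
  fix c1 c2 assume c: "c1 \<in> charts_at M (\<gamma> t)" "c2 \<in> charts_at M (\<gamma> t)"
  have *: "velocity M \<gamma> t c' = transition_deriv c c' (\<gamma> t) v" if "c' \<in> charts_at M (\<gamma> t)" for c'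
    using velocity_chart[of c' \<gamma> t, OF that]
      cvel_eqI[OF chart_change_vector[where \<gamma> = \<gamma> and t = t, OF assms(2) that UNIV_I assms(1) assms(3)]] by simp
  show "velocity M \<gamma> t c2 = transition_deriv c1 c2 (\<gamma> t) (velocity M \<gamma> t c1)"
    unfolding *[OF c(1)] *[OF c(2)] transition_comp[OF assms(2) c] ..
qed (simp add: velocity_def)

lemma geodesic_isCont: "geodesic M \<gamma> \<Longrightarrow> isCont \<gamma> t"
  unfolding geodesic_def by (simp add: continuous_on_eq_continuous_at)

lemma geodesic_coord_derivative:
  assumes "geodesic M \<gamma>" "c \<in> charts_at M (\<gamma> t)"
  shows "((\<lambda>s. coord c (\<gamma> s)) has_vector_derivative cvel c \<gamma> t) (at t)"
proof -
  have "(coord c \<circ> \<gamma>) differentiable (at t)" using assms unfolding geodesic_def by blast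
  then show ?thesis unfolding vector_derivative_works cvel_def by (simp add: o_def)
qed

lemma geodesic_cvel_derivative:
  assumes "geodesic M \<gamma>" "c \<in> charts_at M (\<gamma> t)"
  shows "(cvel c \<gamma> has_vector_derivative - Gam c (coord c (\<gamma> t)) (cvel c \<gamma> t) (cvel c \<gamma> t)) (at t)"
proof -
  have "((\<lambda>s. vector_derivative (coord c \<circ> \<gamma>) (at s)) has_vector_derivative
           (\<chi> k. - (\<Sum>i\<in>UNIV. \<Sum>j\<in>UNIV. christoffel M c k i j (coord c (\<gamma> t)) *
              vector_derivative (coord c \<circ> \<gamma>) (at t) $ i *
              vector_derivative (coord c \<circ> \<gamma>) (at t) $ j))) (at t)"
    using assms unfolding geodesic_def by blast
  moreover have "(\<chi> k. - (\<Sum>i\<in>UNIV. \<Sum>j\<in>UNIV. christoffel M c k i j (coord c (\<gamma> t)) * cvel c \<gamma> t $ i * cvel c \<gamma> t $ j))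
     = - Gam c (coord c (\<gamma> t)) (cvel c \<gamma> t) (cvel c \<gamma> t)"
    unfolding vec_eq_iff Gam_def by simp
  ultimately show ?thesis unfolding cvel_def[abs_def] by simp
qed

lemma geodesicI:
  assumes "\<And>t. isCont \<gamma> t"
    and "\<And>t c. c \<in> charts_at M (\<gamma> t) \<Longrightarrow> ((\<lambda>s. coord c (\<gamma> s)) has_vector_derivative v c t) (at t)"
    and "\<And>t c. c \<in> charts_at M (\<gamma> t) \<Longrightarrow> (v c has_vector_derivative - Gam c (coord c (\<gamma> t)) (v c t) (v c t)) (at t)"
  shows "geodesic M \<gamma>"
  unfolding geodesic_def
proof (intro conjI allI ballI)
  show "continuous_on UNIV \<gamma>" using assms(1) continuous_at_imp_continuous_on by blast
  fix t c assume c: "c \<in> charts_at M (\<gamma> t)"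
  show "(coord c \<circ> \<gamma>) differentiable (at t)"
    using assms(2)[OF c] unfolding o_def by (auto intro: differentiableI_vector)
  have vd: "vector_derivative (coord c \<circ> \<gamma>) (at s) = v c s" if "\<gamma> s \<in> dom_of c" for s
    using assms(2)[OF charts_atI[OF charts_atD(1)[OF c] that]] unfolding o_def by (rule vector_derivative_at)
  have ev: "eventually (\<lambda>s. \<gamma> s \<in> dom_of c) (at t)"
    by (rule curve_in_dom[OF assms(1) c])
  have "- Gam c (coord c (\<gamma> t)) (v c t) (v c t) = (\<chi> k. - (\<Sum>i\<in>UNIV. \<Sum>j\<in>UNIV. christoffel M c k i j (coord c (\<gamma> t)) *
              vector_derivative (coord c \<circ> \<gamma>) (at t) $ i *
              vector_derivative (coord c \<circ> \<gamma>) (at t) $ j))"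
    unfolding vec_eq_iff Gam_def vd[OF charts_atD(2)[OF c]] by simp
  then have "(v c has_vector_derivative (\<chi> k. - (\<Sum>i\<in>UNIV. \<Sum>j\<in>UNIV. christoffel M c k i j (coord c (\<gamma> t)) *
              vector_derivative (coord c \<circ> \<gamma>) (at t) $ i *
              vector_derivative (coord c \<circ> \<gamma>) (at t) $ j))) (at t)"
    using assms(3)[OF c] by simp
  then show "((\<lambda>s. vector_derivative (coord c \<circ> \<gamma>) (at s)) has_vector_derivative
           (\<chi> k. - (\<Sum>i\<in>UNIV. \<Sum>j\<in>UNIV. christoffel M c k i j (coord c (\<gamma> t)) *
              vector_derivative (coord c \<circ> \<gamma>) (at t) $ i *
              vector_derivative (coord c \<circ> \<gamma>) (at t) $ j))) (at t)"
    unfolding has_vector_derivative_def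
    by (rule has_derivative_transform_eventually)
      (use ev vd charts_atD(2)[OF c] in \<open>auto elim: eventually_mono\<close>)
qed

lemma geodesic_affine:
  assumes g: "geodesic M \<gamma>"
  shows "geodesic M (\<lambda>t. \<gamma> (a * t + b))"
    and "c \<in> charts_at M (\<gamma> (a * t + b)) \<Longrightarrow> cvel c (\<lambda>t. \<gamma> (a * t + b)) t = a *\<^sub>R cvel c \<gamma> (a * t + b)"
proof -
  have aff: "((\<lambda>s. a * s + b) has_vector_derivative a) (at t)" for t
    unfolding has_real_derivative_iff_has_vector_derivative[symmetric]
    by (rule DERIV_cong[OF DERIV_add[OF DERIV_cmult[OF DERIV_ident] DERIV_const]]) simp
  have 1: "((\<lambda>s. coord c (\<gamma> (a * s + b))) has_vector_derivative a *\<^sub>R cvel c \<gamma> (a * t + b)) (at t)"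
    if "c \<in> charts_at M (\<gamma> (a * t + b))" for c t
    using vector_diff_chain_at[OF aff geodesic_coord_derivative[OF g that]] by (simp add: o_def)
  have 2: "((\<lambda>s. a *\<^sub>R cvel c \<gamma> (a * s + b)) has_vector_derivative
      - Gam c (coord c (\<gamma> (a * t + b))) (a *\<^sub>R cvel c \<gamma> (a * t + b)) (a *\<^sub>R cvel c \<gamma> (a * t + b))) (at t)"
    if "c \<in> charts_at M (\<gamma> (a * t + b))" for c t
  proof -
    have "((\<lambda>s. cvel c \<gamma> (a * s + b)) has_vector_derivative
      a *\<^sub>R (- Gam c (coord c (\<gamma> (a * t + b))) (cvel c \<gamma> (a * t + b)) (cvel c \<gamma> (a * t + b)))) (at t)"
      using vector_diff_chain_at[OF aff geodesic_cvel_derivative[OF g that]] by (simp add: o_def)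
    from bounded_linear.has_vector_derivative[OF bounded_linear_scaleR_right this]
    show ?thesis by (simp add: Gam_linear)
  qed
  show "geodesic M (\<lambda>t. \<gamma> (a * t + b))"
  proof (rule geodesicI[where v = "\<lambda>c t. a *\<^sub>R cvel c \<gamma> (a * t + b)"])
    show "isCont (\<lambda>t. \<gamma> (a * t + b)) t" for t
      using isCont_o2[of t "\<lambda>t. a * t + b" \<gamma>] geodesic_isCont[OF g] by simp
  qed (fact 1 2)+
  show "c \<in> charts_at M (\<gamma> (a * t + b)) \<Longrightarrow> cvel c (\<lambda>t. \<gamma> (a * t + b)) t = a *\<^sub>R cvel c \<gamma> (a * t + b)"
    using cvel_eqI[OF 1] .
qed

lemma geodesic_velocity_tangent: "geodesic M \<gamma> \<Longrightarrow> velocity M \<gamma> t \<in> tangent_space M (\<gamma> t)"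
  using velocity_tangent[where \<gamma> = \<gamma> and t = t, OF geodesic_isCont some_chart geodesic_coord_derivative[OF _ some_chart]] .

lemma geodesic_affine_velocity:
  assumes g: "geodesic M \<gamma>"
  shows "velocity M (\<lambda>t. \<gamma> (a * t + b)) t = tscale a (velocity M \<gamma> (a * t + b))"
proof
  fix c
  show "velocity M (\<lambda>t. \<gamma> (a * t + b)) t c = tscale a (velocity M \<gamma> (a * t + b)) c"
  proof (cases "c \<in> charts_at M (\<gamma> (a * t + b))")
    case True
    show ?thesis
      using velocity_chart[of c "\<lambda>t. \<gamma> (a * t + b)" t] velocity_chart[of c \<gamma> "a * t + b"]
        geodesic_affine(2)[OF g True] True
      by (simp add: tscale_def)
  qed (simp add: tscale_def velocity_def)
qed

section \<open>The geodesic equation as a first-order system for position and velocity in a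
  chart\<close>

definition geoF :: "('m, 'n) chart \<Rightarrow> (real ^ 'n) \<times> (real ^ 'n) \<Rightarrow> (real ^ 'n) \<times> (real ^ 'n)" where
  "geoF c z = (snd z, - Gam c (fst z) (snd z) (snd z))"

definition geoz :: "('m, 'n) chart \<Rightarrow> (real \<Rightarrow> 'm) \<Rightarrow> real \<Rightarrow> (real ^ 'n) \<times> (real ^ 'n)" where
  "geoz c \<gamma> t = (coord c (\<gamma> t), cvel c \<gamma> t)"

lemma geoz_ode:
  assumes "geodesic M \<gamma>" "c \<in> charts_at M (\<gamma> t)"
  shows "(geoz c \<gamma> has_vector_derivative geoF c (geoz c \<gamma> t)) (at t)"
  unfolding geoz_def[abs_def] geoF_def fst_conv snd_conv
  by (rule has_vector_derivative_Pair[OF geodesic_coord_derivative[OF assms] geodesic_cvel_derivative[OF assms]])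

lemma geoz_isCont: "geodesic M \<gamma> \<Longrightarrow> c \<in> charts_at M (\<gamma> t) \<Longrightarrow> isCont (geoz c \<gamma>) t"
  using geoz_ode has_vector_derivative_continuous by blast

definition phase :: "('m, 'n) chart \<Rightarrow> ((real ^ 'n) \<times> (real ^ 'n)) set" where
  "phase c = coord c ` dom_of c \<times> UNIV"

lemma open_phase: "c \<in> atlas M \<Longrightarrow> open (phase c)"
  unfolding phase_def by (intro open_Times open_img open_UNIV)

lemma geoF_C1:
  assumes "c \<in> atlas M" shows "C1_on (phase c) (geoF c)"
proof -
  have *: "C1_on (phase c) (\<lambda>z. christoffel M c k i j (fst z) * snd z $ i * snd z $ j)" for k i j
    by (intro C1_on_mult C1_on_nth C1_on_snd C1_on_id C1_on_compose[OF C1_on_fst[OF C1_on_id] christoffel_C1[OF assms]])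
      (auto simp: phase_def)
  have "C1_on (phase c) (\<lambda>z. Gam c (fst z) (snd z) (snd z))"
  proof (rule C1_on_vec)
    fix k
    show "C1_on (phase c) (\<lambda>z. Gam c (fst z) (snd z) (snd z) $ k)"
      unfolding Gam_def vec_lambda_beta by (rule C1_on_sum, rule C1_on_sum, rule *)
  qed
  then show ?thesis
    unfolding geoF_def[abs_def] by (intro C1_on_Pair C1_on_minus C1_on_snd[OF C1_on_id])
qed

lemma geoF_lipschitz_ball:
  assumes "c \<in> atlas M" "z \<in> phase c"
  obtains r L where "r > 0" "cball z r \<subseteq> phase c" "0 \<le> L"
    "\<And>x y. x \<in> cball z r \<Longrightarrow> y \<in> cball z r \<Longrightarrow> norm (geoF c x - geoF c y) \<le> L * norm (x - y)"
proof -
  obtain r where r: "r > 0" "cball z r \<subseteq> phase c"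
    using open_phase[OF assms(1)] assms(2) open_contains_cball by blast
  obtain F' where F': "\<And>x. x \<in> phase c \<Longrightarrow> (geoF c has_derivative blinfun_apply (F' x)) (at x)" "continuous_on (phase c) F'"
    using geoF_C1[OF assms(1)] C1_onE by blast
  have "bounded (F' ` cball z r)"
    by (intro compact_imp_bounded compact_continuous_image continuous_on_subset[OF F'(2) r(2)] compact_cball)
  then obtain L where L: "\<And>x. x \<in> cball z r \<Longrightarrow> norm (F' x) \<le> L" unfolding bounded_iff by blast
  have "norm (geoF c x - geoF c y) \<le> L * norm (x - y)" if "x \<in> cball z r" "y \<in> cball z r" for x y
  proof (rule differentiable_bound[OF convex_cball _ _ that])
    fix w assume w: "w \<in> cball z r"
    show "(geoF c has_derivative blinfun_apply (F' w)) (at w within cball z r)"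
      by (rule has_derivative_at_withinI[OF F'(1)]) (use w r in blast)
    show "onorm (blinfun_apply (F' w)) \<le> L" using L[OF w] by (simp add: norm_blinfun.rep_eq)
  qed
  moreover have "0 \<le> L" using L[of z] r by (meson centre_in_cball less_imp_le norm_ge_zero order_trans)
  ultimately show thesis using that r by blast
qed

lemma geoz_eqD:
  assumes "geodesic M \<gamma>" "geodesic M \<sigma>" "c \<in> charts_at M (\<gamma> t)" "\<gamma> t = \<sigma> t"
  shows "geoz c \<gamma> t = geoz c \<sigma> t \<longleftrightarrow> velocity M \<gamma> t = velocity M \<sigma> t"
proof -
  have c': "c \<in> charts_at M (\<sigma> t)" using assms(3,4) by simp
  have "velocity M \<gamma> t = velocity M \<sigma> t \<longleftrightarrow> velocity M \<gamma> t c = velocity M \<sigma> t c"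
    using tangent_space_eqI[OF geodesic_velocity_tangent[OF assms(1)] _ assms(3)] geodesic_velocity_tangent[OF assms(2), of t] assms(4)
    by metis
  then show ?thesis
    unfolding velocity_chart[of c \<gamma> t, OF assms(3)] velocity_chart[of c \<sigma> t, OF c'] geoz_def using assms(4) by simp
qed

text \<open>Both geodesics solve the same first-order system in a chart around the common point,
  with a Lipschitz right-hand side near the common initial state.\<close>

lemma geodesic_unique_local:
  assumes g: "geodesic M \<gamma>" "geodesic M \<sigma>" and eq: "\<gamma> t = \<sigma> t" "velocity M \<gamma> t = velocity M \<sigma> t"
  shows "\<exists>d>0. \<forall>s. \<bar>s - t\<bar> < d \<longrightarrow> \<gamma> s = \<sigma> s \<and> velocity M \<gamma> s = velocity M \<sigma> s"
proof -
  obtain c where c: "c \<in> charts_at M (\<gamma> t)" using ex_chart by blast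
  then have c': "c \<in> charts_at M (\<sigma> t)" using eq by simp
  note ca = charts_atD(1)[OF c]
  define z where "z = geoz c \<gamma> t"
  have z': "z = geoz c \<sigma> t" unfolding z_def using geoz_eqD[OF g c eq(1)] eq(2) by simp
  have "z \<in> phase c" unfolding z_def phase_def geoz_def using charts_atD[OF c] by auto
  then obtain r L where r: "r > 0" "0 \<le> L"
    and lip: "\<And>x y. x \<in> cball z r \<Longrightarrow> y \<in> cball z r \<Longrightarrow> norm (geoF c x - geoF c y) \<le> L * norm (x - y)"
    using geoF_lipschitz_ball[OF ca] by metis
  have near: "\<exists>d>0. \<forall>s. \<bar>s - t\<bar> < d \<longrightarrow> \<rho> s \<in> dom_of c \<and> geoz c \<rho> s \<in> cball z r"
    if \<rho>: "geodesic M \<rho>" "c \<in> charts_at M (\<rho> t)" "geoz c \<rho> t = z" for \<rho>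
  proof -
    have "eventually (\<lambda>s. \<rho> s \<in> dom_of c) (at t)"
      by (rule curve_in_dom[OF geodesic_isCont[OF \<rho>(1)] \<rho>(2)])
    moreover have "eventually (\<lambda>s. dist (geoz c \<rho> s) z < r) (at t)"
      using geoz_isCont[OF \<rho>(1,2)] r(1) unfolding isCont_def \<rho>(3) tendsto_iff by blast
    ultimately have "eventually (\<lambda>s. \<rho> s \<in> dom_of c \<and> geoz c \<rho> s \<in> cball z r) (at t)"
      by eventually_elim (simp add: dist_commute)
    then obtain d where "d > 0" "\<And>s. s \<noteq> t \<Longrightarrow> dist s t < d \<Longrightarrow> \<rho> s \<in> dom_of c \<and> geoz c \<rho> s \<in> cball z r"
      unfolding eventually_at by blast
    moreover have "\<rho> t \<in> dom_of c \<and> geoz c \<rho> t \<in> cball z r" using charts_atD(2)[OF \<rho>(2)] \<rho>(3) r by simp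
    ultimately show ?thesis unfolding dist_real_def by metis
  qed
  obtain d1 where d1: "d1 > 0" "\<And>s. \<bar>s - t\<bar> < d1 \<Longrightarrow> \<gamma> s \<in> dom_of c \<and> geoz c \<gamma> s \<in> cball z r"
    using near[OF g(1) c] z_def by blast
  obtain d2 where d2: "d2 > 0" "\<And>s. \<bar>s - t\<bar> < d2 \<Longrightarrow> \<sigma> s \<in> dom_of c \<and> geoz c \<sigma> s \<in> cball z r"
    using near[OF g(2) c'] z' by blast
  define d where "d = min d1 d2 / 2"
  have d: "d > 0" "d < d1" "d < d2" using d1 d2 by (auto simp: d_def)
  \<comment> \<open>The sign \<open>e\<close> chooses the direction of time, as Gronwall's
    inequality only runs forwards.\<close>
  have zeq: "geoz c \<gamma> (t + e * s) = geoz c \<sigma> (t + e * s)" if e: "e = 1 \<or> e = -1" and s: "s \<in> {0..d}" for e s :: real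
  proof -
    have lt: "\<bar>(t + e * s) - t\<bar> < d1" "\<bar>(t + e * s) - t\<bar> < d2" if "s \<in> {0..d}" for s using e that d by auto
    have der: "((\<lambda>s. geoz c \<rho> (t + e * s)) has_vector_derivative e *\<^sub>R geoF c (geoz c \<rho> (t + e * s))) (at s within {0..d})"
      if "geodesic M \<rho>" "c \<in> charts_at M (\<rho> (t + e * s))" for \<rho> s
    proof -
      have "((\<lambda>s. t + e * s) has_vector_derivative e) (at s within {0..d})"
        unfolding has_real_derivative_iff_has_vector_derivative[symmetric]
        by (rule DERIV_cong[OF DERIV_add[OF DERIV_const DERIV_cmult[OF DERIV_ident]]]) simp
      from vector_diff_chain_within[OF this has_vector_derivative_at_within[OF geoz_ode[OF that]]]
      show ?thesis by (simp add: o_def)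
    qed
    have "norm (geoz c \<gamma> (t + e * s) - geoz c \<sigma> (t + e * s))
       \<le> (norm (geoz c \<gamma> (t + e * 0) - geoz c \<sigma> (t + e * 0)) + 0 * (d - 0)) * exp (L * (d - 0))"
    proof (rule gronwall[OF _ _ r(2) order_refl s])
      fix s assume s: "s \<in> {0..d}"
      have "c \<in> charts_at M (\<gamma> (t + e * s))" "c \<in> charts_at M (\<sigma> (t + e * s))"
        using d1(2)[OF lt(1)[OF s]] d2(2)[OF lt(2)[OF s]] charts_atI[OF ca] by auto
      then show "((\<lambda>s. geoz c \<gamma> (t + e * s) - geoz c \<sigma> (t + e * s)) has_vector_derivative
         e *\<^sub>R geoF c (geoz c \<gamma> (t + e * s)) - e *\<^sub>R geoF c (geoz c \<sigma> (t + e * s))) (at s within {0..d})"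
        by (intro has_vector_derivative_diff der g)
      have "norm (e *\<^sub>R geoF c (geoz c \<gamma> (t + e * s)) - e *\<^sub>R geoF c (geoz c \<sigma> (t + e * s)))
        = norm (geoF c (geoz c \<gamma> (t + e * s)) - geoF c (geoz c \<sigma> (t + e * s)))"
        using e by (auto simp: norm_minus_commute)
      then show "norm (e *\<^sub>R geoF c (geoz c \<gamma> (t + e * s)) - e *\<^sub>R geoF c (geoz c \<sigma> (t + e * s)))
        \<le> L * norm (geoz c \<gamma> (t + e * s) - geoz c \<sigma> (t + e * s)) + 0"
        using lip d1(2)[OF lt(1)[OF s]] d2(2)[OF lt(2)[OF s]] by simp
    qed
    then show ?thesis using z_def z' by simp
  qed
  have "\<gamma> s = \<sigma> s \<and> velocity M \<gamma> s = velocity M \<sigma> s" if s: "\<bar>s - t\<bar> < d" for s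
  proof -
    have "geoz c \<gamma> s = geoz c \<sigma> s"
      using zeq[of 1 "s - t"] zeq[of "-1" "t - s"] s by (cases "s \<ge> t") auto
    moreover have dm: "\<gamma> s \<in> dom_of c" "\<sigma> s \<in> dom_of c" using d1(2)[of s] d2(2)[of s] s d by auto
    ultimately have "\<gamma> s = \<sigma> s"
      unfolding geoz_def using coord_inv_coord[OF ca] by (metis Pair_inject)
    moreover have "c \<in> charts_at M (\<gamma> s)" using charts_atI[OF ca dm(1)] .
    ultimately show ?thesis using geoz_eqD[OF g] \<open>geoz c \<gamma> s = geoz c \<sigma> s\<close> by blast
  qed
  then show ?thesis using d(1) by blast
qed

text \<open>The set of times at which positions and velocities agree is open by local uniqueness.
  Its complement is open too: distinct positions are separated because the space is Hausdorff, and
  at equal positions distinct velocities are separated inside a common chart.\<close>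

lemma geodesic_unique:
  assumes g: "geodesic M \<gamma>" "geodesic M \<sigma>" and eq: "\<gamma> t0 = \<sigma> t0" "velocity M \<gamma> t0 = velocity M \<sigma> t0"
  shows "\<gamma> = \<sigma>"
proof -
  define A where "A = {t. \<gamma> t = \<sigma> t \<and> velocity M \<gamma> t = velocity M \<sigma> t}"
  have "open A"
    unfolding open_dist dist_real_def A_def using geodesic_unique_local[OF g] by blast
  moreover have "open (- A)"
    unfolding open_dist dist_real_def
  proof
    fix t assume t: "t \<in> - A"
    have "eventually (\<lambda>s. s \<notin> A) (at t)"
    proof (cases "\<gamma> t = \<sigma> t")
      case False
      then obtain U V where UV: "open U" "open V" "\<gamma> t \<in> U" "\<sigma> t \<in> V" "U \<inter> V = {}"
        by (meson hausdorff)
      have "eventually (\<lambda>s. \<gamma> s \<in> U) (at t)" "eventually (\<lambda>s. \<sigma> s \<in> V) (at t)"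
        using geodesic_isCont[OF g(1), of t] geodesic_isCont[OF g(2), of t] UV unfolding isCont_def
        by (auto dest: topological_tendstoD)
      then show ?thesis by eventually_elim (use UV in \<open>auto simp: A_def\<close>)
    next
      case True
      obtain c where c: "c \<in> charts_at M (\<gamma> t)" using ex_chart by blast
      then have c': "c \<in> charts_at M (\<sigma> t)" using True by simp
      have "geoz c \<gamma> t \<noteq> geoz c \<sigma> t" using geoz_eqD[OF g c True] t True by (simp add: A_def)
      moreover have "isCont (\<lambda>s. geoz c \<gamma> s - geoz c \<sigma> s) t"
        by (intro continuous_diff geoz_isCont g c c')
      ultimately have "eventually (\<lambda>s. geoz c \<gamma> s - geoz c \<sigma> s \<noteq> 0) (at t)"
        unfolding isCont_def by (intro tendsto_imp_eventually_ne) auto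
      moreover have "eventually (\<lambda>s. \<gamma> s \<in> dom_of c) (at t)"
        by (rule curve_in_dom[OF geodesic_isCont[OF g(1)] c])
      ultimately show ?thesis
      proof eventually_elim
        case (elim s)
        show ?case
        proof
          assume "s \<in> A"
          then have "geoz c \<gamma> s = geoz c \<sigma> s"
            using geoz_eqD[OF g charts_atI[OF charts_atD(1)[OF c] elim(2)]] by (simp add: A_def)
          then show False using elim(1) by simp
        qed
      qed
    qed
    then obtain e where "e > 0" "\<And>s. s \<noteq> t \<Longrightarrow> \<bar>s - t\<bar> < e \<Longrightarrow> s \<notin> A"
      unfolding eventually_at dist_real_def by blast
    with t show "\<exists>e>0. \<forall>y. \<bar>y - t\<bar> < e \<longrightarrow> y \<in> - A" by (intro exI[of _ e] conjI allI impI ComplI) (metis ComplD)+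
  qed
  ultimately have "A = UNIV"
    using clopen[of A] unfolding closed_def by (metis (mono_tags, lifting) A_def empty_iff eq mem_Collect_eq)
  then have "\<gamma> t = \<sigma> t" for t unfolding A_def by (metis (mono_tags, lifting) UNIV_I mem_Collect_eq)
  then show ?thesis by (rule ext)
qed

text \<open>The covariant derivative of the velocity vanishes along a geodesic. The chart depends on
  \<open>t\<close>, so the derivative of the squared speed is computed locally at each time.\<close>

lemma geodesic_speed_constant:
  assumes g: "geodesic M \<gamma>"
  shows "tnorm M (\<gamma> t) (velocity M \<gamma> t) = tnorm M (\<gamma> 0) (velocity M \<gamma> 0)"
proof -
  define h where "h t = tinner M (\<gamma> t) (velocity M \<gamma> t) (velocity M \<gamma> t)" for t
  have hc: "h s = gip c (coord c (\<gamma> s)) (cvel c \<gamma> s) (cvel c \<gamma> s)" if "c \<in> charts_at M (\<gamma> s)" for c s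
    unfolding h_def using tinner_chart[OF geodesic_velocity_tangent[OF g] geodesic_velocity_tangent[OF g] that]
    by (simp add: velocity_chart[of c \<gamma> s, OF that])
  have "(h has_real_derivative 0) (at t)" for t
  proof -
    obtain c where c: "c \<in> charts_at M (\<gamma> t)" using ex_chart by blast
    have a: "c \<in> atlas M" "coord c (\<gamma> t) \<in> coord c ` dom_of c" using charts_atD[OF c] by auto
    have d: "((\<lambda>t. gip c (coord c (\<gamma> t)) (cvel c \<gamma> t) (cvel c \<gamma> t)) has_real_derivative 0) (at t)"
      by (rule DERIV_cong[OF gip_has_real_derivative[OF a geodesic_coord_derivative[OF g c]
          geodesic_cvel_derivative[OF g c] geodesic_cvel_derivative[OF g c]]])
        (simp add: gip_linear)
    have ev: "eventually (\<lambda>s. h s = gip c (coord c (\<gamma> s)) (cvel c \<gamma> s) (cvel c \<gamma> s)) (nhds t)"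
      unfolding eventually_nhds_conv_at
      using curve_in_dom[OF geodesic_isCont[OF g] c] hc[OF c] by (auto elim!: eventually_mono intro!: hc charts_atI[OF a(1)])
    show ?thesis unfolding DERIV_cong_ev[OF refl ev refl] by (rule d)
  qed
  then have "h t = h 0" using DERIV_isconst_all by blast
  then show ?thesis unfolding h_def tnorm_def by simp
qed

end

locale complete_mfd = riem_mfd M for M :: "('m::{t2_space, second_countable_topology}, 'n::finite) riemannian" +
  assumes complete: "geodesically_complete M"
begin

definition gd :: "'m \<Rightarrow> ('m, 'n) tvec \<Rightarrow> real \<Rightarrow> 'm" where
  "gd x v = (THE \<gamma>. geodesic M \<gamma> \<and> \<gamma> 0 = x \<and> velocity M \<gamma> 0 = v)"

lemma gd_props:
  assumes "v \<in> tangent_space M x"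
  shows "geodesic M (gd x v)" "gd x v 0 = x" "velocity M (gd x v) 0 = v"
proof -
  have "\<exists>!\<gamma>. geodesic M \<gamma> \<and> \<gamma> 0 = x \<and> velocity M \<gamma> 0 = v"
    using complete assms geodesic_unique unfolding geodesically_complete_def by (metis (no_types, lifting))
  from theI'[OF this] show "geodesic M (gd x v)" "gd x v 0 = x" "velocity M (gd x v) 0 = v"
    unfolding gd_def by blast+
qed

lemma gd_eqI: "geodesic M \<gamma> \<Longrightarrow> gd (\<gamma> 0) (velocity M \<gamma> 0) = \<gamma>"
  using geodesic_unique[OF _ _ , of _ \<gamma> 0] gd_props[OF geodesic_velocity_tangent[of \<gamma> 0]] by metis

lemma rexp_gd: "rexp M x v = gd x v 1"
  unfolding rexp_def gd_def ..

lemma gd_tscale: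
  assumes "v \<in> tangent_space M x" shows "gd x (tscale r v) t = gd x v (r * t)"
proof -
  note g = gd_props[OF assms]
  have "gd x (tscale r v) = (\<lambda>t. gd x v (r * t + 0))"
    using gd_eqI[OF geodesic_affine(1)[OF g(1), of r 0]] geodesic_affine_velocity[OF g(1), of r 0 0] g by simp
  then show ?thesis by simp
qed

lemma geodesic_ray_gd: "v \<in> tangent_space M x \<Longrightarrow> geodesic_ray M x v t = gd x v t"
  unfolding geodesic_ray_def rexp_gd by (simp add: gd_tscale)

lemma gd_shift: "geodesic M \<gamma> \<Longrightarrow> gd (\<gamma> s) (tscale a (velocity M \<gamma> s)) t = \<gamma> (a * t + s)"
  using gd_eqI[OF geodesic_affine(1)[of \<gamma> a s]] geodesic_affine_velocity[of \<gamma> a s 0] by simp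

end

section \<open>Smooth dependence of geodesics on the initial velocity\<close>

text \<open>Induction along an interval: the supremum of the times up to which \<open>P\<close>
  holds throughout is reached by \<open>left\<close> and could be exceeded by \<open>right\<close>.
  It carries properties along a geodesic here and along the radius of a ball later.\<close>

lemma real_interval_induct:
  fixes a b :: real
  assumes "a \<le> b" "P a"
    and left: "\<And>t. a < t \<Longrightarrow> t \<le> b \<Longrightarrow> (\<And>s. a \<le> s \<Longrightarrow> s < t \<Longrightarrow> P s) \<Longrightarrow> P t"
    and right: "\<And>t. a \<le> t \<Longrightarrow> t < b \<Longrightarrow> (\<And>s. a \<le> s \<Longrightarrow> s \<le> t \<Longrightarrow> P s) \<Longrightarrow> \<exists>e>0. \<forall>s. t < s \<longrightarrow> s < t + e \<longrightarrow> s \<le> b \<longrightarrow> P s"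
    and "t \<in> {a..b}"
  shows "P t"
proof -
  define S where "S = {t \<in> {a..b}. \<forall>s. a \<le> s \<longrightarrow> s \<le> t \<longrightarrow> P s}"
  define \<tau> where "\<tau> = Sup S"
  have SD: "a \<le> t" "t \<le> b" "\<And>s. a \<le> s \<Longrightarrow> s \<le> t \<Longrightarrow> P s" if "t \<in> S" for t
    using that unfolding S_def by simp_all
  have SI: "t \<in> S" if "a \<le> t" "t \<le> b" "\<And>s. a \<le> s \<Longrightarrow> s \<le> t \<Longrightarrow> P s" for t
    using that unfolding S_def by simp
  have aS: "a \<in> S"
  proof (rule SI)
    fix s assume "a \<le> s" "s \<le> a"
    then have e: "a = s" by (rule antisym)
    show "P s" using assms(2) unfolding e .
  qed (use assms(1) in simp_all)
  have bdd: "bdd_above S" by (rule bdd_aboveI[of _ b]) (rule SD(2))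
  have \<tau>: "a \<le> \<tau>" "\<tau> \<le> b"
    unfolding \<tau>_def by (rule cSup_upper[OF aS bdd], rule cSup_least) (use aS SD(2) in auto)
  have below: "P s" if s: "a \<le> s" "s < \<tau>" for s
  proof -
    have "\<exists>u\<in>S. s < u" using s(2) less_cSup_iff[OF _ bdd, of s] aS unfolding \<tau>_def by blast
    then obtain u where u: "u \<in> S" "s < u" by blast
    show ?thesis by (rule SD(3)[OF u(1) s(1) less_imp_le[OF u(2)]])
  qed
  have P\<tau>: "P \<tau>"
  proof (cases "a < \<tau>")
    case True
    show ?thesis by (rule left[OF True \<tau>(2) below])
  next
    case False
    then have e: "a = \<tau>" using \<tau>(1) by linarith
    show ?thesis using assms(2) unfolding e .
  qed
  have upto: "P s" if "a \<le> s" "s \<le> \<tau>" for s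
  proof (cases "s < \<tau>")
    case True
    show ?thesis by (rule below[OF that(1) True])
  next
    case False
    then have e: "\<tau> = s" using that(2) by linarith
    show ?thesis using P\<tau> unfolding e .
  qed
  have "\<tau> = b"
  proof (rule ccontr)
    assume "\<tau> \<noteq> b"
    then have lt: "\<tau> < b" using \<tau> by simp
    obtain e where e: "e > 0" "\<And>s. \<tau> < s \<Longrightarrow> s < \<tau> + e \<Longrightarrow> s \<le> b \<Longrightarrow> P s"
      using right[OF \<tau>(1) lt upto] by blast
    define u where "u = min b (\<tau> + e / 2)"
    have u: "\<tau> < u" "u \<le> b" "u < \<tau> + e" using lt e by (auto simp: u_def min_def)
    have "P s" if "a \<le> s" "s \<le> u" for s
    proof (cases "s \<le> \<tau>")
      case True show ?thesis by (rule upto[OF that(1) True])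
    next
      case False
      then have "\<tau> < s" "s < \<tau> + e" "s \<le> b" using that u by linarith+
      then show ?thesis by (rule e(2))
    qed
    moreover have "a \<le> u" using u \<tau> by linarith
    ultimately have "u \<in> S" using u(2) by (intro SI)
    then have "u \<le> \<tau>" unfolding \<tau>_def by (rule cSup_upper[OF _ bdd])
    then show False using u(1) by linarith
  qed
  have "a \<le> t" "t \<le> \<tau>" using \<open>\<tau> = b\<close> \<open>t \<in> {a..b}\<close> by simp_all
  then show ?thesis by (rule upto)
qed

context riem_mfd
begin

text \<open>On the ball the phase velocity is at most \<open>B\<close>, so the state moves by less
  than \<open>r/2\<close> and cannot reach the boundary of the ball. This is circular as it stands,
  because the bound holds only while the geodesic is in the ball; hence the induction on
  time.\<close>

lemma geodesic_stays_in_chart: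
  assumes g: "geodesic M \<gamma>" and c: "c \<in> atlas M"
    and K: "cball z r \<subseteq> phase c" and B: "\<And>y. y \<in> cball z r \<Longrightarrow> norm (geoF c y) \<le> B" "0 \<le> B"
    and start: "\<gamma> a \<in> dom_of c" "geoz c \<gamma> a \<in> cball z (r/2)" and \<delta>: "a \<le> b" "B * (b - a) < r / 2"
    and t: "t \<in> {a..b}"
  shows "\<gamma> t \<in> dom_of c \<and> geoz c \<gamma> t \<in> cball z r"
proof -
  define z1 where "z1 = geoz c \<gamma> a"
  define P where "P t \<longleftrightarrow> \<gamma> t \<in> dom_of c \<and> dist z1 (geoz c \<gamma> t) \<le> B * (t - a)" for t
  have strict: "dist z (geoz c \<gamma> t) < r" if "P t" "t \<le> b" for t
  proof -
    have "dist z (geoz c \<gamma> t) \<le> dist z z1 + dist z1 (geoz c \<gamma> t)" by (rule dist_triangle)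
    moreover have "B * (t - a) \<le> B * (b - a)" using that(2) B(2) by (intro mult_left_mono) auto
    ultimately show ?thesis using that(1) start(2) \<delta> unfolding P_def z1_def mem_cball by linarith
  qed
  have "P t"
  proof (rule real_interval_induct[OF \<delta>(1) _ _ _ t])
    show "P a" using start by (simp add: P_def z1_def)
  next
    fix t assume t: "a < t" "t \<le> b" and IH: "\<And>s. a \<le> s \<Longrightarrow> s < t \<Longrightarrow> P s"
    \<comment> \<open>A compact, hence closed, set of the manifold inside the chart domain. It keeps
      the limit position at time \<open>t\<close> in the domain before coordinates of that position
      can be used.\<close>
    define C where "C = coord_inv c ` fst ` cball z r"
    have fK: "fst ` cball z r \<subseteq> coord c ` dom_of c" using K unfolding phase_def by auto
    have "compact C"
      unfolding C_def
      by (intro compact_continuous_image continuous_on_subset[OF cont_coord_inv[OF c] fK] continuous_on_fst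
          continuous_on_id compact_cball)
    then have "closed C" by (rule compact_imp_closed)
    have inC: "\<gamma> s \<in> C" if "a \<le> s" "s < t" for s
    proof -
      have "geoz c \<gamma> s \<in> cball z r" using strict[OF IH[OF that]] that t by simp
      then have "coord c (\<gamma> s) \<in> fst ` cball z r" unfolding geoz_def by force
      then show ?thesis unfolding C_def using coord_inv_coord[OF c, of "\<gamma> s"] IH[OF that] unfolding P_def by force
    qed
    have ne: "at_left t \<noteq> bot" by simp
    have evl: "eventually (\<lambda>s. a \<le> s \<and> s < t) (at_left t)"
      unfolding eventually_at_left_field using t(1) by (intro exI[of _ a]) auto
    have "(\<gamma> \<longlongrightarrow> \<gamma> t) (at_left t)"
      using geodesic_isCont[OF g, of t] unfolding isCont_def by (rule tendsto_within_subset[OF _ subset_UNIV])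
    moreover have "eventually (\<lambda>s. \<gamma> s \<in> C) (at_left t)"
      using evl by (rule eventually_mono) (rule inC, simp_all)
    ultimately have "\<gamma> t \<in> C"
      by (intro Lim_in_closed_set[OF \<open>closed C\<close> _ ne])
    then obtain y where y: "\<gamma> t = coord_inv c y" "y \<in> fst ` cball z r" unfolding C_def by (rule imageE)
    have dom: "\<gamma> t \<in> dom_of c"
      unfolding y(1) by (rule coord_coord_inv(2)[OF c subsetD[OF fK y(2)]])
    have "(geoz c \<gamma> \<longlongrightarrow> geoz c \<gamma> t) (at_left t)"
      using geoz_isCont[OF g charts_atI[OF c dom]] unfolding isCont_def by (rule tendsto_within_subset[OF _ subset_UNIV])
    then have "((\<lambda>s. dist z1 (geoz c \<gamma> s)) \<longlongrightarrow> dist z1 (geoz c \<gamma> t)) (at_left t)"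
      by (intro tendsto_dist tendsto_const)
    moreover have "((\<lambda>s. B * (s - a)) \<longlongrightarrow> B * (t - a)) (at_left t)" by (intro tendsto_intros)
    moreover have "eventually (\<lambda>s. dist z1 (geoz c \<gamma> s) \<le> B * (s - a)) (at_left t)"
      using evl by (rule eventually_mono) (rule IH[unfolded P_def, THEN conjunct2], simp_all)
    ultimately have "dist z1 (geoz c \<gamma> t) \<le> B * (t - a)"
      by (intro tendsto_le[OF ne])
    then show "P t" using dom by (simp add: P_def)
  next
    fix t assume t: "a \<le> t" "t < b" and IH: "\<And>s. a \<le> s \<Longrightarrow> s \<le> t \<Longrightarrow> P s"
    have ct: "c \<in> charts_at M (\<gamma> t)" using IH[of t] t charts_atI[OF c] by (simp add: P_def)
    have "eventually (\<lambda>s. dist z (geoz c \<gamma> s) < r) (at t)"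
      using geoz_isCont[OF g ct] strict[OF IH[of t]] t unfolding isCont_def
      by (intro order_tendstoD(2)[OF tendsto_dist[OF tendsto_const]]) auto
    with curve_in_dom[OF geodesic_isCont[OF g] ct]
    have "eventually (\<lambda>s. \<gamma> s \<in> dom_of c \<and> dist z (geoz c \<gamma> s) < r) (at t)" by (rule eventually_conj)
    then obtain e where e: "e > 0" "\<And>s. s \<noteq> t \<Longrightarrow> dist s t < e \<Longrightarrow> \<gamma> s \<in> dom_of c \<and> dist z (geoz c \<gamma> s) < r"
      unfolding eventually_at by blast
    show "\<exists>e>0. \<forall>s. t < s \<longrightarrow> s < t + e \<longrightarrow> s \<le> b \<longrightarrow> P s"
    proof (intro exI[of _ e] conjI allI impI)
      fix s assume s: "t < s" "s < t + e" "s \<le> b"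
      have in': "\<gamma> u \<in> dom_of c \<and> geoz c \<gamma> u \<in> cball z r" if u: "u \<in> {a..s}" for u
      proof (cases "u \<le> t")
        case True
        then show ?thesis using IH[of u] strict[OF IH[of u]] u t by (simp add: P_def)
      next
        case False
        then show ?thesis using e(2)[of u] u s by (simp add: dist_real_def)
      qed
      \<comment> \<open>With \<open>L = 0\<close>, Gronwall's inequality reduces to the mean value
        inequality.\<close>
      have "norm (geoz c \<gamma> s - z1) \<le> (norm (geoz c \<gamma> a - z1) + B * (s - a)) * exp (0 * (s - a))"
      proof (rule gronwall[where f' = "\<lambda>u. geoF c (geoz c \<gamma> u)"])
        fix u assume u: "u \<in> {a..s}"
        have "(geoz c \<gamma> has_vector_derivative geoF c (geoz c \<gamma> u)) (at u within {a..s})"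
          by (rule has_vector_derivative_at_within[OF geoz_ode[OF g charts_atI[OF c]]]) (use in'[OF u] in blast)
        from has_vector_derivative_diff[OF this has_vector_derivative_const]
        show "((\<lambda>u. geoz c \<gamma> u - z1) has_vector_derivative geoF c (geoz c \<gamma> u)) (at u within {a..s})" by simp
        show "norm (geoF c (geoz c \<gamma> u)) \<le> 0 * norm (geoz c \<gamma> u - z1) + B" using B(1) in'[OF u] by simp
      qed (use B(2) s t in auto)
      then show "P s" using in'[of s] s t by (simp add: P_def z1_def dist_norm norm_minus_commute)
    qed (use e in auto)
  qed
  then show ?thesis using strict[of t] t by (simp add: P_def)
qed

lemma cvel_change:
  assumes "geodesic M \<gamma>" "c \<in> charts_at M (\<gamma> t)" "c' \<in> charts_at M (\<gamma> t)"
  shows "cvel c' \<gamma> t = transition_deriv c c' (\<gamma> t) (cvel c \<gamma> t)"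
  using cvel_eqI[OF chart_change_vector[where \<gamma> = \<gamma> and t = t, OF assms(2,3) UNIV_I geodesic_isCont[OF assms(1)]
      geodesic_coord_derivative[OF assms(1,2)]]] .

end

section \<open>Geodesics from a fixed point as functions of the initial velocity\<close>

context complete_mfd
begin

text \<open>The exponential map in coordinates: \<open>Phi x0 c0 w t\<close> is \<open>exp\<close>
  at \<open>x0\<close> of \<open>t\<close> times the vector with coordinates \<open>w\<close> in the
  chart \<open>c0\<close>.\<close>

definition Phi :: "'m \<Rightarrow> ('m, 'n) chart \<Rightarrow> real ^ 'n \<Rightarrow> real \<Rightarrow> 'm" where
  "Phi x0 c0 w = gd x0 (lift_vec M c0 x0 w)"

definition reg :: "'m \<Rightarrow> ('m, 'n) chart \<Rightarrow> ('m, 'n) chart \<Rightarrow> real ^ 'n \<Rightarrow> real \<Rightarrow> bool" where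
  "reg x0 c0 c w0 t \<longleftrightarrow> (\<exists>e>0. (\<forall>w\<in>ball w0 e. Phi x0 c0 w t \<in> dom_of c) \<and>
     C1_on (ball w0 e) (\<lambda>w. geoz c (Phi x0 c0 w) t))"

text \<open>On a time interval \<open>[a,b]\<close> that the geodesics spend in one chart, \<open>D\<close> is the derivative of the flow
  with respect to the initial velocity, and it solves the variational equation. \<open>reg\<close> is the part of
  this that is propagated in time.\<close>

definition sreg :: "'m \<Rightarrow> ('m, 'n) chart \<Rightarrow> ('m, 'n) chart \<Rightarrow> real ^ 'n \<Rightarrow> real \<Rightarrow> real \<Rightarrow>
    real \<Rightarrow> (real \<Rightarrow> real ^ 'n \<Rightarrow> ((real ^ 'n) \<Rightarrow>\<^sub>L ((real ^ 'n) \<times> (real ^ 'n)))) \<Rightarrow> bool" where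
  "sreg x0 c0 c w0 a b e D \<longleftrightarrow> a < b \<and> 0 < e \<and>
     (\<forall>t\<in>{a..b}. \<forall>w\<in>ball w0 e. Phi x0 c0 w t \<in> dom_of c \<and>
        ((\<lambda>w. geoz c (Phi x0 c0 w) t) has_derivative blinfun_apply (D t w)) (at w) \<and>
        (\<exists>A. (geoF c has_derivative blinfun_apply A) (at (geoz c (Phi x0 c0 w) t)) \<and>
          ((\<lambda>t. D t w) has_vector_derivative A o\<^sub>L D t w) (at t within {a..b}))) \<and>
     continuous_on ({a..b} \<times> ball w0 e) (\<lambda>y. D (fst y) (snd y)) \<and>
     continuous_on ({a..b} \<times> ball w0 e) (\<lambda>y. geoz c (Phi x0 c0 (snd y)) (fst y))"

context
  fixes x0 c0 assumes c0: "c0 \<in> charts_at M x0"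
begin

lemma Phi_props:
  "geodesic M (Phi x0 c0 w)" "Phi x0 c0 w 0 = x0" "velocity M (Phi x0 c0 w) 0 = lift_vec M c0 x0 w"
  unfolding Phi_def using gd_props[OF lift_vec_tangent[OF c0]] by auto

lemma Phi_scale: "Phi x0 c0 (r *\<^sub>R w) t = Phi x0 c0 w (r * t)"
  unfolding Phi_def lift_vec_scale[OF c0] by (rule gd_tscale[OF lift_vec_tangent[OF c0]])

lemma geoz_Phi_0: "geoz c0 (Phi x0 c0 w) 0 = (coord c0 x0, w)"
  using velocity_chart[of c0 "Phi x0 c0 w" 0] Phi_props[of w] c0 lift_vec_apply[OF c0, of w] by (simp add: geoz_def)

lemma reg_zero: "reg x0 c0 c0 w0 0"
  unfolding reg_def geoz_Phi_0 Phi_props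
  using charts_atD(2)[OF c0] by (intro exI[of _ 1]) (auto intro: C1_on_Pair C1_on_const C1_on_id)

text \<open>Position and velocity in the new chart are the image of those in the old one under the
  tangent map of the change of charts. Continuity leaves both chart domains available for all
  \<open>w\<close> near \<open>w0\<close>.\<close>

lemma reg_change:
  assumes "reg x0 c0 c w0 t" "c \<in> atlas M" "c' \<in> charts_at M (Phi x0 c0 w0 t)"
  shows "reg x0 c0 c' w0 t"
proof -
  obtain e where e: "e > 0" "\<And>w. w \<in> ball w0 e \<Longrightarrow> Phi x0 c0 w t \<in> dom_of c"
    and C1: "C1_on (ball w0 e) (\<lambda>w. geoz c (Phi x0 c0 w) t)"
    using assms(1) unfolding reg_def by blast
  let ?\<tau> = "coord c' \<circ> coord_inv c"
  let ?O = "coord c ` (dom_of c \<inter> dom_of c')"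
  note c'a = charts_atD(1)[OF assms(3)]
  have O: "open ?O" using overlap_open[OF assms(2) c'a] .
  have sm: "smooth_on ?O ?\<tau>" using smooth_transition[OF assms(2) c'a] .
  define U where "U = {w \<in> ball w0 e. geoz c (Phi x0 c0 w) t \<in> ?O \<times> UNIV}"
  have "open U"
    unfolding U_def using continuous_open_preimage[OF C1_on_imp_continuous_on[OF C1] open_ball open_Times[OF O open_UNIV]]
    by (simp add: vimage_def Int_def)
  moreover have "w0 \<in> U"
    unfolding U_def geoz_def using e charts_atD(2)[OF assms(3)] by auto
  ultimately obtain e' where e': "e' > 0" "ball w0 e' \<subseteq> U" using open_contains_ball by blast
  \<comment> \<open>The tangent map of \<open>?\<tau>\<close>. That it is C1 uses two derivatives of
    \<open>?\<tau>\<close>, since its second component already contains one.\<close>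
  define T where "T z = (?\<tau> (fst z), frechet_derivative ?\<tau> (at (fst z)) (snd z))" for z :: "(real^'n) \<times> (real^'n)"
  have T: "C1_on (?O \<times> UNIV) T"
    unfolding T_def[abs_def]
    by (intro C1_on_Pair smooth_on_imp_C1_on_derivative[OF O sm]
        C1_on_compose[OF C1_on_fst[OF C1_on_id] smooth_on_imp_C1_on[OF O sm]]) auto
  have dom: "Phi x0 c0 w t \<in> dom_of c \<and> Phi x0 c0 w t \<in> dom_of c'" if "w \<in> ball w0 e'" for w
  proof -
    have "w \<in> U" using that e'(2) by blast
    then have w: "w \<in> ball w0 e" "coord c (Phi x0 c0 w t) \<in> ?O" by (auto simp: U_def geoz_def)
    then obtain y where "y \<in> dom_of c" "y \<in> dom_of c'" "coord c (Phi x0 c0 w t) = coord c y" by auto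
    with e(2)[OF w(1)] show ?thesis using coord_inv_coord[OF assms(2)] by metis
  qed
  have "C1_on (ball w0 e') (\<lambda>w. geoz c' (Phi x0 c0 w) t)"
  proof (rule C1_on_cong[OF open_ball C1_on_compose[OF C1_on_subset[OF C1] T]])
    show "ball w0 e' \<subseteq> ball w0 e" using e'(2) U_def by blast
    show "geoz c (Phi x0 c0 w) t \<in> ?O \<times> UNIV" if "w \<in> ball w0 e'" for w using that e'(2) U_def by blast
    fix w assume "w \<in> ball w0 e'"
    note d = dom[OF this]
    have cc: "c \<in> charts_at M (Phi x0 c0 w t)" "c' \<in> charts_at M (Phi x0 c0 w t)"
      using d charts_atI assms(2) c'a by auto
    show "T (geoz c (Phi x0 c0 w) t) = geoz c' (Phi x0 c0 w) t"
      unfolding T_def geoz_def fst_conv snd_conv cvel_change[OF Phi_props(1) cc] transition_deriv_def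
      using coord_inv_coord[OF assms(2)] d by simp
  qed
  then show ?thesis unfolding reg_def using e'(1) dom by blast
qed

lemma sreg_imp_reg:
  assumes "sreg x0 c0 c w0 a b e D" "t \<in> {a..b}"
  shows "reg x0 c0 c w0 t"
proof -
  note s = assms(1)[unfolded sreg_def]
  have "continuous_on (ball w0 e) (\<lambda>w. D (fst (t, w)) (snd (t, w)))"
    by (rule continuous_on_compose2[of "{a..b} \<times> ball w0 e" _ _ "\<lambda>w. (t, w)"])
      (use s assms(2) in \<open>auto intro!: continuous_on_Pair continuous_on_const continuous_on_id\<close>)
  then have "C1_on (ball w0 e) (\<lambda>w. geoz c (Phi x0 c0 w) t)"
    unfolding C1_on_def using s assms(2) by (intro exI[of _ "D t"]) simp
  then show ?thesis unfolding reg_def using s assms(2) by blast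
qed

text \<open>\<open>\<delta>\<close> is chosen before \<open>t1\<close>. A start \<open>t1\<close> up
  to \<open>\<delta>/2\<close> earlier than \<open>t0\<close> therefore yields an interval reaching
  beyond \<open>t0\<close>, which lets regularity at earlier times pass to \<open>t0\<close> and
  past it.\<close>

lemma sreg_local:
  shows "\<exists>c\<in>charts_at M (Phi x0 c0 w0 t0). \<exists>\<delta>>0. \<forall>t1 c'. t0 - \<delta>/2 \<le> t1 \<longrightarrow> t1 \<le> t0 \<longrightarrow>
      c' \<in> atlas M \<longrightarrow> reg x0 c0 c' w0 t1 \<longrightarrow> (\<exists>e D. sreg x0 c0 c w0 t1 (t1 + \<delta>) e D)"
proof -
  obtain c where c: "c \<in> charts_at M (Phi x0 c0 w0 t0)" using ex_chart by blast
  note ca = charts_atD(1)[OF c] and g = Phi_props(1)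
  define z where "z = geoz c (Phi x0 c0 w0) t0"
  have "z \<in> phase c" unfolding z_def phase_def geoz_def using charts_atD[OF c] by auto
  then obtain r where r: "r > 0" "cball z r \<subseteq> phase c"
    using open_phase[OF ca] open_contains_cball by blast
  obtain F' where F': "\<And>x. x \<in> phase c \<Longrightarrow> (geoF c has_derivative blinfun_apply (F' x)) (at x)" "continuous_on (phase c) F'"
    using geoF_C1[OF ca] C1_onE by blast
  have "bounded (F' ` cball z r)" "bounded (geoF c ` cball z r)"
    by (intro compact_imp_bounded compact_continuous_image continuous_on_subset[OF F'(2) r(2)]
        continuous_on_subset[OF C1_on_imp_continuous_on[OF geoF_C1[OF ca]] r(2)] compact_cball)+
  then obtain L B where L: "\<And>x. x \<in> cball z r \<Longrightarrow> norm (F' x) \<le> L" and B: "\<And>x. x \<in> cball z r \<Longrightarrow> norm (geoF c x) \<le> B"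
    unfolding bounded_iff by blast
  have L0: "0 \<le> L" "0 \<le> B" using L[of z] B[of z] r(1) by (auto intro: order_trans[OF norm_ge_zero])
  have "eventually (\<lambda>s. dist (geoz c (Phi x0 c0 w0) s) z < r/2) (at t0)"
    using geoz_isCont[OF g c] r(1) unfolding isCont_def z_def tendsto_iff by (metis half_gt_zero)
  with curve_in_dom[OF geodesic_isCont[OF g] c]
  have "eventually (\<lambda>s. Phi x0 c0 w0 s \<in> dom_of c \<and> dist (geoz c (Phi x0 c0 w0) s) z < r/2) (at t0)"
    by (rule eventually_conj)
  then obtain d1 where d1: "d1 > 0" "\<And>s. s \<noteq> t0 \<Longrightarrow> dist s t0 < d1 \<Longrightarrow> Phi x0 c0 w0 s \<in> dom_of c \<and> dist (geoz c (Phi x0 c0 w0) s) z < r/2"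
    unfolding eventually_at by blast
  \<comment> \<open>The three bounds serve to keep the reference geodesic near \<open>z\<close>, to
    apply \<open>geodesic_stays_in_chart\<close>, and to meet the smallness condition of the ODE
    theorem.\<close>
  define \<delta> where "\<delta> = min d1 (min (r / (4 * (B + 1))) (1 / (2 * (L + 1))))"
  have \<delta>: "\<delta> > 0" "\<delta> \<le> d1" "B * \<delta> < r / 2" "L * \<delta> \<le> 1/2"
  proof -
    show "\<delta> > 0" "\<delta> \<le> d1" using d1 r(1) L0 by (auto simp: \<delta>_def)
    have "B * \<delta> \<le> B * (r / (4 * (B + 1)))" using L0 by (intro mult_left_mono) (auto simp: \<delta>_def)
    also have "\<dots> < r / 2"
    proof -
      have "0 < r * 4 + B * (r * 2)" using L0 r(1) by (intro add_pos_nonneg) simp_all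
      then show ?thesis using L0 r(1) by (simp add: field_simps)
    qed
    finally show "B * \<delta> < r / 2" .
    have "L * \<delta> \<le> L * (1 / (2 * (L + 1)))" using L0 by (intro mult_left_mono) (auto simp: \<delta>_def)
    also have "\<dots> \<le> 1/2" using L0 by (simp add: field_simps)
    finally show "L * \<delta> \<le> 1/2" .
  qed
  have "\<exists>e D. sreg x0 c0 c w0 t1 (t1 + \<delta>) e D"
    if t1: "t0 - \<delta>/2 \<le> t1" "t1 \<le> t0" and c': "c' \<in> atlas M" "reg x0 c0 c' w0 t1" for t1 c'
  proof -
    have "Phi x0 c0 w0 t1 \<in> dom_of c \<and> dist (geoz c (Phi x0 c0 w0) t1) z < r/2"
    proof (cases "t1 = t0")
      case True then show ?thesis using charts_atD(2)[OF c] r(1) by (simp add: z_def)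
    next
      case False then show ?thesis using d1(2)[of t1] t1 \<delta> by (simp add: dist_real_def)
    qed
    then have w0: "Phi x0 c0 w0 t1 \<in> dom_of c" "dist z (geoz c (Phi x0 c0 w0) t1) < r/2"
      by (auto simp: dist_commute)
    obtain e where e: "e > 0" "\<And>w. w \<in> ball w0 e \<Longrightarrow> Phi x0 c0 w t1 \<in> dom_of c"
      and C1: "C1_on (ball w0 e) (\<lambda>w. geoz c (Phi x0 c0 w) t1)"
      using reg_change[OF c'(2,1) charts_atI[OF ca w0(1)]] unfolding reg_def by blast
    define U where "U = ball w0 e \<inter> (\<lambda>w. geoz c (Phi x0 c0 w) t1) -` ball z (r/2)"
    have "open U"
      unfolding U_def by (rule continuous_open_preimage[OF C1_on_imp_continuous_on[OF C1] open_ball open_ball])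
    moreover have "w0 \<in> U" using w0(2) e(1) by (simp add: U_def)
    ultimately obtain e' where e': "e' > 0" "ball w0 e' \<subseteq> U" unfolding open_contains_ball by blast
    have U: "w \<in> ball w0 e" "geoz c (Phi x0 c0 w) t1 \<in> ball z (r/2)" if "w \<in> ball w0 e'" for w
      using subsetD[OF e'(2) that] unfolding U_def by simp_all
    have stay: "Phi x0 c0 w t \<in> dom_of c \<and> geoz c (Phi x0 c0 w) t \<in> cball z r" if "t \<in> {t1..t1+\<delta>}" "w \<in> ball w0 e'" for t w
    proof (rule geodesic_stays_in_chart[where a = t1 and b = "t1 + \<delta>", OF g ca r(2) B L0(2)])
      show "Phi x0 c0 w t1 \<in> dom_of c" "geoz c (Phi x0 c0 w) t1 \<in> cball z (r/2)"
        using e(2)[OF U(1)[OF that(2)]] U(2)[OF that(2)] by simp_all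
    qed (use \<delta> that in auto)
    obtain D0 where D0: "\<And>w. w \<in> ball w0 e' \<Longrightarrow> ((\<lambda>w. geoz c (Phi x0 c0 w) t1) has_derivative blinfun_apply (D0 w)) (at w)"
      "continuous_on (ball w0 e') D0"
      using C1_onE[OF C1_on_subset[OF C1 subsetI[OF U(1)]]] by metis
    have ode: "((\<lambda>t. geoz c (Phi x0 c0 w) t) has_vector_derivative geoF c (geoz c (Phi x0 c0 w) t)) (at t within {t1..t1+\<delta>})"
      if "t \<in> {t1..t1+\<delta>}" "w \<in> ball w0 e'" for t w
      by (rule has_vector_derivative_at_within[OF geoz_ode[OF g charts_atI[OF ca stay[OF that, THEN conjunct1]]]])
    obtain D where D:
      "\<And>t w. t \<in> {t1..t1+\<delta>} \<Longrightarrow> w \<in> ball w0 e' \<Longrightarrow> ((\<lambda>w. geoz c (Phi x0 c0 w) t) has_derivative blinfun_apply (D t w)) (at w)"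
      "continuous_on ({t1..t1+\<delta>} \<times> ball w0 e') (\<lambda>y. D (fst y) (snd y))"
      "continuous_on ({t1..t1+\<delta>} \<times> ball w0 e') (\<lambda>y. geoz c (Phi x0 c0 (snd y)) (fst y))"
      "\<And>t w. t \<in> {t1..t1+\<delta>} \<Longrightarrow> w \<in> ball w0 e' \<Longrightarrow>
         ((\<lambda>t. D t w) has_vector_derivative F' (geoz c (Phi x0 c0 w) t) o\<^sub>L D t w) (at t within {t1..t1+\<delta>})"
    proof (rule ode_derivative_wrt_parameter[where z = "\<lambda>t w. geoz c (Phi x0 c0 w) t" and F' = F' and F = "geoF c" and K = "cball z r"
          and L = L and a = t1 and b = "t1 + \<delta>" and W = "ball w0 e'" and ?D0.0 = D0])
      show "(geoF c has_derivative blinfun_apply (F' x)) (at x within cball z r)" if "x \<in> cball z r" for x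
        using has_derivative_at_withinI[OF F'(1)] that r(2) by blast
      show "continuous_on (cball z r) F'" by (rule continuous_on_subset[OF F'(2) r(2)])
    qed (use \<delta> L L0 ode stay D0 in auto)
    have "sreg x0 c0 c w0 t1 (t1 + \<delta>) e' D"
      unfolding sreg_def
    proof (intro conjI ballI D(2,3))
      fix t w assume tw: "t \<in> {t1..t1+\<delta>}" "w \<in> ball w0 e'"
      show "Phi x0 c0 w t \<in> dom_of c" using stay[OF tw] by blast
      show "\<exists>A. (geoF c has_derivative blinfun_apply A) (at (geoz c (Phi x0 c0 w) t)) \<and>
          ((\<lambda>t. D t w) has_vector_derivative A o\<^sub>L D t w) (at t within {t1..t1+\<delta>})"
        using D(4)[OF tw] F'(1) stay[OF tw] r(2) by blast
    qed (use D(1) \<delta>(1) e'(1) in auto)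
    then show ?thesis by blast
  qed
  then show ?thesis using c \<delta>(1) by blast
qed

lemma reg_all:
  assumes "0 \<le> t" shows "\<exists>c\<in>atlas M. reg x0 c0 c w0 t"
proof (rule real_interval_induct[where a = 0 and b = t and P = "\<lambda>t. \<exists>c\<in>atlas M. reg x0 c0 c w0 t"])
  show "\<exists>c\<in>atlas M. reg x0 c0 c w0 0" using reg_zero charts_atD(1)[OF c0] by blast
next
  fix t :: real assume t: "0 < t" and IH: "\<And>s. 0 \<le> s \<Longrightarrow> s < t \<Longrightarrow> \<exists>c\<in>atlas M. reg x0 c0 c w0 s"
  obtain c \<delta> where c: "c \<in> charts_at M (Phi x0 c0 w0 t)" "\<delta> > 0"
    and *: "\<And>t1 c'. t - \<delta>/2 \<le> t1 \<Longrightarrow> t1 \<le> t \<Longrightarrow> c' \<in> atlas M \<Longrightarrow> reg x0 c0 c' w0 t1 \<Longrightarrow> \<exists>e D. sreg x0 c0 c w0 t1 (t1 + \<delta>) e D"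
    using sreg_local[of w0 t] by blast
  define s where "s = max 0 (t - \<delta>/2)"
  have s: "0 \<le> s" "s < t" "t - \<delta>/2 \<le> s" using t c(2) by (auto simp: s_def)
  obtain c' where "c' \<in> atlas M" "reg x0 c0 c' w0 s" using IH[OF s(1,2)] by blast
  then obtain e D where "sreg x0 c0 c w0 s (s + \<delta>) e D" using *[OF s(3)] s(2) by (meson less_imp_le)
  from sreg_imp_reg[OF this, of t] show "\<exists>c\<in>atlas M. reg x0 c0 c w0 t"
    using s c charts_atD(1)[OF c(1)] by auto
next
  fix t :: real assume t: "0 \<le> t" and IH: "\<And>s. 0 \<le> s \<Longrightarrow> s \<le> t \<Longrightarrow> \<exists>c\<in>atlas M. reg x0 c0 c w0 s"
  obtain c \<delta> where c: "c \<in> charts_at M (Phi x0 c0 w0 t)" "\<delta> > 0"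
    and *: "\<And>t1 c'. t - \<delta>/2 \<le> t1 \<Longrightarrow> t1 \<le> t \<Longrightarrow> c' \<in> atlas M \<Longrightarrow> reg x0 c0 c' w0 t1 \<Longrightarrow> \<exists>e D. sreg x0 c0 c w0 t1 (t1 + \<delta>) e D"
    using sreg_local[of w0 t] by blast
  obtain c' where c': "c' \<in> atlas M" "reg x0 c0 c' w0 t" using IH[OF t order_refl] by blast
  obtain e D where s: "sreg x0 c0 c w0 t (t + \<delta>) e D" using *[OF _ order_refl c'] c(2) by auto
  have "\<exists>c\<in>atlas M. reg x0 c0 c w0 s" if "t < s" "s < t + \<delta>" for s
    using sreg_imp_reg[OF s, of s] that charts_atD(1)[OF c(1)] by auto
  then show "\<exists>e>0. \<forall>s. t < s \<longrightarrow> s < t + e \<longrightarrow> s \<le> t' \<longrightarrow> (\<exists>c\<in>atlas M. reg x0 c0 c w0 s)" for t'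
    using c(2) by blast
qed (use assms in auto)

text \<open>At a positive time the interval extends to both sides, so derivatives in
  \<open>t\<close> are two-sided there. At time 0 it starts exactly at 0, where the initial values
  of the variation are known.\<close>

lemma sreg_all:
  assumes "0 \<le> t"
  obtains c a b e D where "c \<in> charts_at M (Phi x0 c0 w0 t)" "sreg x0 c0 c w0 a b e D" "0 \<le> a" "a \<le> t" "t < b" "t = 0 \<or> a < t"
proof -
  obtain c \<delta> where c: "c \<in> charts_at M (Phi x0 c0 w0 t)" "\<delta> > 0"
    and *: "\<And>t1 c'. t - \<delta>/2 \<le> t1 \<Longrightarrow> t1 \<le> t \<Longrightarrow> c' \<in> atlas M \<Longrightarrow> reg x0 c0 c' w0 t1 \<Longrightarrow> \<exists>e D. sreg x0 c0 c w0 t1 (t1 + \<delta>) e D"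
    using sreg_local[of w0 t] by blast
  define s where "s = max 0 (t - \<delta>/2)"
  have s: "0 \<le> s" "s \<le> t" "t - \<delta>/2 \<le> s" using assms c(2) by (auto simp: s_def)
  obtain c' where "c' \<in> atlas M" "reg x0 c0 c' w0 s" using reg_all[OF s(1)] by blast
  then obtain e D where "sreg x0 c0 c w0 s (s + \<delta>) e D" using *[OF s(3,2)] by blast
  moreover have "t = 0 \<or> s < t" using c(2) assms unfolding s_def max_def by (cases "t = 0") auto
  ultimately show thesis using that[OF c(1) _ s(1,2)] s c(2) by auto
qed

end

end

section \<open>Jacobi fields\<close>

text \<open>The hypothesis \<open>cs\<close> says that \<open>\<surd>g\<close> is convex where \<open>g > 0\<close>. As \<open>g\<close> may vanish, the proof uses the
  convex functions \<open>\<surd>(g + \<epsilon>)\<close>.\<close>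

lemma sqrt_le_linear_of_sqrt_convex:
  fixes g g1 g2 :: "real \<Rightarrow> real"
  assumes d1: "\<And>t. 0 < t \<Longrightarrow> (g has_real_derivative g1 t) (at t)"
    and d2: "\<And>t. 0 < t \<Longrightarrow> (g1 has_real_derivative g2 t) (at t)"
    and cs: "\<And>t. 0 < t \<Longrightarrow> (g1 t)\<^sup>2 \<le> 2 * g t * g2 t"
    and nn: "\<And>t. 0 < t \<Longrightarrow> 0 \<le> g t" "\<And>t. 0 < t \<Longrightarrow> 0 \<le> g2 t"
    and lim: "(g \<longlongrightarrow> 0) (at_right 0)" and \<lambda>: "0 < l" "l \<le> 1"
  shows "sqrt (g l) \<le> l * sqrt (g 1)"
proof -
  have eps: "sqrt (g l + \<epsilon>) \<le> (1 - l) * sqrt \<epsilon> + l * sqrt (g 1 + \<epsilon>)" if \<epsilon>: "0 < \<epsilon>" for \<epsilon>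
  proof (cases "l = 1")
    case False
    then have l1: "l < 1" using \<lambda> by simp
    define f where "f t = sqrt (g t + \<epsilon>)" for t
    have fpos: "0 < f t" if "0 < t" for t using nn(1)[OF that] \<epsilon> by (simp add: f_def)
    have f2: "f t * f t = g t + \<epsilon>" if "0 < t" for t using nn(1)[OF that] \<epsilon> by (simp add: f_def)
    define f1 where "f1 t = inverse (f t) / 2 * g1 t" for t
    have df: "(f has_real_derivative f1 t) (at t)" if "0 < t" for t
    proof -
      have "((\<lambda>t. g t + \<epsilon>) has_real_derivative g1 t) (at t)"
        by (rule DERIV_cong[OF DERIV_add[OF d1[OF that] DERIV_const]]) simp
      from DERIV_chain2[OF DERIV_real_sqrt this] show ?thesis
        using nn(1)[OF that] \<epsilon> unfolding f_def f1_def by simp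
    qed
    define f2' where "f2' t = (g2 t - (g1 t)\<^sup>2 / (2 * (f t * f t))) / (2 * f t)" for t
    have df1: "(f1 has_real_derivative f2' t) (at t)" if t: "0 < t" for t
    proof -
      have inv: "((\<lambda>t. inverse (f t)) has_real_derivative - (inverse (f t) * f1 t * inverse (f t))) (at t)"
        by (rule DERIV_inverse'[OF df[OF t]]) (use fpos[OF t] in simp)
      have "((\<lambda>t. inverse (f t) * (g1 t / 2)) has_real_derivative
         - (inverse (f t) * f1 t * inverse (f t)) * (g1 t / 2) + g2 t / 2 * inverse (f t)) (at t)"
        by (rule DERIV_mult[OF inv DERIV_cdivide[OF d2[OF t]]])
      then have "(f1 has_real_derivative
         - (inverse (f t) * f1 t * inverse (f t)) * (g1 t / 2) + g2 t / 2 * inverse (f t)) (at t)"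
        unfolding f1_def by simp
      moreover have "- (inverse (f t) * f1 t * inverse (f t)) * (g1 t / 2) + g2 t / 2 * inverse (f t) = f2' t"
        using fpos[OF t] unfolding f1_def f2'_def by (simp add: field_simps power2_eq_square)
      ultimately show ?thesis by simp
    qed
    have f2'0: "0 \<le> f2' t" if t: "0 < t" for t
    proof -
      have "(g1 t)\<^sup>2 \<le> 2 * (g t + \<epsilon>) * g2 t"
        by (rule order_trans[OF cs[OF t]]) (intro mult_right_mono nn(2)[OF t], use \<epsilon> in simp)
      then have "(g1 t)\<^sup>2 / (2 * (f t * f t)) \<le> g2 t"
        unfolding f2[OF t] using nn(1)[OF t] \<epsilon> by (simp add: pos_divide_le_eq mult_ac)
      then show ?thesis unfolding f2'_def using fpos[OF t] by simp
    qed
    have conv: "convex_on {0<..} f"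
      by (rule f''_ge0_imp_convex[where f' = f1 and f'' = f2']) (use df df1 f2'0 in auto)
    have "f l \<le> (1 - l) * sqrt (0 + \<epsilon>) + l * f 1"
    proof (rule tendsto_le[where F = "at_right (0::real)"])
      have "(f \<longlongrightarrow> sqrt (0 + \<epsilon>)) (at_right 0)"
        unfolding f_def by (intro tendsto_real_sqrt tendsto_add lim tendsto_const)
      then show "((\<lambda>s. (1 - (l - s) / (1 - s)) * f s + (l - s) / (1 - s) * f 1) \<longlongrightarrow> (1 - l) * sqrt (0 + \<epsilon>) + l * f 1) (at_right 0)"
        by (auto intro!: tendsto_eq_intros)
      show "\<forall>\<^sub>F s in at_right 0. f l \<le> (1 - (l - s) / (1 - s)) * f s + (l - s) / (1 - s) * f 1"
        unfolding eventually_at_right_field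
      proof (intro exI[of _ l] conjI allI impI)
        fix s :: real assume s: "0 < s" "s < l"
        \<comment> \<open>The weight for which \<open>l\<close> is the convex combination of
          \<open>s\<close> and 1. Convexity is available on positive times only, so the endpoint 0
          is reached by letting \<open>s\<close> tend to 0.\<close>
        define m where "m = (l - s) / (1 - s)"
        have "m * (1 - s) = l - s" using s l1 by (simp add: m_def)
        moreover have "(1 - m) * s + m * 1 = s + m * (1 - s)" by (simp add: algebra_simps)
        moreover have "0 \<le> m" "m \<le> 1" using s l1 by (simp_all add: m_def)
        ultimately have m: "0 \<le> m" "m \<le> 1" "(1 - m) * s + m * 1 = l" by simp_all
        have "f ((1 - m) *\<^sub>R s + m *\<^sub>R 1) \<le> (1 - m) * f s + m * f 1"
          by (rule convex_onD[OF conv m(1,2)]) (use s in auto)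
        then show "f l \<le> (1 - (l - s) / (1 - s)) * f s + (l - s) / (1 - s) * f 1"
          using m(3) unfolding m_def[symmetric] by simp
      qed (use \<lambda> in auto)
    qed simp_all
    then show ?thesis unfolding f_def by simp
  qed simp
  have "sqrt (g l) \<le> l * sqrt (g 1)"
  proof (rule tendsto_le[where F = "at_right (0::real)"])
    have lim2: "((\<lambda>\<epsilon>. (1 - l) * sqrt \<epsilon> + l * sqrt (g 1 + \<epsilon>)) \<longlongrightarrow> (1 - l) * sqrt 0 + l * sqrt (g 1 + 0)) (at_right 0)"
      by (intro tendsto_intros)
    then show "((\<lambda>\<epsilon>. (1 - l) * sqrt \<epsilon> + l * sqrt (g 1 + \<epsilon>)) \<longlongrightarrow> l * sqrt (g 1)) (at_right 0)" by simp
    have "((\<lambda>\<epsilon>. sqrt (g l + \<epsilon>)) \<longlongrightarrow> sqrt (g l + 0)) (at_right 0)" by (intro tendsto_intros)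
    then show "((\<lambda>\<epsilon>. sqrt (g l + \<epsilon>)) \<longlongrightarrow> sqrt (g l)) (at_right 0)" by simp
    show "\<forall>\<^sub>F \<epsilon> in at_right 0. sqrt (g l + \<epsilon>) \<le> (1 - l) * sqrt \<epsilon> + l * sqrt (g 1 + \<epsilon>)"
      unfolding eventually_at_right_field using eps by (intro exI[of _ 1]) auto
  qed simp
  then show ?thesis .
qed

lemma has_vector_derivative_vecI:
  fixes f :: "real \<Rightarrow> real ^ 'n::finite"
  assumes "\<And>k. ((\<lambda>t. f t $ k) has_real_derivative f' $ k) (at t within T)"
  shows "(f has_vector_derivative f') (at t within T)"
  unfolding has_vector_derivative_def
proof (subst has_derivative_componentwise_within, intro ballI)
  fix b :: "real ^ 'n" assume "b \<in> Basis"
  then obtain k where b: "b = axis k 1" unfolding Basis_vec_def by auto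
  show "((\<lambda>x. f x \<bullet> b) has_derivative (\<lambda>x. (x *\<^sub>R f') \<bullet> b)) (at t within T)"
    using assms[of k] unfolding has_real_derivative_iff_has_vector_derivative has_vector_derivative_def b
    by (simp add: inner_axis)
qed

context riem_mfd
begin

lemma Gam_along_curve:
  assumes "c \<in> atlas M" "\<alpha> t \<in> coord c ` dom_of c"
    and "(\<alpha> has_vector_derivative \<alpha>') (at t within T)"
    and "(u has_vector_derivative u') (at t within T)"
    and "(v has_vector_derivative v') (at t within T)"
  shows "((\<lambda>t. Gam c (\<alpha> t) (u t) (v t)) has_vector_derivative
    dGam c (\<alpha> t) \<alpha>' (u t) (v t) + Gam c (\<alpha> t) u' (v t) + Gam c (\<alpha> t) (u t) v') (at t within T)"
proof (rule has_vector_derivative_vecI)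
  fix k
  have nth: "((\<lambda>t. w t $ i) has_real_derivative w' $ i) (at t within T)"
    if "(w has_vector_derivative w') (at t within T)" for w :: "real \<Rightarrow> real ^ 'n" and w' i
    using bounded_linear.has_vector_derivative[OF bounded_linear_vec_nth that]
    unfolding has_real_derivative_iff_has_vector_derivative .
  have ch: "((\<lambda>t. christoffel M c k i j (\<alpha> t)) has_real_derivative frechet_derivative (christoffel M c k i j) (at (\<alpha> t)) \<alpha>') (at t within T)" for i j
    using has_derivative_compose[OF assms(3)[unfolded has_vector_derivative_def] christoffel_has_derivative[OF assms(1,2)]]
    unfolding has_real_derivative_iff_has_vector_derivative has_vector_derivative_def
    by (simp add: linear_cmul[OF has_derivative_linear[OF christoffel_has_derivative[OF assms(1,2)]]])
  have "((\<lambda>t. \<Sum>i\<in>UNIV. \<Sum>j\<in>UNIV. christoffel M c k i j (\<alpha> t) * u t $ i * v t $ j) has_real_derivative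
    (\<Sum>i\<in>UNIV. \<Sum>j\<in>UNIV. (frechet_derivative (christoffel M c k i j) (at (\<alpha> t)) \<alpha>' * u t $ i + u' $ i * christoffel M c k i j (\<alpha> t)) * v t $ j
       + v' $ j * (christoffel M c k i j (\<alpha> t) * u t $ i))) (at t within T)"
    by (intro DERIV_sum DERIV_mult ch nth assms)
  then show "((\<lambda>t. Gam c (\<alpha> t) (u t) (v t) $ k) has_real_derivative
    (dGam c (\<alpha> t) \<alpha>' (u t) (v t) + Gam c (\<alpha> t) u' (v t) + Gam c (\<alpha> t) (u t) v') $ k) (at t within T)"
    unfolding Gam_def dGam_def vec_lambda_beta vector_add_component
    by (rule DERIV_cong) (simp add: sum.distrib[symmetric] algebra_simps)
qed

text \<open>The right-hand side of the linearised geodesic equation. As \<open>geoF\<close> is known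
  to be differentiable, it suffices to differentiate it along the straight lines
  \<open>\<beta>\<close>.\<close>

lemma geoF_has_derivative:
  assumes c: "c \<in> atlas M" and a: "a \<in> coord c ` dom_of c"
  shows "(geoF c has_derivative (\<lambda>y. (snd y, - (dGam c a (fst y) v v + Gam c a (snd y) v + Gam c a v (snd y))))) (at (a, v))"
proof -
  have "(a, v) \<in> phase c" using a by (simp add: phase_def)
  then obtain T where T: "(geoF c has_derivative T) (at (a, v))"
    using C1_onE[OF geoF_C1[OF c]] by metis
  have lin: "linear T" using T has_derivative_linear by blast
  have "T y = (snd y, - (dGam c a (fst y) v v + Gam c a (snd y) v + Gam c a v (snd y)))" for y
  proof -
    define \<beta> where "\<beta> s = (a, v) + s *\<^sub>R y" for s :: real
    have \<beta>: "(\<beta> has_vector_derivative y) (at 0)"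
      using has_vector_derivative_add[OF has_vector_derivative_const bounded_linear.has_vector_derivative[OF bounded_linear_scaleR_left[of y] has_vector_derivative_id]]
      unfolding \<beta>_def[abs_def] by simp
    have \<beta>0: "\<beta> 0 = (a, v)" by (simp add: \<beta>_def)
    have fs: "((\<lambda>s. fst (\<beta> s)) has_vector_derivative fst y) (at 0)" "((\<lambda>s. snd (\<beta> s)) has_vector_derivative snd y) (at 0)"
      using bounded_linear.has_vector_derivative[OF bounded_linear_fst \<beta>] bounded_linear.has_vector_derivative[OF bounded_linear_snd \<beta>] by auto
    have "((\<lambda>s. Gam c (fst (\<beta> s)) (snd (\<beta> s)) (snd (\<beta> s))) has_vector_derivative
      dGam c a (fst y) v v + Gam c a (snd y) v + Gam c a v (snd y)) (at 0)"
      using Gam_along_curve[OF c _ fs(1) fs(2) fs(2)] a by (simp add: \<beta>0)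
    from has_vector_derivative_Pair[OF fs(2) has_vector_derivative_minus[OF this]]
    have 1: "((\<lambda>s. geoF c (\<beta> s)) has_vector_derivative (snd y, - (dGam c a (fst y) v v + Gam c a (snd y) v + Gam c a v (snd y)))) (at 0)"
      unfolding geoF_def .
    have "((\<lambda>s. geoF c (\<beta> s)) has_vector_derivative T y) (at 0)"
      using has_derivative_compose[OF \<beta>[unfolded has_vector_derivative_def], of "geoF c" T] T
      unfolding has_vector_derivative_def \<beta>0 by (simp add: linear_cmul[OF lin])
    then show ?thesis using 1 vector_derivative_unique_at by blast
  qed
  then have "T = (\<lambda>y. (snd y, - (dGam c a (fst y) v v + Gam c a (snd y) v + Gam c a v (snd y))))" by (rule ext)
  with T show ?thesis by simp
qed

end

context complete_mfd
begin

text \<open>The variation field of the geodesics in the direction \<open>\<xi>\<close>: the Jacobi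
  field vanishing at time 0 with covariant derivative \<open>\<xi>\<close> there. At time 1 it is
  the differential of \<open>exp\<close> at \<open>w\<close> applied to
  \<open>\<xi>\<close>.\<close>

definition Jac :: "'m \<Rightarrow> ('m, 'n) chart \<Rightarrow> real ^ 'n \<Rightarrow> real ^ 'n \<Rightarrow> real \<Rightarrow> ('m, 'n) tvec" where
  "Jac x0 c0 w \<xi> t = (\<lambda>c. if c \<in> charts_at M (Phi x0 c0 w t)
      then frechet_derivative (\<lambda>w. coord c (Phi x0 c0 w t)) (at w) \<xi> else 0)"

definition Jac_sq :: "'m \<Rightarrow> ('m, 'n) chart \<Rightarrow> real ^ 'n \<Rightarrow> real ^ 'n \<Rightarrow> real \<Rightarrow> real" where
  "Jac_sq x0 c0 w \<xi> t = tinner M (Phi x0 c0 w t) (Jac x0 c0 w \<xi> t) (Jac x0 c0 w \<xi> t)"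

context
  fixes x0 c0 assumes c0: "c0 \<in> charts_at M x0"
begin

lemma reg_at:
  assumes "0 \<le> t" "c \<in> charts_at M (Phi x0 c0 w t)"
  shows "reg x0 c0 c w t"
  using reg_all[OF c0 assms(1), of w] reg_change[OF c0 _ _ assms(2)] by blast

lemma Phi_isCont:
  assumes "0 \<le> t" shows "isCont (\<lambda>w. Phi x0 c0 w t) w"
proof -
  obtain c where c: "c \<in> charts_at M (Phi x0 c0 w t)" using ex_chart by blast
  note ca = charts_atD(1)[OF c]
  obtain e where e: "e > 0" "\<And>w'. w' \<in> ball w e \<Longrightarrow> Phi x0 c0 w' t \<in> dom_of c"
    and C1: "C1_on (ball w e) (\<lambda>w. geoz c (Phi x0 c0 w) t)"
    using reg_at[OF assms c] unfolding reg_def by blast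
  have "continuous_on (ball w e) (\<lambda>w. coord_inv c (fst (geoz c (Phi x0 c0 w) t)))"
    by (rule continuous_on_compose2[OF cont_coord_inv[OF ca] continuous_on_fst[OF C1_on_imp_continuous_on[OF C1]]])
      (use e in \<open>auto simp: geoz_def\<close>)
  then have "continuous_on (ball w e) (\<lambda>w. Phi x0 c0 w t)"
    by (rule continuous_on_eq) (use e coord_inv_coord[OF ca] in \<open>simp add: geoz_def\<close>)
  then show ?thesis using e(1) by (simp add: continuous_on_eq_continuous_at)
qed

lemma coord_Phi_derivative:
  assumes "0 \<le> t" "c \<in> charts_at M (Phi x0 c0 w t)"
  shows "((\<lambda>w. coord c (Phi x0 c0 w t)) has_derivative (\<lambda>\<xi>. Jac x0 c0 w \<xi> t c)) (at w)"
proof -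
  obtain e where e: "e > 0" and C1: "C1_on (ball w e) (\<lambda>w. geoz c (Phi x0 c0 w) t)"
    using reg_at[OF assms] unfolding reg_def by blast
  have "C1_on (ball w e) (\<lambda>w. coord c (Phi x0 c0 w t))"
    using C1_on_fst[OF C1] unfolding geoz_def by simp
  from C1_on_frechet(1)[OF this] e show ?thesis unfolding Jac_def using assms(2) by simp
qed

lemma Jac_tangent:
  assumes "0 \<le> t" shows "Jac x0 c0 w \<xi> t \<in> tangent_space M (Phi x0 c0 w t)"
proof (rule tangent_spaceI)
  fix c c' assume c: "c \<in> charts_at M (Phi x0 c0 w t)" "c' \<in> charts_at M (Phi x0 c0 w t)"
  have "((\<lambda>w. coord c' (Phi x0 c0 w t)) has_derivative (\<lambda>h. transition_deriv c c' (Phi x0 c0 w t) (Jac x0 c0 w h t c))) (at w)"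
    by (rule chart_change[where f = "\<lambda>w. Phi x0 c0 w t" and z = w and S = UNIV, OF c UNIV_I Phi_isCont[OF assms] coord_Phi_derivative[OF assms c(1)]])
  from has_derivative_unique[OF coord_Phi_derivative[OF assms c(2)] this]
  show "Jac x0 c0 w \<xi> t c' = transition_deriv c c' (Phi x0 c0 w t) (Jac x0 c0 w \<xi> t c)" by metis
qed (simp add: Jac_def)

lemma Jac_sq_chart:
  assumes "0 \<le> t" "c \<in> charts_at M (Phi x0 c0 w t)"
  shows "Jac_sq x0 c0 w \<xi> t = gip c (coord c (Phi x0 c0 w t)) (Jac x0 c0 w \<xi> t c) (Jac x0 c0 w \<xi> t c)"
  unfolding Jac_sq_def by (rule tinner_chart[OF Jac_tangent[OF assms(1)] Jac_tangent[OF assms(1)] assms(2)])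

lemma Jac_sq_nonneg: "0 \<le> t \<Longrightarrow> 0 \<le> Jac_sq x0 c0 w \<xi> t"
  unfolding Jac_sq_chart[OF _ some_chart]
  using gip_nonneg[OF charts_atD(1)[OF some_chart]] charts_atD(2)[OF some_chart] by blast

section \<open>The Jacobi equation on a time interval inside one chart\<close>

context
  fixes c w a b e D \<xi> J K
  assumes s: "sreg x0 c0 c w a b e D" and a0: "0 \<le> a"
    and J_def: "J = (\<lambda>t. fst (blinfun_apply (D t w) \<xi>))" and K_def: "K = (\<lambda>t. snd (blinfun_apply (D t w) \<xi>))"
    and cat: "c \<in> atlas M"
begin

abbreviation (input) "X t \<equiv> coord c (Phi x0 c0 w t)"
abbreviation (input) "V t \<equiv> cvel c (Phi x0 c0 w) t"
abbreviation (input) "P t \<equiv> K t + Gam c (X t) (V t) (J t)"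

lemma sreg_chart: "t \<in> {a..b} \<Longrightarrow> c \<in> charts_at M (Phi x0 c0 w t)"
  using s cat unfolding sreg_def by (intro charts_atI) auto

lemma Jac_J: "t \<in> {a..b} \<Longrightarrow> Jac x0 c0 w \<xi> t c = J t"
proof -
  assume t: "t \<in> {a..b}"
  have "((\<lambda>w. geoz c (Phi x0 c0 w) t) has_derivative blinfun_apply (D t w)) (at w)"
    using s t unfolding sreg_def by auto
  from bounded_linear.has_derivative[OF bounded_linear_fst this]
  have "((\<lambda>w. coord c (Phi x0 c0 w t)) has_derivative (\<lambda>x. fst (blinfun_apply (D t w) x))) (at w)"
    unfolding geoz_def by simp
  from has_derivative_unique[OF coord_Phi_derivative[OF _ sreg_chart[OF t]] this] t a0
  show ?thesis unfolding J_def by (simp add: fun_eq_iff)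
qed

lemma X_derivative: "t \<in> {a..b} \<Longrightarrow> ((\<lambda>t. X t) has_vector_derivative V t) (at t within {a..b})"
  by (rule has_vector_derivative_at_within[OF geodesic_coord_derivative[OF Phi_props(1)[OF c0] sreg_chart]])

lemma V_derivative: "t \<in> {a..b} \<Longrightarrow> ((\<lambda>t. V t) has_vector_derivative - Gam c (X t) (V t) (V t)) (at t within {a..b})"
  by (rule has_vector_derivative_at_within[OF geodesic_cvel_derivative[OF Phi_props(1)[OF c0] sreg_chart]])

lemma JK_derivative:
  assumes t: "t \<in> {a..b}"
  shows "(J has_vector_derivative K t) (at t within {a..b})"
    and "(K has_vector_derivative - (dGam c (X t) (J t) (V t) (V t) + Gam c (X t) (K t) (V t) + Gam c (X t) (V t) (K t))) (at t within {a..b})"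
proof -
  have "w \<in> ball w e" using s unfolding sreg_def by simp
  then obtain A where A: "(geoF c has_derivative blinfun_apply A) (at (geoz c (Phi x0 c0 w) t))"
    and D: "((\<lambda>t. D t w) has_vector_derivative A o\<^sub>L D t w) (at t within {a..b})"
    using s t unfolding sreg_def by blast
  have "blinfun_apply A = (\<lambda>y. (snd y, - (dGam c (X t) (fst y) (V t) (V t) + Gam c (X t) (snd y) (V t) + Gam c (X t) (V t) (snd y))))"
    by (rule has_derivative_unique[OF A[unfolded geoz_def] geoF_has_derivative[OF cat]]) (use charts_atD(2)[OF sreg_chart[OF t]] in simp)
  then have "blinfun_apply (A o\<^sub>L D t w) \<xi> = (K t, - (dGam c (X t) (J t) (V t) (V t) + Gam c (X t) (K t) (V t) + Gam c (X t) (V t) (K t)))"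
    by (simp add: J_def K_def)
  with has_vector_derivative_blinfun_apply_left[OF D, of \<xi>]
  have y: "((\<lambda>t. blinfun_apply (D t w) \<xi>) has_vector_derivative (K t, - (dGam c (X t) (J t) (V t) (V t) + Gam c (X t) (K t) (V t) + Gam c (X t) (V t) (K t)))) (at t within {a..b})"
    by simp
  show "(J has_vector_derivative K t) (at t within {a..b})"
    using bounded_linear.has_vector_derivative[OF bounded_linear_fst y] unfolding J_def by simp
  show "(K has_vector_derivative - (dGam c (X t) (J t) (V t) (V t) + Gam c (X t) (K t) (V t) + Gam c (X t) (V t) (K t))) (at t within {a..b})"
    using bounded_linear.has_vector_derivative[OF bounded_linear_snd y] unfolding K_def by simp
qed

lemma JJ_derivative:
  assumes t: "t \<in> {a..b}"
  shows "((\<lambda>t. gip c (X t) (J t) (J t)) has_real_derivative 2 * gip c (X t) (P t) (J t)) (at t within {a..b})"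
proof -
  have m: "X t \<in> coord c ` dom_of c" using charts_atD(2)[OF sreg_chart[OF t]] by simp
  note J' = JK_derivative(1)[OF t]
  show ?thesis
    by (rule DERIV_cong[OF gip_has_real_derivative[where \<alpha> = "\<lambda>t. X t", OF cat m X_derivative[OF t] J' J']])
      (simp add: gip_sym[OF cat m, of "J t"])
qed

text \<open>\<open>P\<close> is the covariant derivative of the Jacobi field \<open>J\<close>, so this is the Jacobi equation paired
  with \<open>J\<close>.\<close>

lemma PJ_derivative:
  assumes t: "t \<in> {a..b}"
  shows "((\<lambda>t. gip c (X t) (P t) (J t)) has_real_derivative
     gip c (X t) (P t) (P t) - gip c (X t) (curv c (X t) (J t) (V t) (V t)) (J t)) (at t within {a..b})"
proof -
  have m: "X t \<in> coord c ` dom_of c" using charts_atD(2)[OF sreg_chart[OF t]] by simp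
  note J' = JK_derivative(1)[OF t] and K' = JK_derivative(2)[OF t]
  define Q where "Q = - (dGam c (X t) (J t) (V t) (V t) + Gam c (X t) (K t) (V t) + Gam c (X t) (V t) (K t))
      + (dGam c (X t) (V t) (V t) (J t) + Gam c (X t) (- Gam c (X t) (V t) (V t)) (J t) + Gam c (X t) (V t) (K t))"
  have P': "((\<lambda>t. P t) has_vector_derivative Q) (at t within {a..b})"
    unfolding Q_def by (rule has_vector_derivative_add[OF K' Gam_along_curve[where \<alpha> = "\<lambda>t. X t", OF cat m X_derivative[OF t] V_derivative[OF t] J']])
  have dsym: "dGam c (X t) k u v = dGam c (X t) k v u" for k u v
  proof -
    have "((\<lambda>a. Gam c a u v) has_derivative (\<lambda>k. dGam c (X t) k v u)) (at (X t))"
      by (rule has_derivative_transform_within_open[OF Gam_has_derivative[OF cat m] open_img[OF cat] m]) (rule Gam_sym[OF cat])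
    from has_derivative_unique[OF Gam_has_derivative[OF cat m] this] show ?thesis by metis
  qed
  \<comment> \<open>The second covariant derivative of \<open>J\<close> is minus the curvature term.
    The symmetry of \<open>Gam\<close> and \<open>dGam\<close> in their last two arguments lets the
    first-order terms cancel.\<close>
  have QR: "Q + Gam c (X t) (V t) (P t) = - curv c (X t) (J t) (V t) (V t)"
    unfolding Q_def curv_def Gam_linear dsym[of "V t" "V t" "J t"]
      Gam_sym[OF cat m, of "K t" "V t"] Gam_sym[OF cat m, of "Gam c (X t) (V t) (V t)" "J t"]
      Gam_sym[OF cat m, of "J t" "V t"]
    by (simp add: algebra_simps)
  show ?thesis
    by (rule DERIV_cong[OF gip_has_real_derivative[where \<alpha> = "\<lambda>t. X t", OF cat m X_derivative[OF t] P' J']])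
      (unfold QR gip_minus_left, rule uminus_add_conv_diff)
qed

end

text \<open>For h = |J|^2 one has h' = 2 <P,J>, and nonpositive curvature gives h'' \<ge> 2 |P|^2.
  Cauchy-Schwarz then yields h'^2 \<le> 2 h h'', the hypothesis of
  \<open>sqrt_le_linear_of_sqrt_convex\<close>. Stating it with \<open>deriv\<close> lets the
  computations in different charts fit together.\<close>

lemma Jac_sq_convexity:
  assumes np: "nonpositive_curvature M" and t: "0 < t"
  shows "\<exists>h2. (Jac_sq x0 c0 w \<xi> has_real_derivative deriv (Jac_sq x0 c0 w \<xi>) t) (at t) \<and>
    (deriv (Jac_sq x0 c0 w \<xi>) has_real_derivative h2) (at t) \<and>
    (deriv (Jac_sq x0 c0 w \<xi>) t)\<^sup>2 \<le> 2 * Jac_sq x0 c0 w \<xi> t * h2 \<and> 0 \<le> h2"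
proof -
  obtain c a b e D where c: "c \<in> charts_at M (Phi x0 c0 w t)" and s: "sreg x0 c0 c w a b e D" and ab: "0 \<le> a" "a < t" "t < b"
    using sreg_all[OF c0, of t w] t by (metis less_imp_le less_irrefl)
  note cat = charts_atD(1)[OF c]
  let ?J = "\<lambda>t. fst (blinfun_apply (D t w) \<xi>)" and ?K = "\<lambda>t. snd (blinfun_apply (D t w) \<xi>)"
  let ?X = "\<lambda>t. coord c (Phi x0 c0 w t)" and ?V = "\<lambda>t. cvel c (Phi x0 c0 w) t"
  let ?P = "\<lambda>t. ?K t + Gam c (?X t) (?V t) (?J t)"
  let ?h = "Jac_sq x0 c0 w \<xi>"
  note chart = sreg_chart[OF s ab(1) refl refl cat]
  have h: "?h s = gip c (?X s) (?J s) (?J s)" if "s \<in> {a..b}" for s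
    using Jac_sq_chart[OF _ chart[OF that]] Jac_J[OF s ab(1) refl refl cat that] that ab(1) by simp
  have d1: "(?h has_real_derivative 2 * gip c (?X s) (?P s) (?J s)) (at s)" if s': "s \<in> {a<..<b}" for s
  proof -
    have "((\<lambda>t. gip c (?X t) (?J t) (?J t)) has_real_derivative 2 * gip c (?X s) (?P s) (?J s)) (at s)"
      using JJ_derivative[OF s ab(1) refl refl cat, of s \<xi>] s' at_within_Icc_at[of a s b] by simp
    then show ?thesis
      by (rule has_field_derivative_transform_within_open[OF _ open_greaterThanLessThan s']) (use h in simp)
  qed
  have dh: "deriv ?h s = 2 * gip c (?X s) (?P s) (?J s)" if "s \<in> {a<..<b}" for s
    using DERIV_imp_deriv[OF d1[OF that]] .
  have tin: "t \<in> {a<..<b}" "t \<in> {a..b}" using ab by auto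
  have m: "?X t \<in> coord c ` dom_of c" using charts_atD(2)[OF c] by simp
  define h2 where "h2 = 2 * (gip c (?X t) (?P t) (?P t) - gip c (?X t) (curv c (?X t) (?J t) (?V t) (?V t)) (?J t))"
  have "((\<lambda>s. gip c (?X s) (?P s) (?J s)) has_real_derivative
     gip c (?X t) (?P t) (?P t) - gip c (?X t) (curv c (?X t) (?J t) (?V t) (?V t)) (?J t)) (at t)"
    using PJ_derivative[OF s ab(1) refl refl cat tin(2), of \<xi>] at_within_Icc_at[of a t b] ab by simp
  from DERIV_cmult[OF this, of 2]
  have "((\<lambda>s. 2 * gip c (?X s) (?P s) (?J s)) has_real_derivative h2) (at t)" unfolding h2_def .
  then have d2: "(deriv ?h has_real_derivative h2) (at t)"
    by (rule has_field_derivative_transform_within_open[OF _ open_greaterThanLessThan tin(1)]) (use dh in simp)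
  have h2ge: "2 * gip c (?X t) (?P t) (?P t) \<le> h2"
    unfolding h2_def using curv_nonpos[OF np c, of "?J t" "?V t"] by simp
  have PP: "0 \<le> gip c (?X t) (?P t) (?P t)" by (rule gip_nonneg[OF cat m])
  have "(deriv ?h t)\<^sup>2 = 4 * (gip c (?X t) (?P t) (?J t))\<^sup>2"
    unfolding dh[OF tin(1)] by (simp add: power_mult_distrib)
  also have "\<dots> \<le> 4 * (gip c (?X t) (?P t) (?P t) * gip c (?X t) (?J t) (?J t))"
    using gip_cauchy_schwarz[OF cat m] by (intro mult_left_mono) auto
  also have "\<dots> = 2 * ?h t * (2 * gip c (?X t) (?P t) (?P t))" unfolding h[OF tin(2)] by simp
  also have "\<dots> \<le> 2 * ?h t * h2"
    using h2ge Jac_sq_nonneg[of t w \<xi>] t by (intro mult_left_mono) auto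
  finally have "(deriv ?h t)\<^sup>2 \<le> 2 * ?h t * h2" .
  moreover have "(?h has_real_derivative deriv ?h t) (at t)" using d1[OF tin(1)] dh[OF tin(1)] by simp
  ultimately show ?thesis using d2 h2ge PP by (intro exI[of _ h2]) auto
qed

text \<open>At time 0 the position is \<open>x0\<close> for every initial velocity, and the velocity
  in the chart \<open>c\<close> depends linearly on \<open>w\<close>. Hence the variation starts at
  0 with derivative \<open>\<xi>\<close>, expressed in \<open>c\<close>.\<close>

lemma Jac_at_zero:
  obtains c b J K where "c \<in> charts_at M x0" "0 < b" "J 0 = 0" "K = lift_vec M c0 x0 \<xi> c"
    "(J has_vector_derivative K) (at 0 within {0..b})"
    "\<And>t. t \<in> {0..b} \<Longrightarrow> c \<in> charts_at M (Phi x0 c0 w t)"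
    "\<And>t. t \<in> {0..b} \<Longrightarrow> Jac x0 c0 w \<xi> t c = J t"
proof -
  obtain c a b e D where c: "c \<in> charts_at M (Phi x0 c0 w 0)" and s: "sreg x0 c0 c w a b e D" and ab: "0 \<le> a" "a \<le> 0" "0 < b"
    using sreg_all[OF c0, of 0 w] by (metis order_refl)
  then have [simp]: "a = 0" by simp
  have cx: "c \<in> charts_at M x0" using c Phi_props(2)[OF c0] by simp
  note cat = charts_atD(1)[OF c]
  have 0: "0 \<in> {a..b}" using ab by simp
  have g0: "geoz c (Phi x0 c0 v) 0 = (coord c x0, transition_deriv c0 c x0 v)" for v
    using velocity_chart[of c "Phi x0 c0 v" 0] Phi_props[OF c0, of v] cx
    unfolding geoz_def by (simp add: lift_vec_def)
  have "((\<lambda>v. geoz c (Phi x0 c0 v) 0) has_derivative (\<lambda>v. (0, transition_deriv c0 c x0 v))) (at w)"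
    unfolding g0
    by (intro has_derivative_Pair has_derivative_const bounded_linear_imp_has_derivative transition_bounded_linear c0 cx)
  moreover have "((\<lambda>w. geoz c (Phi x0 c0 w) 0) has_derivative blinfun_apply (D 0 w)) (at w)"
    using s 0 unfolding sreg_def by auto
  ultimately have D0: "blinfun_apply (D 0 w) = (\<lambda>v. (0, transition_deriv c0 c x0 v))"
    by (metis has_derivative_unique)
  show thesis
  proof (rule that[OF cx ab(3), of "\<lambda>t. fst (blinfun_apply (D t w) \<xi>)" "snd (blinfun_apply (D 0 w) \<xi>)"])
    show "((\<lambda>t. fst (blinfun_apply (D t w) \<xi>)) has_vector_derivative snd (blinfun_apply (D 0 w) \<xi>)) (at 0 within {0..b})"
      using JK_derivative(1)[OF s ab(1) refl refl cat 0, of \<xi>] by simp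
    show "t \<in> {0..b} \<Longrightarrow> c \<in> charts_at M (Phi x0 c0 w t)" for t using sreg_chart[OF s ab(1) refl refl cat, of t] by simp
    show "t \<in> {0..b} \<Longrightarrow> Jac x0 c0 w \<xi> t c = fst (blinfun_apply (D t w) \<xi>)" for t
      using Jac_J[OF s ab(1) refl refl cat, of t \<xi>] by simp
  qed (simp_all add: D0 lift_vec_def cx)
qed

text \<open>\<open>J t / t\<close> tends to the derivative of \<open>J\<close> at 0, whose length is
  computed in the chart \<open>c\<close> and moved to \<open>c0\<close> by invariance of the
  metric.\<close>

lemma Jac_sq_quotient_tendsto:
  "((\<lambda>t. Jac_sq x0 c0 w \<xi> t / t\<^sup>2) \<longlongrightarrow> gip c0 (coord c0 x0) \<xi> \<xi>) (at_right 0)"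
proof -
  obtain c b J K where c: "c \<in> charts_at M x0" and b: "0 < b" and J0: "J 0 = 0" and K: "K = lift_vec M c0 x0 \<xi> c"
    and J': "(J has_vector_derivative K) (at 0 within {0..b})"
    and ch: "\<And>t. t \<in> {0..b} \<Longrightarrow> c \<in> charts_at M (Phi x0 c0 w t)"
    and Jac: "\<And>t. t \<in> {0..b} \<Longrightarrow> Jac x0 c0 w \<xi> t c = J t"
    using Jac_at_zero by metis
  have m: "c \<in> atlas M" "coord c x0 \<in> coord c ` dom_of c" using charts_atD[OF c] by auto
  have right: "at_right 0 = at 0 within {0..b}"
    using at_within_Icc_at_right[OF b] by simp
  have "((\<lambda>t. (J t - J 0) /\<^sub>R (t - 0)) \<longlongrightarrow> K) (at 0 within {0..b})"
  proof (rule Lim_transform_eventually)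
    have "((\<lambda>t. (1 / norm (t - 0)) *\<^sub>R (J t - (J 0 + (t - 0) *\<^sub>R K))) \<longlongrightarrow> 0) (at 0 within {0..b})"
      using J' unfolding has_vector_derivative_def has_derivative_within by blast
    from tendsto_add[OF this tendsto_const[of K]]
    show "((\<lambda>t. (1 / norm (t - 0)) *\<^sub>R (J t - (J 0 + (t - 0) *\<^sub>R K)) + K) \<longlongrightarrow> K) (at 0 within {0..b})" by simp
    show "\<forall>\<^sub>F t in at 0 within {0..b}. (1 / norm (t - 0)) *\<^sub>R (J t - (J 0 + (t - 0) *\<^sub>R K)) + K = (J t - J 0) /\<^sub>R (t - 0)"
      unfolding right[symmetric] eventually_at_right_field
      by (intro exI[of _ 1]) (auto simp: scaleR_diff_right scaleR_add_right divide_inverse_commute)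
  qed
  then have Jq: "((\<lambda>t. J t /\<^sub>R t) \<longlongrightarrow> K) (at 0 within {0..b})" by (simp add: J0)
  have "isCont (gmat c) (coord c x0)" using gmat_has_derivative[OF m] has_derivative_continuous by blast
  moreover have "((\<lambda>t. coord c (Phi x0 c0 w t)) \<longlongrightarrow> coord c x0) (at 0 within {0..b})"
  proof -
    have "isCont (\<lambda>t. coord c (Phi x0 c0 w t)) 0"
      using has_vector_derivative_continuous[OF geodesic_coord_derivative[OF Phi_props(1)[OF c0], of c w 0]] c Phi_props(2)[OF c0] by simp
    then show ?thesis using Phi_props(2)[OF c0] unfolding isCont_def by (metis tendsto_within_subset subset_UNIV)
  qed
  ultimately have gm: "((\<lambda>t. gmat c (coord c (Phi x0 c0 w t))) \<longlongrightarrow> gmat c (coord c x0)) (at 0 within {0..b})"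
    by (rule isCont_tendsto_compose)
  have "((\<lambda>t. gip c (coord c (Phi x0 c0 w t)) (J t /\<^sub>R t) (J t /\<^sub>R t)) \<longlongrightarrow> gip c (coord c x0) K K) (at 0 within {0..b})"
    unfolding gip_gmat by (intro tendsto_inner Jq bounded_bilinear.tendsto[OF bounded_bilinear_matrix_vector gm Jq])
  moreover have "gip c (coord c x0) K K = gip c0 (coord c0 x0) \<xi> \<xi>"
    using tinner_chart[OF lift_vec_tangent[OF c0] lift_vec_tangent[OF c0] c, of \<xi> \<xi>]
      tinner_chart[OF lift_vec_tangent[OF c0] lift_vec_tangent[OF c0] c0, of \<xi> \<xi>]
    unfolding K lift_vec_apply[OF c0] by simp
  ultimately have "((\<lambda>t. gip c (coord c (Phi x0 c0 w t)) (J t /\<^sub>R t) (J t /\<^sub>R t)) \<longlongrightarrow> gip c0 (coord c0 x0) \<xi> \<xi>) (at_right 0)"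
    unfolding right by simp
  then show ?thesis
  proof (rule Lim_transform_eventually)
    show "\<forall>\<^sub>F t in at_right 0. gip c (coord c (Phi x0 c0 w t)) (J t /\<^sub>R t) (J t /\<^sub>R t) = Jac_sq x0 c0 w \<xi> t / t\<^sup>2"
      unfolding eventually_at_right_field
    proof (intro exI[of _ b] conjI allI impI)
      fix t :: real assume t: "0 < t" "t < b"
      show "gip c (coord c (Phi x0 c0 w t)) (J t /\<^sub>R t) (J t /\<^sub>R t) = Jac_sq x0 c0 w \<xi> t / t\<^sup>2"
        using Jac_sq_chart[OF _ ch, of t \<xi>] Jac[of t] t by (simp add: gip_linear power2_eq_square field_simps)
    qed (rule b)
  qed
qed

lemma Jac_contract:
  assumes np: "nonpositive_curvature M" and l: "0 < l" "l \<le> 1"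
  shows "sqrt (Jac_sq x0 c0 w \<xi> l) \<le> l * sqrt (Jac_sq x0 c0 w \<xi> 1)"
proof -
  let ?h = "Jac_sq x0 c0 w \<xi>"
  have h2: "(?h has_real_derivative deriv ?h t) (at t) \<and> (deriv ?h has_real_derivative deriv (deriv ?h) t) (at t) \<and>
    (deriv ?h t)\<^sup>2 \<le> 2 * ?h t * deriv (deriv ?h) t \<and> 0 \<le> deriv (deriv ?h) t" if t: "0 < t" for t
  proof -
    obtain h2 where *: "(?h has_real_derivative deriv ?h t) (at t)" "(deriv ?h has_real_derivative h2) (at t)"
      "(deriv ?h t)\<^sup>2 \<le> 2 * ?h t * h2" "0 \<le> h2"
      using Jac_sq_convexity[OF np t] by blast
    show ?thesis unfolding DERIV_imp_deriv[OF *(2)] using * by simp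
  qed
  have "((\<lambda>t. Jac_sq x0 c0 w \<xi> t / t\<^sup>2 * t\<^sup>2) \<longlongrightarrow> gip c0 (coord c0 x0) \<xi> \<xi> * 0\<^sup>2) (at_right 0)"
    by (intro tendsto_mult Jac_sq_quotient_tendsto tendsto_power tendsto_ident_at)
  then have "((\<lambda>t. Jac_sq x0 c0 w \<xi> t / t\<^sup>2 * t\<^sup>2) \<longlongrightarrow> 0) (at_right 0)" by simp
  then have lim: "(Jac_sq x0 c0 w \<xi> \<longlongrightarrow> 0) (at_right 0)"
    by (rule Lim_transform_eventually) (unfold eventually_at_right_field, intro exI[of _ 1], simp)
  show ?thesis
    by (rule sqrt_le_linear_of_sqrt_convex[OF _ _ _ _ _ lim l]) (use h2 Jac_sq_nonneg in auto)
qed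

text \<open>By \<open>Jac_contract\<close> the quotient |J(t)|^2 / t^2 is at most |J(1)|^2 for
  \<open>t\<close> below 1; let \<open>t\<close> tend to 0.\<close>

lemma Jac_expand:
  assumes np: "nonpositive_curvature M"
  shows "gip c0 (coord c0 x0) \<xi> \<xi> \<le> Jac_sq x0 c0 w \<xi> 1"
proof (rule tendsto_le[OF _ tendsto_const Jac_sq_quotient_tendsto])
  show "\<forall>\<^sub>F t in at_right 0. Jac_sq x0 c0 w \<xi> t / t\<^sup>2 \<le> Jac_sq x0 c0 w \<xi> 1"
    unfolding eventually_at_right_field
  proof (intro exI[of _ 1] conjI allI impI)
    fix t :: real assume t: "0 < t" "t < 1"
    have "(sqrt (Jac_sq x0 c0 w \<xi> t))\<^sup>2 \<le> (t * sqrt (Jac_sq x0 c0 w \<xi> 1))\<^sup>2"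
      using Jac_contract[OF np, of t w \<xi>] t Jac_sq_nonneg[of t w \<xi>] by (intro power_mono) auto
    then have "Jac_sq x0 c0 w \<xi> t \<le> t\<^sup>2 * Jac_sq x0 c0 w \<xi> 1"
      using Jac_sq_nonneg[of t w \<xi>] Jac_sq_nonneg[of 1 w \<xi>] t by (simp add: power_mult_distrib)
    then show "Jac_sq x0 c0 w \<xi> t / t\<^sup>2 \<le> Jac_sq x0 c0 w \<xi> 1" using t by (simp add: pos_divide_le_eq mult.commute)
  qed simp
qed simp

end

end

section \<open>Local sections of expanding maps\<close>

text \<open>The set where the lifts agree is closed by continuity and open by local injectivity of
  \<open>E\<close> along \<open>g1\<close>.\<close>

lemma lift_unique:
  fixes g1 g2 :: "'t::topological_space \<Rightarrow> 'a::metric_space"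
  assumes T: "connected T" and g: "continuous_on T g1" "continuous_on T g2"
    and eq: "\<And>t. t \<in> T \<Longrightarrow> E (g1 t) = E (g2 t)"
    and inj: "\<And>t. t \<in> T \<Longrightarrow> \<exists>N. open N \<and> g1 t \<in> N \<and> inj_on E N"
    and t0: "t0 \<in> T" "g1 t0 = g2 t0" and t: "t \<in> T"
  shows "g1 t = g2 t"
proof -
  define A where "A = {t \<in> T. dist (g1 t) (g2 t) = 0}"
  have "closedin (top_of_set T) A"
    unfolding A_def by (intro continuous_closedin_preimage_constant continuous_on_dist g)
  moreover have "openin (top_of_set T) A"
  proof (subst openin_subopen, intro ballI)
    fix t assume "t \<in> A"
    then have t: "t \<in> T" "g1 t = g2 t" by (simp_all add: A_def)
    obtain N where N: "open N" "g1 t \<in> N" "inj_on E N" using inj[OF t(1)] by blast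
    have "openin (top_of_set T) ((T \<inter> g1 -` N) \<inter> (T \<inter> g2 -` N))"
      by (intro openin_Int continuous_openin_preimage_gen g N(1))
    moreover have "t \<in> (T \<inter> g1 -` N) \<inter> (T \<inter> g2 -` N)" using t N(2) by simp
    moreover have "(T \<inter> g1 -` N) \<inter> (T \<inter> g2 -` N) \<subseteq> A"
      unfolding A_def using inj_onD[OF N(3) eq] by auto
    ultimately show "\<exists>S. openin (top_of_set T) S \<and> t \<in> S \<and> S \<subseteq> A" by (intro exI conjI)
  qed
  moreover have "t0 \<in> A" using t0 by (simp add: A_def)
  ultimately have "A = T" using T unfolding connected_clopen by blast
  with t have "t \<in> A" by simp
  then show ?thesis by (simp add: A_def)
qed

lemma C1_locally_injective:
  fixes f :: "'a::euclidean_space \<Rightarrow> 'a"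
  assumes V: "open V" and der: "\<And>x. x \<in> V \<Longrightarrow> (f has_derivative blinfun_apply (f' x)) (at x)"
    and cf': "continuous_on V f'" and w: "w \<in> V" and inj: "\<And>\<xi>. blinfun_apply (f' w) \<xi> = 0 \<Longrightarrow> \<xi> = 0"
  obtains r where "r > 0" "ball w r \<subseteq> V" "inj_on f (ball w r)"
proof -
  have lin: "linear (blinfun_apply (f' w))" by (rule bounded_linear.linear[OF blinfun.bounded_linear_right])
  have "inj (blinfun_apply (f' w))"
    using inj linear_injective_0[OF lin] by blast
  from linear_injective_left_inverse[OF lin this]
  obtain g' where g': "linear g'" "g' \<circ> blinfun_apply (f' w) = id" by blast
  show thesis
  proof (rule has_derivative_locally_injective[where f' = "\<lambda>x. blinfun_apply (f' x)", OF w V _ g'(2) der])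
    show "bounded_linear g'" using g'(1) linear_conv_bounded_linear by blast
    fix e :: real assume e: "e > 0"
    have "isCont f' w" using cf' V w continuous_on_eq_continuous_at by blast
    then obtain d where d: "d > 0" "\<And>x. dist x w < d \<Longrightarrow> dist (f' x) (f' w) < e"
      unfolding continuous_at_eps_delta using e by blast
    show "\<exists>d>0. \<forall>x. dist w x < d \<longrightarrow> onorm (\<lambda>v. blinfun_apply (f' x) v - blinfun_apply (f' w) v) < e"
    proof (intro exI[of _ d] conjI allI impI)
      fix x assume "dist w x < d"
      then have "dist x w < d" by (simp add: dist_commute)
      from d(2)[OF this] have "norm (f' x - f' w) < e" unfolding dist_norm .
      then show "onorm (\<lambda>v. blinfun_apply (f' x) v - blinfun_apply (f' w) v) < e"
        unfolding norm_blinfun.rep_eq minus_blinfun.rep_eq .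
    qed (rule d(1))
  qed (use that in blast)+
qed

lemma tendsto_dist_transform:
  fixes k a :: "'n \<Rightarrow> 'a::metric_space"
  assumes "(k \<longlongrightarrow> x) F" "((\<lambda>n. dist (k n) (a n)) \<longlongrightarrow> 0) F"
  shows "(a \<longlongrightarrow> x) F"
proof -
  have "((\<lambda>n. dist (k n) (a n) + dist (k n) x) \<longlongrightarrow> 0 + 0) F"
    by (intro tendsto_add assms(2) assms(1)[unfolded tendsto_dist_iff[of k]])
  then have *: "((\<lambda>n. dist (k n) (a n) + dist (k n) x) \<longlongrightarrow> 0) F" by simp
  show ?thesis
    unfolding tendsto_dist_iff[of a]
    by (rule tendsto_sandwich[OF _ _ tendsto_const *]) (simp_all add: always_eventually dist_triangle3)
qed

text \<open>If every neighbourhood failed, there would be distinct points \<open>a n\<close>,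
  \<open>b n\<close> with equal images, approaching \<open>K\<close>. Limits of subsequences lie in
  \<open>K\<close> and have equal images, hence coincide, which contradicts injectivity near the
  limit.\<close>

lemma inj_on_compact_neighbourhood:
  fixes f :: "'a::euclidean_space \<Rightarrow> 'b::metric_space"
  assumes K: "compact K" "K \<subseteq> V" and V: "open V" "continuous_on V f" and inj: "inj_on f K"
    and loc: "\<And>x. x \<in> K \<Longrightarrow> \<exists>r>0. inj_on f (ball x r)"
  obtains N where "open N" "K \<subseteq> N" "N \<subseteq> V" "inj_on f N"
proof -
  obtain e0 where e0: "e0 > 0" "(\<Union>x\<in>K. ball x e0) \<subseteq> V"
    using compact_subset_open_imp_ball_epsilon_subset[OF K(1) V(1) K(2)] by blast
  define U where "U n = (\<Union>x\<in>K. ball x (e0 / Suc n))" for n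
  have U: "open (U n)" "K \<subseteq> U n" "U n \<subseteq> V" for n
  proof -
    show "open (U n)" unfolding U_def by (intro open_UN ballI open_ball)
    show "K \<subseteq> U n"
    proof
      fix x assume "x \<in> K"
      then show "x \<in> U n" unfolding U_def using e0(1) by (intro UN_I[of x]) simp_all
    qed
    have "e0 / Suc n \<le> e0" using e0(1) by (simp add: field_simps)
    then have "U n \<subseteq> (\<Union>x\<in>K. ball x e0)" unfolding U_def by (intro UN_mono subset_refl subset_ball)
    then show "U n \<subseteq> V" using e0(2) by (rule order_trans)
  qed
  have "\<exists>n. inj_on f (U n)"
  proof (rule ccontr)
    assume no: "\<nexists>n. inj_on f (U n)"
    have "\<exists>a b. a \<in> U n \<and> b \<in> U n \<and> f a = f b \<and> a \<noteq> b" for n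
      using no unfolding inj_on_def by metis
    then obtain a b where ab: "\<And>n. a n \<in> U n" "\<And>n. b n \<in> U n" "\<And>n. f (a n) = f (b n)" "\<And>n. a n \<noteq> b n"
      by metis
    have "\<exists>k l. k \<in> K \<and> l \<in> K \<and> dist k (a n) < e0 / Suc n \<and> dist l (b n) < e0 / Suc n" for n
      using ab(1)[of n] ab(2)[of n] unfolding U_def by auto
    then obtain k l where kl: "\<And>n. k n \<in> K" "\<And>n. l n \<in> K" "\<And>n. dist (k n) (a n) < e0 / Suc n" "\<And>n. dist (l n) (b n) < e0 / Suc n"
      by metis
    have "seq_compact (K \<times> K)" by (intro compact_imp_seq_compact compact_Times K(1))
    moreover have "\<forall>n. (k n, l n) \<in> K \<times> K" using kl by simp
    ultimately obtain p r where p: "p \<in> K \<times> K" and r: "strict_mono r" and lim: "((\<lambda>n. (k n, l n)) \<circ> r) \<longlonglongrightarrow> p"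
      by (rule seq_compactE)
    define x y where "x = fst p" and "y = snd p"
    have xy: "x \<in> K" "y \<in> K" using p by (auto simp: x_def y_def)
    have kx: "(\<lambda>n. k (r n)) \<longlonglongrightarrow> x" and ly: "(\<lambda>n. l (r n)) \<longlonglongrightarrow> y"
      using tendsto_fst[OF lim] tendsto_snd[OF lim] by (simp_all add: o_def x_def y_def)
    have z: "(\<lambda>n. e0 / Suc n) \<longlonglongrightarrow> 0"
      using tendsto_mult[OF tendsto_const[of e0] LIMSEQ_inverse_real_of_nat] by (simp add: divide_inverse)
    have zr: "(\<lambda>n. e0 / Suc (r n)) \<longlonglongrightarrow> 0" using LIMSEQ_subseq_LIMSEQ[OF z r] by (simp add: o_def)
    have "(\<lambda>n. dist (k (r n)) (a (r n))) \<longlonglongrightarrow> 0"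
      by (rule tendsto_sandwich[OF _ _ tendsto_const zr]) (intro always_eventually allI less_imp_le kl zero_le_dist)+
    then have ax: "(\<lambda>n. a (r n)) \<longlonglongrightarrow> x" by (rule tendsto_dist_transform[OF kx])
    have "(\<lambda>n. dist (l (r n)) (b (r n))) \<longlonglongrightarrow> 0"
      by (rule tendsto_sandwich[OF _ _ tendsto_const zr]) (intro always_eventually allI less_imp_le kl zero_le_dist)+
    then have bx: "(\<lambda>n. b (r n)) \<longlonglongrightarrow> y" by (rule tendsto_dist_transform[OF ly])
    have cont: "isCont f x" "isCont f y"
      using V(2)[unfolded continuous_on_eq_continuous_at[OF V(1)]] subsetD[OF K(2) xy(1)] subsetD[OF K(2) xy(2)] by auto
    have fa: "(\<lambda>n. f (a (r n))) \<longlonglongrightarrow> f x" by (rule isCont_tendsto_compose[OF cont(1) ax])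
    have fb: "(\<lambda>n. f (b (r n))) \<longlonglongrightarrow> f y" by (rule isCont_tendsto_compose[OF cont(2) bx])
    have "(\<lambda>n. f (a (r n))) = (\<lambda>n. f (b (r n)))" by (rule ext) (rule ab(3))
    then have "f x = f y" using fa fb LIMSEQ_unique by simp
    then have "x = y" by (rule inj_onD[OF inj _ xy])
    from loc[OF xy(1)] obtain \<rho> where \<rho>: "\<rho> > 0" "inj_on f (ball x \<rho>)" by (elim exE conjE)
    have "eventually (\<lambda>n. a (r n) \<in> ball x \<rho>) sequentially" "eventually (\<lambda>n. b (r n) \<in> ball x \<rho>) sequentially"
      using topological_tendstoD[OF ax open_ball, of x \<rho>] topological_tendstoD[OF bx open_ball, of x \<rho>] \<open>x = y\<close> \<rho>(1)
      by simp_all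
    then have "eventually (\<lambda>n. False) sequentially"
    proof eventually_elim
      case (elim n)
      then show ?case using inj_onD[OF \<rho>(2) ab(3)[of "r n"]] ab(4)[of "r n"] by simp
    qed
    then show False by simp
  qed
  then show thesis using U that by blast
qed

lemma ball_subset_UN_ball:
  fixes e :: "'a::real_normed_vector"
  assumes "0 \<le> t" "0 < d"
  shows "ball e (t + d) \<subseteq> (\<Union>x\<in>cball e t. ball x d)"
proof
  fix z assume z: "z \<in> ball e (t + d)"
  show "z \<in> (\<Union>x\<in>cball e t. ball x d)"
  proof (cases "norm (z - e) \<le> t")
    case True
    then show ?thesis using assms(2) by (intro UN_I[of z]) (auto simp: dist_norm norm_minus_commute)
  next
    case False
    \<comment> \<open>The radial projection of \<open>z\<close> to the sphere of radius
      \<open>t\<close>.\<close>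
    define x where "x = e + (t / norm (z - e)) *\<^sub>R (z - e)"
    have n: "norm (z - e) > 0" using False assms(1) by linarith
    have d1: "dist e x = t" unfolding x_def dist_norm using assms(1) n by simp
    have "z - x = (1 - t / norm (z - e)) *\<^sub>R (z - e)" by (simp add: x_def algebra_simps)
    then have "dist x z = \<bar>1 - t / norm (z - e)\<bar> * norm (z - e)" unfolding dist_norm norm_minus_commute[of x z] by simp
    moreover have "\<bar>1 - t / norm (z - e)\<bar> = 1 - t / norm (z - e)" using n False by simp
    moreover have "(1 - t / norm (z - e)) * norm (z - e) = norm (z - e) - t" using n by (simp add: left_diff_distrib)
    ultimately have "dist x z = norm (z - e) - t" by simp
    moreover have "norm (z - e) < t + d" using z by (simp add: dist_norm norm_minus_commute)
    ultimately show ?thesis using d1 by (intro UN_I[of x]) auto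
  qed
qed

text \<open>Induction on the radius: by \<open>exp\<close> a section over a ball is \<open>\<kappa>\<close>-Lipschitz, so it extends to the
  closed ball, whose image has a neighbourhood on which \<open>f\<close> is injective.\<close>

lemma expanding_map_section:
  fixes f :: "'a::euclidean_space \<Rightarrow> 'a"
  assumes V: "open V" and der: "\<And>x. x \<in> V \<Longrightarrow> (f has_derivative blinfun_apply (f' x)) (at x)"
    and cf': "continuous_on V f'" and w0: "w0 \<in> V" and R: "0 < R"
    and exp: "\<And>w \<xi>. w \<in> V \<Longrightarrow> f w \<in> ball (f w0) R \<Longrightarrow> norm \<xi> \<le> \<kappa> * norm (blinfun_apply (f' w) \<xi>)"
    and cl: "\<And>r. 0 \<le> r \<Longrightarrow> r < R \<Longrightarrow> closed {w \<in> V. f w \<in> cball (f w0) r}"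
  obtains s where "continuous_on (ball (f w0) R) s" "\<And>z. z \<in> ball (f w0) R \<Longrightarrow> s z \<in> V"
    "\<And>z. z \<in> ball (f w0) R \<Longrightarrow> f (s z) = z" "s (f w0) = w0"
proof -
  define e where "e = f w0"
  define sec where "sec r s \<longleftrightarrow> continuous_on (ball e r) s \<and> (\<forall>z\<in>ball e r. s z \<in> V \<and> f (s z) = z) \<and> s e = w0" for r s
  have cf: "continuous_on V f" using der by (meson continuous_at_imp_continuous_on has_derivative_continuous)
  have loc: "\<exists>r>0. ball w r \<subseteq> V \<and> inj_on f (ball w r)" if w: "w \<in> V" "f w \<in> ball e R" for w
  proof -
    have "\<xi> = 0" if "blinfun_apply (f' w) \<xi> = 0" for \<xi> using exp[OF w[unfolded e_def], of \<xi>] that by simp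
    from C1_locally_injective[OF V der cf' w(1) this] show ?thesis by metis
  qed
  \<comment> \<open>Balls are connected and all sections take the value \<open>w0\<close> at the
    centre, so sections over balls of different radii are compatible.\<close>
  have uniq: "s z = s' z" if s: "sec r s" "sec r' s'" and r: "r \<le> R" "r \<le> r'" and z: "z \<in> ball e r" for r r' s s' z
  proof (rule lift_unique[of "ball e r" s s' f e])
    show "connected (ball e r)" by simp
    show "continuous_on (ball e r) s" using s unfolding sec_def by blast
    have "ball e r \<subseteq> ball e r'" using r(2) by (rule subset_ball)
    then show "continuous_on (ball e r) s'" using s(2) unfolding sec_def by (meson continuous_on_subset)
    show "f (s t) = f (s' t)" if "t \<in> ball e r" for t using s that r(2) unfolding sec_def by simp
    show "\<exists>N. open N \<and> s t \<in> N \<and> inj_on f N" if t: "t \<in> ball e r" for t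
    proof -
      have "s t \<in> V" "f (s t) = t" using s(1) t unfolding sec_def by auto
      moreover have "t \<in> ball e R" using t r(1) by simp
      ultimately obtain \<rho> where "\<rho> > 0" "inj_on f (ball (s t) \<rho>)" using loc[of "s t"] by auto
      then show ?thesis by (intro exI[of _ "ball (s t) \<rho>"]) simp
    qed
    have "0 < r" using z by (metis ball_eq_empty empty_iff not_le)
    then show "e \<in> ball e r" by simp
    show "s e = s' e" using s unfolding sec_def by simp
  qed (rule z)
  have "\<exists>s. sec R s"
  proof (rule real_interval_induct[where P = "\<lambda>r. \<exists>s. sec r s" and a = 0 and b = R])
    show "\<exists>s. sec 0 s" unfolding sec_def by (intro exI[of _ "\<lambda>_. w0"]) simp
  next
    fix t assume t: "0 < t" "t \<le> R" and IH: "\<And>s. 0 \<le> s \<Longrightarrow> s < t \<Longrightarrow> \<exists>sa. sec s sa"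
    obtain S where S: "\<And>r. 0 \<le> r \<Longrightarrow> r < t \<Longrightarrow> sec r (S r)" using IH by metis
    \<comment> \<open>The radius halfway between \<open>dist e z\<close> and \<open>t\<close> gives
      a section defined at \<open>z\<close>; by uniqueness the choice of the radius does not affect
      the value.\<close>
    define s where "s z = S ((dist e z + t) / 2) z" for z
    have eq: "s z = S r z" if "z \<in> ball e r" "r < t" for z r
    proof -
      have "dist e z < r" using that(1) by simp
      moreover have "0 \<le> r" using calculation zero_le_dist[of e z] by linarith
      ultimately have zr: "dist e z < r" "0 \<le> r" by simp_all
      define q where "q = (dist e z + t) / 2"
      have "dist e z < t" using that(2) zr(1) by linarith
      then have q: "dist e z < q" "q < t" "0 \<le> q" using zero_le_dist[of e z] t(1) by (simp_all add: q_def)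
      show ?thesis
      proof (cases "q \<le> r")
        case True
        then show ?thesis unfolding s_def q_def[symmetric]
          using uniq[OF S[of q] S[of r]] q zr that t by simp
      next
        case False
        then show ?thesis unfolding s_def q_def[symmetric]
          using uniq[OF S[of r] S[of q]] q zr that t by simp
      qed
    qed
    have in': "\<exists>r. 0 \<le> r \<and> r < t \<and> z \<in> ball e r" if "z \<in> ball e t" for z
    proof -
      have "dist e z < t" using that by simp
      then show ?thesis using zero_le_dist[of e z] t(1)
        by (intro exI[of _ "(dist e z + t) / 2"]) (simp add: add_nonneg_nonneg)
    qed
    have "continuous_on (ball e t) s"
    proof (rule continuous_at_imp_continuous_on, intro ballI)
      fix z assume "z \<in> ball e t"
      from in'[OF this] obtain r where r: "0 \<le> r" "r < t" "z \<in> ball e r" by (elim exE conjE)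
      have "continuous_on (ball e r) (S r)" using S[OF r(1,2)] unfolding sec_def by (elim conjE)
      then have "continuous_on (ball e r) s" by (rule continuous_on_eq) (simp add: eq[OF _ r(2)])
      then show "isCont s z" using r(3) by (simp add: continuous_on_eq_continuous_at)
    qed
    moreover have "s z \<in> V \<and> f (s z) = z" if "z \<in> ball e t" for z
    proof -
      from in'[OF that] obtain r where r: "0 \<le> r" "r < t" "z \<in> ball e r" by (elim exE conjE)
      then show ?thesis using S[OF r(1,2)] eq[OF r(3,2)] unfolding sec_def by simp
    qed
    moreover have "s e = w0" using S[of "t/2"] t(1) unfolding s_def sec_def by simp
    ultimately show "\<exists>s. sec t s" unfolding sec_def by (intro exI[of _ s]) simp
  next
    fix t assume t: "0 \<le> t" "t < R" and IH: "\<And>s. 0 \<le> s \<Longrightarrow> s \<le> t \<Longrightarrow> \<exists>sa. sec s sa"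
    from IH[OF t(1) order_refl] obtain s where s: "sec t s" by (rule exE)
    have "\<exists>g. continuous_on (cball e t) g \<and> (\<forall>z\<in>cball e t. g z \<in> V \<and> f (g z) = z) \<and> g e = w0"
    proof (cases "t = 0")
      case True
      then show ?thesis using w0 by (intro exI[of _ "\<lambda>_. w0"]) (simp add: e_def)
    next
      case False
      then have t0: "0 < t" using t by simp
      have sV: "s z \<in> V" "f (s z) = z" "z \<in> ball e R" if "z \<in> ball e t" for z
        using s that t(2) unfolding sec_def by auto
      \<comment> \<open>A continuous section is differentiable with derivative the inverse of that
        of \<open>f\<close>, and \<open>exp\<close> bounds this inverse by
        \<open>\<kappa>\<close>.\<close>
      have der_s: "\<exists>s'. (s has_derivative s') (at z within ball e t) \<and> onorm s' \<le> \<kappa>" if z: "z \<in> ball e t" for z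
      proof -
        let ?A = "blinfun_apply (f' (s z))"
        have lin: "linear ?A" by (rule bounded_linear.linear[OF blinfun.bounded_linear_right])
        have low: "norm \<xi> \<le> \<kappa> * norm (?A \<xi>)" for \<xi> using exp[OF sV(1)[OF z]] sV(2,3)[OF z] unfolding e_def by simp
        have "inj ?A" unfolding linear_injective_0[OF lin] using low by (metis mult_zero_right norm_eq_zero norm_le_zero_iff)
        then obtain B where B: "linear B" "B \<circ> ?A = id" using linear_injective_left_inverse[OF lin] by blast
        have "surj ?A" using linear_injective_imp_surjective[OF lin \<open>inj ?A\<close>] by simp
        have "norm (B \<eta>) \<le> \<kappa> * norm \<eta>" for \<eta>
        proof -
          obtain \<xi> where \<xi>: "\<eta> = ?A \<xi>" using \<open>surj ?A\<close> by (meson surjD)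
          then have "B \<eta> = \<xi>" using fun_cong[OF B(2), of \<xi>] by simp
          then show ?thesis using low[of \<xi>] \<xi> by simp
        qed
        then have "onorm B \<le> \<kappa>" by (rule onorm_le)
        moreover have "(s has_derivative B) (at z)"
        proof (rule has_derivative_inverse_basic[OF der[OF sV(1)[OF z]] _ B(2) _ open_ball z sV(2)])
          show "bounded_linear B" using B(1) linear_conv_bounded_linear by blast
          show "isCont s z" using s z unfolding sec_def by (simp add: continuous_on_eq_continuous_at)
        qed
        ultimately show ?thesis using has_derivative_at_withinI by blast
      qed
      then obtain s' where s': "\<And>z. z \<in> ball e t \<Longrightarrow> (s has_derivative s' z) (at z within ball e t)"
        "\<And>z. z \<in> ball e t \<Longrightarrow> onorm (s' z) \<le> \<kappa>" by metis
      have lip: "norm (s x - s y) \<le> \<kappa> * norm (x - y)" if "x \<in> ball e t" "y \<in> ball e t" for x y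
        using differentiable_bound[OF convex_ball s' that] by blast
      have uc: "uniformly_continuous_on (ball e t) s"
        unfolding uniformly_continuous_on_def
      proof (intro allI impI)
        fix \<epsilon> :: real assume \<epsilon>: "0 < \<epsilon>"
        show "\<exists>d>0. \<forall>x\<in>ball e t. \<forall>x'\<in>ball e t. dist x' x < d \<longrightarrow> dist (s x') (s x) < \<epsilon>"
        proof (intro exI[of _ "\<epsilon> / (\<bar>\<kappa>\<bar> + 1)"] conjI ballI impI)
          fix x x' assume x: "x \<in> ball e t" "x' \<in> ball e t" "dist x' x < \<epsilon> / (\<bar>\<kappa>\<bar> + 1)"
          have "dist (s x') (s x) \<le> \<kappa> * norm (x' - x)" using lip[OF x(2,1)] by (simp add: dist_norm)
          also have "\<dots> \<le> (\<bar>\<kappa>\<bar> + 1) * dist x' x" unfolding dist_norm by (intro mult_right_mono) auto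
          also have "\<dots> < \<epsilon>" using x(3) by (simp add: pos_less_divide_eq mult.commute add_nonneg_pos)
          finally show "dist (s x') (s x) < \<epsilon>" .
        qed (use \<epsilon> in \<open>simp add: add_nonneg_pos\<close>)
      qed
      obtain g where g: "uniformly_continuous_on (closure (ball e t)) g" "\<And>x. x \<in> ball e t \<Longrightarrow> s x = g x"
        by (rule uniformly_continuous_on_extension_on_closure[OF uc]) (rule that; assumption)
      have clos: "closure (ball e t) = cball e t" using t0 by simp
      have cg: "continuous_on (closure (ball e t)) g" by (rule uniformly_continuous_imp_continuous[OF g(1)])
      \<comment> \<open>The hypothesis \<open>cl\<close> keeps the values on the boundary sphere
        inside \<open>V\<close>, where \<open>f\<close> may be applied.\<close>
      have C: "g ` closure (ball e t) \<subseteq> {w \<in> V. f w \<in> cball (f w0) t}"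
      proof (rule image_closure_subset[OF cg cl[OF t]])
        show "g ` ball e t \<subseteq> {w \<in> V. f w \<in> cball (f w0) t}"
          using sV(1,2) g(2) unfolding e_def by (auto simp: image_subset_iff less_imp_le)
      qed
      have "(\<lambda>z. f (g z) - z) ` closure (ball e t) \<subseteq> {0}"
      proof (rule image_closure_subset)
        show "continuous_on (closure (ball e t)) (\<lambda>z. f (g z) - z)"
          by (intro continuous_on_diff continuous_on_id continuous_on_compose2[OF cf cg]) (use C in blast)
        show "(\<lambda>z. f (g z) - z) ` ball e t \<subseteq> {0}" using sV(2) g(2) by (auto simp: image_subset_iff)
      qed simp
      then have "\<forall>z\<in>cball e t. f (g z) = z" unfolding clos by (auto simp: image_subset_iff)
      moreover have "\<forall>z\<in>cball e t. g z \<in> V" using C unfolding clos by blast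
      moreover have "g e = w0" using g(2)[of e] s t0 unfolding sec_def by simp
      ultimately show ?thesis using cg unfolding clos by blast
    qed
    then obtain g where g: "continuous_on (cball e t) g" "\<And>z. z \<in> cball e t \<Longrightarrow> g z \<in> V"
      "\<And>z. z \<in> cball e t \<Longrightarrow> f (g z) = z" "g e = w0" by blast
    obtain N where N: "open N" "g ` cball e t \<subseteq> N" "N \<subseteq> V" "inj_on f N"
    proof (rule inj_on_compact_neighbourhood[of "g ` cball e t" V f])
      show "compact (g ` cball e t)" by (intro compact_continuous_image g(1) compact_cball)
      show "g ` cball e t \<subseteq> V" using g(2) by blast
      show "inj_on f (g ` cball e t)" using g(3) by (intro inj_onI) auto
      show "\<exists>r>0. inj_on f (ball x r)" if x: "x \<in> g ` cball e t" for x
      proof -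
        from x obtain z where z: "x = g z" "z \<in> cball e t" by (rule imageE)
        have "z \<in> ball e R" using z(2) t(2) by simp
        then show ?thesis using loc[of x] g(2,3)[OF z(2)] z(1) by auto
      qed
    qed (use V cf in auto)
    have cfN: "continuous_on N f" using cf N(3) by (rule continuous_on_subset)
    \<comment> \<open>Invariance of domain: the image of \<open>N\<close> contains a slightly larger
      ball, over which the inverse of \<open>f\<close> on \<open>N\<close> is the next
      section.\<close>
    have "open (f ` N)" by (rule invariance_of_domain[OF cfN N(1,4)])
    moreover have "cball e t \<subseteq> f ` N"
    proof
      fix z assume "z \<in> cball e t"
      then show "z \<in> f ` N"
        by (intro image_eqI[of _ _ "g z"] subsetD[OF N(2)] imageI g(3)[symmetric])
    qed
    ultimately obtain d where d: "d > 0" "(\<Union>x\<in>cball e t. ball x d) \<subseteq> f ` N"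
      by (rule compact_subset_open_imp_ball_epsilon_subset[OF compact_cball]) (rule that; assumption)
    have bN: "ball e (t + d) \<subseteq> f ` N" using ball_subset_UN_ball[OF t(1) d(1)] d(2) by (rule order_trans)
    obtain h where h: "homeomorphism N (f ` N) f h"
      using invariance_of_domain_homeomorphism[OF N(1) cfN order_refl N(4)] by blast
    have hN: "h y \<in> N" "f (h y) = y" if "y \<in> f ` N" for y using homeomorphism_apply2[OF h that] homeomorphism_image2[OF h] that by blast+
    have w0N: "w0 \<in> N" using subsetD[OF N(2) imageI[of e]] g(4) t(1) by simp
    have "h e = w0" unfolding e_def by (rule homeomorphism_apply1[OF h w0N])
    have ch: "continuous_on (f ` N) h" by (rule homeomorphism_cont2[OF h])
    have "sec u h" if "t < u" "u < t + d" for u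
    proof -
      have sub: "ball e u \<subseteq> f ` N" using order_trans[OF subset_ball bN] that by simp
      have "h z \<in> V \<and> f (h z) = z" if "z \<in> ball e u" for z
        using hN[OF subsetD[OF sub that]] subsetD[OF N(3)] by simp
      then show ?thesis unfolding sec_def using \<open>h e = w0\<close> continuous_on_subset[OF ch sub] by simp
    qed
    then show "\<exists>ea>0. \<forall>s. t < s \<longrightarrow> s < t + ea \<longrightarrow> s \<le> R \<longrightarrow> (\<exists>sa. sec s sa)" using d(1) by blast
  qed (use R in auto)
  then obtain s where "sec R s" by blast
  then show thesis using that[of s] unfolding sec_def e_def by blast
qed

section \<open>The theorem of Cartan and Hadamard\<close>

lemma C1_on_local:
  fixes f :: "'a::euclidean_space \<Rightarrow> 'b::real_normed_vector"
  assumes "\<And>x. x \<in> S \<Longrightarrow> \<exists>e>0. C1_on (ball x e) f"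
  shows "C1_on S f"
proof (rule C1_onI)
  fix x assume "x \<in> S"
  then obtain e where "e > 0" "C1_on (ball x e) f" using assms by blast
  then show "(f has_derivative frechet_derivative f (at x)) (at x)" using C1_on_frechet(1) by (metis centre_in_ball)
next
  fix b :: 'a assume "b \<in> Basis"
  show "continuous_on S (\<lambda>x. frechet_derivative f (at x) b)"
  proof (rule continuous_at_imp_continuous_on, intro ballI)
    fix x assume "x \<in> S"
    then obtain e where e: "e > 0" "C1_on (ball x e) f" using assms by blast
    show "isCont (\<lambda>x. frechet_derivative f (at x) b) x"
      using C1_on_frechet(2)[OF e(2), of b] e(1) by (simp add: continuous_on_eq_continuous_at)
  qed
qed

context riem_mfd
begin

lemma gip_lower_bound:
  assumes "c \<in> atlas M" "a \<in> coord c ` dom_of c"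
  obtains m where "m > 0" "\<And>v. m * (norm v)\<^sup>2 \<le> gip c a v v"
proof -
  have cont: "continuous_on UNIV (\<lambda>v. gip c a v v)"
    unfolding gip_def by (intro continuous_on_inner continuous_on_id linear_continuous_on
        linear_conv_bounded_linear[THEN iffD1] matrix_vector_mul_linear)
  have ne: "sphere (0::real^'n) 1 \<noteq> {}" by simp
  obtain u where u: "u \<in> sphere 0 1" "\<And>v. v \<in> sphere 0 1 \<Longrightarrow> gip c a u u \<le> gip c a v v"
    using continuous_attains_inf[OF compact_sphere ne continuous_on_subset[OF cont subset_UNIV]] by blast
  show thesis
  proof
    have "u \<noteq> 0" using u(1) by auto
    then show "gip c a u u > 0" by (rule gip_pos[OF assms])
    fix v :: "real ^ 'n"
    show "gip c a u u * (norm v)\<^sup>2 \<le> gip c a v v"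
    proof (cases "v = 0")
      case False
      have "gip c a u u \<le> gip c a ((1 / norm v) *\<^sub>R v) ((1 / norm v) *\<^sub>R v)"
        by (rule u(2)) (use False in simp)
      also have "\<dots> = gip c a v v / (norm v)\<^sup>2" by (simp add: gip_linear power2_eq_square)
      finally show ?thesis using False by (simp add: pos_le_divide_eq)
    qed (simp add: gip_linear)
  qed
qed

lemma gip_upper_bound:
  assumes "c \<in> atlas M" "compact K" "K \<subseteq> coord c ` dom_of c"
  obtains C where "C > 0" "\<And>a v. a \<in> K \<Longrightarrow> gip c a v v \<le> C * (norm v)\<^sup>2"
proof -
  obtain B where B: "B > 0" "\<And>A v. norm ((A :: real^'n^'n) *v v) \<le> norm A * norm v * B"
    using bounded_bilinear.pos_bounded[OF bounded_bilinear_matrix_vector] by blast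
  have "bounded (gmat c ` K)"
    by (intro compact_imp_bounded compact_continuous_image assms(2)
        continuous_on_subset[OF C1_on_imp_continuous_on[OF gmat_C1[OF assms(1)]] assms(3)])
  then obtain G where G: "G > 0" "\<And>a. a \<in> K \<Longrightarrow> norm (gmat c a) \<le> G"
    unfolding bounded_pos by auto
  show thesis
  proof
    show "G * B > 0" using G B by simp
    fix a v assume a: "a \<in> K"
    have "gip c a v v \<le> norm v * norm (gmat c a *v v)" unfolding gip_gmat by (rule norm_cauchy_schwarz)
    also have "\<dots> \<le> norm v * (G * norm v * B)"
      by (intro mult_left_mono order_trans[OF B(2)] mult_right_mono G(2) a) (use B in auto)
    finally show "gip c a v v \<le> G * B * (norm v)\<^sup>2" by (simp add: power2_eq_square mult_ac)
  qed
qed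

end

locale hadamard = complete_mfd M for M :: "('m::{t2_space, second_countable_topology}, 'n::finite) riemannian" +
  assumes nonpos: "nonpositive_curvature M" and sc: "simply_connected (UNIV :: 'm set)"
begin

text \<open>\<open>exp\<close> at \<open>x0\<close>, with the tangent space replaced by
  \<open>real ^ 'n\<close> through \<open>c0\<close>.\<close>

definition Emap :: "'m \<Rightarrow> ('m, 'n) chart \<Rightarrow> real ^ 'n \<Rightarrow> 'm" where
  "Emap x0 c0 w = Phi x0 c0 w 1"

context
  fixes x0 c0 assumes c0: "c0 \<in> charts_at M x0"
begin

lemma Emap_continuous: "continuous_on S (Emap x0 c0)"
  unfolding Emap_def[abs_def] using Phi_isCont[OF c0, of 1] by (simp add: continuous_at_imp_continuous_on)

lemma Emap_0: "Emap x0 c0 0 = x0"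
  using Phi_scale[OF c0, of 0 0 1] Phi_props(2)[OF c0, of 0] by (simp add: Emap_def)

lemma open_Emap_dom: "c \<in> atlas M \<Longrightarrow> open {w. Emap x0 c0 w \<in> dom_of c}"
  using open_vimage[OF open_dom Emap_continuous] by (simp add: vimage_def)

lemma coord_Emap_C1: "c \<in> atlas M \<Longrightarrow> C1_on {w. Emap x0 c0 w \<in> dom_of c} (\<lambda>w. coord c (Emap x0 c0 w))"
proof (rule C1_on_local)
  fix w assume c: "c \<in> atlas M" and w: "w \<in> {w. Emap x0 c0 w \<in> dom_of c}"
  have "reg x0 c0 c w 1" by (rule reg_at[OF c0]) (use c w in \<open>auto intro!: charts_atI simp: Emap_def\<close>)
  then obtain e where "e > 0" "C1_on (ball w e) (\<lambda>w. geoz c (Phi x0 c0 w) 1)" unfolding reg_def by blast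
  then show "\<exists>e>0. C1_on (ball w e) (\<lambda>w. coord c (Emap x0 c0 w))"
    using C1_on_fst[of "ball w e" "\<lambda>w. geoz c (Phi x0 c0 w) 1"] unfolding geoz_def Emap_def by auto
qed

lemma coord_Emap_derivative:
  "c \<in> charts_at M (Emap x0 c0 w) \<Longrightarrow> ((\<lambda>w. coord c (Emap x0 c0 w)) has_derivative (\<lambda>\<xi>. Jac x0 c0 w \<xi> 1 c)) (at w)"
  unfolding Emap_def using coord_Phi_derivative[OF c0, of 1] by simp

lemma Emap_expand:
  assumes "c \<in> charts_at M (Emap x0 c0 w)"
  shows "gip c0 (coord c0 x0) \<xi> \<xi> \<le> gip c (coord c (Emap x0 c0 w)) (Jac x0 c0 w \<xi> 1 c) (Jac x0 c0 w \<xi> 1 c)"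
  using Jac_expand[OF c0 nonpos, of \<xi> w] Jac_sq_chart[OF c0 _ assms[unfolded Emap_def], of \<xi>] by (simp add: Emap_def)

text \<open>\<open>Emap_expand\<close> in Euclidean norms. The inner product at \<open>x0\<close> is
  bounded below by \<open>m\<close> and the metric on \<open>K\<close> above by \<open>C\<close>, so
  \<open>sqrt (C / m)\<close> works for all \<open>w\<close> mapped into \<open>K\<close>, wherever
  they lie.\<close>

lemma Jac_expand_norm:
  assumes c: "c \<in> atlas M" and K: "compact K" "K \<subseteq> coord c ` dom_of c"
  obtains \<kappa> where "\<And>w \<xi>. Emap x0 c0 w \<in> dom_of c \<Longrightarrow> coord c (Emap x0 c0 w) \<in> K \<Longrightarrow> norm \<xi> \<le> \<kappa> * norm (Jac x0 c0 w \<xi> 1 c)"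
proof -
  obtain m where m: "m > 0" "\<And>v. m * (norm v)\<^sup>2 \<le> gip c0 (coord c0 x0) v v"
    using gip_lower_bound[OF charts_atD(1)[OF c0], of "coord c0 x0"] charts_atD(2)[OF c0] by blast
  obtain C where C: "C > 0" "\<And>a v. a \<in> K \<Longrightarrow> gip c a v v \<le> C * (norm v)\<^sup>2"
    using gip_upper_bound[OF c K] by blast
  show thesis
  proof (rule that[of "sqrt (C / m)"])
    fix w \<xi> assume w: "Emap x0 c0 w \<in> dom_of c" "coord c (Emap x0 c0 w) \<in> K"
    let ?J = "Jac x0 c0 w \<xi> 1 c"
    have "m * (norm \<xi>)\<^sup>2 \<le> C * (norm ?J)\<^sup>2"
      using m(2)[of \<xi>] Emap_expand[OF charts_atI[OF c w(1)], of \<xi>] C(2)[OF w(2), of ?J] by linarith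
    then have "(norm \<xi>)\<^sup>2 \<le> C / m * (norm ?J)\<^sup>2" using m(1) by (simp add: field_simps)
    also have "\<dots> = (sqrt (C / m) * norm ?J)\<^sup>2" using m(1) C(1) by (simp add: power_mult_distrib)
    finally show "norm \<xi> \<le> sqrt (C / m) * norm ?J"
      by (rule power2_le_imp_le) (use m(1) C(1) in simp)
  qed
qed

lemma Emap_locally_injective: "\<exists>N. open N \<and> w \<in> N \<and> inj_on (Emap x0 c0) N"
proof -
  obtain c where c: "c \<in> charts_at M (Emap x0 c0 w)" using ex_chart by blast
  note ca = charts_atD(1)[OF c]
  let ?V = "{w. Emap x0 c0 w \<in> dom_of c}"
  have w: "w \<in> ?V" using charts_atD(2)[OF c] by simp
  obtain f' where f': "\<And>x. x \<in> ?V \<Longrightarrow> ((\<lambda>w. coord c (Emap x0 c0 w)) has_derivative blinfun_apply (f' x)) (at x)" "continuous_on ?V f'"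
    using C1_onE[OF coord_Emap_C1[OF ca]] by blast
  have eq: "blinfun_apply (f' w) = (\<lambda>\<xi>. Jac x0 c0 w \<xi> 1 c)"
    by (rule has_derivative_unique[OF f'(1)[OF w] coord_Emap_derivative[OF c]])
  have "\<xi> = 0" if "blinfun_apply (f' w) \<xi> = 0" for \<xi>
  proof (rule ccontr)
    assume "\<xi> \<noteq> 0"
    then have "0 < gip c0 (coord c0 x0) \<xi> \<xi>"
      using gip_pos[OF charts_atD(1)[OF c0], of "coord c0 x0" \<xi>] charts_atD(2)[OF c0] by blast
    then show False using Emap_expand[OF c, of \<xi>] that by (simp add: eq gip_linear)
  qed
  from C1_locally_injective[OF open_Emap_dom[OF ca] f' w this]
  obtain r where r: "r > 0" "inj_on (\<lambda>w. coord c (Emap x0 c0 w)) (ball w r)" by metis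
  have "inj_on (Emap x0 c0) (ball w r)"
  proof (rule inj_onI)
    fix a b assume ab: "a \<in> ball w r" "b \<in> ball w r" "Emap x0 c0 a = Emap x0 c0 b"
    show "a = b" by (rule inj_onD[OF r(2) _ ab(1,2)]) (simp add: ab(3))
  qed
  then show ?thesis using r(1) by (intro exI[of _ "ball w r"]) simp
qed

text \<open>\<open>U\<close> depends on \<open>y\<close> alone and serves all preimages
  \<open>w\<close> at once: the expansion constant is uniform over a compact coordinate ball, so the
  radius of the section does not shrink with \<open>w\<close>. This is what makes
  \<open>Emap\<close> a covering.\<close>

lemma Emap_section:
  "\<exists>U. open U \<and> y \<in> U \<and> (\<forall>w. Emap x0 c0 w \<in> U \<longrightarrow>
     (\<exists>\<sigma>. continuous_on U \<sigma> \<and> (\<forall>z\<in>U. Emap x0 c0 (\<sigma> z) = z) \<and> \<sigma> (Emap x0 c0 w) = w))"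
proof -
  obtain c where c: "c \<in> charts_at M y" using ex_chart by blast
  note ca = charts_atD(1)[OF c]
  define a0 where "a0 = coord c y"
  have "a0 \<in> coord c ` dom_of c" using charts_atD(2)[OF c] by (simp add: a0_def)
  then obtain r where r: "r > 0" "cball a0 r \<subseteq> coord c ` dom_of c"
    using open_img[OF ca] unfolding open_contains_cball by blast
  \<comment> \<open>For an image within \<open>\<rho>\<close> of \<open>a0\<close>, the ball of
    radius \<open>2 * \<rho>\<close> about it contains \<open>ball a0 \<rho>\<close> and stays
    inside the ball of radius \<open>r = 3 * \<rho>\<close>.\<close>
  define \<rho> where "\<rho> = r / 3"
  have \<rho>: "0 < \<rho>" "r = 3 * \<rho>" using r(1) by (simp_all add: \<rho>_def)
  define U where "U = dom_of c \<inter> coord c -` ball a0 \<rho>"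
  have "open U" unfolding U_def by (rule continuous_open_preimage[OF cont_coord[OF ca] open_dom[OF ca] open_ball])
  moreover have "y \<in> U" unfolding U_def using charts_atD(2)[OF c] \<rho>(1) by (simp add: a0_def)
  moreover have "\<exists>\<sigma>. continuous_on U \<sigma> \<and> (\<forall>z\<in>U. Emap x0 c0 (\<sigma> z) = z) \<and> \<sigma> (Emap x0 c0 w) = w" if w: "Emap x0 c0 w \<in> U" for w
  proof -
    let ?V = "{w. Emap x0 c0 w \<in> dom_of c}"
    let ?f = "\<lambda>w. coord c (Emap x0 c0 w)"
    obtain f' where f': "\<And>x. x \<in> ?V \<Longrightarrow> (?f has_derivative blinfun_apply (f' x)) (at x)" "continuous_on ?V f'"
      using C1_onE[OF coord_Emap_C1[OF ca]] by blast
    have wV: "w \<in> ?V" and we: "dist a0 (?f w) < \<rho>" using w unfolding U_def by auto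
    have sub: "cball (?f w) (2 * \<rho>) \<subseteq> cball a0 r"
    proof
      fix z assume "z \<in> cball (?f w) (2 * \<rho>)"
      then show "z \<in> cball a0 r" using we dist_triangle[of a0 z "?f w"] \<rho> by simp
    qed
    have subU: "ball a0 \<rho> \<subseteq> ball (?f w) (2 * \<rho>)"
    proof
      fix z assume "z \<in> ball a0 \<rho>"
      then show "z \<in> ball (?f w) (2 * \<rho>)" using we dist_triangle3[of "?f w" z a0] by simp
    qed
    obtain \<kappa> where \<kappa>: "\<And>w \<xi>. Emap x0 c0 w \<in> dom_of c \<Longrightarrow> coord c (Emap x0 c0 w) \<in> cball a0 r \<Longrightarrow> norm \<xi> \<le> \<kappa> * norm (Jac x0 c0 w \<xi> 1 c)"
      using Jac_expand_norm[OF ca compact_cball r(2)] by blast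
    obtain s where s: "continuous_on (ball (?f w) (2 * \<rho>)) s" "\<And>z. z \<in> ball (?f w) (2 * \<rho>) \<Longrightarrow> s z \<in> ?V"
      "\<And>z. z \<in> ball (?f w) (2 * \<rho>) \<Longrightarrow> ?f (s z) = z" "s (?f w) = w"
    proof (rule expanding_map_section[where f = ?f and V = ?V and f' = f' and ?w0.0 = w and R = "2 * \<rho>" and \<kappa> = \<kappa>])
      fix v \<xi> assume v: "v \<in> ?V" "?f v \<in> ball (?f w) (2 * \<rho>)"
      have "blinfun_apply (f' v) = (\<lambda>\<xi>. Jac x0 c0 v \<xi> 1 c)"
        by (rule has_derivative_unique[OF f'(1)[OF v(1)] coord_Emap_derivative[OF charts_atI[OF ca]]]) (use v in simp)
      moreover have "?f v \<in> cball a0 r" using sub v(2) by (meson ball_subset_cball subsetD)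
      ultimately show "norm \<xi> \<le> \<kappa> * norm (blinfun_apply (f' v) \<xi>)" using \<kappa>[of v \<xi>] v(1) by simp
    next
      fix q assume q: "0 \<le> q" "q < 2 * \<rho>"
      have sub': "cball (?f w) q \<subseteq> coord c ` dom_of c"
        using order_trans[OF subset_cball order_trans[OF sub r(2)]] q by simp
      \<comment> \<open>A compact set of the manifold has a closed preimage under
        \<open>Emap\<close>, which is defined on all of \<open>real ^ 'n\<close> by geodesic
        completeness.\<close>
      have "compact (coord_inv c ` cball (?f w) q)"
        by (intro compact_continuous_image continuous_on_subset[OF cont_coord_inv[OF ca] sub'] compact_cball)
      then have "closed (Emap x0 c0 -` (coord_inv c ` cball (?f w) q))"
        by (intro closed_vimage compact_imp_closed Emap_continuous)
      moreover have "Emap x0 c0 -` (coord_inv c ` cball (?f w) q) = {v \<in> ?V. ?f v \<in> cball (?f w) q}"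
      proof (intro set_eqI iffI)
        fix v assume "v \<in> Emap x0 c0 -` (coord_inv c ` cball (?f w) q)"
        then obtain z where z: "Emap x0 c0 v = coord_inv c z" "z \<in> cball (?f w) q" by auto
        show "v \<in> {v \<in> ?V. ?f v \<in> cball (?f w) q}"
          using coord_coord_inv[OF ca subsetD[OF sub' z(2)]] z by simp
      next
        fix v assume "v \<in> {v \<in> ?V. ?f v \<in> cball (?f w) q}"
        then show "v \<in> Emap x0 c0 -` (coord_inv c ` cball (?f w) q)"
          using coord_inv_coord[OF ca, of "Emap x0 c0 v"] by (intro vimageI2 image_eqI[of _ _ "?f v"]) auto
      qed
      ultimately show "closed {v \<in> ?V. ?f v \<in> cball (?f w) q}" by simp
    qed (use f' wV \<rho>(1) open_Emap_dom[OF ca] in \<open>auto intro: that\<close>)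
    show ?thesis
    proof (intro exI[of _ "\<lambda>z. s (coord c z)"] conjI ballI)
      have UU: "coord c z \<in> ball (?f w) (2 * \<rho>)" "z \<in> dom_of c" if "z \<in> U" for z
        using that subsetD[OF subU] unfolding U_def by auto
      have "continuous_on U (coord c)" by (rule continuous_on_subset[OF cont_coord[OF ca]]) (simp add: U_def)
      then show "continuous_on U (\<lambda>z. s (coord c z))"
        by (rule continuous_on_compose2[OF s(1)]) (use UU in blast)
      show "s (coord c (Emap x0 c0 w)) = w" by (rule s(4))
      fix z assume z: "z \<in> U"
      have "Emap x0 c0 (s (coord c z)) \<in> dom_of c" "coord c (Emap x0 c0 (s (coord c z))) = coord c z"
        using s(2,3)[OF UU(1)[OF z]] by auto
      then show "Emap x0 c0 (s (coord c z)) = z" using coord_inv_coord[OF ca] UU(2)[OF z] by metis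
    qed
  qed
  ultimately show ?thesis by blast
qed

text \<open>The range is open and closed, since each \<open>U\<close> of \<open>Emap_section\<close>
  lies inside or outside it. Connectedness comes from simple connectivity: the constant loops at
  \<open>x0\<close> and \<open>y\<close> are homotopic, so both points lie in the image of a
  square.\<close>

lemma Emap_surj: "y \<in> range (Emap x0 c0)"
proof -
  have hl: "homotopic_loops UNIV (\<lambda>_::real. x0) (\<lambda>_. y)"
    using sc unfolding simply_connected_def by (simp add: path_def pathfinish_def pathstart_def)
  then obtain h where h: "continuous_on ({0..1::real} \<times> {0..1::real}) h" "\<forall>x\<in>{0..1}. h (0, x) = x0" "\<forall>x\<in>{0..1}. h (1, x) = y"
    unfolding homotopic_loops by blast
  let ?S = "h ` ({0..1} \<times> {0..1})"
  have conn: "connected ?S" by (intro connected_continuous_image h convex_connected convex_Times convex_closed_interval)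
  have secU: "U \<subseteq> range (Emap x0 c0)"
    if hyp: "\<forall>w. Emap x0 c0 w \<in> U \<longrightarrow> (\<exists>\<sigma>. continuous_on U \<sigma> \<and> (\<forall>z\<in>U. Emap x0 c0 (\<sigma> z) = z) \<and> \<sigma> (Emap x0 c0 w) = w)" "Emap x0 c0 w \<in> U" for U w
  proof
    fix z assume z: "z \<in> U"
    obtain \<sigma> where "\<forall>z\<in>U. Emap x0 c0 (\<sigma> z) = z" using hyp by blast
    then show "z \<in> range (Emap x0 c0)" using z by (intro range_eqI[of _ _ "\<sigma> z"]) simp
  qed
  have "open (range (Emap x0 c0))"
    unfolding open_subopen[of "range _"]
  proof
    fix z assume "z \<in> range (Emap x0 c0)"
    then obtain w where w: "z = Emap x0 c0 w" by blast
    from Emap_section[of z] obtain U where U: "open U" "z \<in> U"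
      "\<forall>w. Emap x0 c0 w \<in> U \<longrightarrow> (\<exists>\<sigma>. continuous_on U \<sigma> \<and> (\<forall>z\<in>U. Emap x0 c0 (\<sigma> z) = z) \<and> \<sigma> (Emap x0 c0 w) = w)"
      by (elim exE conjE)
    show "\<exists>T. open T \<and> z \<in> T \<and> T \<subseteq> range (Emap x0 c0)"
      by (intro exI[of _ U] conjI U(1,2) secU[OF U(3), of w]) (use U(2) w in simp)
  qed
  moreover have "open (- range (Emap x0 c0))"
    unfolding open_subopen[of "- range _"]
  proof
    fix z assume z: "z \<in> - range (Emap x0 c0)"
    from Emap_section[of z] obtain U where U: "open U" "z \<in> U"
      "\<forall>w. Emap x0 c0 w \<in> U \<longrightarrow> (\<exists>\<sigma>. continuous_on U \<sigma> \<and> (\<forall>z\<in>U. Emap x0 c0 (\<sigma> z) = z) \<and> \<sigma> (Emap x0 c0 w) = w)"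
      by (elim exE conjE)
    have "U \<subseteq> - range (Emap x0 c0)"
    proof
      fix u assume u: "u \<in> U"
      show "u \<in> - range (Emap x0 c0)"
      proof
        assume "u \<in> range (Emap x0 c0)"
        then obtain w where "u = Emap x0 c0 w" by blast
        then have "U \<subseteq> range (Emap x0 c0)" using secU[OF U(3), of w] u by simp
        then show False using z U(2) by blast
      qed
    qed
    then show "\<exists>T. open T \<and> z \<in> T \<and> T \<subseteq> - range (Emap x0 c0)" using U(1,2) by blast
  qed
  moreover have "x0 \<in> ?S" using h(2) by (intro image_eqI[of _ _ "(0,0)"]) auto
  moreover have "y \<in> ?S" using h(3) by (intro image_eqI[of _ _ "(1,0)"]) auto
  moreover have "x0 \<in> range (Emap x0 c0)" using Emap_0 by (metis rangeI)
  ultimately show ?thesis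
    using connectedD[OF conn, of "range (Emap x0 c0)" "- range (Emap x0 c0)"] by blast
qed

text \<open>The pull-back of \<open>Emap\<close> along a map \<open>H\<close> is a covering in the sense of the library, whose lifting
  theorems require a normed base space.\<close>

lemma Emap_lift:
  fixes H :: "'b::real_normed_vector \<Rightarrow> 'm"
  assumes C: "convex C" and H: "continuous_on C H" and z: "z \<in> C" "Emap x0 c0 w = H z"
  obtains g where "continuous_on C g" "\<And>b. b \<in> C \<Longrightarrow> Emap x0 c0 (g b) = H b" "g z = w"
proof -
  let ?E = "Emap x0 c0"
  define P where "P = {p. fst p \<in> C \<and> ?E (snd p) = H (fst p)}"
  have cov: "covering_space P fst C"
    unfolding covering_space_def
  proof (intro conjI ballI)
    show "continuous_on P fst" by (intro continuous_on_fst continuous_on_id)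
    show "fst ` P = C"
    proof
      show "fst ` P \<subseteq> C" by (auto simp: P_def)
      show "C \<subseteq> fst ` P"
      proof
        fix b assume b: "b \<in> C"
        obtain v where "H b = ?E v" using Emap_surj[of "H b"] by blast
        then show "b \<in> fst ` P" using b by (intro image_eqI[of _ _ "(b, v)"]) (auto simp: P_def)
      qed
    qed
    fix a assume a: "a \<in> C"
    from Emap_section[of "H a"] obtain U where U: "open U" "H a \<in> U"
      and sec: "\<And>w. ?E w \<in> U \<Longrightarrow> \<exists>\<sigma>. continuous_on U \<sigma> \<and> (\<forall>z\<in>U. ?E (\<sigma> z) = z) \<and> \<sigma> (?E w) = w"
      by (elim exE conjE) metis
    from sec obtain \<sigma> where \<sigma>: "\<And>w. ?E w \<in> U \<Longrightarrow> continuous_on U (\<sigma> w)" "\<And>w z. ?E w \<in> U \<Longrightarrow> z \<in> U \<Longrightarrow> ?E (\<sigma> w z) = z"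
      "\<And>w. ?E w \<in> U \<Longrightarrow> \<sigma> w (?E w) = w" by metis
    have "continuous (at a within C) H" using H a by (simp add: continuous_on_eq_continuous_within)
    from topological_tendstoD[OF this[unfolded continuous_within] U(1,2)]
    obtain r where r: "r > 0" "\<And>b. b \<in> C \<Longrightarrow> b \<noteq> a \<Longrightarrow> dist b a < r \<Longrightarrow> H b \<in> U"
      unfolding eventually_at by blast
    define T where "T = C \<inter> ball a r"
    have TU: "H b \<in> U" if "b \<in> T" for b using that r(2)[of b] U(2) by (cases "b = a") (auto simp: T_def dist_commute)
    have TC: "T \<subseteq> C" and aT: "a \<in> T" using a r(1) by (auto simp: T_def)
    have Tconn: "connected T" unfolding T_def by (intro convex_connected convex_Int C convex_ball)
    have HT: "continuous_on T H" by (rule continuous_on_subset[OF H TC])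
    define W where "W = {w. ?E w = H a}"
    have WU: "?E w \<in> U" if "w \<in> W" for w using that U(2) by (simp add: W_def)
    \<comment> \<open>The sheet through \<open>(a, w)\<close>: the graph over \<open>T\<close> of
      the local section through \<open>w\<close>, composed with \<open>H\<close>. The sheets are
      indexed by the fibre \<open>W\<close> over \<open>H a\<close>, and two that meet coincide
      because \<open>T\<close> is connected.\<close>
    define sh where "sh w = (\<lambda>b. (b, \<sigma> w (H b))) ` T" for w
    have cs: "continuous_on T (\<lambda>b. \<sigma> w (H b))" if "?E w \<in> U" for w
      by (rule continuous_on_compose2[OF \<sigma>(1)[OF that] HT]) (use TU in blast)
    have un: "\<sigma> w (H b) = \<sigma> w' (H b)"
      if w: "?E w \<in> U" "?E w' \<in> U" and d: "d \<in> T" "\<sigma> w (H d) = \<sigma> w' (H d)" and b: "b \<in> T" for w w' d b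
      by (rule lift_unique[where E = ?E, OF Tconn cs[OF w(1)] cs[OF w(2)] _ Emap_locally_injective d b])
        (simp add: \<sigma>(2) w TU)
    have shP: "sh w \<subseteq> P" if "w \<in> W" for w
      unfolding sh_def P_def using TC \<sigma>(2)[OF WU[OF that]] TU by auto
    show "\<exists>T. a \<in> T \<and> openin (top_of_set C) T \<and>
        (\<exists>v. \<Union>v = P \<inter> fst -` T \<and> (\<forall>u\<in>v. openin (top_of_set P) u) \<and> pairwise disjnt v \<and>
          (\<forall>u\<in>v. \<exists>q. homeomorphism u T fst q))"
    proof (intro exI[of _ T] conjI exI[of _ "sh ` W"])
      show "a \<in> T" by (rule aT)
      show "openin (top_of_set C) T" unfolding T_def by (intro openin_open_Int open_ball)
      show "\<Union> (sh ` W) = P \<inter> fst -` T"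
      proof (intro set_eqI iffI)
        fix p assume "p \<in> \<Union> (sh ` W)"
        then obtain w where "w \<in> W" "p \<in> sh w" by blast
        then show "p \<in> P \<inter> fst -` T" using shP[of w] by (auto simp: sh_def)
      next
        fix p assume p: "p \<in> P \<inter> fst -` T"
        define b v where "b = fst p" and "v = snd p"
        have bv: "p = (b, v)" "b \<in> T" "?E v = H b" using p by (auto simp: b_def v_def P_def)
        have vU: "?E v \<in> U" using TU[OF bv(2)] bv(3) by simp
        define w where "w = \<sigma> v (H a)"
        have w: "w \<in> W" unfolding W_def w_def using \<sigma>(2)[OF vU U(2)] by simp
        have "\<sigma> w (H b) = \<sigma> v (H b)"
        proof (rule un[OF WU[OF w] vU aT _ bv(2)])
          show "\<sigma> w (H a) = \<sigma> v (H a)" using \<sigma>(3)[OF WU[OF w]] w unfolding W_def w_def by simp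
        qed
        also have "\<dots> = v" using \<sigma>(3)[OF vU] bv(3) by simp
        finally have "p \<in> sh w" unfolding sh_def bv(1) using bv(2) by (intro image_eqI[of _ _ b]) simp_all
        then show "p \<in> \<Union> (sh ` W)" using w by blast
      qed
      show "\<forall>u\<in>sh ` W. openin (top_of_set P) u"
      proof (intro ballI)
        fix u assume "u \<in> sh ` W"
        then obtain w where w: "w \<in> W" "u = sh w" by blast
        show "openin (top_of_set P) u"
        proof (subst openin_subopen, intro ballI)
          fix p assume "p \<in> u"
          then obtain b where b: "b \<in> T" "p = (b, \<sigma> w (H b))" unfolding w(2) sh_def by blast
          \<comment> \<open>Injectivity on \<open>N\<close> separates this sheet from the others: a
            point of \<open>P\<close> near \<open>p\<close> with second component in
            \<open>N\<close> must lie on the same graph.\<close>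
          obtain N where N: "open N" "\<sigma> w (H b) \<in> N" "inj_on ?E N" using Emap_locally_injective by blast
          have oT: "openin (top_of_set C) T" unfolding T_def by (intro openin_open_Int open_ball)
          have "openin (top_of_set T) (T \<inter> (\<lambda>b. \<sigma> w (H b)) -` N)"
            by (rule continuous_openin_preimage_gen[OF cs[OF WU[OF w(1)]] N(1)])
          then have "openin (top_of_set C) (T \<inter> (\<lambda>b. \<sigma> w (H b)) -` N)" by (rule openin_trans[OF _ oT])
          then obtain O1 where O1: "open O1" "T \<inter> (\<lambda>b. \<sigma> w (H b)) -` N = C \<inter> O1" unfolding openin_open by blast
          have "openin (top_of_set P) (P \<inter> (O1 \<times> N))" by (intro openin_open_Int open_Times O1(1) N(1))
          moreover have "p \<in> P \<inter> (O1 \<times> N)"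
          proof -
            have "b \<in> C \<inter> O1" unfolding O1(2)[symmetric] using b(1) N(2) by simp
            then show ?thesis using shP[OF w(1)] \<open>p \<in> u\<close> w(2) b(2) N(2) by auto
          qed
          moreover have "P \<inter> (O1 \<times> N) \<subseteq> u"
          proof
            fix p' assume p': "p' \<in> P \<inter> (O1 \<times> N)"
            define b' v' where "b' = fst p'" and "v' = snd p'"
            have bv: "p' = (b', v')" "b' \<in> C \<inter> O1" "v' \<in> N" "?E v' = H b'" using p' by (auto simp: b'_def v'_def P_def)
            have b': "b' \<in> T" "\<sigma> w (H b') \<in> N" using bv(2) unfolding O1(2)[symmetric] by auto
            have "v' = \<sigma> w (H b')"
              by (rule inj_onD[OF N(3) _ bv(3) b'(2)]) (simp add: bv(4) \<sigma>(2)[OF WU[OF w(1)] TU[OF b'(1)]])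
            then show "p' \<in> u" unfolding w(2) sh_def bv(1) using b'(1) by (intro image_eqI[of _ _ b']) simp_all
          qed
          ultimately show "\<exists>S. openin (top_of_set P) S \<and> p \<in> S \<and> S \<subseteq> u" by (intro exI conjI)
        qed
      qed
      show "pairwise disjnt (sh ` W)"
        unfolding pairwise_def
      proof (intro ballI impI)
        fix u u' assume "u \<in> sh ` W" "u' \<in> sh ` W" and ne: "u \<noteq> u'"
        then obtain w w' where w: "w \<in> W" "u = sh w" "w' \<in> W" "u' = sh w'" by blast
        show "disjnt u u'"
          unfolding disjnt_iff
        proof (intro allI notI)
          fix p assume "p \<in> u \<and> p \<in> u'"
          then obtain d where d: "d \<in> T" "\<sigma> w (H d) = \<sigma> w' (H d)" unfolding w(2,4) sh_def by auto
          have "\<sigma> w (H b) = \<sigma> w' (H b)" if "b \<in> T" for b by (rule un[OF WU[OF w(1)] WU[OF w(3)] d that])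
          then have "sh w = sh w'" unfolding sh_def by (intro image_cong) simp_all
          then show False using ne w by simp
        qed
      qed
      show "\<forall>u\<in>sh ` W. \<exists>q. homeomorphism u T fst q"
      proof (intro ballI)
        fix u assume "u \<in> sh ` W"
        then obtain w where w: "w \<in> W" "u = sh w" by blast
        show "\<exists>q. homeomorphism u T fst q"
        proof (intro exI[of _ "\<lambda>b. (b, \<sigma> w (H b))"] homeomorphismI)
          show "continuous_on u fst" by (intro continuous_on_fst continuous_on_id)
          show "continuous_on T (\<lambda>b. (b, \<sigma> w (H b)))"
            by (intro continuous_on_Pair continuous_on_id cs WU w(1))
        qed (auto simp: w(2) sh_def)
      qed
    qed
  qed
  obtain g where g: "continuous_on C g" "g \<in> C \<rightarrow> P" "g z = (z, w)" "\<And>y. y \<in> C \<Longrightarrow> fst (g y) = y"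
  proof (rule covering_space_lift_strong[OF cov, of "(z, w)" z C "\<lambda>b. b"])
    show "(z, w) \<in> P" using z by (simp add: P_def)
    show "simply_connected C" using C by (rule convex_imp_simply_connected)
    show "locally path_connected C" using C by (rule convex_imp_locally_path_connected)
  qed (use z that in auto)
  show thesis
  proof (rule that[of "\<lambda>b. snd (g b)"])
    show "continuous_on C (\<lambda>b. snd (g b))" by (intro continuous_on_snd g(1))
    show "?E (snd (g b)) = H b" if b: "b \<in> C" for b
      using funcset_mem[OF g(2) b] g(4)[OF b] by (simp add: P_def)
    show "snd (g z) = w" by (simp add: g(3))
  qed
qed

text \<open>The segment from \<open>w1\<close> to \<open>w2\<close> maps to a loop; its contraction
  is a square, which is lifted starting at \<open>w1\<close>. The initial edge lifts to the segment
  and the final edge to a constant. As the homotopy is one of free loops, the other two edges lift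
  the same moving base point; they agree at the final edge, hence also at the start, so
  \<open>w1 = w2\<close>.\<close>

lemma Emap_inj:
  assumes eq: "Emap x0 c0 w1 = Emap x0 c0 w2" shows "w1 = w2"
proof -
  let ?E = "Emap x0 c0"
  define seg where "seg t = w1 + t *\<^sub>R (w2 - w1)" for t :: real
  have cseg: "continuous_on S seg" for S unfolding seg_def by (intro continuous_intros)
  have "path (\<lambda>t. ?E (seg t))"
    unfolding path_def by (rule continuous_on_compose2[OF Emap_continuous cseg subset_UNIV])
  then have "homotopic_loops UNIV (\<lambda>t. ?E (seg t)) (\<lambda>_. ?E w1)"
    using sc eq unfolding simply_connected_def by (simp add: path_def pathfinish_def pathstart_def seg_def)
  then obtain h where h': "continuous_on ({0..1::real} \<times> {0..1::real}) h" "\<forall>x\<in>{0..1}. h (0, x) = ?E (seg x)"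
    "\<forall>x\<in>{0..1}. h (1, x) = ?E w1" "\<forall>s\<in>{0..1}. pathfinish (h \<circ> Pair s) = pathstart (h \<circ> Pair s)"
    unfolding homotopic_loops by blast
  have h: "continuous_on ({0..1} \<times> {0..1}) h" "\<And>t. t \<in> {0..1} \<Longrightarrow> h (0, t) = ?E (seg t)"
    "\<And>t. t \<in> {0..1} \<Longrightarrow> h (1, t) = ?E w1" "\<And>s. s \<in> {0..1} \<Longrightarrow> h (s, 1) = h (s, 0)"
    using h' by (simp_all add: pathfinish_def pathstart_def)
  have cvx: "convex ({0..1::real} \<times> {0..1::real})" by (intro convex_Times convex_closed_interval)
  obtain g where g: "continuous_on ({0..1} \<times> {0..1}) g" "\<And>b. b \<in> {0..1} \<times> {0..1} \<Longrightarrow> ?E (g b) = h b" "g (0, 0) = w1"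
    by (rule Emap_lift[OF cvx h(1), of "(0, 0)" w1]) (use h(2)[of 0] in \<open>auto simp: seg_def intro: that\<close>)
  have uni: "a t = b t" if "continuous_on {0..1::real} a" "continuous_on {0..1} b"
    "\<And>t. t \<in> {0..1} \<Longrightarrow> ?E (a t) = ?E (b t)" "t0 \<in> {0..1}" "a t0 = b t0" "t \<in> {0..1}" for a b :: "real \<Rightarrow> real^'n" and t0 t
    by (rule lift_unique[where E = ?E, OF connected_Icc that(1,2,3) Emap_locally_injective that(4-6)])
  have cg: "continuous_on {0..1} (\<lambda>t. g (s, t))" "continuous_on {0..1} (\<lambda>t. g (t, s))" if "s \<in> {0..1}" for s
    by (rule continuous_on_compose2[OF g(1)]; use that in \<open>auto intro!: continuous_on_Pair continuous_on_const continuous_on_id\<close>)+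
  have 1: "g (0, 1) = w2"
    using uni[OF cg(1)[of 0] cseg, of 0 1] g(2,3) h(2) by (simp add: seg_def)
  have 2: "g (1, 0) = g (1, 1)"
    using uni[OF cg(1)[of 1] continuous_on_const[of _ "g (1, 1)"], of 1 0] g(2) h(3) by simp
  have 3: "g (0, 0) = g (0, 1)"
    using uni[OF cg(2)[of 0] cg(2)[of 1], of 1 0] g(2) h(4) 2 by simp
  show ?thesis using 1 3 g(3) by simp
qed

section \<open>The inverse of the exponential map\<close>

definition Einv :: "'m \<Rightarrow> real ^ 'n" where
  "Einv = inv (Emap x0 c0)"

lemma Emap_Einv: "Emap x0 c0 (Einv y) = y"
  unfolding Einv_def using f_inv_into_f[OF Emap_surj] .

lemma Einv_Emap: "Einv (Emap x0 c0 w) = w"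
  using Emap_inj[OF Emap_Einv] .

lemma Einv_continuous: "continuous_on S Einv"
proof (rule continuous_at_imp_continuous_on, intro ballI)
  fix y
  from Emap_section[of y] obtain U where U: "open U" "y \<in> U"
    and sec: "\<And>w. Emap x0 c0 w \<in> U \<Longrightarrow> \<exists>\<sigma>. continuous_on U \<sigma> \<and> (\<forall>z\<in>U. Emap x0 c0 (\<sigma> z) = z) \<and> \<sigma> (Emap x0 c0 w) = w"
    by (elim exE conjE) metis
  obtain \<sigma> where \<sigma>: "continuous_on U \<sigma>" "\<And>z. z \<in> U \<Longrightarrow> Emap x0 c0 (\<sigma> z) = z"
    using sec[of "Einv y"] U(2) Emap_Einv[of y] by auto
  have "continuous_on U Einv"
    by (rule continuous_on_eq[OF \<sigma>(1)]) (metis \<sigma>(2) Einv_Emap)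
  then show "isCont Einv y" using U by (simp add: continuous_on_eq_continuous_at)
qed

text \<open>The derivative \<open>B a\<close> of the inverse is the inverse matrix of the derivative
  at \<open>s a\<close>. Its continuity follows from \<open>f' (s b) (B b \<eta> - B a \<eta>) = (f'
  (s a) - f' (s b)) (B a \<eta>)\<close>, since the expansion bound with a uniform
  \<open>\<kappa>\<close> controls the vector on the left.\<close>

lemma Einv_C1:
  assumes c: "c \<in> atlas M"
  shows "C1_on (coord c ` dom_of c) (\<lambda>a. Einv (coord_inv c a))"
proof -
  let ?D = "coord c ` dom_of c" and ?V = "{w. Emap x0 c0 w \<in> dom_of c}" and ?f = "\<lambda>w. coord c (Emap x0 c0 w)"
  define s where "s a = Einv (coord_inv c a)" for a
  obtain f' where f': "\<And>x. x \<in> ?V \<Longrightarrow> (?f has_derivative blinfun_apply (f' x)) (at x)" "continuous_on ?V f'"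
    using C1_onE[OF coord_Emap_C1[OF c]] by blast
  have cs: "continuous_on ?D s"
    unfolding s_def by (rule continuous_on_compose2[OF Einv_continuous[of UNIV] cont_coord_inv[OF c]]) simp
  have sV: "s a \<in> ?V" "?f (s a) = a" if "a \<in> ?D" for a
    using coord_coord_inv[OF c that] by (simp_all add: s_def Emap_Einv)
  have "\<exists>B. (s has_derivative B) (at a) \<and> B \<circ> blinfun_apply (f' (s a)) = id \<and> blinfun_apply (f' (s a)) \<circ> B = id" if a: "a \<in> ?D" for a
  proof -
    let ?A = "blinfun_apply (f' (s a))"
    have lin: "linear ?A" by (rule bounded_linear.linear[OF blinfun.bounded_linear_right])
    have sub: "{a} \<subseteq> ?D" using a by simp
    obtain \<kappa> where \<kappa>: "\<And>w \<xi>. Emap x0 c0 w \<in> dom_of c \<Longrightarrow> coord c (Emap x0 c0 w) \<in> {a} \<Longrightarrow> norm \<xi> \<le> \<kappa> * norm (Jac x0 c0 w \<xi> 1 c)"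
      using Jac_expand_norm[OF c compact_sing sub] by blast
    have dom: "Emap x0 c0 (s a) \<in> dom_of c" using sV(1)[OF a] by simp
    have A: "?A = (\<lambda>\<xi>. Jac x0 c0 (s a) \<xi> 1 c)"
      by (rule has_derivative_unique[OF f'(1)[OF sV(1)[OF a]] coord_Emap_derivative[OF charts_atI[OF c dom]]])
    have low: "norm \<xi> \<le> \<kappa> * norm (?A \<xi>)" for \<xi> using \<kappa>[OF dom, of \<xi>] sV(2)[OF a] unfolding A by simp
    have "\<xi> = 0" if "?A \<xi> = 0" for \<xi> using low[of \<xi>] that by simp
    then have inj: "inj ?A" using linear_injective_0[OF lin] by blast
    then obtain B where B: "linear B" "B \<circ> ?A = id" using linear_injective_left_inverse[OF lin] by blast
    have surj: "surj ?A" using linear_injective_imp_surjective[OF lin inj] by simp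
    have AB: "?A \<circ> B = id"
    proof
      fix \<eta> obtain \<xi> where "\<eta> = ?A \<xi>" using surj by (meson surjD)
      then show "(?A \<circ> B) \<eta> = id \<eta>" using fun_cong[OF B(2), of \<xi>] by simp
    qed
    have "(s has_derivative B) (at a)"
    proof (rule has_derivative_inverse_basic[OF f'(1)[OF sV(1)[OF a]] _ B(2) _ open_img[OF c] a sV(2)])
      show "bounded_linear B" using B(1) linear_conv_bounded_linear by blast
      show "isCont s a" by (rule cs[unfolded continuous_on_eq_continuous_at[OF open_img[OF c]], rule_format, OF a])
    qed
    then show ?thesis using B(2) AB by blast
  qed
  then obtain B where B: "\<And>a. a \<in> ?D \<Longrightarrow> (s has_derivative B a) (at a)"
    "\<And>a. a \<in> ?D \<Longrightarrow> B a \<circ> blinfun_apply (f' (s a)) = id" "\<And>a. a \<in> ?D \<Longrightarrow> blinfun_apply (f' (s a)) \<circ> B a = id"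
    by metis
  have "C1_on ?D s"
  proof (rule C1_onI[OF B(1)])
    fix \<eta> :: "real ^ 'n" assume "\<eta> \<in> Basis"
    show "continuous_on ?D (\<lambda>a. B a \<eta>)"
    proof (rule continuous_at_imp_continuous_on, intro ballI)
      fix a assume a: "a \<in> ?D"
      obtain r where r: "r > 0" "cball a r \<subseteq> ?D" using open_img[OF c] a unfolding open_contains_cball by blast
      obtain \<kappa> where \<kappa>: "\<And>w \<xi>. Emap x0 c0 w \<in> dom_of c \<Longrightarrow> coord c (Emap x0 c0 w) \<in> cball a r \<Longrightarrow> norm \<xi> \<le> \<kappa> * norm (Jac x0 c0 w \<xi> 1 c)"
        using Jac_expand_norm[OF c compact_cball r(2)] by blast
      have cf: "continuous_on ?D (\<lambda>a. f' (s a))"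
        by (rule continuous_on_compose2[OF f'(2) cs]) (use sV(1) in blast)
      have bound: "norm (B b \<eta> - B a \<eta>) \<le> \<bar>\<kappa>\<bar> * (norm (f' (s a) - f' (s b)) * norm (B a \<eta>))" if b: "b \<in> cball a r" for b
      proof -
        have bD: "b \<in> ?D" using b r(2) by blast
        have dom: "Emap x0 c0 (s b) \<in> dom_of c" using sV(1)[OF bD] by simp
        let ?\<xi> = "B b \<eta> - B a \<eta>"
        have A: "blinfun_apply (f' (s b)) = (\<lambda>\<xi>. Jac x0 c0 (s b) \<xi> 1 c)"
          by (rule has_derivative_unique[OF f'(1)[OF sV(1)[OF bD]] coord_Emap_derivative[OF charts_atI[OF c dom]]])
        have "norm ?\<xi> \<le> \<kappa> * norm (f' (s b) ?\<xi>)" using \<kappa>[OF dom, of ?\<xi>] sV(2)[OF bD] b unfolding A by simp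
        also have "\<dots> \<le> \<bar>\<kappa>\<bar> * norm (f' (s b) ?\<xi>)" by (intro mult_right_mono) auto
        also have "f' (s b) ?\<xi> = (f' (s a) - f' (s b)) (B a \<eta>)"
          using fun_cong[OF B(3)[OF bD], of \<eta>] fun_cong[OF B(3)[OF a], of \<eta>]
          by (simp add: blinfun.diff_right blinfun.diff_left)
        also have "\<bar>\<kappa>\<bar> * norm \<dots> \<le> \<bar>\<kappa>\<bar> * (norm (f' (s a) - f' (s b)) * norm (B a \<eta>))"
          by (intro mult_left_mono norm_blinfun) auto
        finally show ?thesis .
      qed
      have "isCont (\<lambda>a. f' (s a)) a" by (rule cf[unfolded continuous_on_eq_continuous_at[OF open_img[OF c]], rule_format, OF a])
      then have "((\<lambda>b. \<bar>\<kappa>\<bar> * (norm (f' (s a) - f' (s b)) * norm (B a \<eta>))) \<longlongrightarrow> \<bar>\<kappa>\<bar> * (norm (f' (s a) - f' (s a)) * norm (B a \<eta>))) (at a)"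
        unfolding isCont_def by (intro tendsto_mult tendsto_norm tendsto_diff tendsto_const)
      then have lim: "((\<lambda>b. \<bar>\<kappa>\<bar> * (norm (f' (s a) - f' (s b)) * norm (B a \<eta>))) \<longlongrightarrow> 0) (at a)" by simp
      have ev: "eventually (\<lambda>b. norm (B b \<eta> - B a \<eta>) \<le> \<bar>\<kappa>\<bar> * (norm (f' (s a) - f' (s b)) * norm (B a \<eta>))) (at a)"
        unfolding eventually_at using r(1) bound by (intro exI[of _ r]) (auto simp: dist_commute)
      have "((\<lambda>b. B b \<eta> - B a \<eta>) \<longlongrightarrow> 0) (at a)" by (rule Lim_null_comparison[OF ev lim])
      then show "isCont (\<lambda>a. B a \<eta>) a" unfolding isCont_def by (simp add: LIM_zero_iff)
    qed
  qed
  then show ?thesis unfolding s_def .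
qed

end

end

section \<open>Lengths of curves\<close>

lemma continuous_within_openin:
  assumes "openin (top_of_set I) S" "t \<in> S" "continuous_on S f"
  shows "continuous (at t within I) f"
proof -
  obtain T where T: "open T" "S = I \<inter> T" using assms(1) unfolding openin_open by blast
  have "at t within S = at t within I"
    by (rule at_within_nhd[of t T]) (use T assms(2) in auto)
  then show ?thesis using assms(2,3) unfolding continuous_on_eq_continuous_within by metis
qed

lemma integrable_on_finite_gaps:
  fixes f :: "real \<Rightarrow> real"
  assumes "finite S" "a \<le> b"
    and gap: "\<And>u v. a \<le> u \<Longrightarrow> u < v \<Longrightarrow> v \<le> b \<Longrightarrow> {u<..<v} \<inter> S = {} \<Longrightarrow> f integrable_on {u..v}"
  shows "f integrable_on {a..b}"
  using assms
proof (induction S arbitrary: a b rule: finite_induct)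
  case (empty a b)
  show ?case
  proof (cases "a = b")
    case False
    then show ?thesis using empty.prems(1) by (intro empty.prems(2)) auto
  qed (use integrable_on_refl[of f b] in simp)
next
  case (insert s S a b)
  have gen: "f integrable_on {u..v}" if uv: "a \<le> u" "u \<le> v" "v \<le> b" "s \<notin> {u<..<v}" for u v
  proof (rule insert.IH[OF uv(2)])
    fix p q assume pq: "u \<le> p" "p < q" "q \<le> v" "{p<..<q} \<inter> S = {}"
    have "s \<notin> {p<..<q}" using uv(4) pq(1,3) by auto
    then show "f integrable_on {p..q}" using uv pq by (intro insert.prems(2)) auto
  qed
  show ?case
  proof (cases "s \<in> {a<..<b}")
    case True
    have "f integrable_on {a..s}" by (rule gen) (use True in auto)
    moreover have "f integrable_on {s..b}" by (rule gen) (use True in auto)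
    ultimately show ?thesis using True by (intro Henstock_Kurzweil_Integration.integrable_combine[of a s b]) auto
  next
    case False
    then show ?thesis using insert.prems(1) by (intro gen) auto
  qed
qed

lemma has_integral_le_finite:
  fixes f g :: "real \<Rightarrow> real"
  assumes "finite S" "(f has_integral i) T" "(g has_integral j) T" "\<And>x. x \<in> T - S \<Longrightarrow> f x \<le> g x"
  shows "i \<le> j"
proof (rule has_integral_le[OF assms(2)])
  show "((\<lambda>x. if x \<in> S then f x else g x) has_integral j) T"
    by (rule has_integral_spike_finite[OF assms(1) _ assms(3)]) simp
qed (use assms(4) in auto)

context riem_mfd
begin

definition gnorm :: "('m, 'n) chart \<Rightarrow> real ^ 'n \<Rightarrow> real ^ 'n \<Rightarrow> real" where
  "gnorm c a v = sqrt (gip c a v v)"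

lemma gip_le_gnorm:
  assumes "c \<in> atlas M" "a \<in> coord c ` dom_of c"
  shows "gip c a v e \<le> gnorm c a v * gnorm c a e"
proof -
  have "\<bar>gip c a v e\<bar> = sqrt ((gip c a v e)\<^sup>2)" by simp
  also have "\<dots> \<le> sqrt (gip c a v v * gip c a e e)" by (intro real_sqrt_le_mono gip_cauchy_schwarz[OF assms])
  finally show ?thesis unfolding gnorm_def real_sqrt_mult by linarith
qed

lemma gnorm_nonneg:
  assumes "c \<in> atlas M" "a \<in> coord c ` dom_of c"
  shows "0 \<le> gnorm c a v"
  unfolding gnorm_def using gip_nonneg[OF assms] by simp

lemma gnorm_scale: "gnorm c a (r *\<^sub>R v) = \<bar>r\<bar> * gnorm c a v"
  unfolding gnorm_def by (simp add: gip_linear real_sqrt_mult flip: mult.assoc)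

lemma gnorm_triangle:
  assumes "c \<in> atlas M" "a \<in> coord c ` dom_of c"
  shows "gnorm c a u \<le> gnorm c a v + gnorm c a (u - v)"
proof -
  let ?e = "u - v"
  note nn = gip_nonneg[OF assms]
  have cs: "gip c a v ?e \<le> gnorm c a v * gnorm c a ?e" by (rule gip_le_gnorm[OF assms])
  have "gip c a u u = gip c a v v + 2 * gip c a v ?e + gip c a ?e ?e"
    using gip_sym[OF assms, of u v] by (simp add: gip_linear)
  also have "\<dots> \<le> gip c a v v + 2 * (gnorm c a v * gnorm c a ?e) + gip c a ?e ?e" using cs by simp
  also have "\<dots> = (gnorm c a v + gnorm c a ?e)\<^sup>2"
    unfolding power2_sum gnorm_def using nn by simp
  finally show ?thesis unfolding gnorm_def[of c a u]
    by (intro real_le_lsqrt) (simp_all add: gnorm_def nn)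
qed

lemma continuous_on_gip:
  assumes "c \<in> atlas M" "continuous_on S \<alpha>" "\<alpha> ` S \<subseteq> coord c ` dom_of c" "continuous_on S u" "continuous_on S v"
  shows "continuous_on S (\<lambda>t. gip c (\<alpha> t) (u t) (v t))"
proof -
  show ?thesis
    unfolding gip_gmat
    by (intro continuous_on_inner assms bounded_bilinear.continuous_on[OF bounded_bilinear_matrix_vector]
        continuous_on_compose2[OF C1_on_imp_continuous_on[OF gmat_C1[OF assms(1)]] assms(2,3)])
qed

lemma C1_curve_chart_openin:
  assumes "continuous_on I \<gamma>" "c \<in> atlas M"
  shows "openin (top_of_set I) {t \<in> I. \<gamma> t \<in> dom_of c}"
  using continuous_openin_preimage_gen[OF assms(1) open_dom[OF assms(2)]] by (simp add: vimage_def Int_def)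

lemma C1_curve_onD:
  assumes "C1_curve_on M {a..b} \<gamma>" "c \<in> charts_at M (\<gamma> t)" "t \<in> {a..b}"
  shows "((\<lambda>s. coord c (\<gamma> s)) has_vector_derivative vector_derivative (\<lambda>s. coord c (\<gamma> s)) (at t within {a..b})) (at t within {a..b})"
proof -
  have "(coord c \<circ> \<gamma>) differentiable (at t within {a..b})"
    using assms charts_atD[OF assms(2)] unfolding C1_curve_on_def by blast
  then show ?thesis unfolding vector_derivative_works o_def .
qed

text \<open>\<open>velocity\<close> takes a two-sided derivative, which need not exist at the end
  points. The field \<open>V\<close> with derivatives within the interval has continuous length and
  differs from \<open>velocity\<close> at most at these two points.\<close>

lemma speed_integrable_gap:
  assumes ab: "a < b" and \<gamma>: "C1_curve_on M {a..b} \<gamma>"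
  shows "(\<lambda>t. tnorm M (\<gamma> t) (velocity M \<gamma> t)) integrable_on {a..b}"
proof -
  define V where "V t = (\<lambda>c. if c \<in> charts_at M (\<gamma> t) then vector_derivative (\<lambda>s. coord c (\<gamma> s)) (at t within {a..b}) else 0)" for t
  have c\<gamma>: "continuous_on {a..b} \<gamma>" using \<gamma> unfolding C1_curve_on_def by blast
  have VT: "V t \<in> tangent_space M (\<gamma> t)" if t: "t \<in> {a..b}" for t
  proof (rule tangent_spaceI)
    fix c c' assume c: "c \<in> charts_at M (\<gamma> t)" "c' \<in> charts_at M (\<gamma> t)"
    have "continuous (at t within {a..b}) \<gamma>" using c\<gamma> t by (simp add: continuous_on_eq_continuous_within)
    from chart_change_vector[where \<gamma> = \<gamma> and t = t, OF c t this C1_curve_onD[OF \<gamma> c(1) t]]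
    have "vector_derivative (\<lambda>s. coord c' (\<gamma> s)) (at t within {a..b})
      = transition_deriv c c' (\<gamma> t) (vector_derivative (\<lambda>s. coord c (\<gamma> s)) (at t within {a..b}))"
      by (rule vector_derivative_within_closed_interval[OF ab t])
    then show "V t c' = transition_deriv c c' (\<gamma> t) (V t c)" using c by (simp add: V_def)
  qed (simp add: V_def)
  have cont: "continuous_on {a..b} (\<lambda>t. tnorm M (\<gamma> t) (V t))"
    unfolding continuous_on_eq_continuous_within
  proof
    fix t assume t: "t \<in> {a..b}"
    obtain c where c: "c \<in> charts_at M (\<gamma> t)" using ex_chart by blast
    note ca = charts_atD(1)[OF c]
    let ?S = "{s \<in> {a..b}. \<gamma> s \<in> dom_of c}"
    have "continuous_on ?S (\<lambda>s. vector_derivative (\<lambda>s. coord c (\<gamma> s)) (at s within {a..b}))"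
      using \<gamma> ca unfolding C1_curve_on_def o_def by blast
    moreover have "continuous_on ?S (\<lambda>s. coord c (\<gamma> s))"
      by (rule continuous_on_compose2[OF cont_coord[OF ca] continuous_on_subset[OF c\<gamma>]]) auto
    ultimately have "continuous_on ?S (\<lambda>s. sqrt (gip c (coord c (\<gamma> s))
        (vector_derivative (\<lambda>s. coord c (\<gamma> s)) (at s within {a..b})) (vector_derivative (\<lambda>s. coord c (\<gamma> s)) (at s within {a..b}))))"
      by (intro continuous_on_real_sqrt continuous_on_gip[OF ca]) auto
    then have *: "continuous_on ?S (\<lambda>t. tnorm M (\<gamma> t) (V t))"
    proof (rule continuous_on_eq)
      fix s assume s: "s \<in> ?S"
      then have cs: "c \<in> charts_at M (\<gamma> s)" by (intro charts_atI ca) simp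
      show "sqrt (gip c (coord c (\<gamma> s)) (vector_derivative (\<lambda>s. coord c (\<gamma> s)) (at s within {a..b})) (vector_derivative (\<lambda>s. coord c (\<gamma> s)) (at s within {a..b})))
        = tnorm M (\<gamma> s) (V s)"
        using tnorm_chart[OF VT cs] s cs by (simp add: V_def)
    qed
    show "continuous (at t within {a..b}) (\<lambda>t. tnorm M (\<gamma> t) (V t))"
      by (rule continuous_within_openin[OF C1_curve_chart_openin[OF c\<gamma> ca] _ *]) (use t charts_atD(2)[OF c] in simp)
  qed
  have eq: "velocity M \<gamma> t = V t" if "t \<in> {a..b} - {a, b}" for t
  proof -
    have *: "at t within {a..b} = at t" using that by (intro at_within_Icc_at) auto
    show ?thesis unfolding V_def velocity_def o_def by (simp only: *)
  qed
  show ?thesis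
    by (rule integrable_spike_finite[of "{a, b}" _ _ "\<lambda>t. tnorm M (\<gamma> t) (V t)"])
      (use eq integrable_continuous_real[OF cont] in auto)
qed

lemma speed_integrable:
  assumes "piecewise_C1_curve M \<gamma>"
  shows "(\<lambda>t. tnorm M (\<gamma> t) (velocity M \<gamma> t)) integrable_on {0..1}"
proof -
  obtain S where S: "finite S" "\<And>a b. 0 \<le> a \<Longrightarrow> a < b \<Longrightarrow> b \<le> 1 \<Longrightarrow> {a<..<b} \<inter> S = {} \<Longrightarrow> C1_curve_on M {a..b} \<gamma>"
    using assms unfolding piecewise_C1_curve_def by blast
  show ?thesis
    by (rule integrable_on_finite_gaps[OF S(1)]) (use S(2) speed_integrable_gap in auto)
qed

lemma finite_gap_around:
  fixes S :: "real set"
  assumes "finite S" "t \<in> {0<..<1} - S"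
  obtains a b where "0 \<le> a" "a < t" "t < b" "b \<le> 1" "{a<..<b} \<inter> S = {}"
proof -
  have "open ({0<..<1} - S)" using assms(1) by (intro open_Diff finite_imp_closed open_greaterThanLessThan)
  then obtain e where e: "e > 0" "ball t e \<subseteq> {0<..<1} - S" using assms(2) open_contains_ball by blast
  have sub: "s \<in> {0<..<1} - S" if "\<bar>s - t\<bar> < e" for s using e(2) that by (auto simp: dist_real_def subset_iff abs_minus_commute)
  have "t - e/2 \<in> {0<..<1} - S" "t + e/2 \<in> {0<..<1} - S" using e(1) by (intro sub; simp)+
  moreover have "s \<notin> S" if "s \<in> {t - e/2<..<t + e/2}" for s
  proof -
    have "\<bar>s - t\<bar> < e" using that e(1) unfolding abs_less_iff greaterThanLessThan_iff by linarith
    from sub[OF this] show ?thesis by simp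
  qed
  ultimately show thesis using e(1) by (intro that[of "t - e/2" "t + e/2"]) auto
qed

end

section \<open>Images of curves of initial velocities\<close>

context complete_mfd
begin

context
  fixes x0 c0 assumes c0: "c0 \<in> charts_at M x0"
begin

lemma coord_Phi_C1:
  assumes "0 \<le> l" "c \<in> atlas M"
  shows "C1_on {w. Phi x0 c0 w l \<in> dom_of c} (\<lambda>w. coord c (Phi x0 c0 w l))"
proof (rule C1_on_local)
  fix w assume w: "w \<in> {w. Phi x0 c0 w l \<in> dom_of c}"
  have "reg x0 c0 c w l" by (rule reg_at[OF c0 assms(1)]) (use assms w in \<open>auto intro!: charts_atI\<close>)
  then obtain e where "e > 0" "C1_on (ball w e) (\<lambda>w. geoz c (Phi x0 c0 w) l)" unfolding reg_def by blast
  then show "\<exists>e>0. C1_on (ball w e) (\<lambda>w. coord c (Phi x0 c0 w l))"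
    using C1_on_fst[of "ball w e" "\<lambda>w. geoz c (Phi x0 c0 w) l"] unfolding geoz_def by auto
qed

lemma coord_Phi_curve_derivative:
  assumes l: "0 \<le> l" and c: "c \<in> charts_at M (Phi x0 c0 (u t) l)" and u: "(u has_vector_derivative v) (at t within T)"
  shows "((\<lambda>s. coord c (Phi x0 c0 (u s) l)) has_vector_derivative Jac x0 c0 (u t) v l c) (at t within T)"
proof -
  have d: "((\<lambda>w. coord c (Phi x0 c0 w l)) has_derivative (\<lambda>\<xi>. Jac x0 c0 (u t) \<xi> l c)) (at (u t))"
    by (rule coord_Phi_derivative[OF c0 l c])
  show ?thesis
    using has_derivative_compose[OF u[unfolded has_vector_derivative_def] d]
    unfolding has_vector_derivative_def by (simp add: linear_cmul[OF has_derivative_linear[OF d]])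
qed

lemma velocity_Phi_curve:
  assumes l: "0 \<le> l" and u: "(u has_vector_derivative v) (at t)"
  shows "velocity M (\<lambda>s. Phi x0 c0 (u s) l) t = Jac x0 c0 (u t) v l"
proof
  fix c
  show "velocity M (\<lambda>s. Phi x0 c0 (u s) l) t c = Jac x0 c0 (u t) v l c"
  proof (cases "c \<in> charts_at M (Phi x0 c0 (u t) l)")
    case True
    show ?thesis
      using velocity_chart[where \<gamma> = "\<lambda>s. Phi x0 c0 (u s) l" and t = t, OF True]
        cvel_eqI[OF coord_Phi_curve_derivative[OF l True u]] by simp
  qed (simp add: velocity_def Jac_def)
qed

lemma C1_curve_Phi:
  assumes ab: "a < b" and l: "0 \<le> l"
    and u: "\<And>t. t \<in> {a..b} \<Longrightarrow> (u has_vector_derivative u' t) (at t within {a..b})" "continuous_on {a..b} u'"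
  shows "C1_curve_on M {a..b} (\<lambda>t. Phi x0 c0 (u t) l)"
  unfolding C1_curve_on_def
proof (intro conjI ballI impI)
  have cu: "continuous_on {a..b} u" by (rule continuous_on_vector_derivative[OF u(1)])
  have "continuous_on UNIV (\<lambda>w. Phi x0 c0 w l)"
    using Phi_isCont[OF c0 l] continuous_at_imp_continuous_on by blast
  then show "continuous_on {a..b} (\<lambda>t. Phi x0 c0 (u t) l)" by (rule continuous_on_compose2[OF _ cu]) simp
  fix c assume c: "c \<in> atlas M"
  have vd: "((\<lambda>s. coord c (Phi x0 c0 (u s) l)) has_vector_derivative Jac x0 c0 (u t) (u' t) l c) (at t within {a..b})"
    if "t \<in> {a..b}" "Phi x0 c0 (u t) l \<in> dom_of c" for t
    by (rule coord_Phi_curve_derivative[OF l charts_atI[OF c that(2)] u(1)[OF that(1)]])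
  show "(coord c \<circ> (\<lambda>t. Phi x0 c0 (u t) l)) differentiable (at t within {a..b})"
    if "t \<in> {a..b}" "Phi x0 c0 (u t) l \<in> dom_of c" for t
    using vd[OF that] unfolding o_def by (rule differentiableI_vector)
  let ?S = "{t \<in> {a..b}. Phi x0 c0 (u t) l \<in> dom_of c}"
  let ?V = "{w. Phi x0 c0 w l \<in> dom_of c}"
  obtain f' where f': "\<And>x. x \<in> ?V \<Longrightarrow> ((\<lambda>w. coord c (Phi x0 c0 w l)) has_derivative blinfun_apply (f' x)) (at x)" "continuous_on ?V f'"
    using C1_onE[OF coord_Phi_C1[OF l c]] by blast
  have "continuous_on ?S (\<lambda>t. blinfun_apply (f' (u t)) (u' t))"
    by (intro continuous_on_blinfun_apply continuous_on_compose2[OF f'(2)] continuous_on_subset[OF cu] continuous_on_subset[OF u(2)]) auto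
  then show "continuous_on ?S (\<lambda>t. vector_derivative (coord c \<circ> (\<lambda>t. Phi x0 c0 (u t) l)) (at t within {a..b}))"
  proof (rule continuous_on_eq)
    fix t assume t: "t \<in> ?S"
    then have t': "t \<in> {a..b}" "Phi x0 c0 (u t) l \<in> dom_of c" by auto
    have "blinfun_apply (f' (u t)) = (\<lambda>\<xi>. Jac x0 c0 (u t) \<xi> l c)"
      by (rule has_derivative_unique[OF f'(1) coord_Phi_derivative[OF c0 l charts_atI[OF c t'(2)]]]) (use t' in simp)
    moreover have "vector_derivative (\<lambda>s. coord c (Phi x0 c0 (u s) l)) (at t within {a..b}) = Jac x0 c0 (u t) (u' t) l c"
      by (rule vector_derivative_within_closed_interval[OF ab t'(1) vd[OF t']])
    ultimately show "blinfun_apply (f' (u t)) (u' t) = vector_derivative (coord c \<circ> (\<lambda>t. Phi x0 c0 (u t) l)) (at t within {a..b})"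
      unfolding o_def by simp
  qed
qed

end

end

section \<open>Lifting curves through the exponential map and comparing lengths\<close>

context hadamard
begin

context
  fixes x0 c0 assumes c0: "c0 \<in> charts_at M x0"
begin

abbreviation (input) "Ei \<equiv> Einv x0 c0"

text \<open>The chain rule applies chart by chart. The local derivatives agree because derivatives
  within a nondegenerate interval are unique, so a single \<open>u'\<close> is continuous
  everywhere.\<close>

lemma C1_curve_Einv:
  assumes ab: "a < b" and \<gamma>: "C1_curve_on M {a..b} \<gamma>"
  obtains u' where "\<And>t. t \<in> {a..b} \<Longrightarrow> ((\<lambda>t. Ei (\<gamma> t)) has_vector_derivative u' t) (at t within {a..b})"
    "continuous_on {a..b} u'"
proof -
  have c\<gamma>: "continuous_on {a..b} \<gamma>" using \<gamma> unfolding C1_curve_on_def by blast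
  have loc: "\<exists>G'. (\<forall>s\<in>{s \<in> {a..b}. \<gamma> s \<in> dom_of c}. ((\<lambda>t. Ei (\<gamma> t)) has_vector_derivative G' s) (at s within {a..b})) \<and>
      continuous_on {s \<in> {a..b}. \<gamma> s \<in> dom_of c} G'" if ca: "c \<in> atlas M" for c
  proof -
    let ?S = "{s \<in> {a..b}. \<gamma> s \<in> dom_of c}" and ?D = "coord c ` dom_of c"
    let ?v = "\<lambda>s. vector_derivative (\<lambda>s. coord c (\<gamma> s)) (at s within {a..b})"
    obtain B where B: "\<And>x. x \<in> ?D \<Longrightarrow> ((\<lambda>a. Ei (coord_inv c a)) has_derivative blinfun_apply (B x)) (at x)" "continuous_on ?D B"
      using C1_onE[OF Einv_C1[OF c0 ca]] by blast
    define G' where "G' s = blinfun_apply (B (coord c (\<gamma> s))) (?v s)" for s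
    have "continuous_on ?S ?v" using \<gamma> ca unfolding C1_curve_on_def o_def by blast
    moreover have "continuous_on ?S (\<lambda>s. coord c (\<gamma> s))"
      by (rule continuous_on_compose2[OF cont_coord[OF ca] continuous_on_subset[OF c\<gamma>]]) auto
    ultimately have "continuous_on ?S G'"
      unfolding G'_def by (intro continuous_on_blinfun_apply continuous_on_compose2[OF B(2)]) auto
    moreover have "((\<lambda>t. Ei (\<gamma> t)) has_vector_derivative G' s) (at s within {a..b})" if s: "s \<in> ?S" for s
    proof -
      have s': "s \<in> {a..b}" "c \<in> charts_at M (\<gamma> s)" using s charts_atI[OF ca] by auto
      have "((\<lambda>t. Ei (coord_inv c (coord c (\<gamma> t)))) has_derivative (\<lambda>h. blinfun_apply (B (coord c (\<gamma> s))) (h *\<^sub>R ?v s))) (at s within {a..b})"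
        by (rule has_derivative_compose[OF C1_curve_onD[OF \<gamma> s'(2,1), unfolded has_vector_derivative_def] B(1)])
          (use charts_atD(2)[OF s'(2)] in simp)
      then have "((\<lambda>t. Ei (\<gamma> t)) has_derivative (\<lambda>h. blinfun_apply (B (coord c (\<gamma> s))) (h *\<^sub>R ?v s))) (at s within {a..b})"
      proof (rule has_derivative_transform_eventually)
        have "continuous (at s within {a..b}) \<gamma>" using c\<gamma> s'(1) by (simp add: continuous_on_eq_continuous_within)
        from eventually_in_dom[where f = \<gamma> and z = s, OF s'(2) this]
        show "\<forall>\<^sub>F t in at s within {a..b}. Ei (coord_inv c (coord c (\<gamma> t))) = Ei (\<gamma> t)"
          by (rule eventually_mono) (simp add: coord_inv_coord[OF ca])
      qed (use s' coord_inv_coord[OF ca] s in auto)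
      then show ?thesis unfolding has_vector_derivative_def G'_def by (simp add: blinfun.scaleR_right)
    qed
    ultimately show ?thesis by blast
  qed
  define u' where "u' t = vector_derivative (\<lambda>t. Ei (\<gamma> t)) (at t within {a..b})" for t
  have u'_eq: "u' t = v" if "((\<lambda>t. Ei (\<gamma> t)) has_vector_derivative v) (at t within {a..b})" "t \<in> {a..b}" for t v
    unfolding u'_def by (rule vector_derivative_within_closed_interval[OF ab that(2) that(1)])
  have "((\<lambda>t. Ei (\<gamma> t)) has_vector_derivative u' t) (at t within {a..b}) \<and> continuous (at t within {a..b}) u'" if t: "t \<in> {a..b}" for t
  proof -
    obtain c where c: "c \<in> charts_at M (\<gamma> t)" using ex_chart by blast
    note ca = charts_atD(1)[OF c]
    let ?S = "{s \<in> {a..b}. \<gamma> s \<in> dom_of c}"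
    obtain G' where G': "\<And>s. s \<in> ?S \<Longrightarrow> ((\<lambda>t. Ei (\<gamma> t)) has_vector_derivative G' s) (at s within {a..b})" "continuous_on ?S G'"
      using loc[OF ca] by (elim exE conjE) (rule that, erule bspec, assumption, assumption)
    have tS: "t \<in> ?S" using t charts_atD(2)[OF c] by simp
    have "continuous_on ?S u'"
    proof (rule continuous_on_eq[OF G'(2)])
      fix s assume s: "s \<in> ?S"
      then have "s \<in> {a..b}" by simp
      from u'_eq[OF G'(1)[OF s] this] show "G' s = u' s" by (rule sym)
    qed
    from continuous_within_openin[OF C1_curve_chart_openin[OF c\<gamma> ca] tS this]
    show ?thesis using G'(1)[OF tS] u'_eq[OF G'(1)[OF tS] t] by simp
  qed
  then show thesis by (intro that[of u']) (simp_all add: continuous_on_eq_continuous_within)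
qed

lemma piecewise_C1_Einv:
  assumes "piecewise_C1_curve M \<gamma>"
  obtains S u' where "finite S" "\<And>t. t \<in> {0<..<1} - S \<Longrightarrow> ((\<lambda>t. Ei (\<gamma> t)) has_vector_derivative u' t) (at t)"
proof -
  obtain S where S: "finite S" "\<And>a b. 0 \<le> a \<Longrightarrow> a < b \<Longrightarrow> b \<le> 1 \<Longrightarrow> {a<..<b} \<inter> S = {} \<Longrightarrow> C1_curve_on M {a..b} \<gamma>"
    using assms unfolding piecewise_C1_curve_def by blast
  have "\<exists>v. ((\<lambda>t. Ei (\<gamma> t)) has_vector_derivative v) (at t)" if t: "t \<in> {0<..<1} - S" for t
  proof -
    obtain a b where ab: "0 \<le> a" "a < t" "t < b" "b \<le> 1" "{a<..<b} \<inter> S = {}" by (rule finite_gap_around[OF S(1) t])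
    have lt: "a < b" using ab by linarith
    obtain u' where u': "\<And>t. t \<in> {a..b} \<Longrightarrow> ((\<lambda>t. Ei (\<gamma> t)) has_vector_derivative u' t) (at t within {a..b})"
      by (rule C1_curve_Einv[OF lt S(2)[OF ab(1) lt ab(4,5)]]) (rule that; assumption)
    have "t \<in> {a..b}" using ab by simp
    from u'[OF this] show ?thesis unfolding at_within_Icc_at[OF ab(2,3)] by (rule exI)
  qed
  then have "\<forall>t. \<exists>v. t \<in> {0<..<1} - S \<longrightarrow> ((\<lambda>t. Ei (\<gamma> t)) has_vector_derivative v) (at t)" by blast
  from choice[OF this] obtain u' where u': "\<forall>t. t \<in> {0<..<1} - S \<longrightarrow> ((\<lambda>t. Ei (\<gamma> t)) has_vector_derivative u' t) (at t)" by (elim exE)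
  show thesis by (rule that[OF S(1)]) (rule u'[rule_format])
qed

lemma Jac_sq_eq_speed:
  assumes "0 \<le> l" "(u has_vector_derivative v) (at t)"
  shows "tnorm M (Phi x0 c0 (u t) l) (velocity M (\<lambda>s. Phi x0 c0 (u s) l) t) = sqrt (Jac_sq x0 c0 (u t) v l)"
  unfolding velocity_Phi_curve[OF c0 assms] tnorm_def Jac_sq_def ..

lemma Phi_1_Ei: "Phi x0 c0 (Ei y) 1 = y"
  using Emap_Einv[OF c0, of y] unfolding Emap_def .

text \<open>The lifted curve is paired with the fixed vector \<open>e\<close> from start to end: the
  integral of <u',e> is |e|^2 by the fundamental theorem, while Cauchy-Schwarz and
  \<open>Jac_expand\<close> bound it by the length times |e|. Only the scalar function
  <Ei(\<gamma>(t)),e> is integrated back.\<close>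

lemma curve_length_lower_bound:
  assumes \<gamma>: "piecewise_C1_curve M \<gamma>"
  shows "gnorm c0 (coord c0 x0) (Ei (\<gamma> 1) - Ei (\<gamma> 0)) \<le> curve_length M \<gamma>"
proof -
  let ?a = "coord c0 x0" and ?sp = "\<lambda>t. tnorm M (\<gamma> t) (velocity M \<gamma> t)"
  have a: "c0 \<in> atlas M" "?a \<in> coord c0 ` dom_of c0" using charts_atD[OF c0] by auto
  obtain S u' where S: "finite S" and u': "\<And>t. t \<in> {0<..<1} - S \<Longrightarrow> ((\<lambda>t. Ei (\<gamma> t)) has_vector_derivative u' t) (at t)"
    by (rule piecewise_C1_Einv[OF \<gamma>]) (rule that; assumption)
  define e where "e = Ei (\<gamma> 1) - Ei (\<gamma> 0)"
  have lin: "bounded_linear (\<lambda>v. gip c0 ?a v e)"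
    unfolding linear_conv_bounded_linear[symmetric] by (rule linearI) (simp_all add: gip_linear)
  have speed: "gnorm c0 ?a (u' t) \<le> ?sp t" if t: "t \<in> {0<..<1} - S" for t
  proof -
    have "sqrt (gip c0 ?a (u' t) (u' t)) \<le> sqrt (Jac_sq x0 c0 (Ei (\<gamma> t)) (u' t) 1)"
      by (intro real_sqrt_le_mono Jac_expand[OF c0 nonpos])
    also have "\<dots> = ?sp t"
      using Jac_sq_eq_speed[OF _ u'[OF t], of 1] by (simp add: Phi_1_Ei)
    finally show ?thesis unfolding gnorm_def .
  qed
  have c\<gamma>: "continuous_on {0..1} \<gamma>" using \<gamma> unfolding piecewise_C1_curve_def by blast
  have cu: "continuous_on {0..1} (\<lambda>t. Ei (\<gamma> t))"
    by (rule continuous_on_compose2[OF Einv_continuous[OF c0, of UNIV] c\<gamma>]) simp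
  have "((\<lambda>t. gip c0 ?a (u' t) e) has_integral (gip c0 ?a (Ei (\<gamma> 1)) e - gip c0 ?a (Ei (\<gamma> 0)) e)) {0..1}"
  proof (rule fundamental_theorem_of_calculus_interior_strong[OF S])
    fix t :: real assume t: "t \<in> {0<..<1} - S"
    show "((\<lambda>t. gip c0 ?a (Ei (\<gamma> t)) e) has_vector_derivative gip c0 ?a (u' t) e) (at t)"
      by (rule bounded_linear.has_vector_derivative[OF lin u'[OF t]])
  next
    show "continuous_on {0..1} (\<lambda>t. gip c0 ?a (Ei (\<gamma> t)) e)"
      by (rule bounded_linear.continuous_on[OF lin cu])
  qed simp
  moreover have "gip c0 ?a (Ei (\<gamma> 1)) e - gip c0 ?a (Ei (\<gamma> 0)) e = gip c0 ?a e e"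
    using linear_diff[OF bounded_linear.linear[OF lin], of "Ei (\<gamma> 1)" "Ei (\<gamma> 0)"] unfolding e_def[symmetric] by simp
  ultimately have i1: "((\<lambda>t. gip c0 ?a (u' t) e) has_integral gip c0 ?a e e) {0..1}" by simp
  have i2: "((\<lambda>t. ?sp t * gnorm c0 ?a e) has_integral (curve_length M \<gamma> * gnorm c0 ?a e)) {0..1}"
    unfolding curve_length_def by (intro has_integral_mult_left integrable_integral speed_integrable[OF \<gamma>])
  have "gip c0 ?a e e \<le> curve_length M \<gamma> * gnorm c0 ?a e"
  proof (rule has_integral_le_finite[OF _ i1 i2, of "S \<union> {0, 1}"])
    fix t :: real assume "t \<in> {0..1} - (S \<union> {0, 1})"
    then have t: "t \<in> {0<..<1} - S" by auto
    have "gip c0 ?a (u' t) e \<le> gnorm c0 ?a (u' t) * gnorm c0 ?a e" by (rule gip_le_gnorm[OF a])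
    also have "\<dots> \<le> ?sp t * gnorm c0 ?a e"
      by (intro mult_right_mono speed[OF t]) (simp add: gnorm_def gip_nonneg[OF a])
    finally show "gip c0 ?a (u' t) e \<le> ?sp t * gnorm c0 ?a e" .
  qed (use S in simp)
  moreover have "gip c0 ?a e e = gnorm c0 ?a e * gnorm c0 ?a e" by (simp add: gnorm_def gip_nonneg[OF a])
  ultimately have *: "gnorm c0 ?a e * gnorm c0 ?a e \<le> curve_length M \<gamma> * gnorm c0 ?a e" by simp
  show ?thesis
  proof (cases "gnorm c0 ?a e = 0")
    case True
    have z: "((\<lambda>t. 0) has_integral (0::real)) {0..1}" by (rule has_integral_0)
    have "0 \<le> integral {0..1} ?sp"
    proof (rule has_integral_le_finite[OF _ z integrable_integral[OF speed_integrable[OF \<gamma>]], of "S \<union> {0, 1}"])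
      fix t :: real assume "t \<in> {0..1} - (S \<union> {0, 1})"
      then have "t \<in> {0<..<1} - S" by auto
      from order_trans[OF gnorm_nonneg[OF a] speed[OF this]] show "0 \<le> ?sp t" .
    qed (use S in simp)
    then show ?thesis using True unfolding e_def curve_length_def by simp
  next
    case False
    then have "0 < gnorm c0 ?a e" using gnorm_nonneg[OF a, of e] by simp
    with * show ?thesis unfolding e_def by simp
  qed
qed

lemma piecewise_C1_contract:
  assumes \<gamma>: "piecewise_C1_curve M \<gamma>" and l: "0 \<le> l"
  shows "piecewise_C1_curve M (\<lambda>t. Phi x0 c0 (Ei (\<gamma> t)) l)"
proof -
  obtain S where S: "finite S" "\<And>a b. 0 \<le> a \<Longrightarrow> a < b \<Longrightarrow> b \<le> 1 \<Longrightarrow> {a<..<b} \<inter> S = {} \<Longrightarrow> C1_curve_on M {a..b} \<gamma>"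
    using \<gamma> unfolding piecewise_C1_curve_def by blast
  have c\<gamma>: "continuous_on {0..1} \<gamma>" using \<gamma> unfolding piecewise_C1_curve_def by blast
  show ?thesis
    unfolding piecewise_C1_curve_def
  proof (intro conjI exI[of _ S] allI impI S(1))
    have cu: "continuous_on {0..1} (\<lambda>t. Ei (\<gamma> t))"
      by (rule continuous_on_compose2[OF Einv_continuous[OF c0, of UNIV] c\<gamma>]) simp
    have "continuous_on UNIV (\<lambda>w. Phi x0 c0 w l)"
      using Phi_isCont[OF c0 l] continuous_at_imp_continuous_on by blast
    then show "continuous_on {0..1} (\<lambda>t. Phi x0 c0 (Ei (\<gamma> t)) l)" by (rule continuous_on_compose2[OF _ cu]) simp
    fix a b :: real assume ab: "0 \<le> a \<and> a < b \<and> b \<le> 1 \<and> {a<..<b} \<inter> S = {}"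
    then have lt: "a < b" and C: "C1_curve_on M {a..b} \<gamma>" using S(2)[of a b] by simp_all
    show "C1_curve_on M {a..b} (\<lambda>t. Phi x0 c0 (Ei (\<gamma> t)) l)"
      by (rule C1_curve_Einv[OF lt C]) (rule C1_curve_Phi[OF c0 lt l]; assumption)
  qed
qed

text \<open>For one and the same variation, the speeds of the contracted and of the original curve
  are the lengths of a Jacobi field at the times \<open>l\<close> and 1, compared by
  \<open>Jac_contract\<close>.\<close>

lemma curve_length_contract:
  assumes \<gamma>: "piecewise_C1_curve M \<gamma>" and l: "0 < l" "l \<le> 1"
  shows "curve_length M (\<lambda>t. Phi x0 c0 (Ei (\<gamma> t)) l) \<le> l * curve_length M \<gamma>"
proof -
  let ?\<delta> = "\<lambda>t. Phi x0 c0 (Ei (\<gamma> t)) l"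
  have l0: "0 \<le> l" using l by simp
  obtain S u' where S: "finite S" and u': "\<And>t. t \<in> {0<..<1} - S \<Longrightarrow> ((\<lambda>t. Ei (\<gamma> t)) has_vector_derivative u' t) (at t)"
    by (rule piecewise_C1_Einv[OF \<gamma>]) (rule that; assumption)
  have i1: "((\<lambda>t. tnorm M (?\<delta> t) (velocity M ?\<delta> t)) has_integral curve_length M ?\<delta>) {0..1}"
    unfolding curve_length_def by (intro integrable_integral speed_integrable piecewise_C1_contract \<gamma> l0)
  have i2: "((\<lambda>t. l * tnorm M (\<gamma> t) (velocity M \<gamma> t)) has_integral l * curve_length M \<gamma>) {0..1}"
    unfolding curve_length_def by (intro has_integral_mult_right integrable_integral speed_integrable[OF \<gamma>])
  show ?thesis
  proof (rule has_integral_le_finite[OF _ i1 i2, of "S \<union> {0, 1}"])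
    fix t :: real assume "t \<in> {0..1} - (S \<union> {0, 1})"
    then have t: "t \<in> {0<..<1} - S" by auto
    have "tnorm M (?\<delta> t) (velocity M ?\<delta> t) = sqrt (Jac_sq x0 c0 (Ei (\<gamma> t)) (u' t) l)"
      by (rule Jac_sq_eq_speed[OF l0 u'[OF t]])
    also have "\<dots> \<le> l * sqrt (Jac_sq x0 c0 (Ei (\<gamma> t)) (u' t) 1)" by (rule Jac_contract[OF c0 nonpos l])
    also have "sqrt (Jac_sq x0 c0 (Ei (\<gamma> t)) (u' t) 1) = tnorm M (\<gamma> t) (velocity M \<gamma> t)"
      using Jac_sq_eq_speed[OF _ u'[OF t], of 1] by (simp add: Phi_1_Ei)
    finally show "tnorm M (?\<delta> t) (velocity M ?\<delta> t) \<le> l * tnorm M (\<gamma> t) (velocity M \<gamma> t)" .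
  qed (use S in simp)
qed

lemma piecewise_C1_segment: "piecewise_C1_curve M (\<lambda>t. Phi x0 c0 (w + t *\<^sub>R e) 1)"
proof -
  have d: "((\<lambda>t. w + t *\<^sub>R e) has_vector_derivative e) (at t within T)" for t T
    by (rule has_vector_derivative_eq_rhs, (rule derivative_intros)+) simp
  have C1: "C1_curve_on M {a..b} (\<lambda>t. Phi x0 c0 (w + t *\<^sub>R e) 1)" if "a < b" for a b
    by (rule C1_curve_Phi[where u' = "\<lambda>_. e", OF c0 that]) (simp_all add: d continuous_on_const)
  have "continuous_on {0..1} (\<lambda>t. Phi x0 c0 (w + t *\<^sub>R e) 1)"
    using C1[of 0 1] unfolding C1_curve_on_def by simp
  then show ?thesis unfolding piecewise_C1_curve_def by (intro conjI exI[of _ "{}"]) (simp_all add: C1)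
qed

text \<open>The image of a segment under \<open>exp\<close>. It makes the infimum defining
  \<open>rdist\<close> range over a nonempty set.\<close>

lemma ex_curve: "\<exists>\<gamma>. piecewise_C1_curve M \<gamma> \<and> \<gamma> 0 = y \<and> \<gamma> 1 = z"
  using piecewise_C1_segment[of "Ei y" "Ei z - Ei y"]
  by (intro exI[of _ "\<lambda>t. Phi x0 c0 (Ei y + t *\<^sub>R (Ei z - Ei y)) 1"]) (simp add: Phi_1_Ei)

lemma le_rdist:
  assumes "\<And>\<gamma>. piecewise_C1_curve M \<gamma> \<Longrightarrow> \<gamma> 0 = y \<Longrightarrow> \<gamma> 1 = z \<Longrightarrow> m \<le> curve_length M \<gamma>"
  shows "m \<le> rdist M y z"
  unfolding rdist_def
proof (rule cInf_greatest)
  show "{curve_length M \<gamma> |\<gamma>. piecewise_C1_curve M \<gamma> \<and> \<gamma> 0 = y \<and> \<gamma> 1 = z} \<noteq> {}"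
    using ex_curve[of y z] by blast
qed (elim CollectE exE conjE, simp add: assms)

lemma rdist_le:
  assumes "piecewise_C1_curve M \<gamma>" "\<gamma> 0 = y" "\<gamma> 1 = z"
  shows "rdist M y z \<le> curve_length M \<gamma>"
  unfolding rdist_def
proof (rule cInf_lower)
  show "bdd_below {curve_length M \<gamma> |\<gamma>. piecewise_C1_curve M \<gamma> \<and> \<gamma> 0 = y \<and> \<gamma> 1 = z}"
  proof (rule bdd_belowI[of _ 0])
    fix m assume "m \<in> {curve_length M \<gamma> |\<gamma>. piecewise_C1_curve M \<gamma> \<and> \<gamma> 0 = y \<and> \<gamma> 1 = z}"
    then obtain \<sigma> where "m = curve_length M \<sigma>" "piecewise_C1_curve M \<sigma>" by blast
    with order_trans[OF gnorm_nonneg curve_length_lower_bound] charts_atD[OF c0] show "0 \<le> m" by blast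
  qed
qed (use assms in blast)

lemma rdist_ge_gnorm: "gnorm c0 (coord c0 x0) (Ei z - Ei y) \<le> rdist M y z"
  by (rule le_rdist) (use curve_length_lower_bound in blast)

lemma rdist_Phi_contract:
  assumes l: "0 < l" "l \<le> 1"
  shows "rdist M (Phi x0 c0 (Ei y) l) (Phi x0 c0 (Ei z) l) \<le> l * rdist M y z"
proof -
  have "rdist M (Phi x0 c0 (Ei y) l) (Phi x0 c0 (Ei z) l) / l \<le> rdist M y z"
  proof (rule le_rdist)
    fix \<gamma> assume \<gamma>: "piecewise_C1_curve M \<gamma>" "\<gamma> 0 = y" "\<gamma> 1 = z"
    have "rdist M (Phi x0 c0 (Ei y) l) (Phi x0 c0 (Ei z) l) \<le> curve_length M (\<lambda>t. Phi x0 c0 (Ei (\<gamma> t)) l)"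
      by (rule rdist_le[OF piecewise_C1_contract[OF \<gamma>(1)]]) (use l \<gamma> in simp_all)
    also have "\<dots> \<le> l * curve_length M \<gamma>" by (rule curve_length_contract[OF \<gamma>(1) l])
    finally show "rdist M (Phi x0 c0 (Ei y) l) (Phi x0 c0 (Ei z) l) / l \<le> curve_length M \<gamma>"
      using l by (simp add: field_simps)
  qed
  then show ?thesis using l by (simp add: field_simps)
qed

text \<open>The geodesic from \<open>x0\<close> to \<open>y\<close> has constant speed and gives the
  upper bound; the lower bound is the expansion estimate from the origin, since
  \<open>Ei x0 = 0\<close>.\<close>

lemma rdist_eq_gnorm: "rdist M x0 y = gnorm c0 (coord c0 x0) (Ei y)"
proof (rule antisym)
  let ?\<gamma> = "Phi x0 c0 (Ei y)"
  have eq: "(\<lambda>t. Phi x0 c0 (0 + t *\<^sub>R Ei y) 1) = ?\<gamma>" by (simp add: fun_eq_iff Phi_scale[OF c0])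
  have "rdist M x0 y \<le> curve_length M ?\<gamma>"
    by (rule rdist_le[OF piecewise_C1_segment[of 0 "Ei y", unfolded eq]]) (simp_all add: Phi_props[OF c0] Phi_1_Ei)
  also have "curve_length M ?\<gamma> = tnorm M x0 (lift_vec M c0 x0 (Ei y))"
    unfolding curve_length_def geodesic_speed_constant[OF Phi_props(1)[OF c0]] Phi_props[OF c0] by simp
  also have "\<dots> = gnorm c0 (coord c0 x0) (Ei y)"
    using tnorm_chart[OF lift_vec_tangent[OF c0] c0] by (simp add: lift_vec_apply[OF c0] gnorm_def)
  finally show "rdist M x0 y \<le> gnorm c0 (coord c0 x0) (Ei y)" .
  have "Ei x0 = 0" using Einv_Emap[OF c0, of 0] by (simp add: Emap_0[OF c0])
  then show "gnorm c0 (coord c0 x0) (Ei y) \<le> rdist M x0 y" using rdist_ge_gnorm[of y x0] by simp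
qed

end

subsection \<open>The distance function\<close>

text \<open>Distances from \<open>x\<close> are norms in the tangent space at \<open>x\<close>,
  where the triangle inequality holds, and the expansion estimate bounds the norm of the difference
  by \<open>rdist M y z\<close>. Symmetry and the triangle inequality for \<open>rdist\<close>
  follow formally from this one estimate, without reversing or joining curves.\<close>

lemma rdist_abs_diff: "\<bar>rdist M x y - rdist M x z\<bar> \<le> rdist M y z"
proof -
  obtain c where c: "c \<in> charts_at M x" using ex_chart by blast
  note a = charts_atD(1)[OF c] imageI[OF charts_atD(2)[OF c], of "coord c"]
  let ?N = "gnorm c (coord c x)"
  have "?N (Einv x c y) \<le> ?N (Einv x c z) + ?N (Einv x c y - Einv x c z)"
    "?N (Einv x c z) \<le> ?N (Einv x c y) + ?N (Einv x c z - Einv x c y)"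
    by (rule gnorm_triangle[OF a])+
  moreover have "?N (Einv x c y - Einv x c z) = ?N (Einv x c z - Einv x c y)"
    unfolding gnorm_def by (simp add: gip_linear)
  moreover have "?N (Einv x c z - Einv x c y) \<le> rdist M y z" by (rule rdist_ge_gnorm[OF c])
  ultimately show ?thesis unfolding rdist_eq_gnorm[OF c] by linarith
qed

lemma rdist_self: "rdist M x x = 0"
proof -
  obtain c where c: "c \<in> charts_at M x" using ex_chart by blast
  have "Einv x c x = 0" using Einv_Emap[OF c, of 0] by (simp add: Emap_0[OF c])
  then show ?thesis unfolding rdist_eq_gnorm[OF c] gnorm_def using gip_linear(1)[of c "coord c x" 0 0 0] by (simp add: gip_linear)
qed

lemma rdist_nonneg: "0 \<le> rdist M x y"
  using rdist_abs_diff[of x x y] by (simp add: rdist_self)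

lemma rdist_sym: "rdist M x y = rdist M y x"
proof -
  have "rdist M x y \<le> rdist M y x" for x y
    using rdist_abs_diff[of x y x] by (simp add: rdist_self)
  then show ?thesis by (intro antisym)
qed

lemma rdist_triangle: "rdist M x z \<le> rdist M x y + rdist M y z"
  using rdist_abs_diff[of x z y] rdist_sym[of z y] by linarith

lemma rexp_Emap:
  assumes "c \<in> charts_at M x" "v \<in> tangent_space M x"
  shows "rexp M x v = Emap x c (v c)"
  unfolding rexp_gd Emap_def Phi_def lift_vec_of_tangent[OF assms] ..

lemma rexp_bij: "bij_betw (rexp M x) (tangent_space M x) UNIV"
proof -
  obtain c where c: "c \<in> charts_at M x" using ex_chart by blast
  show ?thesis
  proof (rule bij_betw_imageI)
    show "inj_on (rexp M x) (tangent_space M x)"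
    proof (rule inj_onI)
      fix u v assume uv: "u \<in> tangent_space M x" "v \<in> tangent_space M x" and eq: "rexp M x u = rexp M x v"
      have "u c = v c" by (rule Emap_inj[OF c]) (use eq in \<open>simp add: rexp_Emap[OF c] uv\<close>)
      then show "u = v" by (rule tangent_space_eqI[OF uv c])
    qed
    have "y \<in> rexp M x ` tangent_space M x" for y
    proof (rule image_eqI)
      show t: "lift_vec M c x (Einv x c y) \<in> tangent_space M x" by (rule lift_vec_tangent[OF c])
      show "y = rexp M x (lift_vec M c x (Einv x c y))"
        unfolding rexp_Emap[OF c t] lift_vec_apply[OF c] by (simp add: Emap_Einv[OF c])
    qed
    then show "rexp M x ` tangent_space M x = UNIV" by blast
  qed
qed

lemma rexp_inv_tangent: "rexp_inv M x y \<in> tangent_space M x"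
  and rexp_rexp_inv: "rexp M x (rexp_inv M x y) = y"
proof -
  have "y \<in> rexp M x ` tangent_space M x" using bij_betw_imp_surj_on[OF rexp_bij] by simp
  from inv_into_into[OF this] f_inv_into_f[OF this]
  show "rexp_inv M x y \<in> tangent_space M x" "rexp M x (rexp_inv M x y) = y" unfolding rexp_inv_def by simp_all
qed

lemma rdist_rexp:
  assumes v: "v \<in> tangent_space M x"
  shows "rdist M x (rexp M x v) = tnorm M x v"
proof -
  obtain c where c: "c \<in> charts_at M x" using ex_chart by blast
  show ?thesis unfolding rdist_eq_gnorm[OF c] rexp_Emap[OF c v] Einv_Emap[OF c] gnorm_def tnorm_chart[OF v c] ..
qed

lemma tnorm_rexp_inv: "tnorm M x (rexp_inv M x y) = rdist M x y"
  using rdist_rexp[OF rexp_inv_tangent[of x y]] by (simp add: rexp_rexp_inv)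

lemma rdist_eq_0D:
  assumes "rdist M x y = 0" shows "y = x"
proof -
  have "rexp_inv M x y = tzero" using assms tnorm_eq_0_iff[OF rexp_inv_tangent[of x y]] by (simp add: tnorm_rexp_inv)
  moreover have "rexp M x tzero = x"
    using rdist_self
    using gd_tscale[OF tzero_tangent, of x 0 1] gd_props(2)[OF tzero_tangent, of x] unfolding rexp_gd by (simp add: tscale_def tzero_def)
  ultimately show ?thesis using rexp_rexp_inv[of x y] by simp
qed

lemma rdist_geodesic:
  assumes g: "geodesic M \<gamma>"
  shows "rdist M (\<gamma> s) (\<gamma> t) = \<bar>t - s\<bar> * tnorm M (\<gamma> 0) (velocity M \<gamma> 0)"
proof -
  note v = geodesic_velocity_tangent[OF g, of s]
  have "\<gamma> t = rexp M (\<gamma> s) (tscale (t - s) (velocity M \<gamma> s))" unfolding rexp_gd gd_shift[OF g] by simp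
  then show ?thesis
    using rdist_rexp[OF tscale_tangent[OF v], of "t - s"] tnorm_tscale[OF v, of "t - s"] geodesic_speed_constant[OF g, of s] by simp
qed

text \<open>The expansion estimate for the vectors scaled by \<open>t\<close>: rays from one point
  diverge at least linearly.\<close>

lemma rdist_rays_ge:
  assumes uv: "u \<in> tangent_space M x" "v \<in> tangent_space M x" and c: "c \<in> charts_at M x" and t: "0 \<le> t"
  shows "t * gnorm c (coord c x) (v c - u c) \<le> rdist M (gd x u t) (gd x v t)"
proof -
  have "gd x w t = Emap x c (t *\<^sub>R w c)" if "w \<in> tangent_space M x" for w
    using rexp_Emap[OF c tscale_tangent[OF that, of t]] by (simp add: rexp_gd gd_tscale[OF that]) (simp add: tscale_def)
  then have "gnorm c (coord c x) (t *\<^sub>R v c - t *\<^sub>R u c) \<le> rdist M (gd x u t) (gd x v t)"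
    using rdist_ge_gnorm[OF c, of "gd x v t" "gd x u t"] by (simp add: uv Einv_Emap[OF c])
  moreover have "gnorm c (coord c x) (t *\<^sub>R v c - t *\<^sub>R u c) = t * gnorm c (coord c x) (v c - u c)"
    using t by (simp add: gnorm_scale flip: scaleR_diff_right)
  ultimately show ?thesis by simp
qed

lemma rdist_contract:
  assumes uv: "u \<in> tangent_space M x" "v \<in> tangent_space M x" and l: "0 \<le> l" "l \<le> 1"
  shows "rdist M (rexp M x (tscale l u)) (rexp M x (tscale l v)) \<le> l * rdist M (rexp M x u) (rexp M x v)"
proof (cases "l = 0")
  case True
  then show ?thesis by (simp add: rexp_gd gd_tscale uv gd_props rdist_self)
next
  case False
  obtain c where c: "c \<in> charts_at M x" using ex_chart by blast
  have "Phi x c (Einv x c (rexp M x w)) l = rexp M x (tscale l w)" if w: "w \<in> tangent_space M x" for w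
    unfolding rexp_Emap[OF c w] Einv_Emap[OF c] unfolding rexp_gd gd_tscale[OF w] Phi_def lift_vec_of_tangent[OF c w] by simp
  with rdist_Phi_contract[OF c, of l "rexp M x u" "rexp M x v"] False l show ?thesis by (simp add: uv)
qed

lemma rdist_continuous: "continuous_on S (rdist M x)"
proof -
  obtain c where c: "c \<in> charts_at M x" using ex_chart by blast
  have "continuous_on S (\<lambda>y. sqrt (gip c (coord c x) (Einv x c y) (Einv x c y)))"
    by (intro continuous_on_real_sqrt continuous_on_gip[OF charts_atD(1)[OF c]] Einv_continuous[OF c] continuous_on_const)
      (use charts_atD(2)[OF c] in auto)
  then show ?thesis using rdist_eq_gnorm[OF c] unfolding gnorm_def by (simp cong: continuous_on_cong)
qed

end

section \<open>Asymptotic rays\<close>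

context hadamard
begin

text \<open>Seen from the common point, both curves are rays run backwards, with velocities scaled
  by \<open>a\<close> and \<open>b\<close> so that they reach time 0 at parameter 1. This is the
  contraction in a form suited to comparing geodesics at different times.\<close>

lemma geodesics_meeting_contract:
  assumes g: "geodesic M \<gamma>" "geodesic M \<sigma>" and eq: "\<gamma> a = \<sigma> b" and l: "0 \<le> l" "l \<le> 1"
  shows "rdist M (\<gamma> (a - l * a)) (\<sigma> (b - l * b)) \<le> l * rdist M (\<gamma> 0) (\<sigma> 0)"
proof -
  let ?q = "\<gamma> a"
  have u: "tscale (- a) (velocity M \<gamma> a) \<in> tangent_space M ?q"
    by (rule tscale_tangent[OF geodesic_velocity_tangent[OF g(1)]])
  have v: "tscale (- b) (velocity M \<sigma> b) \<in> tangent_space M ?q"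
    unfolding eq by (rule tscale_tangent[OF geodesic_velocity_tangent[OF g(2)]])
  have e1: "rexp M ?q (tscale r (tscale (- a) (velocity M \<gamma> a))) = \<gamma> (a - r * a)" for r
    unfolding rexp_gd gd_tscale[OF u] gd_shift[OF g(1)] by (simp add: algebra_simps)
  have e2: "rexp M ?q (tscale r (tscale (- b) (velocity M \<sigma> b))) = \<sigma> (b - r * b)" for r
    unfolding rexp_gd gd_tscale[OF v] unfolding eq gd_shift[OF g(2)] by (simp add: algebra_simps)
  have t1: "tscale 1 w = w" for w :: "('m, 'n) tvec" by (simp add: tscale_def)
  show ?thesis using rdist_contract[OF u v l] e1[of 1] e2[of 1] by (simp add: t1 e1 e2)
qed

lemma gd_unit_speed:
  assumes "u \<in> unit_tangent M x"
  shows "rdist M (gd x u s) (gd x u t) = \<bar>t - s\<bar>"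
  using assms rdist_geodesic[OF gd_props(1), of u x s t] gd_props[of u x] unfolding unit_tangent_def by simp

text \<open>The segment from \<open>x\<close> to \<open>\<gamma> T\<close> has length
  \<open>?L\<close>, which differs from \<open>T\<close> by at most \<open>?D\<close>. Contraction
  compares \<open>\<gamma> t\<close> with its point at parameter \<open>?L * t / T\<close>, at a
  cost of \<open>?D\<close>; passing to unit speed costs at most another \<open>?D\<close>. The
  bound on \<open>T\<close> makes \<open>?L\<close> positive.\<close>

lemma ray_towards_point:
  assumes g: "geodesic M \<gamma>" and sp: "tnorm M (\<gamma> 0) (velocity M \<gamma> 0) = 1" and T: "rdist M x (\<gamma> 0) < T"
  shows "\<exists>u\<in>unit_tangent M x. \<forall>t\<in>{0..T}. rdist M (\<gamma> t) (gd x u t) \<le> 2 * rdist M x (\<gamma> 0)"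
proof -
  let ?D = "rdist M x (\<gamma> 0)" and ?L = "rdist M x (\<gamma> T)"
  define w where "w = rexp_inv M x (\<gamma> T)"
  have w: "w \<in> tangent_space M x" unfolding w_def by (rule rexp_inv_tangent)
  have T0: "0 < T" using T rdist_nonneg[of x "\<gamma> 0"] by linarith
  have d: "rdist M (\<gamma> 0) (\<gamma> T) = T" using rdist_geodesic[OF g, of 0 T] sp T0 by simp
  have L: "\<bar>?L - T\<bar> \<le> ?D" using rdist_abs_diff[of "\<gamma> T" x "\<gamma> 0"] d
    by (simp add: rdist_sym[of "\<gamma> T"])
  then have L0: "0 < ?L" using T by linarith
  define u where "u = tscale (1 / ?L) w"
  have u: "u \<in> unit_tangent M x"
    unfolding unit_tangent_def u_def using tscale_tangent[OF w] L0 tnorm_tscale[OF w] tnorm_rexp_inv[of x "\<gamma> T"]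
    by (simp add: w_def)
  then have ut: "u \<in> tangent_space M x" unfolding unit_tangent_def by simp
  have fin: "gd x u ?L = \<gamma> T"
    unfolding u_def gd_tscale[OF w] using L0 rexp_rexp_inv[of x "\<gamma> T"] by (simp add: w_def rexp_gd)
  have "rdist M (\<gamma> t) (gd x u t) \<le> 2 * ?D" if t: "t \<in> {0..T}" for t
  proof -
    define l where "l = 1 - t / T"
    have l: "0 \<le> l" "l \<le> 1" using t T0 by (simp_all add: l_def)
    have s: "T - l * T = t" "?L - l * ?L = ?L * t / T" using T0 by (simp_all add: l_def field_simps)
    have "rdist M (\<gamma> t) (gd x u (?L * t / T)) \<le> l * rdist M (\<gamma> 0) (gd x u 0)"
      using geodesics_meeting_contract[OF g gd_props(1)[OF ut] fin[symmetric] l] unfolding s .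
    also have "\<dots> \<le> 1 * ?D"
      by (intro mult_mono l) (simp_all add: gd_props[OF ut] rdist_sym[of x] rdist_nonneg)
    finally have 1: "rdist M (\<gamma> t) (gd x u (?L * t / T)) \<le> ?D" by simp
    have "rdist M (gd x u (?L * t / T)) (gd x u t) = \<bar>t - ?L * t / T\<bar>" by (rule gd_unit_speed[OF u])
    also have "t - ?L * t / T = (T - ?L) * (t / T)" using T0 by (simp add: field_simps)
    also have "\<bar>\<dots>\<bar> = \<bar>?L - T\<bar> * (t / T)" using t T0 by (simp add: abs_mult abs_minus_commute)
    also have "\<dots> \<le> ?D * 1" by (intro mult_mono L) (use t T0 in \<open>simp_all add: rdist_nonneg\<close>)
    finally show ?thesis using 1 rdist_triangle[of "\<gamma> t" "gd x u t" "gd x u (?L * t / T)"] by simp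
  qed
  with u show ?thesis by blast
qed

lemma compact_unit_vectors:
  assumes "c \<in> atlas M" "a \<in> coord c ` dom_of c"
  shows "compact {w. gip c a w w = 1}"
proof -
  have "continuous_on UNIV (\<lambda>w. gip c a w w)"
    by (rule continuous_on_gip[OF assms(1)]) (use assms(2) in \<open>auto intro: continuous_on_const continuous_on_id\<close>)
  then have "closed {w. gip c a w w = 1}" by (rule closed_Collect_eq[OF _ continuous_on_const])
  moreover obtain m where m: "m > 0" "\<And>v. m * (norm v)\<^sup>2 \<le> gip c a v v"
    using gip_lower_bound[OF assms] by blast
  have "norm w \<le> sqrt (1 / m)" if "gip c a w w = 1" for w
    using m(2)[of w] that m(1) by (intro real_le_rsqrt) (simp add: field_simps)
  then have "bounded {w. gip c a w w = 1}" unfolding bounded_iff by blast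
  ultimately show ?thesis by (simp add: compact_eq_bounded_closed)
qed

lemma gd_lift_vec_continuous:
  assumes c: "c \<in> charts_at M x" shows "isCont (\<lambda>w. gd x (lift_vec M c x w) t) w"
proof -
  have "gd x (lift_vec M c x w) t = Emap x c (t *\<^sub>R w)" for w
    unfolding Emap_def Phi_scale[OF c] unfolding Phi_def by simp
  moreover have "continuous_on UNIV (\<lambda>w. Emap x c (t *\<^sub>R w))"
    by (rule continuous_on_compose2[OF Emap_continuous[OF c, of UNIV]]) (simp_all add: continuous_on_scaleR)
  ultimately show ?thesis by (simp add: continuous_on_eq_continuous_at)
qed

lemma asymptotic_ray_exists:
  assumes g: "geodesic M \<gamma>" and sp: "tnorm M (\<gamma> 0) (velocity M \<gamma> 0) = 1"
  shows "\<exists>u\<in>unit_tangent M x. asymptotic M \<gamma> (geodesic_ray M x u)"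
proof -
  let ?D = "rdist M x (\<gamma> 0)"
  obtain c where c: "c \<in> charts_at M x" using ex_chart by blast
  let ?a = "coord c x"
  have a: "c \<in> atlas M" "?a \<in> coord c ` dom_of c" using charts_atD[OF c] by auto
  \<comment> \<open>These times exceed \<open>?D\<close>, as \<open>ray_towards_point\<close>
    requires, and tend to infinity, so that every fixed \<open>t\<close> is eventually
    covered.\<close>
  have "\<exists>u. u \<in> unit_tangent M x \<and> (\<forall>t\<in>{0..?D + 1 + real n}. rdist M (\<gamma> t) (gd x u t) \<le> 2 * ?D)" for n
    using ray_towards_point[OF g sp, of x "?D + 1 + real n"] by auto
  then have "\<forall>n. \<exists>u. u \<in> unit_tangent M x \<and> (\<forall>t\<in>{0..?D + 1 + real n}. rdist M (\<gamma> t) (gd x u t) \<le> 2 * ?D)" ..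
  from choice[OF this] obtain U where
    U0: "\<forall>n. U n \<in> unit_tangent M x \<and> (\<forall>t\<in>{0..?D + 1 + real n}. rdist M (\<gamma> t) (gd x (U n) t) \<le> 2 * ?D)"
    by (elim exE)
  have U: "U n \<in> unit_tangent M x"
    "t \<in> {0..?D + 1 + real n} \<Longrightarrow> rdist M (\<gamma> t) (gd x (U n) t) \<le> 2 * ?D" for n t
    using U0[rule_format, of n] by simp_all
  have Ut: "U n \<in> tangent_space M x" for n using U(1) unfolding unit_tangent_def by simp
  have "\<forall>n. U n c \<in> {w. gip c ?a w w = 1}"
    using U(1) tnorm_chart[OF Ut c] unfolding unit_tangent_def by simp
  then obtain w r where w: "gip c ?a w w = 1" and r: "strict_mono r" and lim: "((\<lambda>n. U n c) \<circ> r) \<longlonglongrightarrow> w"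
    using compact_unit_vectors[OF a, unfolded compact_def, rule_format, of "\<lambda>n. U n c"] by auto
  define u where "u = lift_vec M c x w"
  have ut: "u \<in> tangent_space M x" unfolding u_def by (rule lift_vec_tangent[OF c])
  have uu: "u \<in> unit_tangent M x"
    unfolding unit_tangent_def using ut tnorm_chart[OF ut c] w by (simp add: u_def lift_vec_apply[OF c])
  have "rdist M (\<gamma> t) (gd x u t) \<le> 2 * ?D" if t: "0 \<le> t" for t
  proof -
    have "isCont (\<lambda>w. rdist M (\<gamma> t) (gd x (lift_vec M c x w) t)) w"
      by (rule isCont_o2[OF gd_lift_vec_continuous[OF c]])
        (use rdist_continuous[of UNIV "\<gamma> t"] in \<open>simp add: continuous_on_eq_continuous_at\<close>)
    from isCont_tendsto_compose[OF this lim]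
    have "(\<lambda>n. rdist M (\<gamma> t) (gd x (U (r n)) t)) \<longlonglongrightarrow> rdist M (\<gamma> t) (gd x u t)"
      by (simp add: lift_vec_of_tangent[OF c Ut] u_def)
    moreover have "\<forall>n\<ge>nat \<lceil>t\<rceil>. rdist M (\<gamma> t) (gd x (U (r n)) t) \<le> 2 * ?D"
    proof (intro allI impI U(2))
      fix n assume "nat \<lceil>t\<rceil> \<le> n"
      moreover have "n \<le> r n" by (rule seq_suble[OF r])
      ultimately have "t \<le> real (r n)" by linarith
      then show "t \<in> {0..?D + 1 + real (r n)}" using t rdist_nonneg[of x "\<gamma> 0"] by simp
    qed
    ultimately show ?thesis by (intro LIMSEQ_le_const2) blast+
  qed
  then have "asymptotic M \<gamma> (geodesic_ray M x u)"
    unfolding asymptotic_def bounded_iff geodesic_ray_gd[OF ut]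
    by (intro exI[of _ "2 * ?D"]) (simp add: rdist_nonneg)
  with uu show ?thesis by blast
qed

lemma asymptotic_sym: "asymptotic M \<gamma> \<sigma> \<Longrightarrow> asymptotic M \<sigma> \<gamma>"
  unfolding asymptotic_def by (simp add: rdist_sym)

lemma asymptotic_unique:
  assumes uv: "u \<in> tangent_space M x" "v \<in> tangent_space M x"
    and as: "asymptotic M \<gamma> (geodesic_ray M x u)" "asymptotic M \<gamma> (geodesic_ray M x v)"
  shows "u = v"
proof -
  obtain c where c: "c \<in> charts_at M x" using ex_chart by blast
  let ?N = "gnorm c (coord c x)"
  have a: "c \<in> atlas M" "coord c x \<in> coord c ` dom_of c" using charts_atD[OF c] by auto
  obtain B where B: "\<And>t. 0 \<le> t \<Longrightarrow> rdist M (\<gamma> t) (gd x u t) \<le> B"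
    using as(1) unfolding asymptotic_def bounded_iff geodesic_ray_gd[OF uv(1)] by (fastforce simp: rdist_nonneg)
  obtain C where C: "\<And>t. 0 \<le> t \<Longrightarrow> rdist M (\<gamma> t) (gd x v t) \<le> C"
    using as(2) unfolding asymptotic_def bounded_iff geodesic_ray_gd[OF uv(2)] by (fastforce simp: rdist_nonneg)
  have bd: "t * ?N (v c - u c) \<le> B + C" if t: "0 \<le> t" for t
    using rdist_rays_ge[OF uv c t] rdist_triangle[of "gd x u t" "gd x v t" "\<gamma> t"] B[OF t] C[OF t]
    by (simp add: rdist_sym[of "gd x u t" "\<gamma> t"])
  have "?N (v c - u c) = 0"
  proof (rule ccontr)
    assume "?N (v c - u c) \<noteq> 0"
    then have pos: "0 < ?N (v c - u c)" using gnorm_nonneg[OF a, of "v c - u c"] by simp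
    have BC: "0 \<le> B + C" using bd[of 0] by simp
    \<comment> \<open>The time at which linear divergence exceeds the bound
      \<open>B + C\<close>.\<close>
    have "((B + C + 1) / ?N (v c - u c)) * ?N (v c - u c) \<le> B + C"
      by (rule bd) (use pos BC in simp)
    then show False using pos by simp
  qed
  then have "v c - u c = 0" using gip_pos[OF a, of "v c - u c"] unfolding gnorm_def by fastforce
  then show ?thesis by (intro tangent_space_eqI[OF uv c]) simp
qed

section \<open>Busemann subgradients\<close>

lemma tscale_tscale: "tscale r (tscale s v) = tscale (r * s) v"
  by (simp add: tscale_def)

lemma tscale_1: "tscale 1 v = v"
  by (simp add: tscale_def)

lemma eta_pt_unit:
  assumes "y \<noteq> p" shows "eta_pt M p y \<in> unit_tangent M p"
proof -
  have "0 < rdist M p y" using rdist_nonneg[of p y] rdist_eq_0D[of p y] assms by fastforce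
  then show ?thesis
    unfolding eta_pt_def unit_tangent_def
    using tscale_tangent[OF rexp_inv_tangent] tnorm_tscale[OF rexp_inv_tangent[of p y]]
    by (simp add: tnorm_rexp_inv)
qed

text \<open>Existence and uniqueness of asymptotic rays make the definite description meaningful.
  The definition uses the ray in direction \<open>-u\<close>, so the vector sought is the negative
  of the asymptotic direction \<open>w\<close>.\<close>

lemma u_dir_props:
  assumes y: "y \<noteq> p"
  shows "u_dir M p x y \<in> unit_tangent M x"
    and "asymptotic M (geodesic_ray M p (eta_pt M p y)) (geodesic_ray M x (tscale (- 1) (u_dir M p x y)))"
proof -
  let ?\<eta> = "eta_pt M p y"
  have \<eta>: "?\<eta> \<in> tangent_space M p" "tnorm M p ?\<eta> = 1" using eta_pt_unit[OF y] unfolding unit_tangent_def by auto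
  have ray: "geodesic_ray M p ?\<eta> = gd p ?\<eta>" by (rule ext) (rule geodesic_ray_gd[OF \<eta>(1)])
  obtain w where w: "w \<in> unit_tangent M x" "asymptotic M (gd p ?\<eta>) (geodesic_ray M x w)"
    using asymptotic_ray_exists[OF gd_props(1)[OF \<eta>(1)], of x] by (auto simp: gd_props \<eta>)
  have wt: "w \<in> tangent_space M x" "tnorm M x w = 1" using w(1) unfolding unit_tangent_def by auto
  let ?P = "\<lambda>u. u \<in> unit_tangent M x \<and> asymptotic M (gd p ?\<eta>) (geodesic_ray M x (tscale (- 1) u))"
  have "?P (tscale (- 1) w)"
    using w(2) wt tscale_tangent[OF wt(1)] tnorm_tscale[OF wt(1)]
    unfolding unit_tangent_def by (simp add: tscale_tscale tscale_1)
  moreover have "u = tscale (- 1) w" if u: "?P u" for u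
  proof -
    have ut: "u \<in> tangent_space M x" using u unfolding unit_tangent_def by simp
    have "tscale (- 1) u = w"
      by (rule asymptotic_unique[OF tscale_tangent[OF ut] wt(1) conjunct2[OF u] w(2)])
    then show ?thesis by (auto simp: tscale_tscale tscale_1)
  qed
  ultimately have "?P (THE u. ?P u)" by (rule theI)
  then show "u_dir M p x y \<in> unit_tangent M x"
    "asymptotic M (geodesic_ray M p ?\<eta>) (geodesic_ray M x (tscale (- 1) (u_dir M p x y)))"
    unfolding u_dir_def ray by auto
qed

lemma V_map_tangent: "V_map M p x y \<in> tangent_space M x"
  unfolding V_map_def using tzero_tangent tscale_tangent u_dir_props(1)[of y p x] unfolding unit_tangent_def by auto

text \<open>\<open>V_map\<close> has length \<open>rdist M p y\<close> and its reversed direction is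
  asymptotic to \<open>eta_pt M p y\<close>. Uniqueness of the asymptotic ray from \<open>p\<close>
  therefore returns \<open>eta_pt\<close> as \<open>eta_dir\<close>, and following it backwards over
  this length undoes \<open>rexp_inv\<close>.\<close>

lemma Y_map_V_map: "Y_map M p x (V_map M p x y) = y"
proof (cases "y = p")
  case True
  then show ?thesis by (simp add: V_map_def Y_map_def)
next
  case y: False
  let ?\<eta> = "eta_pt M p y" and ?r = "rdist M p y" and ?u = "u_dir M p x y"
  have r: "0 < ?r" using rdist_nonneg[of p y] rdist_eq_0D[of p y] y by fastforce
  note \<eta> = eta_pt_unit[OF y] and u = u_dir_props[OF y, of x]
  have ut: "?u \<in> tangent_space M x" "tnorm M x ?u = 1" using u(1) unfolding unit_tangent_def by auto
  have V: "V_map M p x y = tscale ?r ?u" using y by (simp add: V_map_def)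
  have nV: "tnorm M x (tscale ?r ?u) = ?r" using tnorm_tscale[OF ut(1)] ut(2) r by simp
  have "tnorm M x tzero = 0" using tnorm_eq_0_iff[OF tzero_tangent] by blast
  then have nz: "tscale ?r ?u \<noteq> tzero" using nV r by force
  \<comment> \<open>After normalisation only the factor \<open>- 1 / ?r * ?r = - 1\<close> remains,
    so the ray at \<open>x\<close> is the one that defines \<open>u_dir\<close>.\<close>
  have "eta_dir M p x (tscale ?r ?u) = ?\<eta>"
    unfolding eta_dir_def nV tscale_tscale
  proof (rule the_equality)
    have s: "- 1 / ?r * ?r = - 1" using r by simp
    show P: "?\<eta> \<in> unit_tangent M p \<and> asymptotic M (geodesic_ray M p ?\<eta>) (geodesic_ray M x (tscale (- 1 / ?r * ?r) ?u))"
      unfolding s using \<eta> u(2) by simp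
    fix \<eta> assume Q: "\<eta> \<in> unit_tangent M p \<and> asymptotic M (geodesic_ray M p \<eta>) (geodesic_ray M x (tscale (- 1 / ?r * ?r) ?u))"
    show "\<eta> = ?\<eta>"
      by (rule asymptotic_unique[OF _ _ asymptotic_sym[OF conjunct2[OF Q]] asymptotic_sym[OF conjunct2[OF P]]])
        (use P Q in \<open>simp_all add: unit_tangent_def\<close>)
  qed
  then have "Y_map M p x (V_map M p x y) = rexp M p (tscale (- ?r) ?\<eta>)"
    unfolding V Y_map_def nV using nz by simp
  also have "tscale (- ?r) ?\<eta> = rexp_inv M p y" unfolding eta_pt_def tscale_tscale using r by (simp add: tscale_1)
  finally show ?thesis by (simp add: rexp_rexp_inv)
qed

lemma V_map_subdiff:
  assumes rep: "attained_envelope_rep M p A y a f" and \<alpha>: "\<alpha> \<in> active_indices M p A y a f x"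
  shows "V_map M p x (y \<alpha>) \<in> subdiff M p f x"
proof -
  have \<alpha>A: "\<alpha> \<in> A" and fx: "f x = coupling M p x (y \<alpha>) - a \<alpha>" using \<alpha> unfolding active_indices_def by auto
  have le: "coupling M p z (y \<alpha>) - a \<alpha> \<le> f z" for z
    using rep cSUP_upper[OF \<alpha>A, of "\<lambda>\<alpha>. coupling M p z (y \<alpha>) - a \<alpha>"]
    unfolding attained_envelope_rep_def envelope_rep_def by simp
  have "f x + coupling M p z (y \<alpha>) - coupling M p x (y \<alpha>) \<le> f z" for z
    using le[of z] fx by linarith
  then show ?thesis unfolding subdiff_def by (simp add: V_map_tangent Y_map_V_map)
qed

end

text \<open>The subgradient chosen at a point gives a minorant of \<open>f\<close> that touches
  \<open>f\<close> there, and all these minorants together form the envelope. An index carries its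
  contact point in its first component, so \<open>(z, 0)\<close> is active at
  \<open>z\<close>.\<close>

lemma subdiff_attained_envelope:
  fixes M :: "('m::topological_space, 'n::finite) riemannian"
  assumes "\<And>x. subdiff M p f x \<noteq> {}"
  shows "attained_envelope M p f"
proof -
  have "\<forall>x. \<exists>v. v \<in> subdiff M p f x" using assms by blast
  from choice[OF this] obtain v where v: "\<And>x. v x \<in> subdiff M p f x" by blast
  define y where "y \<alpha> = Y_map M p (fst \<alpha>) (v (fst \<alpha>))" for \<alpha> :: "'m \<times> real"
  define a where "a \<alpha> = coupling M p (fst \<alpha>) (y \<alpha>) - f (fst \<alpha>)" for \<alpha> :: "'m \<times> real"
  have le: "coupling M p z (y \<alpha>) - a \<alpha> \<le> f z" for z \<alpha>
    using v[of "fst \<alpha>"] unfolding subdiff_def a_def y_def by (simp add: algebra_simps)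
  have eq: "coupling M p z (y (z, 0)) - a (z, 0) = f z" for z by (simp add: a_def)
  have bdd: "bdd_above (range (\<lambda>\<alpha>. coupling M p z (y \<alpha>) - a \<alpha>))" for z by (rule bdd_aboveI2[OF le])
  have sup: "f z = (SUP \<alpha>. coupling M p z (y \<alpha>) - a \<alpha>)" for z
  proof (rule antisym)
    show "f z \<le> (SUP \<alpha>. coupling M p z (y \<alpha>) - a \<alpha>)"
      using cSUP_upper[OF UNIV_I bdd, of z "(z, 0)"] by (simp only: eq)
  qed (rule cSUP_least[OF UNIV_not_empty le])
  have "(z, 0) \<in> active_indices M p UNIV y a f z" for z
    unfolding active_indices_def using eq[of z] by simp
  then have act: "active_indices M p UNIV y a f z \<noteq> {}" for z by (metis empty_iff)
  have "attained_envelope_rep M p UNIV y a f"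
    unfolding attained_envelope_rep_def envelope_rep_def by (intro conjI allI UNIV_not_empty bdd sup act)
  then show ?thesis unfolding attained_envelope_def by blast
qed

theorem theorem16:
  fixes M :: "('m::{t2_space, second_countable_topology}, 'n::finite) riemannian"
    and p :: 'm and f :: "'m \<Rightarrow> real"
  assumes "hadamard_manifold M"
  shows "((\<forall>x. subdiff M p f x \<noteq> {}) \<longleftrightarrow> attained_envelope M p f) \<and>
    (\<forall>(A :: 'i set) y a. attained_envelope_rep M p A y a f \<longrightarrow>
       (\<forall>x. {V_map M p x (y \<alpha>) |\<alpha>. \<alpha> \<in> active_indices M p A y a f x} \<subseteq> subdiff M p f x))"
proof -
  interpret hadamard M
    using assms unfolding hadamard_manifold_def by unfold_locales auto
  have "subdiff M p f x \<noteq> {}" if "attained_envelope M p f" for x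
  proof -
    obtain A :: "('m \<times> real) set" and y a where rep: "attained_envelope_rep M p A y a f"
      using \<open>attained_envelope M p f\<close> unfolding attained_envelope_def by blast
    then obtain \<alpha> where "\<alpha> \<in> active_indices M p A y a f x" unfolding attained_envelope_rep_def by blast
    from V_map_subdiff[OF rep this] show ?thesis by blast
  qed
  moreover have "attained_envelope M p f" if "\<forall>x. subdiff M p f x \<noteq> {}"
    using that by (intro subdiff_attained_envelope) blast
  moreover have "{V_map M p x (y \<alpha>) |\<alpha>. \<alpha> \<in> active_indices M p A y a f x} \<subseteq> subdiff M p f x"
    if "attained_envelope_rep M p A y a f" for A :: "'i set" and y a x
    using V_map_subdiff[OF that] by blast
  ultimately show ?thesis by blast
qed

end
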